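(* Let $T>0$, $n\ge1$, and let $\sigma=(\sigma_{jk})_{1\le j,k\le n}$ be a matrix function on $\mathbb{R}^n$ with $\sigma_{jk}\in BV_{\mathrm{loc}}(\mathbb{R}^n)\cap L^\infty(\mathbb{R}^n)$ for all $j,k$ and $\det(\sigma)>\varepsilon_0$ $\mathcal{L}^n$-a.e. on $\mathbb{R}^n$ for some $\varepsilon_0>0$. Let $f:\mathbb{R}^n\to\mathbb{R}^n$ be a bi-Lipschitz function which solves $\nabla f=\sigma(f)$ ($\mathcal{L}^n$-a.e.). Let $s\in(0,1)$, $\gamma\in(\frac1{1+s},1)$, let $Y=(Y_t)_{t\in[0,T]}$ be an $\mathbb{R}^n$-valued stochastic process with $Y_0=0$ on a probability space $(\Omega,\mathcal{F},\mathbb{P})$ with paths $\mathbb{P}$-a.s. Hölder continuous of order $\gamma$, and let $\mathring{x}\in\mathbb{R}^n$. Suppose that there are $\varepsilon\in(0,1-s)$, $c>0$ and $\delta\in(0,n-1+s+\varepsilon)$ such that $$\mathbb{E}\int_0^T|Y_t-x|^{-n+\varepsilon}\,dt<c\,|x|^{-n+\delta},\quad x\in\mathbb{R}^n$$ (the condition being regarded as void at $x=0$, where the right-hand side is $+\infty$), and for all $j,k$ $$\int_{\mathbb{R}^n}|x-\mathring{x}|^{-n+1-s-\varepsilon+\delta}\,\|D\sigma_{jk}\|(dx)<+\infty.$$ Then for $\mathbb{P}$-a.e. $\omega\in\Omega$ the path $X_t(\omega)=f(Y_t(\omega)+f^{-1}(\mathring{x}))$, $t\in[0,T]$, is a variability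 solution $X(\omega)\in\mathcal{C}^\gamma([0,T],\mathbb{R}^n)\cap V(\sigma,s)$ for $\sigma$ and $Y(\omega)$ started at $\mathring{x}$.
   Context: **BV, variability.** $\varphi\in L^1_{\mathrm{loc}}(\mathbb{R}^n)$ is in $BV_{\mathrm{loc}}(\mathbb{R}^n)$ if its distributional partial derivatives are signed Radon measures; $\|D\varphi\|$ is the total variation measure of $D\varphi$. A path is a continuous function $X:[0,T]\to\mathbb{R}^n$. For $s\in(0,1)$, $X\in V(\varphi,s)$ ("$(s,1)$-variable") if there is a relatively compact open neighborhood $\mathcal{U}$ of $X([0,T])$ with $\int_0^T\int_{\mathcal{U}}|X_t-z|^{-n+1-s}\|D\varphi\|(dz)\,dt<\infty$; $V(\sigma,s)=\bigcap_{j,k}V(\sigma_{jk},s)$. $\nabla f=(\partial_kf_j)_{j,k}$ is the Jacobian matrix. **Composition.** $\varphi$ has approximate limit $\lambda_\varphi(x)$ at $x$ if $\lim_{r\to0}\mathcal{L}^n(B(x,r))^{-1}\int_{B(x,r)}|\varphi(y)-\lambda_\varphi(x)|dy=0$; $S_\varphi$ is the set of points without approximate limit; a Lebesgue representative is a Borel function $\widetilde\varphi$ with $\widetilde\varphi=\lambda_\varphi$ off $S_\varphi$. For $X\in V(\varphi,s)$, $\varphi(X)$ is the $\mathcal{L}^1$-a.e. class of $t\mapsto\widetilde\varphi(X_t)$ (independent of the choice of $\widetilde\varphi$); $\sigma(X)$ is defined entrywise. **Integral.** $W^{\theta,1}_0(0,T)$: measurable $h$ with $\int_0^T\frac{|h(t)|}{t^\theta}dt+\int_0^T\int_0^T\frac{|h(t)-h(u)|}{|t-u|^{1+\theta}}du\,dt<\infty$.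 $W^{\theta,\infty}_T(0,T)$: measurable $k$ such that $k(T-)$ exists and $\sup_t\frac{|k(T-)-k(t)|}{(T-t)^\theta}+\sup_t\int_t^T\frac{|k(t)-k(u)|}{|t-u|^{1+\theta}}du<\infty$. For $h\in W_0^{\theta,1}(0,T)$, $k\in W_T^{1-\theta,\infty}(0,T)$, $\theta\in(0,1)$, $$\int_0^Th_t\,dk_t=(-1)^\theta\int_0^TD^\theta_{0+}h(t)\,D^{1-\theta}_{T-}(k-k(T-))(t)\,dt,$$ with $D^\theta_{0+}h(t)=\frac1{\Gamma(1-\theta)}\Big(\frac{h(t)}{t^\theta}+\theta\int_0^t\frac{h(t)-h(r)}{(t-r)^{\theta+1}}dr\Big)$ and $D^\theta_{T-}k(t)=\frac{(-1)^\theta}{\Gamma(1-\theta)}\Big(\frac{k(t)}{(T-t)^\theta}+\theta\int_t^T\frac{k(t)-k(r)}{(r-t)^{\theta+1}}dr\Big)$ (complex prefactors combine to $-1$; the value is independent of admissible $\theta$); $\int_0^th\,dk:=\int_0^T\mathbf{1}_{[0,t]}h\,dk$. **Variability solution.** For $Y\in\mathcal{C}^\gamma([0,T],\mathbb{R}^n)$, a path $X$ is a variability solution for $\sigma$ and $Y$ started at $\mathring{x}$ if $X_0=\mathring{x}$; $X\in\mathcal{C}^\alpha([0,T],\mathbb{R}^n)\cap V(\sigma,s')$ for some $\alpha\in(0,1)$ and $s'\in(\frac{1-\gamma}\alpha,1)$; and $X_t=\mathring{x}+\int_0^t\sigma(X_u)\,dY_u$ for $t\in[0,T]$, i.e. $X^j_t=\mathring{x}_j+\sum_{k=1}^n\int_0^t\sigma_{jk}(X_u)\,dY^k_u$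 for all $j$. $\mathcal{C}^\gamma$ denotes Hölder functions of order $\gamma$. *)

theory Defs
  imports "HOL-Probability.Probability"
begin

section \<open>Functions of locally bounded variation\<close>

definition locally_integrable :: "('a::euclidean_space \<Rightarrow> real) \<Rightarrow> bool" where
  "locally_integrable \<phi> \<longleftrightarrow> (\<forall>K. compact K \<longrightarrow> set_integrable lebesgue K \<phi>)"

definition essentially_bounded :: "('a::euclidean_space \<Rightarrow> real) \<Rightarrow> bool" where
  "essentially_bounded \<phi> \<longleftrightarrow>
     \<phi> \<in> borel_measurable lebesgue \<and> (\<exists>C. AE x in lebesgue. \<bar>\<phi> x\<bar> \<le> C)"

definition has_partial :: "(real^'n \<Rightarrow> real) \<Rightarrow> 'n::finite \<Rightarrow> real \<Rightarrow> real^'n \<Rightarrow> bool" where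
  "has_partial \<psi> i D x \<longleftrightarrow> ((\<lambda>\<tau>. \<psi> (x + \<tau> *\<^sub>R axis i 1)) has_real_derivative D) (at 0)"

definition partial :: "'n::finite \<Rightarrow> (real^'n \<Rightarrow> real) \<Rightarrow> real^'n \<Rightarrow> real" where
  "partial i \<psi> x = deriv (\<lambda>\<tau>. \<psi> (x + \<tau> *\<^sub>R axis i 1)) 0"

fun C_k :: "nat \<Rightarrow> (real^'n::finite \<Rightarrow> real) \<Rightarrow> bool" where
  "C_k 0 \<psi> \<longleftrightarrow> continuous_on UNIV \<psi>"
| "C_k (Suc k) \<psi> \<longleftrightarrow> continuous_on UNIV \<psi> \<and>
     (\<forall>i. (\<forall>x. \<exists>D. has_partial \<psi> i D x) \<and> C_k k (partial i \<psi>))"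

definition test_function :: "(real^'n::finite \<Rightarrow> real) \<Rightarrow> bool" where
  "test_function \<psi> \<longleftrightarrow> (\<forall>k. C_k k \<psi>) \<and> compact (closure {x. \<psi> x \<noteq> 0})"

text \<open>
  A signed Radon measure may have infinite positive and negative parts, so it is a set function that
  is meaningful (and countably additive) only on the bounded Borel sets. Its values on other sets
  are irrelevant and are never used below.
\<close>

definition signed_radon_measure :: "('a::euclidean_space set \<Rightarrow> real) \<Rightarrow> bool" where
  "signed_radon_measure m \<longleftrightarrow>
     (\<forall>A :: nat \<Rightarrow> 'a set. range A \<subseteq> sets borel \<longrightarrow> disjoint_family A \<longrightarrow> bounded (\<Union>i. A i) \<longrightarrow>
        (\<lambda>i. m (A i)) sums m (\<Union>i. A i))"

text \<open>
  Upper variation; the Jordan decomposition of \<open>m\<close> is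
  \<open>positive_part m - positive_part (\<lambda>A. - m A)\<close>.
\<close>

definition positive_part :: "('a::euclidean_space set \<Rightarrow> real) \<Rightarrow> 'a measure" where
  "positive_part m = measure_of UNIV (sets borel)
     (\<lambda>A. SUP B \<in> {B \<in> sets borel. bounded B \<and> B \<subseteq> A}. ennreal (m B))"

definition signed_integral :: "('a::euclidean_space set \<Rightarrow> real) \<Rightarrow> ('a \<Rightarrow> real) \<Rightarrow> real" where
  "signed_integral m \<psi> =
     (LINT x|positive_part m. \<psi> x) - (LINT x|positive_part (\<lambda>A. - m A). \<psi> x)"

definition is_distributional_partial ::
    "(real^'n \<Rightarrow> real) \<Rightarrow> 'n::finite \<Rightarrow> ((real^'n) set \<Rightarrow> real) \<Rightarrow> bool" where
  "is_distributional_partial \<phi> i m \<longleftrightarrow> signed_radon_measure m \<and>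
     (\<forall>\<psi>. test_function \<psi> \<longrightarrow>
        signed_integral m \<psi> = - (LINT x|lebesgue. \<phi> x * partial i \<psi> x))"

definition BV_loc :: "(real^'n::finite \<Rightarrow> real) set" where
  "BV_loc = {\<phi>. locally_integrable \<phi> \<and> (\<forall>i. \<exists>m. is_distributional_partial \<phi> i m)}"

text \<open>For \<open>\<phi>\<close> in \<open>BV_loc\<close> the choice is unique on the bounded Borel sets.\<close>

definition gradient_measure :: "(real^'n::finite \<Rightarrow> real) \<Rightarrow> (real^'n) set \<Rightarrow> real^'n" where
  "gradient_measure \<phi> A = (\<chi> i. (SOME m. is_distributional_partial \<phi> i m) A)"

text \<open>
  Supremum over countable Borel partitions. The pieces are required to be bounded so that
  this is also correct for unbounded sets.
\<close>

definition total_variation_measure :: 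
    "('a::euclidean_space set \<Rightarrow> 'b::real_normed_vector) \<Rightarrow> 'a measure" where
  "total_variation_measure \<nu> = measure_of UNIV (sets borel)
     (\<lambda>A. SUP P \<in> {P :: nat \<Rightarrow> 'a set. (\<forall>i. P i \<in> sets borel \<and> bounded (P i)) \<and>
                     disjoint_family P \<and> (\<Union>i. P i) = A}.
            \<Sum>i. ennreal (norm (\<nu> (P i))))"

abbreviation gradient_variation :: "(real^'n::finite \<Rightarrow> real) \<Rightarrow> (real^'n) measure" where
  "gradient_variation \<phi> \<equiv> total_variation_measure (gradient_measure \<phi>)"


section \<open>Variability\<close>

text \<open>
  The function \<open>|x| powr a\<close> for exponents \<open>a < 0\<close>, with value \<open>\<infinity>\<close> at the origin
  (whereas \<open>0 powr a = 0\<close>).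
\<close>

definition riesz_kernel :: "real \<Rightarrow> 'a::real_normed_vector \<Rightarrow> ennreal" where
  "riesz_kernel a x = (if x = 0 then \<infinity> else ennreal (norm x powr a))"

definition variable_path :: 
    "real \<Rightarrow> (real^'n::finite \<Rightarrow> real) \<Rightarrow> real \<Rightarrow> (real \<Rightarrow> real^'n) \<Rightarrow> bool" where
  "variable_path T \<phi> s X \<longleftrightarrow> 0 < s \<and> s < 1 \<and> continuous_on {0..T} X \<and>
     (\<exists>U. open U \<and> compact (closure U) \<and> X ` {0..T} \<subseteq> U \<and>
        (\<integral>\<^sup>+ t\<in>{0..T}. (\<integral>\<^sup>+ z\<in>U. riesz_kernel (- real CARD('n) + 1 - s) (X t - z)
           \<partial>gradient_variation \<phi>) \<partial>lebesgue) < \<infinity>)"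

definition V_class :: 
    "real \<Rightarrow> (real^'n::finite \<Rightarrow> real^'n^'n) \<Rightarrow> real \<Rightarrow> (real \<Rightarrow> real^'n) set" where
  "V_class T \<sigma> s = {X. \<forall>j k. variable_path T (\<lambda>x. \<sigma> x $ j $ k) s X}"


section \<open>Composition of a locally integrable function with a path\<close>

definition has_approximate_limit :: 
    "('a::euclidean_space \<Rightarrow> real) \<Rightarrow> 'a \<Rightarrow> real \<Rightarrow> bool" where
  "has_approximate_limit \<phi> x l \<longleftrightarrow>
     ((\<lambda>r. (LINT y:ball x r|lebesgue. \<bar>\<phi> y - l\<bar>) / measure lebesgue (ball x r)) \<longlongrightarrow> 0)
       (at_right 0)"

definition lebesgue_representative :: 
    "('a::euclidean_space \<Rightarrow> real) \<Rightarrow> ('a \<Rightarrow> real) \<Rightarrow> bool" where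
  "lebesgue_representative \<phi> g \<longleftrightarrow> g \<in> borel_measurable borel \<and>
     (\<forall>x l. has_approximate_limit \<phi> x l \<longrightarrow> g x = l)"

text \<open>
  Representatives always exist, so quantifying over all of them is not vacuous.
\<close>

lemma lebesgue_representative_exists:
  fixes \<phi> :: "'a::euclidean_space \<Rightarrow> real"
  assumes loc: "locally_integrable \<phi>"
  shows "\<exists>g. lebesgue_representative \<phi> g"
proof -
  have int: "set_integrable lebesgue (ball x r) \<phi>" for x r
    by (rule set_integrable_subset[of _ "cball x r"]) (use loc in \<open>auto simp: locally_integrable_def\<close>)
  have "(\<lambda>y. indicator (ball 0 (real n)) y *\<^sub>R \<phi> y) \<in> borel_measurable lebesgue" for n
    using int[of 0 "real n"] by (auto simp: set_integrable_def)
  then have "\<phi> \<in> borel_measurable lebesgue"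
  proof (rule borel_measurable_LIMSEQ_real[rotated])
    fix y :: 'a
    obtain N :: nat where N: "norm y < real N" using reals_Archimedean2 by blast
    have "\<forall>\<^sub>F n in sequentially. indicator (ball 0 (real n)) y *\<^sub>R \<phi> y = \<phi> y"
      using eventually_ge_at_top[of N] by eventually_elim (use N in \<open>auto simp: indicator_def\<close>)
    then show "(\<lambda>n. indicator (ball 0 (real n)) y *\<^sub>R \<phi> y) \<longlonglongrightarrow> \<phi> y"
      by (rule tendsto_eventually)
  qed
  then obtain \<phi>' where meas[measurable]: "\<phi>' \<in> borel_measurable lborel"
    and ae: "AE y in lborel. \<phi> y = \<phi>' y"
    using completion_ex_borel_measurable_real by blast
  define avg where
    "avg r x = (\<integral>y. (if dist x y < r then \<phi>' y else 0) \<partial>lborel) / measure lebesgue (ball x r)"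
    for r x
  define g where "g x = lim (\<lambda>n. avg (1 / real (Suc n)) x)" for x
  have [measurable]: "avg r \<in> borel_measurable borel" for r
  proof -
    have "measure lebesgue (ball x r) = measure lebesgue (ball (0::'a) r)" for x :: 'a
      by (cases "r \<ge> 0") (simp_all add: content_ball ball_empty)
    then have eq: "avg r = (\<lambda>x. (\<integral>y. (if dist x y < r then \<phi>' y else 0) \<partial>lborel) / measure lebesgue (ball (0::'a) r))"
      unfolding avg_def by (intro ext arg_cong2[where f="(/)"] refl)
    show ?thesis by (subst eq) measurable
  qed
  have "g \<in> borel_measurable borel" unfolding g_def by measurable
  moreover have "g x = l" if l: "has_approximate_limit \<phi> x l" for x l
  proof -
    have est: "norm (avg r x - l) \<le> (LINT y:ball x r|lebesgue. \<bar>\<phi> y - l\<bar>) / measure lebesgue (ball x r)"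
      if r: "r > 0" for r
    proof -
      have pos: "measure lebesgue (ball x r) > 0" using r by (simp add: content_ball_pos)
      have cst: "set_integrable lebesgue (ball x r) (\<lambda>_. l)"
        unfolding set_integrable_def
        by (intro integrable_scaleR_left integrable_real_indicator) (use emeasure_bounded_finite[OF bounded_ball, of x r] in \<open>auto simp: infinity_ennreal_def\<close>)
      have "(\<integral>y. (if dist x y < r then \<phi>' y else 0) \<partial>lborel)
          = (\<integral>y. (if dist x y < r then \<phi>' y else 0) \<partial>lebesgue)"
        by (rule integral_completion[symmetric]) measurable
      also have "\<dots> = (LINT y:ball x r|lebesgue. \<phi> y)"
        unfolding set_lebesgue_integral_def
        by (rule integral_cong_AE)
          (use int[of x r] AE_completion[OF ae] in \<open>auto simp: set_integrable_def indicator_def elim!: eventually_mono intro!: measurable_completion\<close>)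
      finally have eq: "(\<integral>y. (if dist x y < r then \<phi>' y else 0) \<partial>lborel) = (LINT y:ball x r|lebesgue. \<phi> y)" .
      have "(LINT y:ball x r|lebesgue. \<phi> y - l) = (LINT y:ball x r|lebesgue. \<phi> y) - l * measure lebesgue (ball x r)"
        using set_integral_diff(2)[OF int[of x r] cst]
        by (simp add: set_lebesgue_integral_def mult.commute)
      then have "avg r x - l = (LINT y:ball x r|lebesgue. \<phi> y - l) / measure lebesgue (ball x r)"
        using pos by (simp add: avg_def eq field_simps)
      moreover have "norm (LINT y:ball x r|lebesgue. \<phi> y - l) \<le> (LINT y:ball x r|lebesgue. \<bar>\<phi> y - l\<bar>)"
        using set_integral_norm_bound[OF set_integral_diff(1)[OF int[of x r] cst]] by simp
      ultimately show ?thesis using pos by (simp add: divide_right_mono abs_divide)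
    qed
    have "((\<lambda>r. avg r x - l) \<longlongrightarrow> 0) (at_right 0)"
      by (rule Lim_null_comparison[OF _ l[unfolded has_approximate_limit_def]])
        (use est in \<open>auto simp: eventually_at_right_less intro: eventually_mono[OF eventually_at_right_less]\<close>)
    then have "((\<lambda>r. avg r x) \<longlongrightarrow> l) (at_right 0)" by (simp add: LIM_zero_iff)
    moreover have "filterlim (\<lambda>n. 1 / real (Suc n)) (at_right 0) sequentially"
      unfolding filterlim_at using lim_inverse_n' LIMSEQ_Suc by (auto simp del: of_nat_Suc)
    ultimately have "(\<lambda>n. avg (1 / real (Suc n)) x) \<longlonglongrightarrow> l"
      by (rule filterlim_compose)
    then show ?thesis unfolding g_def by (rule limI)
  qed
  ultimately show ?thesis unfolding lebesgue_representative_def by blast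
qed

text \<open>All members of the a.e.-class \<open>\<phi>(X)\<close>, over all Lebesgue representatives.\<close>

definition composition_class :: 
    "real \<Rightarrow> ('a::euclidean_space \<Rightarrow> real) \<Rightarrow> (real \<Rightarrow> 'a) \<Rightarrow> (real \<Rightarrow> real) set" where
  "composition_class T \<phi> X =
     {h. \<exists>g. lebesgue_representative \<phi> g \<and> (AE t in lebesgue. t \<in> {0..T} \<longrightarrow> h t = g (X t))}"


section \<open>Generalized Lebesgue--Stieltjes integral\<close>

definition W_0 :: "real \<Rightarrow> real \<Rightarrow> (real \<Rightarrow> real) set" where
  "W_0 T \<theta> = {h. h \<in> borel_measurable (lebesgue_on {0<..<T}) \<and>
     (\<integral>\<^sup>+ t\<in>{0<..<T}. ennreal (\<bar>h t\<bar> / t powr \<theta>) \<partial>lebesgue) +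
     (\<integral>\<^sup>+ t\<in>{0<..<T}. (\<integral>\<^sup>+ u\<in>{0<..<T}.
        ennreal (\<bar>h t - h u\<bar> / \<bar>t - u\<bar> powr (1 + \<theta>)) \<partial>lebesgue) \<partial>lebesgue) < \<infinity>}"

definition left_value :: "real \<Rightarrow> (real \<Rightarrow> real) \<Rightarrow> real" where
  "left_value T k = Lim (at_left T) k"

definition W_T :: "real \<Rightarrow> real \<Rightarrow> (real \<Rightarrow> real) set" where
  "W_T T \<theta> = {k. k \<in> borel_measurable (lebesgue_on {0<..<T}) \<and> (\<exists>l. (k \<longlongrightarrow> l) (at_left T)) \<and>
     (SUP t\<in>{0<..<T}. ennreal (\<bar>left_value T k - k t\<bar> / (T - t) powr \<theta>)) +
     (SUP t\<in>{0<..<T}. (\<integral>\<^sup>+ u\<in>{t<..<T}.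
        ennreal (\<bar>k t - k u\<bar> / \<bar>t - u\<bar> powr (1 + \<theta>)) \<partial>lebesgue)) < \<infinity>}"

definition frac_deriv_left :: "real \<Rightarrow> (real \<Rightarrow> real) \<Rightarrow> real \<Rightarrow> real" where
  "frac_deriv_left \<theta> h t = 1 / Gamma (1 - \<theta>) *
     (h t / t powr \<theta> + \<theta> * (LINT r:{0<..<t}|lebesgue. (h t - h r) / (t - r) powr (\<theta> + 1)))"

text \<open>The right-sided derivative without its complex prefactor \<open>(-1)\<^sup>\<theta>\<close>.\<close>

definition frac_deriv_right :: "real \<Rightarrow> real \<Rightarrow> (real \<Rightarrow> real) \<Rightarrow> real \<Rightarrow> real" where
  "frac_deriv_right T \<theta> k t = 1 / Gamma (1 - \<theta>) *
     (k t / (T - t) powr \<theta> + \<theta> * (LINT r:{t<..<T}|lebesgue. (k t - k r) / (r - t) powr (\<theta> + 1)))"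

text \<open>
  \<open>has_stieltjes_integral T h k I\<close>: the integral of \<open>h\<close> against \<open>k\<close> over \<open>[0,T]\<close> exists and
  equals \<open>I\<close>. The sign is the product of the prefactors \<open>(-1)\<^sup>\<theta>\<close> and \<open>(-1)\<^bsup>1-\<theta>\<^esup>\<close>. The value
  does not depend on the admissible \<open>\<theta>\<close>.
\<close>

definition has_stieltjes_integral :: 
    "real \<Rightarrow> (real \<Rightarrow> real) \<Rightarrow> (real \<Rightarrow> real) \<Rightarrow> real \<Rightarrow> bool" where
  "has_stieltjes_integral T h k I \<longleftrightarrow>
     (\<exists>\<theta>. 0 < \<theta> \<and> \<theta> < 1 \<and> h \<in> W_0 T \<theta> \<and> k \<in> W_T T (1 - \<theta>) \<and>
        I = - (LINT t:{0<..<T}|lebesgue.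
                 frac_deriv_left \<theta> h t *
                 frac_deriv_right T (1 - \<theta>) (\<lambda>r. k r - left_value T k) t))"


section \<open>Variability solutions\<close>

definition holder_on :: 
    "real \<Rightarrow> 'a::metric_space set \<Rightarrow> ('a \<Rightarrow> 'b::metric_space) \<Rightarrow> bool" where
  "holder_on \<alpha> S f \<longleftrightarrow> (\<exists>C. \<forall>s\<in>S. \<forall>t\<in>S. dist (f s) (f t) \<le> C * dist s t powr \<alpha>)"

text \<open>
  The equation is demanded for every choice \<open>h j k\<close> in the a.e.-class \<open>\<sigma>\<^sub>j\<^sub>k(X)\<close>.
\<close>

definition variability_solution :: 
    "real \<Rightarrow> real \<Rightarrow> (real^'n::finite \<Rightarrow> real^'n^'n) \<Rightarrow> (real \<Rightarrow> real^'n) \<Rightarrow> real^'n \<Rightarrow>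
     (real \<Rightarrow> real^'n) \<Rightarrow> bool" where
  "variability_solution T \<gamma> \<sigma> Y x\<^sub>0 X \<longleftrightarrow>
     holder_on \<gamma> {0..T} Y \<and>
     X 0 = x\<^sub>0 \<and>
     (\<exists>\<alpha> s'. 0 < \<alpha> \<and> \<alpha> < 1 \<and> (1 - \<gamma>) / \<alpha> < s' \<and> s' < 1 \<and>
        holder_on \<alpha> {0..T} X \<and> X \<in> V_class T \<sigma> s') \<and>
     (\<forall>h. (\<forall>j k. h j k \<in> composition_class T (\<lambda>x. \<sigma> x $ j $ k) X) \<longrightarrow>
        (\<forall>t\<in>{0..T}. \<forall>j. \<exists>I. 
           (\<forall>k. has_stieltjes_integral T (\<lambda>u. indicator {0..t} u * h j k u) (\<lambda>u. Y u $ k) (I k)) \<and>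
           X t $ j = x\<^sub>0 $ j + (\<Sum>k\<in>UNIV. I k)))"

definition bi_lipschitz :: "('a::metric_space \<Rightarrow> 'b::metric_space) \<Rightarrow> bool" where
  "bi_lipschitz f \<longleftrightarrow>
     (\<exists>L>0. \<forall>x y. dist x y / L \<le> dist (f x) (f y) \<and> dist (f x) (f y) \<le> L * dist x y)"

text \<open>Only the partial derivatives at \<open>x\<close> are required, not total differentiability.\<close>

definition has_jacobian :: "(real^'n::finite \<Rightarrow> real^'n) \<Rightarrow> real^'n^'n \<Rightarrow> real^'n \<Rightarrow> bool" where
  "has_jacobian f A x \<longleftrightarrow> (\<forall>j k. has_partial (\<lambda>y. f y $ j) k (A $ j $ k) x)"

end

theory Submission
  imports Defs
begin

text \<open>
  Let \<open>V x\<close> be the potential of the measures \<open>\<parallel>D\<sigma>\<^sub>j\<^sub>k\<parallel>\<close> for the kernel \<open>\<bar>x - z\<bar> powr (-n + 1 - s)\<close>, summed over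
  \<open>j\<close> and \<open>k\<close>. Riesz kernels compose up to constants, and \<open>f\<close> distorts them by at most a constant, so
  the two moment conditions and Tonelli's theorem bound the expectation of the time integral of
  \<open>V (X t)\<close>. Hence this integral is finite along almost every path, and the path is fixed from then on.

  Where \<open>V x < \<infinity>\<close>, the translation estimate for BV functions and a Campanato argument yield a value
  \<open>l x\<close> of \<open>\<sigma>\<close> whose mean oscillation on cubes of size \<open>r\<close> is at most \<open>C * V x * r powr s\<close>. Therefore
  \<open>\<bar>l x - l x'\<bar> \<le> C * (V x + V x') * \<bar>x - x'\<bar> powr s\<close>, which makes \<open>\<sigma>(X)\<close> integrable against \<open>Y\<close>. The same
  argument one order higher, applied to \<open>f\<close> with gradient \<open>\<sigma>(f)\<close>, bounds the first-order Taylor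
  remainder of \<open>f\<close> between \<open>y\<close> and \<open>y'\<close> by \<open>C * (V (f y) + V (f y')) * \<bar>y - y'\<bar> powr (1 + s)\<close>.

  The generalized Stieltjes integral of \<open>h\<close> against \<open>k\<close> is the limit, as \<open>d\<close> tends to 0, of the integrals of
  \<open>h u * (k (u + d) - k u) / d\<close>. For \<open>h = \<sigma>(X)\<close> and \<open>k = Y\<close> the integrand may be replaced by
  \<open>(X (u + d) - X u) / d\<close> at the cost of an error of order \<open>d powr (\<gamma> * (1 + s) - 1)\<close>, which vanishes since
  \<open>\<gamma> * (1 + s) > 1\<close>, and the integrals of these quotients converge to the increment of \<open>X\<close>.
\<close>

section \<open>Fractional calculus\<close>

text \<open>The obstacle is that \<open>\<sigma>\<close> is given only up to null sets, while the
  path may spend all its time on one, so a chain rule or a smooth approximation of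
  \<open>\<sigma>\<close> says nothing along it directly. All estimates are therefore pointwise, at
  points of finite potential \<open>V\<close>, and \<open>V\<close> is controlled only after
  integration in time. An error between two times that carries \<open>V\<close> at both ends stays
  integrable under a time shift; this is why the integral is reached through difference quotients
  averaged over time and not through Riemann sums, whose nodes might have infinite potential.

  Call \<open>-n + a\<close> the exponent of a kernel of order \<open>a\<close>. Composition with
  order \<open>1 - s - \<epsilon>\<close> raises the order \<open>\<epsilon>\<close> of the moment
  condition to \<open>1 - s\<close>, the order in the definition of variability, and turns
  \<open>-n + \<delta>\<close> into the exponent of the second condition; the bound on
  \<open>\<delta>\<close> makes that exponent negative. The Stieltjes integral needs an order
  \<open>\<theta>\<close> with \<open>1 - \<gamma> < \<theta> < \<gamma> * s\<close>, and such a
  \<open>\<theta>\<close> exists because \<open>\<gamma> * (1 + s) > 1\<close>.\<close>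

lemma nn_integral_powr_right:
  fixes a b p :: real
  assumes "p > -1" "a \<le> b"
  shows "(\<integral>\<^sup>+u\<in>{a<..<b}. ennreal ((u - a) powr p) \<partial>lborel) = ennreal ((b - a) powr (p + 1) / (p + 1))"
proof -
  have "((\<lambda>x. x powr p) has_integral ((b - a) powr (p + 1) / (p + 1))) {0..b - a}"
    by (rule has_integral_powr_from_0) (use assms in auto)
  from nn_integral_has_integral_lebesgue[OF _ this]
  have "(\<integral>\<^sup>+x. ennreal (indicator {0..b - a} x * x powr p) \<partial>lborel) = ennreal ((b - a) powr (p + 1) / (p + 1))"
    by simp
  moreover have "(\<integral>\<^sup>+x. ennreal (indicator {0..b - a} x * x powr p) \<partial>lborel)
     = (\<integral>\<^sup>+x. ennreal (indicator {0..b - a} (x - a) * (x - a) powr p) \<partial>lborel)"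
    by (subst nn_integral_real_affine[where c = 1 and t = "-a"]) (auto simp: algebra_simps)
  moreover have "(\<integral>\<^sup>+x. ennreal (indicator {0..b - a} (x - a) * (x - a) powr p) \<partial>lborel)
     = (\<integral>\<^sup>+u\<in>{a<..<b}. ennreal ((u - a) powr p) \<partial>lborel)"
  proof (rule nn_integral_cong_AE)
    have "AE x in lborel. x \<noteq> a" "AE x in lborel. x \<noteq> b" by (auto intro: AE_lborel_singleton)
    then show "AE x in lborel. ennreal (indicator {0..b - a} (x - a) * (x - a) powr p)
        = ennreal ((x - a) powr p) * indicator {a<..<b} x"
      by eventually_elim (auto simp: indicator_def)
  qed
  ultimately show ?thesis by simp
qed

lemma nn_integral_powr_left:
  fixes a b p :: real
  assumes "p > -1" "a \<le> b"
  shows "(\<integral>\<^sup>+u\<in>{a<..<b}. ennreal ((b - u) powr p) \<partial>lborel) = ennreal ((b - a) powr (p + 1) / (p + 1))"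
proof -
  have "(\<integral>\<^sup>+u\<in>{a<..<b}. ennreal ((b - u) powr p) \<partial>lborel)
     = (\<integral>\<^sup>+u\<in>{-b<..<-a}. ennreal ((u - (-b)) powr p) \<partial>lborel)"
    by (subst nn_integral_real_affine[where c = "-1" and t = 0])
       (auto simp: algebra_simps indicator_def intro!: nn_integral_cong)
  also have "\<dots> = ennreal ((-a - (-b)) powr (p + 1) / (p + 1))"
    by (rule nn_integral_powr_right) (use assms in auto)
  finally show ?thesis by simp
qed

lemma integrable_powr_right:
  fixes a b p :: real
  assumes "p > -1"
  shows "integrable lborel (\<lambda>u. if a < u \<and> u < b then (u - a) powr p else 0)"
proof (cases "a \<le> b")
  case True
  have "(\<integral>\<^sup>+u. ennreal (norm (if a < u \<and> u < b then (u - a) powr p else 0)) \<partial>lborel)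
      = (\<integral>\<^sup>+u\<in>{a<..<b}. ennreal ((u - a) powr p) \<partial>lborel)"
    by (intro nn_integral_cong) (auto simp: indicator_def)
  then show ?thesis
    by (intro integrableI_bounded) (auto simp: nn_integral_powr_right[OF assms True])
next
  case False
  then have "(\<lambda>u. if a < u \<and> u < b then (u - a) powr p else 0) = (\<lambda>_. 0)" by (auto simp: fun_eq_iff)
  then show ?thesis by simp
qed

lemma integrable_powr_left:
  fixes a b p :: real
  assumes "p > -1"
  shows "integrable lborel (\<lambda>u. if a < u \<and> u < b then (b - u) powr p else 0)"
proof (cases "a \<le> b")
  case True
  have "(\<integral>\<^sup>+u. ennreal (norm (if a < u \<and> u < b then (b - u) powr p else 0)) \<partial>lborel)
      = (\<integral>\<^sup>+u\<in>{a<..<b}. ennreal ((b - u) powr p) \<partial>lborel)"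
    by (intro nn_integral_cong) (auto simp: indicator_def)
  then show ?thesis
    by (intro integrableI_bounded) (auto simp: nn_integral_powr_left[OF assms True])
next
  case False
  then have "(\<lambda>u. if a < u \<and> u < b then (b - u) powr p else 0) = (\<lambda>_. 0)" by (auto simp: fun_eq_iff)
  then show ?thesis by simp
qed

lemma integral_powr_shift_right:
  fixes a b c \<theta> :: real
  assumes "a \<le> b" "c < a" "\<theta> \<noteq> 0"
  shows "(\<integral>q. (if a < q \<and> q < b then (q - c) powr (-(\<theta> + 1)) else 0) \<partial>lborel)
    = ((a - c) powr -\<theta> - (b - c) powr -\<theta>) / \<theta>"
proof -
  have "(\<integral>q. (q - c) powr (-(\<theta> + 1)) * indicator {a..b} q \<partial>lborel)
      = (- ((b - c) powr -\<theta>) / \<theta>) - (- ((a - c) powr -\<theta>) / \<theta>)"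
    by (rule integral_FTC_Icc_real[where F = "\<lambda>x. - ((x - c) powr -\<theta>) / \<theta>"])
       (use assms in \<open>auto intro!: derivative_eq_intros continuous_intros simp: powr_diff powr_minus field_simps powr_add\<close>)
  moreover have "(\<integral>q. (if a < q \<and> q < b then (q - c) powr (-(\<theta> + 1)) else 0) \<partial>lborel)
     = (\<integral>q. (q - c) powr (-(\<theta> + 1)) * indicator {a..b} q \<partial>lborel)"
  proof (rule integral_cong_AE)
    have "AE x in lborel. x \<noteq> a" "AE x in lborel. x \<noteq> b" by (auto intro: AE_lborel_singleton)
    then show "AE x in lborel. (if a < x \<and> x < b then (x - c) powr (-(\<theta> + 1)) else 0)
        = (x - c) powr (-(\<theta> + 1)) * indicator {a..b} x"
      by eventually_elim (auto simp: indicator_def)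
  qed auto
  ultimately show ?thesis by (simp add: diff_divide_distrib)
qed

lemma integral_powr_shift_left:
  fixes a b c \<theta> :: real
  assumes "a \<le> b" "b < c" "\<theta> \<noteq> 0"
  shows "(\<integral>q. (if a < q \<and> q < b then (c - q) powr (-(\<theta> + 1)) else 0) \<partial>lborel)
    = ((c - b) powr -\<theta> - (c - a) powr -\<theta>) / \<theta>"
proof -
  have "(\<integral>q. (if a < q \<and> q < b then (c - q) powr (-(\<theta> + 1)) else 0) \<partial>lborel)
     = (\<integral>q. (if -b < q \<and> q < -a then (q - (-c)) powr (-(\<theta> + 1)) else 0) \<partial>lborel)"
    by (subst lborel_integral_real_affine[where c = "-1" and t = 0])
       (auto simp: algebra_simps intro!: Bochner_Integration.integral_cong)
  also have "\<dots> = ((-b - (-c)) powr -\<theta> - (-a - (-c)) powr -\<theta>) / \<theta>"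
    by (rule integral_powr_shift_right) (use assms in auto)
  finally show ?thesis by simp
qed

section \<open>Marchaud derivatives and Abel's integral equation\<close>

lemma integrable_triangle:
  fixes g :: "real \<times> real \<Rightarrow> real"
  assumes [measurable]: "g \<in> borel_measurable (lborel \<Otimes>\<^sub>M lborel)"
    and b: "\<And>r q. 0 < q \<Longrightarrow> q < r \<Longrightarrow> r < t \<Longrightarrow> \<bar>g (r, q)\<bar> \<le> B"
  shows "integrable (lborel \<Otimes>\<^sub>M lborel) (\<lambda>(r, q). if 0 < q \<and> q < r \<and> r < t then g (r, q) else 0)"
proof (rule integrableI_bounded_set[where A = "{0..t} \<times> {0..t}" and B = "max 0 B"])
  show "emeasure (lborel \<Otimes>\<^sub>M lborel) ({0..t} \<times> {0..t}) < \<infinity>"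
    by (subst lborel.emeasure_pair_measure_Times) (auto simp: ennreal_mult_less_top emeasure_lborel_Icc_eq)
  show "AE x in lborel \<Otimes>\<^sub>M lborel. x \<in> {0..t} \<times> {0..t} \<longrightarrow>
      norm (case x of (r, q) \<Rightarrow> if 0 < q \<and> q < r \<and> r < t then g (r, q) else 0) \<le> max 0 B"
    using b by (auto simp: le_max_iff_disj split: prod.split)
qed (auto split: if_splits)

text \<open>
  This is \<open>D\<^sup>\<theta> = d/dt I\<^bsup>1-\<theta>\<^esup>\<close>. Regularising the singular kernel to \<open>(r - q + e) powr -(\<theta> + 1)\<close>, instead
  of truncating it, makes the divergent terms cancel exactly.
\<close>

lemma integral_marchaud:
  fixes h :: "real \<Rightarrow> real"
  assumes h[measurable]: "h \<in> borel_measurable borel" and bd: "\<And>t. \<bar>h t\<bar> \<le> M"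
    and \<theta>: "0 < \<theta>" "\<theta> < 1" and t: "0 < t"
    and fin: "integrable (lborel \<Otimes>\<^sub>M lborel)
      (\<lambda>(r, q). if 0 < q \<and> q < r \<and> r < t then (h r - h q) * (r - q) powr (-(\<theta> + 1)) else 0)"
  shows "(\<integral>r. (if 0 < r \<and> r < t then h r * r powr -\<theta> +
      \<theta> * (\<integral>q. (if 0 < q \<and> q < r then (h r - h q) * (r - q) powr (-(\<theta> + 1)) else 0) \<partial>lborel) else 0) \<partial>lborel)
    = (\<integral>u. (if 0 < u \<and> u < t then h u * (t - u) powr -\<theta> else 0) \<partial>lborel)"
    and "integrable lborel (\<lambda>r. if 0 < r \<and> r < t then h r * r powr -\<theta> +
      \<theta> * (\<integral>q. (if 0 < q \<and> q < r then (h r - h q) * (r - q) powr (-(\<theta> + 1)) else 0) \<partial>lborel) else 0)"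
proof -
  have M: "M \<ge> 0" using bd[of 0] by linarith
  define k where "k e = (\<lambda>(r, q). if 0 < q \<and> q < r \<and> r < t then (h r - h q) * (r - q + e) powr (-(\<theta> + 1)) else 0)" for e
  have [measurable]: "k e \<in> borel_measurable (lborel \<Otimes>\<^sub>M lborel)" for e unfolding k_def by measurable
  have k0: "integrable (lborel \<Otimes>\<^sub>M lborel) (k 0)" using fin unfolding k_def by (simp only: add_0_right)
  have i0: "integrable lborel (\<lambda>u. if 0 < u \<and> u < t then h u * u powr -\<theta> else 0)"
    by (rule Bochner_Integration.integrable_bound[OF integrable_mult_right[OF integrable_powr_right[of "-\<theta>" 0 t], of M]])
       (use \<theta> M bd in \<open>auto simp: abs_mult intro!: mult_right_mono\<close>)
  have it: "integrable lborel (\<lambda>u. if 0 < u \<and> u < t then h u * (t - u) powr -\<theta> else 0)"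
    by (rule Bochner_Integration.integrable_bound[OF integrable_mult_right[OF integrable_powr_left[of "-\<theta>" 0 t], of M]])
       (use \<theta> M bd in \<open>auto simp: abs_mult intro!: mult_right_mono\<close>)
  define e where "e n = inverse (real (Suc n))" for n
  have e: "e n > 0" for n by (simp add: e_def)
  have elim: "e \<longlonglongrightarrow> 0" unfolding e_def by (rule LIMSEQ_inverse_real_of_nat)
  \<comment> \<open>The kernel decreases in \<open>e\<close>, so the unregularised integrand,
    integrable by \<open>fin\<close>, dominates all the regularised ones.\<close>
  have lim1: "(\<lambda>n. integral\<^sup>L (lborel \<Otimes>\<^sub>M lborel) (k (e n))) \<longlonglongrightarrow> integral\<^sup>L (lborel \<Otimes>\<^sub>M lborel) (k 0)"
  proof (rule integral_dominated_convergence[where w = "\<lambda>x. \<bar>k 0 x\<bar>"])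
    show "AE x in lborel \<Otimes>\<^sub>M lborel. (\<lambda>n. k (e n) x) \<longlonglongrightarrow> k 0 x"
    proof (rule AE_I2)
      fix x :: "real \<times> real"
      obtain r q where x: "x = (r, q)" by force
      have "(\<lambda>n. (h r - h q) * (r - q + e n) powr (-(\<theta> + 1))) \<longlonglongrightarrow> (h r - h q) * (r - q + 0) powr (-(\<theta> + 1))" if "q < r"
        by (intro tendsto_intros elim) (use that in auto)
      then show "(\<lambda>n. k (e n) x) \<longlonglongrightarrow> k 0 x" by (auto simp: k_def x)
    qed
    show "AE x in lborel \<Otimes>\<^sub>M lborel. norm (k (e n) x) \<le> \<bar>k 0 x\<bar>" for n
    proof (rule AE_I2)
      fix x :: "real \<times> real"
      obtain r q where x: "x = (r, q)" by force
      have "(r - q + e n) powr (-(\<theta> + 1)) \<le> (r - q) powr (-(\<theta> + 1))" if "q < r"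
        by (rule powr_mono2') (use that e[of n] \<theta> in auto)
      then show "norm (k (e n) x) \<le> \<bar>k 0 x\<bar>" by (auto simp: k_def x abs_mult intro!: mult_left_mono)
    qed
  qed (use k0 in auto)
  \<comment> \<open>For \<open>e > 0\<close> the kernel is bounded, so its two halves
    \<open>g1\<close> and \<open>g2\<close> can be integrated separately. Integrating
    \<open>g1\<close> over \<open>q\<close> and \<open>g2\<close> over \<open>r\<close> produces the
    same term \<open>e powr -\<theta>\<close>, times \<open>h\<close> at the remaining variable, and
    the two copies cancel.\<close>
  have eq: "\<theta> * integral\<^sup>L (lborel \<Otimes>\<^sub>M lborel) (k e)
     = (\<integral>u. (if 0 < u \<and> u < t then h u * ((t - u + e) powr -\<theta> - (u + e) powr -\<theta>) else 0) \<partial>lborel)" if e: "e > 0" for e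
  proof -
    define g1 where "g1 = (\<lambda>(r, q). if 0 < q \<and> q < r \<and> r < t then h r * (r - q + e) powr (-(\<theta> + 1)) else 0)"
    define g2 where "g2 = (\<lambda>(r, q). if 0 < q \<and> q < r \<and> r < t then h q * (r - q + e) powr (-(\<theta> + 1)) else 0)"
    have bnd: "\<bar>h x * (r - q + e) powr (-(\<theta> + 1))\<bar> \<le> M * e powr (-(\<theta> + 1))" if "q < r" for x r q
      unfolding abs_mult using that e \<theta> by (intro mult_mono bd) (auto intro!: powr_mono2' M)
    have g1: "integrable (lborel \<Otimes>\<^sub>M lborel) g1" unfolding g1_def
      using integrable_triangle[of "\<lambda>(r, q). h r * (r - q + e) powr (-(\<theta> + 1))" t "M * e powr (-(\<theta> + 1))", simplified prod.case, OF _ bnd] by measurable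
    have g2: "integrable (lborel \<Otimes>\<^sub>M lborel) g2" unfolding g2_def
      using integrable_triangle[of "\<lambda>(r, q). h q * (r - q + e) powr (-(\<theta> + 1))" t "M * e powr (-(\<theta> + 1))", simplified prod.case, OF _ bnd] by measurable
    have "integral\<^sup>L (lborel \<Otimes>\<^sub>M lborel) (k e) = integral\<^sup>L (lborel \<Otimes>\<^sub>M lborel) (\<lambda>x. g1 x - g2 x)"
      by (intro Bochner_Integration.integral_cong) (auto simp: k_def g1_def g2_def algebra_simps)
    also have "\<dots> = integral\<^sup>L (lborel \<Otimes>\<^sub>M lborel) g1 - integral\<^sup>L (lborel \<Otimes>\<^sub>M lborel) g2"
      by (rule Bochner_Integration.integral_diff[OF g1 g2])
    finally have a: "integral\<^sup>L (lborel \<Otimes>\<^sub>M lborel) (k e) = integral\<^sup>L (lborel \<Otimes>\<^sub>M lborel) g1 - integral\<^sup>L (lborel \<Otimes>\<^sub>M lborel) g2" .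
    have q1: "(\<integral>q. g1 (r, q) \<partial>lborel) = (if 0 < r \<and> r < t then h r * ((e powr -\<theta> - (r + e) powr -\<theta>) / \<theta>) else 0)" for r
    proof (cases "0 < r \<and> r < t")
      case True
      have "(\<integral>q. g1 (r, q) \<partial>lborel) = (\<integral>q. h r * (if 0 < q \<and> q < r then ((r + e) - q) powr (-(\<theta> + 1)) else 0) \<partial>lborel)"
        using True by (intro Bochner_Integration.integral_cong) (auto simp: g1_def algebra_simps)
      also have "\<dots> = h r * ((((r + e) - r) powr -\<theta> - ((r + e) - 0) powr -\<theta>) / \<theta>)"
        by (subst integral_mult_right_zero, subst integral_powr_shift_left) (use True e \<theta> in auto)
      finally show ?thesis using True by simp
    next
      case False
      then have "(\<lambda>q. g1 (r, q)) = (\<lambda>_. 0)" by (auto simp: g1_def fun_eq_iff)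
      then show ?thesis using False by auto
    qed
    have q2: "(\<integral>r. g2 (r, q) \<partial>lborel) = (if 0 < q \<and> q < t then h q * ((e powr -\<theta> - (t - q + e) powr -\<theta>) / \<theta>) else 0)" for q
    proof (cases "0 < q \<and> q < t")
      case True
      have "(\<integral>r. g2 (r, q) \<partial>lborel) = (\<integral>r. h q * (if q < r \<and> r < t then (r - (q - e)) powr (-(\<theta> + 1)) else 0) \<partial>lborel)"
        using True by (intro Bochner_Integration.integral_cong) (auto simp: g2_def algebra_simps)
      also have "\<dots> = h q * (((q - (q - e)) powr -\<theta> - (t - (q - e)) powr -\<theta>) / \<theta>)"
        by (subst integral_mult_right_zero, subst integral_powr_shift_right) (use True e \<theta> in auto)
      finally show ?thesis using True by (simp add: algebra_simps)
    next
      case False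
      then have "(\<lambda>r. g2 (r, q)) = (\<lambda>_. 0)" by (auto simp: g2_def fun_eq_iff)
      then show ?thesis using False by auto
    qed
    have b1: "integrable lborel (\<lambda>r. \<integral>q. g1 (r, q) \<partial>lborel)" by (rule lborel_pair.integrable_fst'[OF g1])
    have b2: "integrable lborel (\<lambda>q. \<integral>r. g2 (r, q) \<partial>lborel)"
      by (rule lborel_pair.integrable_snd) (use g2 in simp)
    have "integral\<^sup>L (lborel \<Otimes>\<^sub>M lborel) (k e)
       = (\<integral>u. (\<integral>q. g1 (u, q) \<partial>lborel) \<partial>lborel) - (\<integral>u. (\<integral>r. g2 (r, u) \<partial>lborel) \<partial>lborel)"
      unfolding a lborel_pair.integral_fst'[OF g1] using lborel_pair.integral_snd[of "curry g2"] g2 by simp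
    also have "\<dots> = (\<integral>u. (\<integral>q. g1 (u, q) \<partial>lborel) - (\<integral>r. g2 (r, u) \<partial>lborel) \<partial>lborel)"
      by (rule Bochner_Integration.integral_diff[symmetric, OF b1 b2])
    finally have "\<theta> * integral\<^sup>L (lborel \<Otimes>\<^sub>M lborel) (k e)
      = (\<integral>u. \<theta> * ((\<integral>q. g1 (u, q) \<partial>lborel) - (\<integral>r. g2 (r, u) \<partial>lborel)) \<partial>lborel)" by simp
    also have "\<dots> = (\<integral>u. (if 0 < u \<and> u < t then h u * ((t - u + e) powr -\<theta> - (u + e) powr -\<theta>) else 0) \<partial>lborel)"
      unfolding q1 q2 using \<theta> by (intro Bochner_Integration.integral_cong) (auto simp: field_simps)
    finally show ?thesis .
  qed
  have lim2: "(\<lambda>n. \<theta> * integral\<^sup>L (lborel \<Otimes>\<^sub>M lborel) (k (e n))) \<longlonglongrightarrow>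
     (\<integral>u. (if 0 < u \<and> u < t then h u * ((t - u) powr -\<theta> - u powr -\<theta>) else 0) \<partial>lborel)"
    unfolding eq[OF e]
  proof (rule integral_dominated_convergence[where w = "\<lambda>u. M * ((if 0 < u \<and> u < t then (t - u) powr -\<theta> else 0) + (if 0 < u \<and> u < t then (u - 0) powr -\<theta> else 0))"])
    show "integrable lborel (\<lambda>u. M * ((if 0 < u \<and> u < t then (t - u) powr -\<theta> else 0) + (if 0 < u \<and> u < t then (u - 0) powr -\<theta> else 0)))"
      by (intro integrable_mult_right Bochner_Integration.integrable_add integrable_powr_right integrable_powr_left) (use \<theta> in auto)
    show "AE u in lborel. (\<lambda>n. if 0 < u \<and> u < t then h u * ((t - u + e n) powr -\<theta> - (u + e n) powr -\<theta>) else 0)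
        \<longlonglongrightarrow> (if 0 < u \<and> u < t then h u * ((t - u) powr -\<theta> - u powr -\<theta>) else 0)"
    proof (rule AE_I2)
      fix u :: real
      have "(\<lambda>n. h u * ((t - u + e n) powr -\<theta> - (u + e n) powr -\<theta>)) \<longlonglongrightarrow> h u * ((t - u + 0) powr -\<theta> - (u + 0) powr -\<theta>)"
        if "0 < u \<and> u < t" by (intro tendsto_intros elim) (use that in auto)
      then show "(\<lambda>n. if 0 < u \<and> u < t then h u * ((t - u + e n) powr -\<theta> - (u + e n) powr -\<theta>) else 0)
        \<longlonglongrightarrow> (if 0 < u \<and> u < t then h u * ((t - u) powr -\<theta> - u powr -\<theta>) else 0)" by auto
    qed
    show "AE u in lborel. norm (if 0 < u \<and> u < t then h u * ((t - u + e n) powr -\<theta> - (u + e n) powr -\<theta>) else 0)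
      \<le> M * ((if 0 < u \<and> u < t then (t - u) powr -\<theta> else 0) + (if 0 < u \<and> u < t then (u - 0) powr -\<theta> else 0))" for n
    proof (rule AE_I2)
      fix u :: real
      have "\<bar>h u\<bar> * \<bar>(t - u + e n) powr -\<theta> - (u + e n) powr -\<theta>\<bar> \<le> M * ((t - u) powr -\<theta> + u powr -\<theta>)" if u: "0 < u \<and> u < t"
      proof (intro mult_mono bd M)
        have "(t - u + e n) powr -\<theta> \<le> (t - u) powr -\<theta>" "(u + e n) powr -\<theta> \<le> u powr -\<theta>"
          by (rule powr_mono2'; use u e[of n] \<theta> in simp)+
        moreover have "(t - u + e n) powr -\<theta> \<ge> 0" "(u + e n) powr -\<theta> \<ge> 0" by auto
        ultimately show "\<bar>(t - u + e n) powr -\<theta> - (u + e n) powr -\<theta>\<bar> \<le> (t - u) powr -\<theta> + u powr -\<theta>" by linarith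
      qed auto
      then show "norm (if 0 < u \<and> u < t then h u * ((t - u + e n) powr -\<theta> - (u + e n) powr -\<theta>) else 0)
      \<le> M * ((if 0 < u \<and> u < t then (t - u) powr -\<theta> else 0) + (if 0 < u \<and> u < t then (u - 0) powr -\<theta> else 0))"
        by (auto simp: abs_mult)
    qed
  qed auto
  have lim3: "\<theta> * integral\<^sup>L (lborel \<Otimes>\<^sub>M lborel) (k 0) = (\<integral>u. (if 0 < u \<and> u < t then h u * ((t - u) powr -\<theta> - u powr -\<theta>) else 0) \<partial>lborel)"
    by (rule LIMSEQ_unique[OF tendsto_mult_left[OF lim1] lim2])
  define J where "J r = (\<integral>q. k 0 (r, q) \<partial>lborel)" for r
  have J: "integrable lborel J" unfolding J_def by (rule lborel_pair.integrable_fst'[OF k0])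
  have form: "(if 0 < r \<and> r < t then h r * r powr -\<theta> +
      \<theta> * (\<integral>q. (if 0 < q \<and> q < r then (h r - h q) * (r - q) powr (-(\<theta> + 1)) else 0) \<partial>lborel) else 0)
     = (if 0 < r \<and> r < t then h r * r powr -\<theta> else 0) + \<theta> * J r" for r
  proof -
    have "J r = (\<integral>q. (if 0 < q \<and> q < r then (h r - h q) * (r - q) powr (-(\<theta> + 1)) else 0) \<partial>lborel)" if "0 < r \<and> r < t"
      unfolding J_def using that by (intro Bochner_Integration.integral_cong) (auto simp: k_def)
    moreover have "J r = 0" if "\<not> (0 < r \<and> r < t)"
    proof -
      have "k 0 (r, q) = 0" for q using that by (auto simp: k_def)
      then show ?thesis by (simp add: J_def)
    qed
    ultimately show ?thesis by auto
  qed
  show "integrable lborel (\<lambda>r. if 0 < r \<and> r < t then h r * r powr -\<theta> +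
      \<theta> * (\<integral>q. (if 0 < q \<and> q < r then (h r - h q) * (r - q) powr (-(\<theta> + 1)) else 0) \<partial>lborel) else 0)"
    unfolding form by (intro Bochner_Integration.integrable_add integrable_mult_right i0 J)
  have "(\<integral>r. (if 0 < r \<and> r < t then h r * r powr -\<theta> else 0) + \<theta> * J r \<partial>lborel)
     = (\<integral>r. (if 0 < r \<and> r < t then h r * r powr -\<theta> else 0) \<partial>lborel) + \<theta> * integral\<^sup>L (lborel \<Otimes>\<^sub>M lborel) (k 0)"
    using i0 J by (subst Bochner_Integration.integral_add) (auto simp: J_def[abs_def] lborel_pair.integral_fst'[OF k0])
  also have "\<dots> = (\<integral>u. (if 0 < u \<and> u < t then h u * u powr -\<theta> else 0) +
      (if 0 < u \<and> u < t then h u * ((t - u) powr -\<theta> - u powr -\<theta>) else 0) \<partial>lborel)"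
  proof -
    have "integrable lborel (\<lambda>u. if 0 < u \<and> u < t then h u * ((t - u) powr -\<theta> - u powr -\<theta>) else 0)"
      by (rule Bochner_Integration.integrable_cong[THEN iffD1, OF _ _ Bochner_Integration.integrable_diff[OF it i0]]) (auto simp: algebra_simps)
    then show ?thesis unfolding lim3 by (subst Bochner_Integration.integral_add[OF i0]) auto
  qed
  also have "\<dots> = (\<integral>u. (if 0 < u \<and> u < t then h u * (t - u) powr -\<theta> else 0) \<partial>lborel)"
    by (intro Bochner_Integration.integral_cong) (auto simp: algebra_simps)
  finally show "(\<integral>r. (if 0 < r \<and> r < t then h r * r powr -\<theta> +
      \<theta> * (\<integral>q. (if 0 < q \<and> q < r then (h r - h q) * (r - q) powr (-(\<theta> + 1)) else 0) \<partial>lborel) else 0) \<partial>lborel)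
    = (\<integral>u. (if 0 < u \<and> u < t then h u * (t - u) powr -\<theta> else 0) \<partial>lborel)" unfolding form .
qed

text \<open>The substitution \<open>r = u + (t - u) * x\<close> leads to the Beta integral on the
  unit interval; the exponent \<open>a + b - 1\<close> collects both powers and the
  Jacobian.\<close>

lemma nn_integral_Beta_interval:
  fixes a b u t :: real
  assumes "0 < a" "0 < b" "u < t"
  shows "(\<integral>\<^sup>+r. ennreal (if u < r \<and> r < t then (t - r) powr (a - 1) * (r - u) powr (b - 1) else 0) \<partial>lborel)
    = ennreal ((t - u) powr (a + b - 1) * Beta b a)"
proof -
  let ?c = "t - u"
  have "((\<lambda>x. x powr (b - 1) * (1 - x) powr (a - 1)) has_integral Beta b a) {0..1}"
    by (rule has_integral_Beta_real) (use assms in auto)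
  from nn_integral_has_integral_lebesgue[OF _ this]
  have 1: "(\<integral>\<^sup>+x. ennreal (indicator {0..1} x * (x powr (b - 1) * (1 - x) powr (a - 1))) \<partial>lborel) = ennreal (Beta b a)"
    by simp
  have "(\<integral>\<^sup>+r. ennreal (if u < r \<and> r < t then (t - r) powr (a - 1) * (r - u) powr (b - 1) else 0) \<partial>lborel)
    = ?c * (\<integral>\<^sup>+x. ennreal (if u < u + ?c * x \<and> u + ?c * x < t then (t - (u + ?c * x)) powr (a - 1) * (u + ?c * x - u) powr (b - 1) else 0) \<partial>lborel)"
    by (subst nn_integral_real_affine[where c = ?c and t = u]) (use assms in auto)
  also have "(\<integral>\<^sup>+x. ennreal (if u < u + ?c * x \<and> u + ?c * x < t then (t - (u + ?c * x)) powr (a - 1) * (u + ?c * x - u) powr (b - 1) else 0) \<partial>lborel)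
    = (\<integral>\<^sup>+x. ennreal (?c powr (a + b - 2)) * ennreal (indicator {0..1} x * (x powr (b - 1) * (1 - x) powr (a - 1))) \<partial>lborel)"
  proof (rule nn_integral_cong_AE)
    have "AE x in lborel. x \<noteq> (0::real)" "AE x in lborel. x \<noteq> (1::real)" by (rule AE_lborel_singleton)+
    then show "AE x in lborel. ennreal (if u < u + ?c * x \<and> u + ?c * x < t then (t - (u + ?c * x)) powr (a - 1) * (u + ?c * x - u) powr (b - 1) else 0)
        = ennreal (?c powr (a + b - 2)) * ennreal (indicator {0..1} x * (x powr (b - 1) * (1 - x) powr (a - 1)))"
    proof eventually_elim
      case (elim x)
      have iff: "(u < u + ?c * x \<and> u + ?c * x < t) = (0 < x \<and> x < 1)"
      proof -
        have "u + y < t \<longleftrightarrow> y < t - u" for y by auto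
        then have "u + ?c * x < t \<longleftrightarrow> ?c * x < ?c * 1" by simp
        also have "\<dots> \<longleftrightarrow> x < 1" using assms by (subst mult_less_cancel_left_pos) auto
        finally show ?thesis using assms by (auto simp: zero_less_mult_iff)
      qed
      show ?case
      proof (cases "0 < x \<and> x < 1")
        case True
        have "t - (u + ?c * x) = ?c * (1 - x)" by (simp add: algebra_simps)
        moreover have "?c powr (a + b - 2) = ?c powr (a - 1) * ?c powr (b - 1)" by (simp add: powr_add[symmetric])
        ultimately show ?thesis using True assms iff
          by (simp add: powr_mult ennreal_mult'[symmetric] mult_ac)
      next
        case False
        then show ?thesis using elim iff by (auto simp: indicator_def)
      qed
    qed
  qed
  also have "\<dots> = ennreal (?c powr (a + b - 2)) * ennreal (Beta b a)"
    using 1 by (subst nn_integral_cmult) auto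
  also have "ennreal ?c * (ennreal (?c powr (a + b - 2)) * ennreal (Beta b a)) = ennreal (?c powr (a + b - 1) * Beta b a)"
  proof -
    have "?c powr (a + b - 1) = ?c * ?c powr (a + b - 2)"
      using assms powr_add[of ?c 1 "a + b - 2"] by (simp add: algebra_simps)
    then show ?thesis using assms by (simp add: ennreal_mult' mult.assoc)
  qed
  finally show ?thesis .
qed

text \<open>Measures are compared on half-lines, which requires nonnegative densities. So the
  negative parts change sides: \<open>p\<close> is the positive part of \<open>f\<close> plus the
  negative part of \<open>g\<close>, \<open>q\<close> is the reverse, and
  \<open>p - q = f - g\<close>.\<close>

lemma AE_eq_if_integral_Ioi_eq:
  fixes f g :: "real \<Rightarrow> real"
  assumes f: "integrable lborel f" and g: "integrable lborel g"
    and eq: "\<And>x. (\<integral>u. (if x < u then f u else 0) \<partial>lborel) = (\<integral>u. (if x < u then g u else 0) \<partial>lborel)"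
  shows "AE x in lborel. f x = g x"
proof -
  define p where "p x = max 0 (f x) + max 0 (- g x)" for x
  define q where "q x = max 0 (g x) + max 0 (- f x)" for x
  have [measurable]: "f \<in> borel_measurable borel" "g \<in> borel_measurable borel" using f g by auto
  have p: "integrable lborel p" and q: "integrable lborel q"
    unfolding p_def q_def using f g by (auto intro!: Bochner_Integration.integrable_add integrable_max)
  have nn: "p x \<ge> 0" "q x \<ge> 0" for x by (auto simp: p_def q_def)
  have pq: "p x - q x = f x - g x" for x by (auto simp: p_def q_def max_def)
  have res: "integrable lborel (\<lambda>u. if x < u then F u else 0)" if "integrable lborel F" for F :: "real \<Rightarrow> real" and x
    using integrable_mult_indicator[of "{x<..}" lborel F] that
    by (auto simp: indicator_def if_distrib cong: if_cong elim!: Bochner_Integration.integrable_cong[THEN iffD1, rotated -1])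
  have eq': "(\<integral>u. (if x < u then p u else 0) \<partial>lborel) = (\<integral>u. (if x < u then q u else 0) \<partial>lborel)" for x
  proof -
    have "(\<integral>u. (if x < u then p u else 0) \<partial>lborel) - (\<integral>u. (if x < u then q u else 0) \<partial>lborel)
       = (\<integral>u. (if x < u then p u else 0) - (if x < u then q u else 0) \<partial>lborel)"
      by (rule Bochner_Integration.integral_diff[symmetric]) (intro res p q)+
    also have "\<dots> = (\<integral>u. (if x < u then f u else 0) - (if x < u then g u else 0) \<partial>lborel)"
      by (intro Bochner_Integration.integral_cong) (auto simp: pq)
    also have "\<dots> = 0"
      by (subst Bochner_Integration.integral_diff) (auto intro!: res f g simp: eq)
    finally show ?thesis by simp
  qed
  have em: "emeasure (density lborel (\<lambda>x. ennreal (F x))) {x<..} = ennreal (\<integral>u. (if x < u then F u else 0) \<partial>lborel)"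
    if F: "integrable lborel F" "\<And>x. F x \<ge> 0" for F :: "real \<Rightarrow> real" and x
  proof -
    have "(\<integral>\<^sup>+u. ennreal (F u) * indicator {x<..} u \<partial>lborel) = (\<integral>\<^sup>+u. ennreal (if x < u then F u else 0) \<partial>lborel)"
      by (intro nn_integral_cong) (auto simp: indicator_def)
    also have "\<dots> = ennreal (\<integral>u. (if x < u then F u else 0) \<partial>lborel)"
      by (rule nn_integral_eq_integral) (use F res in auto)
    finally show ?thesis using F by (subst emeasure_density) auto
  qed
  have "density lborel (\<lambda>x. ennreal (p x)) = density lborel (\<lambda>x. ennreal (q x))"
    by (rule measure_eqI_lessThan) (auto simp: em[OF p nn(1)] em[OF q nn(2)] eq')
  then have "AE x in lborel. ennreal (p x) = ennreal (q x)"
    using p q by (subst (asm) sigma_finite_measure.density_unique_iff[OF sigma_finite_lborel]) auto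
  then show ?thesis
  proof eventually_elim
    case (elim x)
    then have "p x = q x" using nn by simp
    then show ?case using pq[of x] by simp
  qed
qed

text \<open>This solves Abel's equation. By \<open>eq\<close> the primitive of \<open>D\<close> is,
  up to a Gamma factor, the fractional integral of \<open>h\<close> of order
  \<open>1 - \<theta>\<close>. Applying the fractional integral of order \<open>\<theta>\<close>
  turns the right-hand side into a multiple of the primitive of \<open>h\<close>, and the left-hand
  side into the primitive of the function \<open>E\<close> to be computed. Equal primitives have
  integrands that agree a.e.\<close>

lemma abel_inversion:
  fixes D h :: "real \<Rightarrow> real"
  assumes D: "integrable lborel D" and D0: "\<And>r. \<not> (0 < r \<and> r < T) \<Longrightarrow> D r = 0"
    and h[measurable]: "h \<in> borel_measurable borel" and bd: "\<And>t. \<bar>h t\<bar> \<le> M"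
    and \<theta>: "0 < \<theta>" "\<theta> < 1" and T: "0 < T"
    and eq: "\<And>t. 0 < t \<Longrightarrow> t \<le> T \<Longrightarrow> (\<integral>r. (if 0 < r \<and> r < t then D r else 0) \<partial>lborel)
        = (\<integral>u. (if 0 < u \<and> u < t then h u * (t - u) powr -\<theta> else 0) \<partial>lborel)"
  shows "AE t in lborel. 0 < t \<and> t < T \<longrightarrow>
     (\<integral>r. (if 0 < r \<and> r < t then (t - r) powr (\<theta> - 1) * D r else 0) \<partial>lborel) = Beta (1 - \<theta>) \<theta> * h t"
proof -
  have M: "M \<ge> 0" using bd[of 0] by linarith
  have [measurable]: "D \<in> borel_measurable borel" using D by auto
  define B where "B = Beta (1 - \<theta>) \<theta>"
  have B: "B > 0" unfolding B_def Beta_def using \<theta> by (auto intro!: divide_pos_pos mult_pos_pos Gamma_real_pos)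
  define A where "A t = (\<lambda>(r, q). if 0 < q \<and> q < r \<and> r < t then (r - q) powr (\<theta> - 1) * D q else 0)" for t
  have [measurable]: "A t \<in> borel_measurable (lborel \<Otimes>\<^sub>M lborel)" for t unfolding A_def by measurable
  have Aint: "integrable (lborel \<Otimes>\<^sub>M lborel) (A t)" if t: "0 < t" "t \<le> T" for t
  proof (rule integrableI_bounded)
    have "(\<integral>\<^sup>+x. ennreal (norm (A t x)) \<partial>(lborel \<Otimes>\<^sub>M lborel)) = (\<integral>\<^sup>+q. (\<integral>\<^sup>+r. ennreal (norm (A t (r, q))) \<partial>lborel) \<partial>lborel)"
      by (rule lborel_pair.nn_integral_snd[symmetric]) auto
    also have "\<dots> \<le> (\<integral>\<^sup>+q. ennreal (T powr \<theta> / \<theta> * \<bar>D q\<bar>) \<partial>lborel)"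
    proof (rule nn_integral_mono)
      fix q :: real
      show "(\<integral>\<^sup>+r. ennreal (norm (A t (r, q))) \<partial>lborel) \<le> ennreal (T powr \<theta> / \<theta> * \<bar>D q\<bar>)"
      proof (cases "0 < q \<and> q < t")
        case True
        have "(\<integral>\<^sup>+r. ennreal (norm (A t (r, q))) \<partial>lborel) = (\<integral>\<^sup>+r. ennreal \<bar>D q\<bar> * (ennreal ((r - q) powr (\<theta> - 1)) * indicator {q<..<t} r) \<partial>lborel)"
          using True by (intro nn_integral_cong) (auto simp: A_def indicator_def abs_mult ennreal_mult'[symmetric] mult.commute)
        also have "\<dots> = ennreal \<bar>D q\<bar> * ennreal ((t - q) powr \<theta> / \<theta>)"
          using True \<theta> by (subst nn_integral_cmult) (auto simp: nn_integral_powr_right)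
        also have "\<dots> \<le> ennreal \<bar>D q\<bar> * ennreal (T powr \<theta> / \<theta>)"
          using True t \<theta> by (intro mult_left_mono ennreal_leI divide_right_mono powr_mono2) auto
        finally show ?thesis by (simp add: ennreal_mult'[symmetric] mult.commute)
      next
        case False
        then have "A t (r, q) = 0" for r by (auto simp: A_def)
        then show ?thesis by simp
      qed
    qed
    also have "\<dots> = ennreal (T powr \<theta> / \<theta>) * (\<integral>\<^sup>+q. ennreal \<bar>D q\<bar> \<partial>lborel)"
      using \<theta> by (subst nn_integral_cmult[symmetric]) (auto simp: ennreal_mult'[symmetric])
    also have "\<dots> < \<infinity>"
      using D by (auto simp: integrable_iff_bounded ennreal_mult_less_top)
    finally show "(\<integral>\<^sup>+x. ennreal (norm (A t x)) \<partial>(lborel \<Otimes>\<^sub>M lborel)) < \<infinity>" .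
  qed simp
  define E where "E r = (\<integral>q. (if 0 < q \<and> q < r then (r - q) powr (\<theta> - 1) * D q else 0) \<partial>lborel)" for r
  have Ain: "(\<integral>q. A t (r, q) \<partial>lborel) = (if 0 < r \<and> r < t then E r else 0)" for t r
  proof (cases "0 < r \<and> r < t")
    case True then show ?thesis unfolding E_def by (auto simp: A_def intro!: Bochner_Integration.integral_cong)
  next
    case False
    then have "(\<lambda>q. A t (r, q)) = (\<lambda>_. 0)" by (auto simp: A_def fun_eq_iff)
    then show ?thesis using False by auto
  qed
  have Eint: "integrable lborel (\<lambda>r. if 0 < r \<and> r < t then E r else 0)" if "0 < t" "t \<le> T" for t
    using lborel_pair.integrable_fst'[OF Aint[OF that]] unfolding Ain .
  have hint: "integrable lborel (\<lambda>u. if 0 < u \<and> u < t then h u else 0)" for t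
    by (rule integrableI_bounded_set[where A = "{0..t}" and B = M]) (use bd in \<open>auto simp: M emeasure_lborel_Icc_eq\<close>)
  have main: "(\<integral>r. (if 0 < r \<and> r < t then E r else 0) \<partial>lborel) = (\<integral>u. (if 0 < u \<and> u < t then B * h u else 0) \<partial>lborel)"
    if t: "0 < t" "t \<le> T" for t
  proof -
    \<comment> \<open>both sides are \<open>I\<^sup>\<theta> I\<^sup>1 D\<close>\<close>
    define C where "C = (\<lambda>(p, q). if 0 < q \<and> q < p \<and> p < t then (t - p) powr (\<theta> - 1) * D q else 0)"
    define G where "G = (\<lambda>(p, u). if 0 < u \<and> u < p \<and> p < t then (t - p) powr (\<theta> - 1) * (h u * (p - u) powr -\<theta>) else 0)"
    have [measurable]: "C \<in> borel_measurable (lborel \<Otimes>\<^sub>M lborel)" "G \<in> borel_measurable (lborel \<Otimes>\<^sub>M lborel)"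
      unfolding C_def G_def by measurable
    have Cq: "(\<integral>\<^sup>+p. ennreal (norm (C (p, q))) \<partial>lborel) = ennreal (if 0 < q \<and> q < t then (t - q) powr \<theta> / \<theta> * \<bar>D q\<bar> else 0)" for q
    proof (cases "0 < q \<and> q < t")
      case True
      have "(\<integral>\<^sup>+p. ennreal (norm (C (p, q))) \<partial>lborel) = (\<integral>\<^sup>+p. ennreal \<bar>D q\<bar> * (ennreal ((t - p) powr (\<theta> - 1)) * indicator {q<..<t} p) \<partial>lborel)"
        using True by (intro nn_integral_cong) (auto simp: C_def indicator_def abs_mult ennreal_mult'[symmetric] mult.commute)
      also have "\<dots> = ennreal \<bar>D q\<bar> * ennreal ((t - q) powr \<theta> / \<theta>)"
        using True \<theta> by (subst nn_integral_cmult) (auto simp: nn_integral_powr_left)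
      finally show ?thesis using True by (simp add: ennreal_mult'[symmetric] mult.commute)
    next
      case False
      then have "C (p, q) = 0" for p by (auto simp: C_def)
      then have "(\<integral>\<^sup>+p. ennreal (norm (C (p, q))) \<partial>lborel) = 0" by simp
      then show ?thesis using False by auto
    qed
    have Cint: "integrable (lborel \<Otimes>\<^sub>M lborel) C"
    proof (rule integrableI_bounded)
      have "(\<integral>\<^sup>+x. ennreal (norm (C x)) \<partial>(lborel \<Otimes>\<^sub>M lborel)) = (\<integral>\<^sup>+q. (\<integral>\<^sup>+p. ennreal (norm (C (p, q))) \<partial>lborel) \<partial>lborel)"
        by (rule lborel_pair.nn_integral_snd[symmetric]) auto
      also have "\<dots> \<le> (\<integral>\<^sup>+q. ennreal (T powr \<theta> / \<theta>) * ennreal \<bar>D q\<bar> \<partial>lborel)"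
        unfolding Cq using t \<theta> by (intro nn_integral_mono)
          (auto simp: ennreal_mult'[symmetric] intro!: ennreal_leI mult_right_mono divide_right_mono powr_mono2)
      also have "\<dots> < \<infinity>"
        using D by (subst nn_integral_cmult) (auto simp: integrable_iff_bounded ennreal_mult_less_top)
      finally show "(\<integral>\<^sup>+x. ennreal (norm (C x)) \<partial>(lborel \<Otimes>\<^sub>M lborel)) < \<infinity>" .
    qed simp
    have Gu: "(\<integral>\<^sup>+p. ennreal (norm (G (p, u))) \<partial>lborel) = ennreal (if 0 < u \<and> u < t then \<bar>h u\<bar> * B else 0)" for u
    proof (cases "0 < u \<and> u < t")
      case True
      have "(\<integral>\<^sup>+p. ennreal (norm (G (p, u))) \<partial>lborel) = (\<integral>\<^sup>+p. ennreal \<bar>h u\<bar> *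
          ennreal (if u < p \<and> p < t then (t - p) powr (\<theta> - 1) * (p - u) powr ((1 - \<theta>) - 1) else 0) \<partial>lborel)"
        using True by (intro nn_integral_cong) (auto simp: G_def abs_mult ennreal_mult'[symmetric] mult_ac)
      also have "\<dots> = ennreal \<bar>h u\<bar> * ennreal B"
        using True \<theta> by (subst nn_integral_cmult, simp, subst nn_integral_Beta_interval) (auto simp: B_def)
      finally show ?thesis using True by (simp add: ennreal_mult'[symmetric])
    next
      case False
      then have "G (p, u) = 0" for p by (auto simp: G_def)
      then have "(\<integral>\<^sup>+p. ennreal (norm (G (p, u))) \<partial>lborel) = 0" by simp
      then show ?thesis using False by auto
    qed
    have Gint: "integrable (lborel \<Otimes>\<^sub>M lborel) G"
    proof (rule integrableI_bounded)
      have "(\<integral>\<^sup>+x. ennreal (norm (G x)) \<partial>(lborel \<Otimes>\<^sub>M lborel)) = (\<integral>\<^sup>+q. (\<integral>\<^sup>+p. ennreal (norm (G (p, q))) \<partial>lborel) \<partial>lborel)"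
        by (rule lborel_pair.nn_integral_snd[symmetric]) auto
      also have "\<dots> \<le> (\<integral>\<^sup>+u. ennreal (M * B) * indicator {0..t} u \<partial>lborel)"
        unfolding Gu using B bd by (intro nn_integral_mono) (auto simp: indicator_def intro!: ennreal_leI mult_right_mono)
      also have "\<dots> < \<infinity>"
        using t by (subst nn_integral_cmult) (auto simp: ennreal_mult_less_top)
      finally show "(\<integral>\<^sup>+x. ennreal (norm (G x)) \<partial>(lborel \<Otimes>\<^sub>M lborel)) < \<infinity>" .
    qed simp
    have "(\<integral>r. (if 0 < r \<and> r < t then E r else 0) \<partial>lborel) = integral\<^sup>L (lborel \<Otimes>\<^sub>M lborel) (A t)"
      using lborel_pair.integral_fst'[OF Aint[OF t]] unfolding Ain .
    also have "\<dots> = (\<integral>q. (\<integral>r. A t (r, q) \<partial>lborel) \<partial>lborel)"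
      using lborel_pair.integral_snd[of "curry (A t)"] Aint[OF t] by simp
    \<comment> \<open>Fractional integrals commute: for fixed \<open>q\<close> both inner integrals
      run over the interval from \<open>q\<close> to \<open>t\<close>, and the reflection of
      \<open>p\<close> into \<open>t + q - p\<close> maps one to the other.\<close>
    also have "\<dots> = (\<integral>q. (\<integral>p. C (p, q) \<partial>lborel) \<partial>lborel)"
    proof (rule Bochner_Integration.integral_cong[OF refl])
      fix q :: real
      show "(\<integral>r. A t (r, q) \<partial>lborel) = (\<integral>p. C (p, q) \<partial>lborel)"
      proof (cases "0 < q \<and> q < t")
        case True
        have "(\<integral>p. C (p, q) \<partial>lborel) = (\<integral>p. C (t + q + -1 * p, q) \<partial>lborel)"
          by (subst lborel_integral_real_affine[where c = "-1" and t = "t + q"]) auto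
        also have "\<dots> = (\<integral>r. A t (r, q) \<partial>lborel)"
          using True by (intro Bochner_Integration.integral_cong) (auto simp: A_def C_def)
        finally show ?thesis ..
      next
        case False
        then have "(\<lambda>r. A t (r, q)) = (\<lambda>_. 0)" "(\<lambda>r. C (r, q)) = (\<lambda>_. 0)" by (auto simp: A_def C_def fun_eq_iff)
        then show ?thesis by simp
      qed
    qed
    also have "\<dots> = integral\<^sup>L (lborel \<Otimes>\<^sub>M lborel) C"
      using lborel_pair.integral_snd[of "curry C"] Cint by simp
    also have "\<dots> = (\<integral>p. (\<integral>q. C (p, q) \<partial>lborel) \<partial>lborel)"
      by (rule lborel_pair.integral_fst'[OF Cint, symmetric])
    also have "\<dots> = (\<integral>p. (\<integral>u. G (p, u) \<partial>lborel) \<partial>lborel)"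
    proof (rule Bochner_Integration.integral_cong[OF refl])
      fix p :: real
      show "(\<integral>q. C (p, q) \<partial>lborel) = (\<integral>u. G (p, u) \<partial>lborel)"
      proof (cases "0 < p \<and> p < t")
        case True
        have "(\<integral>q. C (p, q) \<partial>lborel) = (\<integral>q. (t - p) powr (\<theta> - 1) * (if 0 < q \<and> q < p then D q else 0) \<partial>lborel)"
          using True by (intro Bochner_Integration.integral_cong) (auto simp: C_def)
        also have "\<dots> = (t - p) powr (\<theta> - 1) * (\<integral>u. (if 0 < u \<and> u < p then h u * (p - u) powr -\<theta> else 0) \<partial>lborel)"
          using True t by (subst integral_mult_right_zero, subst eq) auto
        also have "\<dots> = (\<integral>u. (t - p) powr (\<theta> - 1) * (if 0 < u \<and> u < p then h u * (p - u) powr -\<theta> else 0) \<partial>lborel)"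
          by simp
        also have "\<dots> = (\<integral>u. G (p, u) \<partial>lborel)"
          using True by (intro Bochner_Integration.integral_cong) (auto simp: G_def)
        finally show ?thesis .
      next
        case False
        then have "(\<lambda>r. G (p, r)) = (\<lambda>_. 0)" "(\<lambda>r. C (p, r)) = (\<lambda>_. 0)" by (auto simp: G_def C_def fun_eq_iff)
        then show ?thesis by simp
      qed
    qed
    also have "\<dots> = integral\<^sup>L (lborel \<Otimes>\<^sub>M lborel) G"
      by (rule lborel_pair.integral_fst'[OF Gint])
    also have "\<dots> = (\<integral>u. (\<integral>p. G (p, u) \<partial>lborel) \<partial>lborel)"
      using lborel_pair.integral_snd[of "curry G"] Gint by simp
    also have "\<dots> = (\<integral>u. (if 0 < u \<and> u < t then B * h u else 0) \<partial>lborel)"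
    proof (rule Bochner_Integration.integral_cong[OF refl])
      fix u :: real
      show "(\<integral>p. G (p, u) \<partial>lborel) = (if 0 < u \<and> u < t then B * h u else 0)"
      proof (cases "0 < u \<and> u < t")
        case True
        have "(\<integral>p. G (p, u) \<partial>lborel) = (\<integral>p. h u * (if u < p \<and> p < t then (t - p) powr (\<theta> - 1) * (p - u) powr ((1 - \<theta>) - 1) else 0) \<partial>lborel)"
          using True by (intro Bochner_Integration.integral_cong) (auto simp: G_def mult_ac)
        also have "\<dots> = h u * (\<integral>p. (if u < p \<and> p < t then (t - p) powr (\<theta> - 1) * (p - u) powr ((1 - \<theta>) - 1) else 0) \<partial>lborel)"
          by simp
        also have "(\<integral>p. (if u < p \<and> p < t then (t - p) powr (\<theta> - 1) * (p - u) powr ((1 - \<theta>) - 1) else 0) \<partial>lborel) = B"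
          by (subst integral_eq_nn_integral, simp, simp, subst nn_integral_Beta_interval) (use True \<theta> B in \<open>auto simp: B_def\<close>)
        finally show ?thesis using True by simp
      next
        case False
        then have "(\<lambda>p. G (p, u)) = (\<lambda>_. 0)" by (auto simp: G_def fun_eq_iff)
        then show ?thesis using False by auto
      qed
    qed
    finally show ?thesis .
  qed
  let ?f = "\<lambda>r. if 0 < r \<and> r < T then E r else 0"
  let ?g = "\<lambda>u. if 0 < u \<and> u < T then B * h u else 0"
  have fi: "integrable lborel ?f" using Eint[of T] T by simp
  have gi: "integrable lborel (\<lambda>u. if 0 < u \<and> u < t then B * h u else 0)" for t
    using integrable_mult_right[OF hint, of B t] by (rule Bochner_Integration.integrable_cong[THEN iffD1, rotated -1]) auto
  have "AE x in lborel. ?f x = ?g x"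
  proof (rule AE_eq_if_integral_Ioi_eq[OF fi gi])
    fix x :: real
    consider "x \<le> 0" | "0 < x" "x < T" | "T \<le> x" by linarith
    then show "(\<integral>u. (if x < u then ?f u else 0) \<partial>lborel) = (\<integral>u. (if x < u then ?g u else 0) \<partial>lborel)"
    proof cases
      case 1
      then have "(\<lambda>u. if x < u then ?f u else 0) = ?f" "(\<lambda>u. if x < u then ?g u else 0) = ?g" by (auto simp: fun_eq_iff)
      then show ?thesis using main[of T] T by simp
    next
      case 2
      have ne: "AE u in lborel. u \<noteq> x" by (rule AE_lborel_singleton)
      \<comment> \<open>\<open>main\<close> speaks only of intervals starting at 0, so the part
        beyond \<open>x\<close> is obtained as a difference of two of them.\<close>
      have split: "(\<integral>u. (if x < u then (if 0 < u \<and> u < T then F u else 0) else 0) \<partial>lborel)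
          = (\<integral>u. (if 0 < u \<and> u < T then F u else 0) \<partial>lborel) - (\<integral>u. (if 0 < u \<and> u < x then F u else 0) \<partial>lborel)"
        if "integrable lborel (\<lambda>u. if 0 < u \<and> u < T then F u else 0)" "integrable lborel (\<lambda>u. if 0 < u \<and> u < x then F u else 0)"
        for F :: "real \<Rightarrow> real"
      proof -
        have [measurable]: "(\<lambda>u. if 0 < u \<and> u < T then F u else 0) \<in> borel_measurable borel" using that by auto
        have "(\<integral>u. (if 0 < u \<and> u < T then F u else 0) \<partial>lborel) - (\<integral>u. (if 0 < u \<and> u < x then F u else 0) \<partial>lborel)
           = (\<integral>u. (if 0 < u \<and> u < T then F u else 0) - (if 0 < u \<and> u < x then F u else 0) \<partial>lborel)"
          by (rule Bochner_Integration.integral_diff[symmetric]) (use that in auto)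
        also have "\<dots> = (\<integral>u. (if x < u then (if 0 < u \<and> u < T then F u else 0) else 0) \<partial>lborel)"
        proof (rule integral_cong_AE)
          show "(\<lambda>u. (if 0 < u \<and> u < T then F u else 0) - (if 0 < u \<and> u < x then F u else 0)) \<in> borel_measurable lborel"
            using that by (intro borel_measurable_diff) auto
          show "AE u in lborel. (if 0 < u \<and> u < T then F u else 0) - (if 0 < u \<and> u < x then F u else 0) = (if x < u then (if 0 < u \<and> u < T then F u else 0) else 0)"
            using ne by eventually_elim (use 2 in auto)
        qed simp
        finally show ?thesis ..
      qed
      show ?thesis using 2 T Eint[of T] Eint[of x] gi[of T] gi[of x] main[of T] main[of x] by (simp add: split)
    next
      case 3
      then have "(\<lambda>u. if x < u then ?f u else 0) = (\<lambda>_. 0)" "(\<lambda>u. if x < u then ?g u else 0) = (\<lambda>_. 0)" by (auto simp: fun_eq_iff)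
      then show ?thesis by simp
    qed
  qed
  then show ?thesis by eventually_elim (auto simp: E_def B_def)
qed

text \<open>If \<open>K\<close> has a density, its Marchaud derivative is an ordinary fractional
  integral of that density: write \<open>K t - K r\<close> as the integral of \<open>\<phi>\<close>
  from \<open>t\<close> to \<open>r\<close> and exchange the integrations. The contribution of the
  upper limit \<open>T\<close> cancels the boundary term
  \<open>K t * (T - t) powr -\<beta>\<close>.\<close>

lemma marchaud_of_primitive:
  fixes \<phi> K :: "real \<Rightarrow> real"
  assumes [measurable]: "\<phi> \<in> borel_measurable borel" and bd: "\<And>u. \<bar>\<phi> u\<bar> \<le> M"
    and K: "\<And>r. t \<le> r \<Longrightarrow> r < T \<Longrightarrow> K r = (\<integral>u. (if r < u \<and> u < T then \<phi> u else 0) \<partial>lborel)"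
    and \<beta>: "0 < \<beta>" "\<beta> < 1" and t: "t < T"
  shows "K t * (T - t) powr -\<beta> + \<beta> * (\<integral>r. (if t < r \<and> r < T then (K t - K r) * (r - t) powr (-(\<beta> + 1)) else 0) \<partial>lborel)
    = (\<integral>u. (if t < u \<and> u < T then \<phi> u * (u - t) powr -\<beta> else 0) \<partial>lborel)"
proof -
  have M: "M \<ge> 0" using bd[of 0] by linarith
  have \<phi>i: "integrable lborel (\<lambda>u. if a < u \<and> u < b then \<phi> u else 0)" for a b
    by (rule integrableI_bounded_set[where A = "{a..b}" and B = M]) (use bd in \<open>auto simp: M emeasure_lborel_Icc_eq\<close>)
  have Kd: "K t - K r = (\<integral>u. (if t < u \<and> u < r then \<phi> u else 0) \<partial>lborel)" if r: "t < r" "r < T" for r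
  proof -
    have "K t - K r = (\<integral>u. (if t < u \<and> u < T then \<phi> u else 0) - (if r < u \<and> u < T then \<phi> u else 0) \<partial>lborel)"
      using r by (subst Bochner_Integration.integral_diff) (auto simp: K \<phi>i)
    also have "\<dots> = (\<integral>u. (if t < u \<and> u < r then \<phi> u else 0) \<partial>lborel)"
    proof (rule integral_cong_AE)
      have "AE u in lborel. u \<noteq> r" by (rule AE_lborel_singleton)
      then show "AE u in lborel. (if t < u \<and> u < T then \<phi> u else 0) - (if r < u \<and> u < T then \<phi> u else 0) = (if t < u \<and> u < r then \<phi> u else 0)"
        by eventually_elim (use r in auto)
    qed auto
    finally show ?thesis .
  qed
  define A where "A = (\<lambda>(r, u). if t < u \<and> u < r \<and> r < T then \<phi> u * (r - t) powr (-(\<beta> + 1)) else 0)"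
  have [measurable]: "A \<in> borel_measurable (lborel \<Otimes>\<^sub>M lborel)" unfolding A_def by measurable
  have Aint: "integrable (lborel \<Otimes>\<^sub>M lborel) A"
  proof (rule integrableI_bounded)
    have "(\<integral>\<^sup>+x. ennreal (norm (A x)) \<partial>(lborel \<Otimes>\<^sub>M lborel)) = (\<integral>\<^sup>+r. (\<integral>\<^sup>+u. ennreal (norm (A (r, u))) \<partial>lborel) \<partial>lborel)"
      by (rule lborel.nn_integral_fst[symmetric]) auto
    also have "\<dots> \<le> (\<integral>\<^sup>+r. ennreal M * (ennreal ((r - t) powr -\<beta>) * indicator {t<..<T} r) \<partial>lborel)"
    proof (rule nn_integral_mono)
      fix r :: real
      show "(\<integral>\<^sup>+u. ennreal (norm (A (r, u))) \<partial>lborel) \<le> ennreal M * (ennreal ((r - t) powr -\<beta>) * indicator {t<..<T} r)"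
      proof (cases "t < r \<and> r < T")
        case True
        have "(\<integral>\<^sup>+u. ennreal (norm (A (r, u))) \<partial>lborel) \<le> (\<integral>\<^sup>+u. ennreal (M * (r - t) powr (-(\<beta> + 1))) * indicator {t..r} u \<partial>lborel)"
          using True M bd by (intro nn_integral_mono) (auto simp: A_def indicator_def abs_mult intro!: ennreal_leI mult_right_mono)
        also have "\<dots> = ennreal (M * (r - t) powr (-(\<beta> + 1)) * (r - t))"
          using True M by (subst nn_integral_cmult) (auto simp: ennreal_mult'[symmetric])
        also have "M * (r - t) powr (-(\<beta> + 1)) * (r - t) = M * (r - t) powr -\<beta>"
          using True powr_add[of "r - t" "-(\<beta> + 1)" 1] by simp
        finally show ?thesis using True M by (simp add: ennreal_mult')
      next
        case False
        then have "A (r, u) = 0" for u by (auto simp: A_def)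
        then have "(\<integral>\<^sup>+u. ennreal (norm (A (r, u))) \<partial>lborel) = 0" by simp
        then show ?thesis by simp
      qed
    qed
    also have "\<dots> < \<infinity>"
      using \<beta> t by (subst nn_integral_cmult) (auto simp: nn_integral_powr_right ennreal_mult_less_top)
    finally show "(\<integral>\<^sup>+x. ennreal (norm (A x)) \<partial>(lborel \<Otimes>\<^sub>M lborel)) < \<infinity>" .
  qed simp
  have "(\<integral>r. (if t < r \<and> r < T then (K t - K r) * (r - t) powr (-(\<beta> + 1)) else 0) \<partial>lborel) = (\<integral>r. (\<integral>u. A (r, u) \<partial>lborel) \<partial>lborel)"
  proof (rule Bochner_Integration.integral_cong[OF refl])
    fix r :: real
    show "(if t < r \<and> r < T then (K t - K r) * (r - t) powr (-(\<beta> + 1)) else 0) = (\<integral>u. A (r, u) \<partial>lborel)"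
    proof (cases "t < r \<and> r < T")
      case True
      have "(\<integral>u. A (r, u) \<partial>lborel) = (\<integral>u. (if t < u \<and> u < r then \<phi> u else 0) * (r - t) powr (-(\<beta> + 1)) \<partial>lborel)"
        using True by (intro Bochner_Integration.integral_cong) (auto simp: A_def)
      then show ?thesis using True by (simp add: Kd)
    next
      case False
      then have "(\<lambda>u. A (r, u)) = (\<lambda>_. 0)" by (auto simp: A_def fun_eq_iff)
      then show ?thesis using False by auto
    qed
  qed
  also have "\<dots> = (\<integral>u. (\<integral>r. A (r, u) \<partial>lborel) \<partial>lborel)"
    using lborel_pair.integral_snd[of "curry A"] Aint lborel_pair.integral_fst'[OF Aint] by simp
  also have "\<dots> = (\<integral>u. (if t < u \<and> u < T then \<phi> u * (((u - t) powr -\<beta> - (T - t) powr -\<beta>) / \<beta>) else 0) \<partial>lborel)"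
  proof (rule Bochner_Integration.integral_cong[OF refl])
    fix u :: real
    show "(\<integral>r. A (r, u) \<partial>lborel) = (if t < u \<and> u < T then \<phi> u * (((u - t) powr -\<beta> - (T - t) powr -\<beta>) / \<beta>) else 0)"
    proof (cases "t < u \<and> u < T")
      case True
      have "(\<integral>r. A (r, u) \<partial>lborel) = (\<integral>r. \<phi> u * (if u < r \<and> r < T then (r - t) powr (-(\<beta> + 1)) else 0) \<partial>lborel)"
        using True by (intro Bochner_Integration.integral_cong) (auto simp: A_def)
      also have "\<dots> = \<phi> u * (((u - t) powr -\<beta> - (T - t) powr -\<beta>) / \<beta>)"
        by (subst integral_mult_right_zero, subst integral_powr_shift_right) (use True \<beta> in auto)
      finally show ?thesis using True by simp
    next
      case False
      then have "(\<lambda>r. A (r, u)) = (\<lambda>_. 0)" by (auto simp: A_def fun_eq_iff)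
      then show ?thesis using False by auto
    qed
  qed
  finally have 1: "\<beta> * (\<integral>r. (if t < r \<and> r < T then (K t - K r) * (r - t) powr (-(\<beta> + 1)) else 0) \<partial>lborel)
     = (\<integral>u. \<beta> * (if t < u \<and> u < T then \<phi> u * (((u - t) powr -\<beta> - (T - t) powr -\<beta>) / \<beta>) else 0) \<partial>lborel)" by simp
  also have "\<dots> = (\<integral>u. (if t < u \<and> u < T then \<phi> u * (u - t) powr -\<beta> else 0) - (T - t) powr -\<beta> * (if t < u \<and> u < T then \<phi> u else 0) \<partial>lborel)"
    using \<beta> by (intro Bochner_Integration.integral_cong) (auto simp: field_simps)
  also have "\<dots> = (\<integral>u. (if t < u \<and> u < T then \<phi> u * (u - t) powr -\<beta> else 0) \<partial>lborel) - (T - t) powr -\<beta> * K t"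
  proof -
    have "integrable lborel (\<lambda>u. if t < u \<and> u < T then \<phi> u * (u - t) powr -\<beta> else 0)"
      by (rule Bochner_Integration.integrable_bound[OF integrable_mult_right[OF integrable_powr_right[of "-\<beta>" t T], of M]])
         (use \<beta> M bd in \<open>auto simp: abs_mult intro!: mult_right_mono\<close>)
    then show ?thesis
      using t by (subst Bochner_Integration.integral_diff) (auto simp: \<phi>i K)
  qed
  finally show ?thesis by (simp add: algebra_simps)
qed

text \<open>For a non-integrable \<open>f\<close> the Bochner integral has the default value 0, and
  \<open>g\<close> is nonnegative by \<open>le\<close>, so the bound holds in that case too.\<close>

lemma abs_integral_le:
  fixes f g :: "'a \<Rightarrow> real"
  assumes g: "integrable M g" and le: "\<And>x. \<bar>f x\<bar> \<le> g x"
  shows "\<bar>integral\<^sup>L M f\<bar> \<le> integral\<^sup>L M g"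
proof (cases "integrable M f")
  case True
  have "\<bar>integral\<^sup>L M f\<bar> \<le> (\<integral>x. \<bar>f x\<bar> \<partial>M)" by (rule integral_abs_bound)
  also have "\<dots> \<le> integral\<^sup>L M g" by (rule integral_mono) (use True g le in auto)
  finally show ?thesis .
next
  case False
  have "0 \<le> g x" for x using le[of x] by linarith
  then show ?thesis using False by (simp add: not_integrable_integral_eq)
qed

lemma integral_powr_right:
  fixes a b p :: real
  assumes "p > -1" "a \<le> b"
  shows "(\<integral>u. (if a < u \<and> u < b then (u - a) powr p else 0) \<partial>lborel) = (b - a) powr (p + 1) / (p + 1)"
proof -
  have "(\<integral>\<^sup>+u. ennreal (if a < u \<and> u < b then (u - a) powr p else 0) \<partial>lborel)
      = (\<integral>\<^sup>+u\<in>{a<..<b}. ennreal ((u - a) powr p) \<partial>lborel)"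
    by (intro nn_integral_cong) (auto simp: indicator_def)
  then show ?thesis
    using assms by (subst integral_eq_nn_integral) (auto simp: nn_integral_powr_right)
qed

lemma holder_on_continuous_on:
  assumes h: "holder_on \<gamma> S f" and \<gamma>: "0 < \<gamma>"
  shows "continuous_on S f"
proof -
  obtain C where C: "\<And>s t. s \<in> S \<Longrightarrow> t \<in> S \<Longrightarrow> dist (f s) (f t) \<le> C * dist s t powr \<gamma>"
    using h by (auto simp: holder_on_def)
  show ?thesis unfolding continuous_on
  proof
    fix s assume s: "s \<in> S"
    have "((\<lambda>t. C * dist t s powr \<gamma>) \<longlongrightarrow> C * 0 powr \<gamma>) (at s within S)"
    proof (intro tendsto_mult tendsto_const tendsto_powr')
      show "((\<lambda>t. dist t s) \<longlongrightarrow> 0) (at s within S)"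
        using tendsto_dist[OF tendsto_ident_at[of s S] tendsto_const[of s]] by simp
    qed (use \<gamma> in auto)
    then have "((\<lambda>t. C * dist t s powr \<gamma>) \<longlongrightarrow> 0) (at s within S)" using \<gamma> by simp
    then have "((\<lambda>t. dist (f t) (f s)) \<longlongrightarrow> 0) (at s within S)"
    proof (rule Lim_null_comparison[rotated])
      show "\<forall>\<^sub>F t in at s within S. norm (dist (f t) (f s)) \<le> C * dist t s powr \<gamma>"
        using C s by (auto simp: eventually_at_filter)
    qed
    then show "(f \<longlongrightarrow> f s) (at s within S)" by (rule tendsto_dist_iff[THEN iffD2])
  qed
qed

text \<open>
  Up to a constant, \<open>K r\<close> is the average of \<open>\<kappa>\<close> over \<open>[r, r + e]\<close>; the mean value theorem
  transfers bounds on the increments of \<open>\<kappa>\<close> to \<open>K\<close>.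
\<close>

lemma moving_average_increment:
  fixes \<kappa> :: "real \<Rightarrow> real" and T e :: real
  defines "K \<equiv> \<lambda>r. \<integral>u. (if r < u \<and> u < T then (\<kappa> u - \<kappa> (u + e)) / e else 0) \<partial>lborel"
  assumes cont: "continuous_on UNIV \<kappa>" and e: "0 < e" and tr: "0 \<le> t" "t \<le> T" "0 \<le> r" "r \<le> T"
  shows "\<exists>\<xi>. 0 < \<xi> \<and> \<xi> < e \<and> K t - K r = \<kappa> (t + \<xi>) - \<kappa> (r + \<xi>)"
proof -
  \<comment> \<open>The margin of 1 at both ends makes every point that occurs below an interior
    point, where \<open>G\<close> has a two-sided derivative.\<close>
  obtain G where G: "\<And>x. x \<in> {-1..T + e + 1} \<Longrightarrow> (G has_vector_derivative \<kappa> x) (at x within {-1..T + e + 1})"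
    using antiderivative_continuous[of "-1" "T + e + 1" \<kappa>] continuous_on_subset[OF cont] by blast
  have G': "(G has_real_derivative \<kappa> x) (at x)" if "-1 < x" "x < T + e + 1" for x
    using G[of x] that by (simp add: at_within_Icc_at has_real_derivative_iff_has_vector_derivative)
  have [measurable]: "\<kappa> \<in> borel_measurable borel" by (rule borel_measurable_continuous_onI[OF cont])
  have isC: "isCont \<kappa> x" for x using cont by (simp add: continuous_on_eq_continuous_at)
  have KG: "K r = ((G T - G (T + e)) / e) - ((G r - G (r + e)) / e)" if r: "0 \<le> r" "r \<le> T" for r
  proof -
    have "(\<integral>u. ((\<kappa> u - \<kappa> (u + e)) / e) * indicator {r..T} u \<partial>lborel) = ((G T - G (T + e)) / e) - ((G r - G (r + e)) / e)"
    proof (rule integral_FTC_Icc_real[where F = "\<lambda>x. (G x - G (x + e)) / e"])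
      fix x assume x: "r \<le> x" "x \<le> T"
      have "((\<lambda>x. G (x + e)) has_real_derivative \<kappa> (x + e)) (at x)"
        using G'[of "x + e"] x r e by (simp add: DERIV_shift)
      then show "((\<lambda>x. (G x - G (x + e)) / e) has_real_derivative (\<kappa> x - \<kappa> (x + e)) / e) (at x)"
        using x r e by (intro DERIV_cdivide DERIV_diff G') auto
      have "isCont (\<lambda>x. \<kappa> (x + e)) x" by (rule isCont_o2[OF _ isC]) auto
      then show "isCont (\<lambda>x. (\<kappa> x - \<kappa> (x + e)) / e) x" using e isC by (intro continuous_intros) auto
    qed (use r in auto)
    moreover have "K r = (\<integral>u. ((\<kappa> u - \<kappa> (u + e)) / e) * indicator {r..T} u \<partial>lborel)"
      unfolding K_def
    proof (rule integral_cong_AE)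
      have "AE x in lborel. x \<noteq> r" "AE x in lborel. x \<noteq> T" by (rule AE_lborel_singleton)+
      then show "AE x in lborel. (if r < x \<and> x < T then (\<kappa> x - \<kappa> (x + e)) / e else 0) = (\<kappa> x - \<kappa> (x + e)) / e * indicator {r..T} x"
        by eventually_elim (auto simp: indicator_def)
    qed auto
    ultimately show ?thesis by simp
  qed
  define p where "p x = G (x + t) - G (x + r)" for x
  have "\<exists>\<xi>. 0 < \<xi> \<and> \<xi> < e \<and> p e - p 0 = (e - 0) * (\<kappa> (t + \<xi>) - \<kappa> (r + \<xi>))"
  proof (rule MVT2[OF e])
    fix x assume x: "0 \<le> x" "x \<le> e"
    have "((\<lambda>x. G (x + t)) has_real_derivative \<kappa> (x + t)) (at x)" "((\<lambda>x. G (x + r)) has_real_derivative \<kappa> (x + r)) (at x)"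
      using G'[of "x + t"] G'[of "x + r"] x tr e by (simp_all add: DERIV_shift)
    then show "(p has_real_derivative \<kappa> (t + x) - \<kappa> (r + x)) (at x)"
      unfolding p_def by (subst (1 2) add.commute) (rule DERIV_diff)
  qed
  then obtain \<xi> where \<xi>: "0 < \<xi>" "\<xi> < e" "p e - p 0 = e * (\<kappa> (t + \<xi>) - \<kappa> (r + \<xi>))" by auto
  \<comment> \<open>The values of \<open>G\<close> at \<open>T\<close> and \<open>T + e\<close>
    enter \<open>KG\<close> in the same way for \<open>t\<close> and \<open>r\<close> and drop
    out.\<close>
  have "K t - K r = (p e - p 0) / e"
    unfolding KG[OF tr(1,2)] KG[OF tr(3,4)] p_def using e by (simp add: field_simps)
  then show ?thesis using \<xi> e by auto
qed

text \<open>\<open>Dh\<close> and \<open>b\<close> are the two fractional derivatives without their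
  Gamma factors. If \<open>\<kappa>\<close> is replaced by its moving averages \<open>K n\<close>,
  the derivative \<open>b\<close> becomes the fractional integral \<open>bn n\<close> of a
  difference quotient. Tonelli-Fubini moves the kernel onto \<open>Dh\<close>, where Abel inversion
  gives back \<open>h\<close>. The averages inherit the Hoelder bound of \<open>\<kappa>\<close>
  uniformly in \<open>n\<close>, which yields dominated convergence of \<open>bn n\<close> to
  \<open>b\<close>.\<close>

lemma stieltjes_forward_limit_aux:
  fixes h \<kappa> d :: "_ \<Rightarrow> real" and T \<theta> :: real
  defines "Dh \<equiv> \<lambda>r. if 0 < r \<and> r < T then h r * r powr -\<theta> +
      \<theta> * (\<integral>q. (if 0 < q \<and> q < r then (h r - h q) * (r - q) powr (-(\<theta> + 1)) else 0) \<partial>lborel) else 0"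
    and "b \<equiv> \<lambda>t. (\<kappa> t - \<kappa> T) * (T - t) powr -(1 - \<theta>) +
      (1 - \<theta>) * (\<integral>r. (if t < r \<and> r < T then (\<kappa> t - \<kappa> r) * (r - t) powr (-((1 - \<theta>) + 1)) else 0) \<partial>lborel)"
  assumes h[measurable]: "h \<in> borel_measurable borel" and bd: "\<And>t. \<bar>h t\<bar> \<le> M"
    and \<theta>: "0 < \<theta>" "\<theta> < 1" and T: "0 < T" and \<gamma>: "1 - \<theta> < \<gamma>"
    and fin: "integrable (lborel \<Otimes>\<^sub>M lborel)
      (\<lambda>(r, q). if 0 < q \<and> q < r \<and> r < T then (h r - h q) * (r - q) powr (-(\<theta> + 1)) else 0)"
    and \<kappa>: "\<And>t u. \<bar>\<kappa> t - \<kappa> u\<bar> \<le> H * \<bar>t - u\<bar> powr \<gamma>" and \<kappa>T: "\<And>u. T \<le> u \<Longrightarrow> \<kappa> u = \<kappa> T"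
    and d: "\<And>n. 0 < d n" "d \<longlonglongrightarrow> 0"
  shows "(\<lambda>n. \<integral>u. (if 0 < u \<and> u < T then h u * ((\<kappa> (u + d n) - \<kappa> u) / d n) else 0) \<partial>lborel)
     \<longlonglongrightarrow> - (\<integral>t. Dh t * b t \<partial>lborel) / Beta (1 - \<theta>) \<theta>"
proof -
  define \<beta> where "\<beta> = 1 - \<theta>"
  have \<beta>: "0 < \<beta>" "\<beta> < 1" "\<beta> < \<gamma>" using \<theta> \<gamma> by (auto simp: \<beta>_def)
  have H: "H \<ge> 0" using \<kappa>[of 0 1] by (simp add: powr_def)
  have cont: "continuous_on UNIV \<kappa>" by (rule holder_on_continuous_on[of \<gamma>]) (use \<kappa> \<beta> in \<open>auto simp: holder_on_def dist_real_def\<close>)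
  have [measurable]: "\<kappa> \<in> borel_measurable borel" by (rule borel_measurable_continuous_onI[OF cont])
  have isC: "isCont \<kappa> x" for x using cont by (simp add: continuous_on_eq_continuous_at)
  have B: "Beta (1 - \<theta>) \<theta> > 0" unfolding Beta_def using \<theta> by (auto intro!: divide_pos_pos mult_pos_pos Gamma_real_pos)
  have Dhi: "integrable lborel Dh" unfolding Dh_def by (rule integral_marchaud(2)[OF h bd \<theta> T fin])
  then have [measurable]: "Dh \<in> borel_measurable borel" by auto
  have abel: "AE t in lborel. 0 < t \<and> t < T \<longrightarrow>
     (\<integral>r. (if 0 < r \<and> r < t then (t - r) powr (\<theta> - 1) * Dh r else 0) \<partial>lborel) = Beta (1 - \<theta>) \<theta> * h t"
  proof (rule abel_inversion[OF Dhi _ h bd \<theta> T])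
    show "Dh r = 0" if "\<not> (0 < r \<and> r < T)" for r using that by (auto simp: Dh_def)
    fix t assume t: "0 < t" "t \<le> T"
    have "integrable (lborel \<Otimes>\<^sub>M lborel) (\<lambda>(r, q). if 0 < q \<and> q < r \<and> r < t then (h r - h q) * (r - q) powr (-(\<theta> + 1)) else 0)"
      by (rule Bochner_Integration.integrable_bound[OF fin]) (use t in auto)
    from integral_marchaud(1)[OF h bd \<theta> t(1) this]
    show "(\<integral>r. (if 0 < r \<and> r < t then Dh r else 0) \<partial>lborel) = (\<integral>u. (if 0 < u \<and> u < t then h u * (t - u) powr -\<theta> else 0) \<partial>lborel)"
      unfolding Dh_def using t by (auto intro!: Bochner_Integration.integral_cong elim!: back_subst[of "\<lambda>x. x = _"])
  qed
  \<comment> \<open>This is minus the forward quotient: the primitive \<open>K n\<close> is taken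
    from the right, vanishing at \<open>T\<close>, and then has increments of the same sign as those
    of \<open>\<kappa>\<close>.\<close>
  define \<phi> where "\<phi> n u = (\<kappa> u - \<kappa> (u + d n)) / d n" for n u
  have [measurable]: "\<phi> n \<in> borel_measurable borel" for n unfolding \<phi>_def by measurable
  have \<phi>b: "\<bar>\<phi> n u\<bar> \<le> H * d n powr \<gamma> / d n" for n u
    using \<kappa>[of u "u + d n"] d(1)[of n] by (auto simp: \<phi>_def abs_divide intro!: divide_right_mono)
  define K where "K n r = (\<integral>u. (if r < u \<and> u < T then \<phi> n u else 0) \<partial>lborel)" for n r
  have Kinc: "\<exists>\<xi>. 0 < \<xi> \<and> \<xi> < d n \<and> K n t - K n r = \<kappa> (t + \<xi>) - \<kappa> (r + \<xi>)"
    if "0 \<le> t" "t \<le> T" "0 \<le> r" "r \<le> T" for n t r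
    unfolding K_def \<phi>_def by (rule moving_average_increment[OF cont d(1) that])
  have KT: "K n T = 0" for n
  proof -
    have "(\<lambda>u. if T < u \<and> u < T then \<phi> n u else 0) = (\<lambda>_. 0)" by (auto simp: fun_eq_iff)
    then show ?thesis by (simp add: K_def)
  qed
  have Kh: "\<bar>K n t - K n r\<bar> \<le> H * \<bar>t - r\<bar> powr \<gamma>" if tr: "0 \<le> t" "t \<le> T" "0 \<le> r" "r \<le> T" for n t r
  proof -
    obtain \<xi> where "K n t - K n r = \<kappa> (t + \<xi>) - \<kappa> (r + \<xi>)" using Kinc[OF tr] by blast
    then show ?thesis using \<kappa>[of "t + \<xi>" "r + \<xi>"] by simp
  qed
  have Klim: "(\<lambda>n. K n t - K n r) \<longlonglongrightarrow> \<kappa> t - \<kappa> r" if tr: "0 \<le> t" "t \<le> T" "0 \<le> r" "r \<le> T" for t r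
  proof -
    obtain \<xi> where \<xi>: "\<And>n. 0 < \<xi> n" "\<And>n. \<xi> n < d n" "\<And>n. K n t - K n r = \<kappa> (t + \<xi> n) - \<kappa> (r + \<xi> n)"
      using Kinc[OF tr] by metis
    have "\<xi> \<longlonglongrightarrow> 0"
      by (rule real_tendsto_sandwich[OF _ _ tendsto_const d(2)]; intro always_eventually allI less_imp_le \<xi>)
    then have "(\<lambda>n. \<kappa> (t + \<xi> n) - \<kappa> (r + \<xi> n)) \<longlonglongrightarrow> \<kappa> (t + 0) - \<kappa> (r + 0)"
      by (intro tendsto_diff isCont_tendsto_compose[OF isC] tendsto_intros)
    then show ?thesis by (simp add: \<xi>)
  qed
  define bn where "bn n t = (\<integral>u. (if t < u \<and> u < T then \<phi> n u * (u - t) powr -\<beta> else 0) \<partial>lborel)" for n t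
  have [measurable]: "bn n \<in> borel_measurable borel" for n unfolding bn_def by measurable
  have [measurable]: "b \<in> borel_measurable borel" unfolding b_def by measurable
  have bn: "bn n t = K n t * (T - t) powr -\<beta> + \<beta> * (\<integral>r. (if t < r \<and> r < T then (K n t - K n r) * (r - t) powr (-(\<beta> + 1)) else 0) \<partial>lborel)"
    if "t < T" for n t
    unfolding bn_def by (rule marchaud_of_primitive[symmetric, OF _ \<phi>b _ \<beta>(1,2) that]) (auto simp: K_def)
  have wi: "integrable lborel (\<lambda>r. H * (if t < r \<and> r < T then (r - t) powr (\<gamma> - \<beta> - 1) else 0))" for t
    by (intro integrable_mult_right integrable_powr_right) (use \<beta> in auto)
  \<comment> \<open>The exponent \<open>\<gamma> - \<beta> - 1\<close> exceeds -1 since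
    \<open>\<beta> = 1 - \<theta> < \<gamma>\<close>; this is where the integrator must be smoother
    than the order of its derivative.\<close>
  have dom: "\<bar>if t < r \<and> r < T then (K n t - K n r) * (r - t) powr (-(\<beta> + 1)) else 0\<bar>
      \<le> H * (if t < r \<and> r < T then (r - t) powr (\<gamma> - \<beta> - 1) else 0)" if "0 < t" for n t r
  proof -
    have "\<bar>K n t - K n r\<bar> * (r - t) powr (-(\<beta> + 1)) \<le> H * (r - t) powr (\<gamma> - \<beta> - 1)" if r: "t < r" "r < T"
    proof -
      have "\<bar>K n t - K n r\<bar> * (r - t) powr (-(\<beta> + 1)) \<le> (H * (r - t) powr \<gamma>) * (r - t) powr (-(\<beta> + 1))"
        using Kh[of t r n] r \<open>0 < t\<close> by (intro mult_right_mono) auto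
      also have "\<dots> = H * (r - t) powr (\<gamma> - \<beta> - 1)"
        using powr_add[of "r - t" \<gamma> "-(\<beta> + 1)"] by (simp add: algebra_simps)
      finally show ?thesis .
    qed
    then show ?thesis by (auto simp: abs_mult)
  qed
  define C where "C = H * T powr (\<gamma> - \<beta>) + \<beta> * (H * (T powr (\<gamma> - \<beta>) / (\<gamma> - \<beta>)))"
  have bnb: "\<bar>bn n t\<bar> \<le> C" if t: "0 < t" "t < T" for n t
  proof -
    have "\<bar>K n t * (T - t) powr -\<beta>\<bar> \<le> H * T powr (\<gamma> - \<beta>)"
    proof -
      have "\<bar>K n t * (T - t) powr -\<beta>\<bar> \<le> (H * (T - t) powr \<gamma>) * (T - t) powr -\<beta>"
        using Kh[of t T n] t by (auto simp: KT abs_mult intro!: mult_right_mono)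
      also have "\<dots> = H * (T - t) powr (\<gamma> - \<beta>)"
        using powr_add[of "T - t" \<gamma> "-\<beta>"] by (simp add: algebra_simps)
      also have "\<dots> \<le> H * T powr (\<gamma> - \<beta>)"
        using t \<beta> H by (intro mult_left_mono powr_mono2) auto
      finally show ?thesis .
    qed
    moreover have "\<bar>\<beta> * (\<integral>r. (if t < r \<and> r < T then (K n t - K n r) * (r - t) powr (-(\<beta> + 1)) else 0) \<partial>lborel)\<bar>
      \<le> \<beta> * (H * (T powr (\<gamma> - \<beta>) / (\<gamma> - \<beta>)))"
    proof -
      have "\<bar>\<integral>r. (if t < r \<and> r < T then (K n t - K n r) * (r - t) powr (-(\<beta> + 1)) else 0) \<partial>lborel\<bar>
        \<le> (\<integral>r. H * (if t < r \<and> r < T then (r - t) powr (\<gamma> - \<beta> - 1) else 0) \<partial>lborel)"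
        by (rule abs_integral_le[OF wi dom[OF t(1)]])
      also have "\<dots> = H * ((T - t) powr (\<gamma> - \<beta>) / (\<gamma> - \<beta>))"
        using t \<beta> by (simp add: integral_powr_right)
      also have "\<dots> \<le> H * (T powr (\<gamma> - \<beta>) / (\<gamma> - \<beta>))"
        using t \<beta> H by (intro mult_left_mono divide_right_mono powr_mono2) auto
      finally show ?thesis using \<beta> unfolding abs_mult by (simp only: abs_of_pos mult_left_mono less_imp_le)
    qed
    ultimately show ?thesis unfolding bn[OF t(2)] C_def by linarith
  qed
  have bnl: "(\<lambda>n. bn n t) \<longlonglongrightarrow> b t" if t: "0 < t" "t < T" for t
  proof -
    have 1: "(\<lambda>n. K n t * (T - t) powr -\<beta>) \<longlonglongrightarrow> (\<kappa> t - \<kappa> T) * (T - t) powr -\<beta>"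
      using Klim[of t T] t by (intro tendsto_mult_right) (simp add: KT)
    have [measurable]: "K n \<in> borel_measurable borel" for n unfolding K_def by measurable
    have 2: "(\<lambda>n. \<integral>r. (if t < r \<and> r < T then (K n t - K n r) * (r - t) powr (-(\<beta> + 1)) else 0) \<partial>lborel)
      \<longlonglongrightarrow> (\<integral>r. (if t < r \<and> r < T then (\<kappa> t - \<kappa> r) * (r - t) powr (-(\<beta> + 1)) else 0) \<partial>lborel)"
    proof (rule integral_dominated_convergence[OF _ _ wi[of t]])
      show "AE r in lborel. (\<lambda>n. if t < r \<and> r < T then (K n t - K n r) * (r - t) powr (-(\<beta> + 1)) else 0)
        \<longlonglongrightarrow> (if t < r \<and> r < T then (\<kappa> t - \<kappa> r) * (r - t) powr (-(\<beta> + 1)) else 0)"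
        using t by (intro AE_I2) (auto intro!: tendsto_mult_right Klim)
      show "AE r in lborel. norm (if t < r \<and> r < T then (K n t - K n r) * (r - t) powr (-(\<beta> + 1)) else 0)
        \<le> H * (if t < r \<and> r < T then (r - t) powr (\<gamma> - \<beta> - 1) else 0)" for n
        using dom[OF t(1)] by (intro AE_I2) simp
    qed auto
    show ?thesis unfolding bn[OF t(2)] b_def \<beta>_def[symmetric]
      by (intro tendsto_add 1 tendsto_mult_left 2)
  qed
  have L: "(\<lambda>n. \<integral>t. Dh t * bn n t \<partial>lborel) \<longlonglongrightarrow> (\<integral>t. Dh t * b t \<partial>lborel)"
  proof (rule integral_dominated_convergence[where w = "\<lambda>t. C * \<bar>Dh t\<bar>"])
    show "AE t in lborel. (\<lambda>n. Dh t * bn n t) \<longlonglongrightarrow> Dh t * b t"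
    proof (rule AE_I2)
      fix t show "(\<lambda>n. Dh t * bn n t) \<longlonglongrightarrow> Dh t * b t"
        by (cases "0 < t \<and> t < T") (auto intro!: tendsto_mult_left bnl simp: Dh_def)
    qed
    show "AE t in lborel. norm (Dh t * bn n t) \<le> C * \<bar>Dh t\<bar>" for n
    proof (rule AE_I2)
      fix t show "norm (Dh t * bn n t) \<le> C * \<bar>Dh t\<bar>"
      proof (cases "0 < t \<and> t < T")
        case True
        then have "\<bar>Dh t\<bar> * \<bar>bn n t\<bar> \<le> \<bar>Dh t\<bar> * C" using bnb by (intro mult_left_mono) auto
        then show ?thesis by (simp add: abs_mult mult.commute)
      qed (auto simp: Dh_def)
    qed
  qed (use Dhi in auto)
  \<comment> \<open>Since \<open>-\<beta> = \<theta> - 1\<close>, after the exchange of integrations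
    the inner integral over \<open>t\<close> is exactly the left-hand side of \<open>abel\<close>.
    The minus sign comes from \<open>\<phi>\<close>.\<close>
  have eq: "(\<integral>t. Dh t * bn n t \<partial>lborel) = - Beta (1 - \<theta>) \<theta> * (\<integral>u. (if 0 < u \<and> u < T then h u * ((\<kappa> (u + d n) - \<kappa> u) / d n) else 0) \<partial>lborel)" for n
  proof -
    define F where "F = (\<lambda>(t, u). if 0 < t \<and> t < u \<and> u < T then Dh t * (\<phi> n u * (u - t) powr -\<beta>) else 0)"
    have [measurable]: "F \<in> borel_measurable (lborel \<Otimes>\<^sub>M lborel)" unfolding F_def by measurable
    define Q where "Q = H * d n powr \<gamma> / d n"
    have Q: "Q \<ge> 0" unfolding Q_def using H d(1)[of n] by auto
    have Fi: "integrable (lborel \<Otimes>\<^sub>M lborel) F"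
    proof (rule integrableI_bounded)
      have "(\<integral>\<^sup>+x. ennreal (norm (F x)) \<partial>(lborel \<Otimes>\<^sub>M lborel)) = (\<integral>\<^sup>+t. (\<integral>\<^sup>+u. ennreal (norm (F (t, u))) \<partial>lborel) \<partial>lborel)"
        by (rule lborel.nn_integral_fst[symmetric]) auto
      also have "\<dots> \<le> (\<integral>\<^sup>+t. ennreal (Q * (T powr (1 - \<beta>) / (1 - \<beta>))) * ennreal \<bar>Dh t\<bar> \<partial>lborel)"
      proof (rule nn_integral_mono)
        fix t :: real
        show "(\<integral>\<^sup>+u. ennreal (norm (F (t, u))) \<partial>lborel) \<le> ennreal (Q * (T powr (1 - \<beta>) / (1 - \<beta>))) * ennreal \<bar>Dh t\<bar>"
        proof (cases "0 < t \<and> t < T")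
          case True
          have "(\<integral>\<^sup>+u. ennreal (norm (F (t, u))) \<partial>lborel) \<le> (\<integral>\<^sup>+u. ennreal (\<bar>Dh t\<bar> * Q) * (ennreal ((u - t) powr -\<beta>) * indicator {t<..<T} u) \<partial>lborel)"
          proof (rule nn_integral_mono)
            fix u :: real
            have "\<bar>Dh t\<bar> * (\<bar>\<phi> n u\<bar> * (u - t) powr -\<beta>) \<le> \<bar>Dh t\<bar> * (Q * (u - t) powr -\<beta>)"
              using \<phi>b[of n u] by (intro mult_left_mono mult_right_mono) (auto simp: Q_def)
            then show "ennreal (norm (F (t, u))) \<le> ennreal (\<bar>Dh t\<bar> * Q) * (ennreal ((u - t) powr -\<beta>) * indicator {t<..<T} u)"
              using Q by (auto simp: F_def indicator_def abs_mult ennreal_mult'[symmetric] mult.assoc intro!: ennreal_leI)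
          qed
          also have "\<dots> = ennreal (\<bar>Dh t\<bar> * Q) * ennreal ((T - t) powr (1 - \<beta>) / (1 - \<beta>))"
            using True \<beta> by (subst nn_integral_cmult) (auto simp: nn_integral_powr_right)
          also have "\<dots> \<le> ennreal (\<bar>Dh t\<bar> * Q) * ennreal (T powr (1 - \<beta>) / (1 - \<beta>))"
            using True \<beta> by (intro mult_left_mono ennreal_leI divide_right_mono powr_mono2) auto
          finally show ?thesis using Q \<beta> by (simp add: ennreal_mult'[symmetric] mult_ac)
        next
          case False
          then have "F (t, u) = 0" for u by (auto simp: F_def)
          then show ?thesis by simp
        qed
      qed
      also have "\<dots> < \<infinity>"
        using Dhi by (subst nn_integral_cmult) (auto simp: integrable_iff_bounded ennreal_mult_less_top)
      finally show "(\<integral>\<^sup>+x. ennreal (norm (F x)) \<partial>(lborel \<Otimes>\<^sub>M lborel)) < \<infinity>" .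
    qed simp
    have "(\<integral>t. Dh t * bn n t \<partial>lborel) = (\<integral>t. (\<integral>u. F (t, u) \<partial>lborel) \<partial>lborel)"
    proof (rule Bochner_Integration.integral_cong[OF refl])
      fix t :: real
      show "Dh t * bn n t = (\<integral>u. F (t, u) \<partial>lborel)"
      proof (cases "0 < t \<and> t < T")
        case True
        have "Dh t * bn n t = (\<integral>u. Dh t * (if t < u \<and> u < T then \<phi> n u * (u - t) powr -\<beta> else 0) \<partial>lborel)"
          unfolding bn_def by simp
        also have "\<dots> = (\<integral>u. F (t, u) \<partial>lborel)"
          using True by (intro Bochner_Integration.integral_cong) (auto simp: F_def)
        finally show ?thesis .
      next
        case False
        then have "F (t, u) = 0" for u by (auto simp: F_def)
        then show ?thesis using False by (auto simp: Dh_def)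
      qed
    qed
    also have "\<dots> = (\<integral>u. (\<integral>t. F (t, u) \<partial>lborel) \<partial>lborel)"
      using lborel_pair.integral_snd[of "curry F"] Fi lborel_pair.integral_fst'[OF Fi] by simp
    also have "\<dots> = (\<integral>u. - Beta (1 - \<theta>) \<theta> * (if 0 < u \<and> u < T then h u * ((\<kappa> (u + d n) - \<kappa> u) / d n) else 0) \<partial>lborel)"
    proof (rule integral_cong_AE)
      show "AE u in lborel. (\<integral>t. F (t, u) \<partial>lborel) = - Beta (1 - \<theta>) \<theta> * (if 0 < u \<and> u < T then h u * ((\<kappa> (u + d n) - \<kappa> u) / d n) else 0)"
        using abel
      proof eventually_elim
        case (elim u)
        show ?case
        proof (cases "0 < u \<and> u < T")
          case True
          have "(\<integral>t. F (t, u) \<partial>lborel) = (\<integral>t. \<phi> n u * (if 0 < t \<and> t < u then (u - t) powr (\<theta> - 1) * Dh t else 0) \<partial>lborel)"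
            using True by (intro Bochner_Integration.integral_cong) (auto simp: F_def \<beta>_def)
          also have "\<dots> = \<phi> n u * (Beta (1 - \<theta>) \<theta> * h u)" using elim True by simp
          also have "\<dots> = - Beta (1 - \<theta>) \<theta> * (h u * ((\<kappa> (u + d n) - \<kappa> u) / d n))"
            unfolding \<phi>_def by (simp add: diff_divide_distrib algebra_simps)
          finally show ?thesis using True by simp
        next
          case False
          then have "F (t, u) = 0" for t by (auto simp: F_def)
          then show ?thesis using False by auto
        qed
      qed
    qed auto
    finally show ?thesis by simp
  qed
  have "(\<lambda>n. (\<integral>t. Dh t * bn n t \<partial>lborel) / - Beta (1 - \<theta>) \<theta>) \<longlonglongrightarrow> (\<integral>t. Dh t * b t \<partial>lborel) / - Beta (1 - \<theta>) \<theta>"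
    by (intro tendsto_divide L tendsto_const) (use B in auto)
  then show ?thesis unfolding eq using B by simp
qed

section \<open>The generalized Stieltjes integral as a limit of forward quotients\<close>

lemma powr_minus_div: "(x::real) / y powr a = x * y powr -a"
  by (simp add: powr_minus divide_inverse)

lemma set_integral_lebesgue_eq:
  fixes f :: "real \<Rightarrow> real"
  assumes [measurable]: "f \<in> borel_measurable borel"
  shows "(LINT r:{a<..<b}|lebesgue. f r) = (\<integral>r. (if a < r \<and> r < b then f r else 0) \<partial>lborel)"
proof -
  have "(LINT r:{a<..<b}|lebesgue. f r) = (\<integral>r. (if a < r \<and> r < b then f r else 0) \<partial>lebesgue)"
    unfolding set_lebesgue_integral_def by (intro Bochner_Integration.integral_cong) auto
  also have "\<dots> = (\<integral>r. (if a < r \<and> r < b then f r else 0) \<partial>lborel)"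
    by (rule integral_completion) measurable
  finally show ?thesis .
qed

text \<open>\<open>f\<close> stands for an arbitrary member of an a.e. class: since
  \<open>lebesgue\<close> is complete, agreement with a Borel function on the interval makes the
  restricted \<open>f\<close> measurable.\<close>

lemma set_integral_lebesgue_cong_AE:
  fixes f g :: "real \<Rightarrow> real"
  assumes eq: "AE r in lborel. a < r \<and> r < b \<longrightarrow> f r = g r"
    and g[measurable]: "g \<in> borel_measurable borel"
  shows "(LINT r:{a<..<b}|lebesgue. f r) = (\<integral>r. (if a < r \<and> r < b then g r else 0) \<partial>lborel)"
proof -
  have gm: "(\<lambda>r. indicator {a<..<b} r *\<^sub>R g r) \<in> borel_measurable lebesgue"
    by (rule measurable_completion) measurable
  have ae: "AE r in lebesgue. indicator {a<..<b} r *\<^sub>R g r = indicator {a<..<b} r *\<^sub>R f r"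
    using AE_completion[OF eq] by eventually_elim (auto simp: indicator_def)
  have "(LINT r:{a<..<b}|lebesgue. f r) = (LINT r:{a<..<b}|lebesgue. g r)"
    unfolding set_lebesgue_integral_def
    by (rule integral_cong_AE[OF borel_measurable_AE[OF gm ae] gm]) (use ae in \<open>auto elim: eventually_mono\<close>)
  then show ?thesis by (simp add: set_integral_lebesgue_eq)
qed

text \<open>\<open>g\<close> is the integrand as prescribed, possibly wild on a null set, and
  \<open>h\<close> a bounded Borel version on which the computation takes place. The integral is
  insensitive to the difference, because both fractional derivatives occur only under integrals. The
  double integral in \<open>sq\<close> is the seminorm of \<open>W_0\<close>, so one hypothesis
  serves membership and the Fubini arguments.\<close>

lemma has_stieltjes_integral_forward_limit:
  fixes h g k d :: "real \<Rightarrow> real" and dn :: "nat \<Rightarrow> real" and T \<theta> :: real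
  assumes h[measurable]: "h \<in> borel_measurable borel" and bd: "\<And>t. \<bar>h t\<bar> \<le> M"
    and gh: "AE t in lborel. 0 < t \<and> t < T \<longrightarrow> g t = h t"
    and \<theta>: "0 < \<theta>" "\<theta> < 1" and T: "0 < T" and \<gamma>: "1 - \<theta> < \<gamma>"
    and sq: "(\<integral>\<^sup>+r. \<integral>\<^sup>+q. ennreal (if 0 < q \<and> q < T \<and> 0 < r \<and> r < T
          then \<bar>h r - h q\<bar> * \<bar>r - q\<bar> powr (-(\<theta> + 1)) else 0) \<partial>lborel \<partial>lborel) < \<infinity>"
    and k: "\<And>t u. t \<in> {0..T} \<Longrightarrow> u \<in> {0..T} \<Longrightarrow> \<bar>k t - k u\<bar> \<le> H * \<bar>t - u\<bar> powr \<gamma>"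
  shows "\<exists>I. has_stieltjes_integral T g k I \<and>
    (\<forall>d. (\<forall>n. 0 < d n) \<longrightarrow> d \<longlonglongrightarrow> 0 \<longrightarrow> (\<lambda>n. \<integral>u. (if 0 < u \<and> u < T then h u * ((k (min T (u + d n)) - k u) / d n) else 0) \<partial>lborel) \<longlonglongrightarrow> I)"
proof -
  \<comment> \<open>Clamping extends \<open>k\<close> by constants, which preserves the Hoelder
    bound and gives a meaning to increments that reach beyond \<open>T\<close>.\<close>
  define \<kappa> where "\<kappa> u = k (max 0 (min T u))" for u
  have M: "M \<ge> 0" using bd[of 0] by linarith
  have "0 \<le> H * T powr \<gamma>" using k[of 0 T] T by auto
  then have H: "H \<ge> 0" using T by (simp add: zero_le_mult_iff)
  have \<gamma>0: "\<gamma> > 0" using \<gamma> \<theta> by simp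
  have \<kappa>h: "\<bar>\<kappa> t - \<kappa> u\<bar> \<le> H * \<bar>t - u\<bar> powr \<gamma>" for t u
  proof -
    have "\<bar>\<kappa> t - \<kappa> u\<bar> \<le> H * \<bar>max 0 (min T t) - max 0 (min T u)\<bar> powr \<gamma>"
      unfolding \<kappa>_def using T by (intro k) auto
    also have "\<dots> \<le> H * \<bar>t - u\<bar> powr \<gamma>"
      using H \<gamma>0 by (intro mult_left_mono powr_mono2) (auto simp: max_def min_def)
    finally show ?thesis .
  qed
  have \<kappa>T: "\<kappa> u = \<kappa> T" if "T \<le> u" for u using that T by (simp add: \<kappa>_def)
  have \<kappa>k: "\<kappa> t = k t" if "0 \<le> t" "t \<le> T" for t using that by (simp add: \<kappa>_def)
  have cont: "continuous_on UNIV \<kappa>" by (rule holder_on_continuous_on[OF _ \<gamma>0]) (use \<kappa>h in \<open>auto simp: holder_on_def dist_real_def\<close>)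
  have [measurable]: "\<kappa> \<in> borel_measurable borel" by (rule borel_measurable_continuous_onI[OF cont])
  have isC: "isCont \<kappa> x" for x using cont by (simp add: continuous_on_eq_continuous_at)
  have klim: "(k \<longlongrightarrow> k T) (at_left T)"
  proof -
    have "(\<kappa> \<longlongrightarrow> \<kappa> T) (at_left T)" using isC[of T] by (simp add: isCont_def filterlim_at_split)
    moreover have "\<forall>\<^sub>F x in at_left T. \<kappa> x = k x"
      using eventually_at_left_real[OF T] by eventually_elim (use \<kappa>k in auto)
    ultimately show ?thesis using \<kappa>k[of T] T by (simp cong: filterlim_cong)
  qed
  have lv: "left_value T k = k T"
    unfolding left_value_def by (rule tendsto_Lim[OF _ klim]) simp
  define \<beta> where "\<beta> = 1 - \<theta>"
  have \<beta>: "0 < \<beta>" "\<beta> < 1" "\<beta> < \<gamma>" using \<theta> \<gamma> by (auto simp: \<beta>_def)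

  have WT: "k \<in> W_T T (1 - \<theta>)"
  proof -
    have km: "k \<in> borel_measurable (lebesgue_on {0<..<T})"
    proof -
      have "\<kappa> \<in> borel_measurable (lebesgue_on {0<..<T})"
        by (intro measurable_restrict_space1 measurable_completion) simp
      then show ?thesis by (rule measurable_cong[THEN iffD1, rotated]) (auto simp: \<kappa>k)
    qed
    have 1: "(SUP t\<in>{0<..<T}. ennreal (\<bar>left_value T k - k t\<bar> / (T - t) powr \<beta>)) \<le> ennreal (H * T powr (\<gamma> - \<beta>))"
    proof (rule SUP_least)
      fix t assume t: "t \<in> {0<..<T}"
      have "\<bar>k T - k t\<bar> / (T - t) powr \<beta> \<le> H * (T - t) powr \<gamma> / (T - t) powr \<beta>"
        using k[of T t] t by (intro divide_right_mono) auto
      also have "\<dots> = H * (T - t) powr (\<gamma> - \<beta>)" by (simp add: powr_diff)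
      also have "\<dots> \<le> H * T powr (\<gamma> - \<beta>)" using t H \<beta> by (intro mult_left_mono powr_mono2) auto
      finally show "ennreal (\<bar>left_value T k - k t\<bar> / (T - t) powr \<beta>) \<le> ennreal (H * T powr (\<gamma> - \<beta>))"
        unfolding lv by (rule ennreal_leI)
    qed
    have 2: "(SUP t\<in>{0<..<T}. (\<integral>\<^sup>+ u\<in>{t<..<T}. ennreal (\<bar>k t - k u\<bar> / \<bar>t - u\<bar> powr (1 + \<beta>)) \<partial>lebesgue))
      \<le> ennreal (H * (T powr (\<gamma> - \<beta>) / (\<gamma> - \<beta>)))"
    proof (rule SUP_least)
      fix t assume t: "t \<in> {0<..<T}"
      have "(\<integral>\<^sup>+ u\<in>{t<..<T}. ennreal (\<bar>k t - k u\<bar> / \<bar>t - u\<bar> powr (1 + \<beta>)) \<partial>lebesgue)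
        \<le> (\<integral>\<^sup>+ u. ennreal H * (ennreal ((u - t) powr (\<gamma> - \<beta> - 1)) * indicator {t<..<T} u) \<partial>lebesgue)"
      proof (rule nn_integral_mono)
        fix u :: real
        have "\<bar>k t - k u\<bar> / \<bar>t - u\<bar> powr (1 + \<beta>) \<le> H * (u - t) powr (\<gamma> - \<beta> - 1)" if u: "t < u" "u < T"
        proof -
          have "\<bar>k t - k u\<bar> / \<bar>t - u\<bar> powr (1 + \<beta>) \<le> H * (u - t) powr \<gamma> / (u - t) powr (1 + \<beta>)"
            using k[of t u] t u by (auto intro!: divide_right_mono)
          also have "\<dots> = H * (u - t) powr (\<gamma> - \<beta> - 1)"
            using powr_diff[of "u - t" \<gamma> "1 + \<beta>"] by (simp add: algebra_simps)
          finally show ?thesis .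
        qed
        then show "ennreal (\<bar>k t - k u\<bar> / \<bar>t - u\<bar> powr (1 + \<beta>)) * indicator {t<..<T} u
          \<le> ennreal H * (ennreal ((u - t) powr (\<gamma> - \<beta> - 1)) * indicator {t<..<T} u)"
          using H by (auto simp: indicator_def ennreal_mult'[symmetric] intro!: ennreal_leI)
      qed
      also have "\<dots> = (\<integral>\<^sup>+ u. ennreal H * (ennreal ((u - t) powr (\<gamma> - \<beta> - 1)) * indicator {t<..<T} u) \<partial>lborel)"
        by (rule nn_integral_completion)
      also have "\<dots> = ennreal H * ennreal ((T - t) powr (\<gamma> - \<beta>) / (\<gamma> - \<beta>))"
        using nn_integral_powr_right[of "\<gamma> - \<beta> - 1" t T] t \<beta> by (subst nn_integral_cmult) auto
      also have "\<dots> = ennreal (H * ((T - t) powr (\<gamma> - \<beta>) / (\<gamma> - \<beta>)))"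
        by (rule ennreal_mult'[symmetric, OF H])
      also have "\<dots> \<le> ennreal (H * (T powr (\<gamma> - \<beta>) / (\<gamma> - \<beta>)))"
        using t H \<beta> by (intro ennreal_leI mult_left_mono divide_right_mono powr_mono2) auto
      finally show "(\<integral>\<^sup>+ u\<in>{t<..<T}. ennreal (\<bar>k t - k u\<bar> / \<bar>t - u\<bar> powr (1 + \<beta>)) \<partial>lebesgue)
        \<le> ennreal (H * (T powr (\<gamma> - \<beta>) / (\<gamma> - \<beta>)))" .
    qed
    have "(SUP t\<in>{0<..<T}. ennreal (\<bar>left_value T k - k t\<bar> / (T - t) powr \<beta>)) +
      (SUP t\<in>{0<..<T}. (\<integral>\<^sup>+ u\<in>{t<..<T}. ennreal (\<bar>k t - k u\<bar> / \<bar>t - u\<bar> powr (1 + \<beta>)) \<partial>lebesgue)) < \<infinity>"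
      using le_less_trans[OF 1 ennreal_less_top] le_less_trans[OF 2 ennreal_less_top] by simp
    then show ?thesis unfolding W_T_def \<beta>_def using km klim by blast
  qed

  have ghc: "AE t in lebesgue. 0 < t \<and> t < T \<longrightarrow> g t = h t" by (rule AE_completion[OF gh])
  have W0: "g \<in> W_0 T \<theta>"
  proof -
    have gm: "g \<in> borel_measurable (lebesgue_on {0<..<T})"
    proof -
      have hm: "(\<lambda>x. indicator {0<..<T} x *\<^sub>R h x) \<in> borel_measurable lebesgue"
        by (intro measurable_completion) measurable
      have "AE x in lebesgue. indicator {0<..<T} x *\<^sub>R h x = indicator {0<..<T} x *\<^sub>R g x"
        using ghc by eventually_elim (auto simp: indicator_def)
      from borel_measurable_AE[OF hm this] show ?thesis by (subst borel_measurable_restrict_space_iff) auto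
    qed
    have "(\<integral>\<^sup>+ t\<in>{0<..<T}. ennreal (\<bar>g t\<bar> / t powr \<theta>) \<partial>lebesgue)
      \<le> (\<integral>\<^sup>+ t. ennreal M * (ennreal ((t - 0) powr -\<theta>) * indicator {0<..<T} t) \<partial>lebesgue)"
    proof (rule nn_integral_mono_AE)
      show "AE t in lebesgue. ennreal (\<bar>g t\<bar> / t powr \<theta>) * indicator {0<..<T} t
         \<le> ennreal M * (ennreal ((t - 0) powr -\<theta>) * indicator {0<..<T} t)"
        using ghc by eventually_elim
          (use M bd in \<open>auto simp: indicator_def powr_minus_div ennreal_mult'[symmetric] intro!: ennreal_leI mult_right_mono\<close>)
    qed
    also have "\<dots> = (\<integral>\<^sup>+ t. ennreal M * (ennreal ((t - 0) powr -\<theta>) * indicator {0<..<T} t) \<partial>lborel)"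
      by (rule nn_integral_completion)
    also have "\<dots> = ennreal M * ennreal (T powr (1 - \<theta>) / (1 - \<theta>))"
      using \<theta> T nn_integral_powr_right[of "-\<theta>" 0 T] by (subst nn_integral_cmult) auto
    also have "\<dots> = ennreal (M * (T powr (1 - \<theta>) / (1 - \<theta>)))"
      by (rule ennreal_mult'[symmetric, OF M])
    finally have 1: "(\<integral>\<^sup>+ t\<in>{0<..<T}. ennreal (\<bar>g t\<bar> / t powr \<theta>) \<partial>lebesgue) < \<infinity>"
      using le_less_trans ennreal_less_top by fastforce
    have "(\<integral>\<^sup>+ t\<in>{0<..<T}. (\<integral>\<^sup>+ u\<in>{0<..<T}. ennreal (\<bar>g t - g u\<bar> / \<bar>t - u\<bar> powr (1 + \<theta>)) \<partial>lebesgue) \<partial>lebesgue)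
      = (\<integral>\<^sup>+t. (\<integral>\<^sup>+u. ennreal (if 0 < u \<and> u < T \<and> 0 < t \<and> t < T
          then \<bar>h t - h u\<bar> * \<bar>t - u\<bar> powr (-(\<theta> + 1)) else 0) \<partial>lborel) \<partial>lebesgue)"
    proof (rule nn_integral_cong_AE)
      show "AE t in lebesgue. (\<integral>\<^sup>+ u\<in>{0<..<T}. ennreal (\<bar>g t - g u\<bar> / \<bar>t - u\<bar> powr (1 + \<theta>)) \<partial>lebesgue) * indicator {0<..<T} t
       = (\<integral>\<^sup>+u. ennreal (if 0 < u \<and> u < T \<and> 0 < t \<and> t < T then \<bar>h t - h u\<bar> * \<bar>t - u\<bar> powr (-(\<theta> + 1)) else 0) \<partial>lborel)"
        using ghc
      proof eventually_elim
        case (elim t)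
        show ?case
        proof (cases "0 < t \<and> t < T")
          case True
          have "(\<integral>\<^sup>+ u\<in>{0<..<T}. ennreal (\<bar>g t - g u\<bar> / \<bar>t - u\<bar> powr (1 + \<theta>)) \<partial>lebesgue)
            = (\<integral>\<^sup>+u. ennreal (if 0 < u \<and> u < T \<and> 0 < t \<and> t < T then \<bar>h t - h u\<bar> * \<bar>t - u\<bar> powr (-(\<theta> + 1)) else 0) \<partial>lebesgue)"
          proof (rule nn_integral_cong_AE)
            show "AE u in lebesgue. ennreal (\<bar>g t - g u\<bar> / \<bar>t - u\<bar> powr (1 + \<theta>)) * indicator {0<..<T} u
               = ennreal (if 0 < u \<and> u < T \<and> 0 < t \<and> t < T then \<bar>h t - h u\<bar> * \<bar>t - u\<bar> powr (-(\<theta> + 1)) else 0)"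
              using ghc by eventually_elim (use True elim in \<open>auto simp: indicator_def powr_minus_div add.commute\<close>)
          qed
          also have "\<dots> = (\<integral>\<^sup>+u. ennreal (if 0 < u \<and> u < T \<and> 0 < t \<and> t < T then \<bar>h t - h u\<bar> * \<bar>t - u\<bar> powr (-(\<theta> + 1)) else 0) \<partial>lborel)"
            by (rule nn_integral_completion)
          finally show ?thesis using True by simp
        next
          case False
          then have "(\<lambda>u. ennreal (if 0 < u \<and> u < T \<and> 0 < t \<and> t < T then \<bar>h t - h u\<bar> * \<bar>t - u\<bar> powr (-(\<theta> + 1)) else 0)) = (\<lambda>_. 0)" by auto
          then show ?thesis using False by auto
        qed
      qed
    qed
    also have "\<dots> < \<infinity>" using sq by (subst nn_integral_completion)
    finally have 2: "(\<integral>\<^sup>+ t\<in>{0<..<T}. (\<integral>\<^sup>+ u\<in>{0<..<T}. ennreal (\<bar>g t - g u\<bar> / \<bar>t - u\<bar> powr (1 + \<theta>)) \<partial>lebesgue) \<partial>lebesgue) < \<infinity>" .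
    show ?thesis unfolding W_0_def using gm 1 2 by simp
  qed

  have fin: "integrable (lborel \<Otimes>\<^sub>M lborel)
      (\<lambda>(r, q). if 0 < q \<and> q < r \<and> r < T then (h r - h q) * (r - q) powr (-(\<theta> + 1)) else 0)" (is "integrable _ ?F")
  proof (rule integrableI_bounded)
    have [measurable]: "?F \<in> borel_measurable (lborel \<Otimes>\<^sub>M lborel)" by measurable
    show "?F \<in> borel_measurable (lborel \<Otimes>\<^sub>M lborel)" by measurable
    have "(\<integral>\<^sup>+x. ennreal (norm (?F x)) \<partial>(lborel \<Otimes>\<^sub>M lborel)) = (\<integral>\<^sup>+r. (\<integral>\<^sup>+q. ennreal (norm (?F (r, q))) \<partial>lborel) \<partial>lborel)"
      by (rule lborel.nn_integral_fst[symmetric]) measurable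
    also have "\<dots> \<le> (\<integral>\<^sup>+r. \<integral>\<^sup>+q. ennreal (if 0 < q \<and> q < T \<and> 0 < r \<and> r < T
          then \<bar>h r - h q\<bar> * \<bar>r - q\<bar> powr (-(\<theta> + 1)) else 0) \<partial>lborel \<partial>lborel)"
      by (intro nn_integral_mono) (auto simp: abs_mult)
    finally show "(\<integral>\<^sup>+x. ennreal (norm (?F x)) \<partial>(lborel \<Otimes>\<^sub>M lborel)) < \<infinity>" using sq by (rule le_less_trans)
  qed
  define Dh where "Dh r = (if 0 < r \<and> r < T then h r * r powr -\<theta> +
      \<theta> * (\<integral>q. (if 0 < q \<and> q < r then (h r - h q) * (r - q) powr (-(\<theta> + 1)) else 0) \<partial>lborel) else 0)" for r
  define b where "b t = (\<kappa> t - \<kappa> T) * (T - t) powr -(1 - \<theta>) +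
      (1 - \<theta>) * (\<integral>r. (if t < r \<and> r < T then (\<kappa> t - \<kappa> r) * (r - t) powr (-((1 - \<theta>) + 1)) else 0) \<partial>lborel)" for t
  have [measurable]: "Dh \<in> borel_measurable borel" "b \<in> borel_measurable borel" unfolding Dh_def b_def by measurable
  have fl: "AE t in lborel. 0 < t \<and> t < T \<longrightarrow> frac_deriv_left \<theta> g t = 1 / Gamma (1 - \<theta>) * Dh t"
    using gh
  proof eventually_elim
    case (elim t)
    have "(LINT r:{0<..<t}|lebesgue. (g t - g r) / (t - r) powr (\<theta> + 1))
      = (\<integral>r. (if 0 < r \<and> r < t then (h t - h r) * (t - r) powr (-(\<theta> + 1)) else 0) \<partial>lborel)" if t: "0 < t" "t < T"
    proof (rule set_integral_lebesgue_cong_AE)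
      show "AE r in lborel. 0 < r \<and> r < t \<longrightarrow> (g t - g r) / (t - r) powr (\<theta> + 1) = (h t - h r) * (t - r) powr (-(\<theta> + 1))"
        using gh by eventually_elim (use elim t in \<open>auto simp: powr_minus_div\<close>)
    qed measurable
    then show ?case using elim by (auto simp: frac_deriv_left_def Dh_def powr_minus_div)
  qed
  have fr: "frac_deriv_right T (1 - \<theta>) (\<lambda>r. k r - left_value T k) t = 1 / Gamma \<theta> * b t" if t: "0 < t" "t < T" for t
  proof -
    have "(LINT r:{t<..<T}|lebesgue. ((k t - left_value T k) - (k r - left_value T k)) / (r - t) powr ((1 - \<theta>) + 1))
      = (\<integral>r. (if t < r \<and> r < T then (\<kappa> t - \<kappa> r) * (r - t) powr (-((1 - \<theta>) + 1)) else 0) \<partial>lborel)"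
      by (rule set_integral_lebesgue_cong_AE) (use t in \<open>auto simp: powr_minus_div \<kappa>k\<close>)
    then show ?thesis using t T by (simp add: frac_deriv_right_def b_def lv \<kappa>k powr_minus_div)
  qed
  define I where "I = - (LINT t:{0<..<T}|lebesgue. frac_deriv_left \<theta> g t *
                 frac_deriv_right T (1 - \<theta>) (\<lambda>r. k r - left_value T k) t)"
  have "(LINT t:{0<..<T}|lebesgue. frac_deriv_left \<theta> g t * frac_deriv_right T (1 - \<theta>) (\<lambda>r. k r - left_value T k) t)
    = (\<integral>t. (if 0 < t \<and> t < T then (1 / Gamma (1 - \<theta>) * Dh t) * (1 / Gamma \<theta> * b t) else 0) \<partial>lborel)"
    by (rule set_integral_lebesgue_cong_AE) (use fl fr in \<open>auto elim: eventually_mono\<close>)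
  \<comment> \<open>The normalising factors of the two derivatives multiply to
    \<open>1 / Beta (1 - \<theta>) \<theta>\<close>, since \<open>Gamma 1 = 1\<close>; this is the
    constant that Abel inversion produces.\<close>
  also have "\<dots> = (\<integral>t. (1 / Beta (1 - \<theta>) \<theta>) * (Dh t * b t) \<partial>lborel)"
    by (intro Bochner_Integration.integral_cong) (auto simp: Beta_def Dh_def)
  finally have I: "I = - (\<integral>t. Dh t * b t \<partial>lborel) / Beta (1 - \<theta>) \<theta>"
    unfolding I_def by simp
  have "has_stieltjes_integral T g k I"
    unfolding has_stieltjes_integral_def I_def using W0 WT \<theta> by blast
  moreover have "(\<lambda>n. \<integral>u. (if 0 < u \<and> u < T then h u * ((k (min T (u + d n)) - k u) / d n) else 0) \<partial>lborel) \<longlonglongrightarrow> I"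
    if d: "\<forall>n. 0 < d n" "d \<longlonglongrightarrow> 0" for d
  proof -
    have "(\<lambda>n. \<integral>u. (if 0 < u \<and> u < T then h u * ((\<kappa> (u + d n) - \<kappa> u) / d n) else 0) \<partial>lborel)
     \<longlonglongrightarrow> - (\<integral>t. Dh t * b t \<partial>lborel) / Beta (1 - \<theta>) \<theta>"
      unfolding Dh_def[abs_def] b_def[abs_def]
      by (rule stieltjes_forward_limit_aux[OF h bd \<theta> T \<gamma> fin \<kappa>h \<kappa>T]) (use d in auto)
    moreover have "(if 0 < u \<and> u < T then h u * ((\<kappa> (u + d n) - \<kappa> u) / d n) else 0)
       = (if 0 < u \<and> u < T then h u * ((k (min T (u + d n)) - k u) / d n) else 0)" for u n
    proof -
      have "\<kappa> (u + d n) = k (min T (u + d n))" if "0 < u"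
        unfolding \<kappa>_def using d(1)[rule_format, of n] that T by (simp add: max_def)
      then show ?thesis by (simp add: \<kappa>k)
    qed
    ultimately show ?thesis unfolding I by simp
  qed
  ultimately show ?thesis by blast
qed

section \<open>The total variation measure\<close>

abbreviation bounded_partitions :: "'a::euclidean_space set \<Rightarrow> (nat \<Rightarrow> 'a set) set" where
  "bounded_partitions A \<equiv> {P. (\<forall>i. P i \<in> sets borel \<and> bounded (P i)) \<and> disjoint_family P \<and> (\<Union>i. P i) = A}"

abbreviation total_variation :: "('a::euclidean_space set \<Rightarrow> 'b::real_normed_vector) \<Rightarrow> 'a set \<Rightarrow> ennreal" where
  "total_variation \<nu> A \<equiv> (SUP P \<in> bounded_partitions A. \<Sum>i. ennreal (norm (\<nu> (P i))))"

text \<open>The condition of \<open>signed_radon_measure\<close> for values in a normed space, as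
  the gradient measure is vector valued.\<close>

definition bounded_countably_additive :: "('a::euclidean_space set \<Rightarrow> 'b::real_normed_vector) \<Rightarrow> bool" where
  "bounded_countably_additive \<nu> \<longleftrightarrow>
     (\<forall>A :: nat \<Rightarrow> 'a set. range A \<subseteq> sets borel \<longrightarrow> disjoint_family A \<longrightarrow> bounded (\<Union>i. A i) \<longrightarrow>
        (\<lambda>i. \<nu> (A i)) sums \<nu> (\<Union>i. A i))"

lemma bounded_countably_additive_empty:
  assumes "bounded_countably_additive \<nu>" shows "\<nu> {} = 0"
proof -
  have "(\<lambda>i::nat. \<nu> {}) sums \<nu> (\<Union>i::nat. {})"
    using assms unfolding bounded_countably_additive_def
    by (elim allE[of _ "\<lambda>_. {}"]) (auto simp: disjoint_family_on_def)
  then have "summable (\<lambda>i::nat. \<nu> {})" by (rule sums_summable)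
  then show ?thesis by (simp only: summable_const_iff)
qed

lemma ennreal_suminf_swap:
  fixes f :: "nat \<Rightarrow> nat \<Rightarrow> ennreal"
  shows "(\<Sum>i. \<Sum>j. f i j) = (\<Sum>j. \<Sum>i. f i j)"
proof -
  have "(\<Sum>i. \<Sum>j. f i j) = (\<integral>\<^sup>+i. (\<Sum>j. f i j) \<partial>count_space UNIV)" by (simp add: nn_integral_count_space_nat)
  also have "\<dots> = (\<Sum>j. \<integral>\<^sup>+i. f i j \<partial>count_space UNIV)" by (rule nn_integral_suminf) simp
  finally show ?thesis by (simp add: nn_integral_count_space_nat)
qed

text \<open>Suprema can be added only over nonempty index sets, as superadditivity requires. The
  witness cuts the set into annuli.\<close>

lemma bounded_partitions_nonempty:
  fixes A :: "'a::euclidean_space set"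
  assumes A: "A \<in> sets borel"
  shows "bounded_partitions A \<noteq> {}"
proof -
  define P where "P = disjointed (\<lambda>n. A \<inter> cball 0 (real n))"
  have U: "(\<Union>n. A \<inter> cball 0 (real n)) = A"
  proof -
    have "\<exists>n. norm x \<le> real n" for x :: 'a using real_arch_simple by blast
    then show ?thesis by auto
  qed
  have "P i \<subseteq> cball 0 (real i)" for i
    unfolding P_def using disjointed_subset[of "\<lambda>n. A \<inter> cball 0 (real n)" i] by auto
  then have b: "bounded (P i)" for i using bounded_cball bounded_subset by blast
  have "range (\<lambda>n. A \<inter> cball 0 (real n)) \<subseteq> sets borel" using A by auto
  then have m: "range P \<subseteq> sets borel" unfolding P_def by (rule sets.range_disjointed_sets)
  have "P \<in> bounded_partitions A"
    using b m U disjoint_family_disjointed[of "\<lambda>n. A \<inter> cball 0 (real n)"] by (auto simp: P_def UN_disjointed_eq)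
  then show ?thesis by blast
qed

text \<open>A partition of \<open>X\<close> placed at the even indices and one of \<open>Y\<close>
  at the odd indices form a partition of the union.\<close>

lemma total_variation_superadditive:
  fixes \<nu> :: "'a::euclidean_space set \<Rightarrow> 'b::real_normed_vector"
  assumes X: "X \<in> sets borel" and Y: "Y \<in> sets borel" and XY: "X \<inter> Y = {}"
  shows "total_variation \<nu> X + total_variation \<nu> Y \<le> total_variation \<nu> (X \<union> Y)"
proof -
  let ?s = "\<lambda>P. \<Sum>i::nat. ennreal (norm (\<nu> (P i)))"
  have le: "?s P + ?s Q \<le> total_variation \<nu> (X \<union> Y)" if P: "P \<in> bounded_partitions X" and Q: "Q \<in> bounded_partitions Y" for P Q
  proof -
    define R where "R i = (if even i then P (i div 2) else Q (i div 2))" for i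
    have P': "\<And>i. P i \<in> sets borel" "\<And>i. bounded (P i)" "disjoint_family P" "(\<Union>i. P i) = X" using P by auto
    have Q': "\<And>i. Q i \<in> sets borel" "\<And>i. bounded (Q i)" "disjoint_family Q" "(\<Union>i. Q i) = Y" using Q by auto
    have PQ: "P i \<inter> Q j = {}" for i j using P'(4) Q'(4) XY by blast
    have "R \<in> bounded_partitions (X \<union> Y)"
    proof (intro CollectI conjI allI)
      show "R i \<in> sets borel" "bounded (R i)" for i using P' Q' by (auto simp: R_def)
      show "disjoint_family R"
        unfolding disjoint_family_on_def
      proof (intro ballI impI)
        fix m n :: nat assume mn: "m \<noteq> n"
        show "R m \<inter> R n = {}"
        proof (cases "even m = even n")
          case True
          then have "m div 2 \<noteq> n div 2" using mn by (auto elim!: evenE oddE)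
          then show ?thesis using True P'(3) Q'(3) by (auto simp: R_def disjoint_family_on_def)
        next
          case False
          then show ?thesis using PQ[of "m div 2" "n div 2"] PQ[of "n div 2" "m div 2"] by (auto simp: R_def)
        qed
      qed
      have "R (2 * i) = P i" "R (2 * i + 1) = Q i" for i by (auto simp: R_def)
      then have "X \<union> Y \<subseteq> (\<Union>i. R i)" using P'(4) Q'(4) by blast
      moreover have "R i \<subseteq> X \<union> Y" for i using P'(4) Q'(4) by (auto simp: R_def)
      ultimately show "(\<Union>i. R i) = X \<union> Y" by blast
    qed
    then have "?s R \<le> total_variation \<nu> (X \<union> Y)" by (rule SUP_upper)
    moreover have "?s P + ?s Q \<le> ?s R"
    proof -
      have fin: "(\<Sum>i<n. ennreal (norm (\<nu> (P i)))) + (\<Sum>i<n. ennreal (norm (\<nu> (Q i)))) = (\<Sum>i<2*n. ennreal (norm (\<nu> (R i))))" for n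
        by (induction n) (auto simp: R_def ac_simps)
      have "?s P + ?s Q = (\<Sum>i. ennreal (norm (\<nu> (P i))) + ennreal (norm (\<nu> (Q i))))"
        by (rule suminf_add[OF summableI summableI])
      also have "\<dots> \<le> ?s R"
      proof (rule suminf_le_const[OF summableI])
        show "(\<Sum>i<n. ennreal (norm (\<nu> (P i))) + ennreal (norm (\<nu> (Q i)))) \<le> ?s R" for n
          unfolding sum.distrib fin by (rule sum_le_suminf[OF summableI]) auto
      qed
      finally show ?thesis .
    qed
    ultimately show ?thesis by order
  qed
  have ne: "bounded_partitions X \<noteq> {}" "bounded_partitions Y \<noteq> {}" by (rule bounded_partitions_nonempty[OF X], rule bounded_partitions_nonempty[OF Y])
  have "total_variation \<nu> X + total_variation \<nu> Y = (SUP P\<in>bounded_partitions X. ?s P + total_variation \<nu> Y)"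
    by (rule ennreal_SUP_add_left[symmetric, OF ne(1)])
  also have "\<dots> \<le> total_variation \<nu> (X \<union> Y)"
  proof (rule SUP_least)
    fix P assume P: "P \<in> bounded_partitions X"
    have "?s P + total_variation \<nu> Y = (SUP Q\<in>bounded_partitions Y. ?s Q + ?s P)"
      by (subst ennreal_SUP_add_left[OF ne(2)]) (simp add: add.commute)
    also have "\<dots> \<le> total_variation \<nu> (X \<union> Y)"
      by (rule SUP_least) (use le[OF P] in \<open>simp add: add.commute\<close>)
    finally show "?s P + total_variation \<nu> Y \<le> total_variation \<nu> (X \<union> Y)" .
  qed
  finally show ?thesis .
qed

text \<open>Intersecting a partition of the union with every \<open>A j\<close> refines it. The
  triangle inequality for the convergent series supplied by additivity on bounded sets compares the
  two, and exchanging the order of summation regroups the pieces into partitions of the single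
  \<open>A j\<close>.\<close>

lemma total_variation_countably_subadditive:
  fixes \<nu> :: "'a::euclidean_space set \<Rightarrow> 'b::real_normed_vector"
  assumes \<nu>: "bounded_countably_additive \<nu>"
    and A: "range A \<subseteq> sets borel" "disjoint_family A"
  shows "total_variation \<nu> (\<Union>i. A i) \<le> (\<Sum>i. total_variation \<nu> (A i))"
proof (rule SUP_least)
  fix P assume "P \<in> bounded_partitions (\<Union>i. A i)"
  then have P: "\<And>i. P i \<in> sets borel" "\<And>i. bounded (P i)" "disjoint_family P" "(\<Union>i. P i) = (\<Union>i. A i)" by auto
  have "ennreal (norm (\<nu> (P i))) \<le> (\<Sum>j. ennreal (norm (\<nu> (P i \<inter> A j))))" for i
  proof -
    have U: "(\<Union>j. P i \<inter> A j) = P i" using P(4) by blast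
    have "(\<lambda>j. \<nu> (P i \<inter> A j)) sums \<nu> (\<Union>j. P i \<inter> A j)"
    proof (rule \<nu>[unfolded bounded_countably_additive_def, rule_format])
      show "range (\<lambda>j. P i \<inter> A j) \<subseteq> sets borel" using P(1) A(1) by blast
      show "disjoint_family (\<lambda>j. P i \<inter> A j)" using A(2) by (auto simp: disjoint_family_on_def)
      show "bounded (\<Union>j. P i \<inter> A j)" using P(2) U by simp
    qed
    then have "(\<lambda>n. \<Sum>j<n. \<nu> (P i \<inter> A j)) \<longlonglongrightarrow> \<nu> (P i)" unfolding U sums_def .
    then have "(\<lambda>n. ennreal (norm (\<Sum>j<n. \<nu> (P i \<inter> A j)))) \<longlonglongrightarrow> ennreal (norm (\<nu> (P i)))"
      by (intro tendsto_ennrealI tendsto_norm)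
    then show ?thesis
    proof (rule LIMSEQ_le_const2, intro exI allI impI)
      fix n :: nat
      have "ennreal (norm (\<Sum>j<n. \<nu> (P i \<inter> A j))) \<le> ennreal (\<Sum>j<n. norm (\<nu> (P i \<inter> A j)))"
        by (intro ennreal_leI norm_sum)
      also have "\<dots> = (\<Sum>j<n. ennreal (norm (\<nu> (P i \<inter> A j))))" by (rule sum_ennreal[symmetric]) simp
      also have "\<dots> \<le> (\<Sum>j. ennreal (norm (\<nu> (P i \<inter> A j))))" by (rule sum_le_suminf[OF summableI]) auto
      finally show "ennreal (norm (\<Sum>j<n. \<nu> (P i \<inter> A j))) \<le> (\<Sum>j. ennreal (norm (\<nu> (P i \<inter> A j))))" .
    qed
  qed
  then have "(\<Sum>i. ennreal (norm (\<nu> (P i)))) \<le> (\<Sum>i. \<Sum>j. ennreal (norm (\<nu> (P i \<inter> A j))))"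
    by (rule suminf_le[OF _ summableI summableI])
  also have "\<dots> = (\<Sum>j. \<Sum>i. ennreal (norm (\<nu> (P i \<inter> A j))))" using ennreal_suminf_swap[of "\<lambda>i j. ennreal (norm (\<nu> (P i \<inter> A j)))"] .
  also have "\<dots> \<le> (\<Sum>j. total_variation \<nu> (A j))"
  proof (rule suminf_le[OF _ summableI summableI])
    fix j
    have "(\<lambda>i. P i \<inter> A j) \<in> bounded_partitions (A j)"
    proof (intro CollectI conjI allI)
      show "P i \<inter> A j \<in> sets borel" for i using P(1) A(1) by blast
      show "bounded (P i \<inter> A j)" for i using P(2) by (meson bounded_Int)
      show "disjoint_family (\<lambda>i. P i \<inter> A j)" using P(3) by (auto simp: disjoint_family_on_def)
      show "(\<Union>i. P i \<inter> A j) = A j" using P(4) by blast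
    qed
    then show "(\<Sum>i. ennreal (norm (\<nu> (P i \<inter> A j)))) \<le> total_variation \<nu> (A j)"
      by (rule SUP_upper2) simp
  qed
  finally show "(\<Sum>i. ennreal (norm (\<nu> (P i)))) \<le> (\<Sum>j. total_variation \<nu> (A j))" .
qed

text \<open>\<open>measure_of\<close> returns the prescribed values only if they form a measure.
  Countable additivity combines finite superadditivity, passed to the limit by monotonicity, with
  countable subadditivity.\<close>

lemma emeasure_total_variation_measure:
  fixes \<nu> :: "'a::euclidean_space set \<Rightarrow> 'b::real_normed_vector"
  assumes \<nu>: "bounded_countably_additive \<nu>" and X: "X \<in> sets borel"
  shows "emeasure (total_variation_measure \<nu>) X = total_variation \<nu> X"
  unfolding total_variation_measure_def
proof (rule emeasure_measure_of_sigma)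
  have "sigma_algebra (space (borel :: 'a measure)) (sets borel)" by (rule sets.sigma_algebra_axioms)
  then show "sigma_algebra UNIV (sets (borel :: 'a measure))" by simp
  have e: "\<nu> {} = 0" by (rule bounded_countably_additive_empty[OF \<nu>])
  show "positive (sets borel) (total_variation \<nu>)"
    unfolding positive_def
  proof -
    have z: "(\<Sum>i. ennreal (norm (\<nu> (P i)))) = 0" if "P \<in> bounded_partitions {}" for P
    proof -
      have "P i = {}" for i using that by blast
      then show ?thesis by (simp add: e)
    qed
    have "total_variation \<nu> {} \<le> 0" by (intro SUP_least eq_refl z)
    then show "total_variation \<nu> {} = 0" by simp
  qed
  have mono: "total_variation \<nu> A \<le> total_variation \<nu> B" if "A \<in> sets borel" "B \<in> sets borel" "A \<subseteq> B" for A B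
  proof -
    have "total_variation \<nu> A \<le> total_variation \<nu> A + total_variation \<nu> (B - A)" by simp
    also have "\<dots> \<le> total_variation \<nu> (A \<union> (B - A))"
      by (rule total_variation_superadditive) (use that in auto)
    finally show ?thesis using that by (simp add: Un_absorb1)
  qed
  show "countably_additive (sets borel) (total_variation \<nu>)"
    unfolding countably_additive_def
  proof (intro allI impI)
    fix A :: "nat \<Rightarrow> 'a set" assume A: "range A \<subseteq> sets borel" "disjoint_family A" "(\<Union>i. A i) \<in> sets borel"
    have Ai: "A i \<in> sets borel" for i using A by blast
    have "(\<Sum>i. total_variation \<nu> (A i)) \<le> total_variation \<nu> (\<Union>i. A i)"
    proof (rule suminf_le_const[OF summableI])
      fix n
      have "(\<Sum>i<n. total_variation \<nu> (A i)) \<le> total_variation \<nu> (\<Union>i<n. A i)"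
      proof (induction n)
        case (Suc n)
        have "(\<Sum>i<Suc n. total_variation \<nu> (A i)) \<le> total_variation \<nu> (\<Union>i<n. A i) + total_variation \<nu> (A n)"
          using Suc by (simp add: add_right_mono)
        also have "\<dots> \<le> total_variation \<nu> ((\<Union>i<n. A i) \<union> A n)"
        proof (rule total_variation_superadditive)
          show "(\<Union>i<n. A i) \<inter> A n = {}" 
          proof -
            have "A i \<inter> A n = {}" if "i < n" for i using A(2) that by (simp add: disjoint_family_on_def)
            then show ?thesis by blast
          qed
        qed (use Ai in auto)
        also have "(\<Union>i<n. A i) \<union> A n = (\<Union>i<Suc n. A i)" by (auto simp: lessThan_Suc)
        finally show ?case .
      qed simp
      also have "\<dots> \<le> total_variation \<nu> (\<Union>i. A i)" by (rule mono) (use Ai A in auto)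
      finally show "(\<Sum>i<n. total_variation \<nu> (A i)) \<le> total_variation \<nu> (\<Union>i. A i)" .
    qed
    with total_variation_countably_subadditive[OF \<nu> A(1,2)]
    show "(\<Sum>i. total_variation \<nu> (A i)) = total_variation \<nu> (\<Union>i. A i)" by (rule antisym[rotated])
  qed
  show "X \<in> sets borel" by (rule X)
qed

lemma sets_total_variation_measure [simp, measurable_cong]:
  "sets (total_variation_measure \<nu>) = sets borel"
  unfolding total_variation_measure_def by (simp add: sets.sigma_sets_eq[of borel, simplified])

lemma space_total_variation_measure [simp]: "space (total_variation_measure \<nu>) = UNIV"
  unfolding total_variation_measure_def by (simp add: space_measure_of)

lemma norm_le_total_variation_measure:
  fixes \<nu> :: "'a::euclidean_space set \<Rightarrow> 'b::real_normed_vector"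
  assumes \<nu>: "bounded_countably_additive \<nu>" and B: "B \<in> sets borel" "bounded B" "B \<subseteq> A" and A: "A \<in> sets borel"
  shows "ennreal (norm (\<nu> B)) \<le> emeasure (total_variation_measure \<nu>) A"
proof -
  define P where "P i = (if i = 0 then B else {})" for i :: nat
  have P: "P \<in> bounded_partitions B"
    using B by (auto simp: P_def disjoint_family_on_def split: if_splits)
  have "ennreal (norm (\<nu> B)) = ennreal (norm (\<nu> (P 0)))" by (simp add: P_def)
  also have "\<dots> = (\<Sum>i\<in>{0}. ennreal (norm (\<nu> (P i))))" by simp
  also have "\<dots> \<le> (\<Sum>i. ennreal (norm (\<nu> (P i))))" by (rule sum_le_suminf[OF summableI]) auto
  also have "\<dots> \<le> total_variation \<nu> B" using P by (rule SUP_upper)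
  also have "\<dots> = emeasure (total_variation_measure \<nu>) B" by (rule emeasure_total_variation_measure[OF \<nu> B(1), symmetric])
  also have "\<dots> \<le> emeasure (total_variation_measure \<nu>) A" by (rule emeasure_mono) (use B A in auto)
  finally show ?thesis .
qed

text \<open>
  If \<open>positive_part m\<close> were not countably additive, \<open>measure_of\<close> would return the null measure,
  for which the bound holds as well.
\<close>

lemma positive_part_le:
  fixes m :: "'a::euclidean_space set \<Rightarrow> real" and \<nu> :: "'a set \<Rightarrow> 'b::real_normed_vector"
  assumes \<nu>: "bounded_countably_additive \<nu>"
    and m: "\<And>B. B \<in> sets borel \<Longrightarrow> bounded B \<Longrightarrow> m B \<le> norm (\<nu> B)"
  shows "positive_part m \<le> total_variation_measure \<nu>" and "sets (positive_part m) = sets borel"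
proof -
  show s: "sets (positive_part m) = sets borel"
    unfolding positive_part_def by (simp add: sets.sigma_sets_eq[of borel, simplified])
  show "positive_part m \<le> total_variation_measure \<nu>"
  proof (subst le_measure)
    show "\<forall>A\<in>sets (positive_part m). emeasure (positive_part m) A \<le> emeasure (total_variation_measure \<nu>) A"
    proof
      fix A assume "A \<in> sets (positive_part m)"
      then have A: "A \<in> sets borel" by (simp add: s)
      have "emeasure (positive_part m) A \<le> (SUP B \<in> {B \<in> sets borel. bounded B \<and> B \<subseteq> A}. ennreal (m B))"
        unfolding positive_part_def emeasure_measure_of_conv by simp
      also have "\<dots> \<le> emeasure (total_variation_measure \<nu>) A"
      proof (rule SUP_least)
        fix B assume B: "B \<in> {B \<in> sets borel. bounded B \<and> B \<subseteq> A}"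
        then have "ennreal (m B) \<le> ennreal (norm (\<nu> B))" by (intro ennreal_leI m) auto
        also have "\<dots> \<le> emeasure (total_variation_measure \<nu>) A"
          by (rule norm_le_total_variation_measure[OF \<nu>]) (use B A in auto)
        finally show "ennreal (m B) \<le> emeasure (total_variation_measure \<nu>) A" .
      qed
      finally show "emeasure (positive_part m) A \<le> emeasure (total_variation_measure \<nu>) A" .
    qed
  qed (simp add: s)
qed

lemma ennreal_abs_integral_le: "ennreal \<bar>LINT x|M. f x\<bar> \<le> (\<integral>\<^sup>+x. ennreal \<bar>f x\<bar> \<partial>M)" for f :: "_ \<Rightarrow> real"
proof (cases "integrable M f")
  case True
  then show ?thesis using integral_norm_bound_ennreal[OF True] by simp
qed (simp add: not_integrable_integral_eq)

text \<open>The factor 2 arises because the integrals against the positive and the negative part of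
  \<open>m\<close> are bounded separately by the total variation. The loss only affects
  constants.\<close>

lemma signed_integral_le:
  fixes m :: "'a::euclidean_space set \<Rightarrow> real" and \<nu> :: "'a set \<Rightarrow> 'b::real_normed_vector"
  assumes \<nu>: "bounded_countably_additive \<nu>"
    and m: "\<And>B. B \<in> sets borel \<Longrightarrow> bounded B \<Longrightarrow> \<bar>m B\<bar> \<le> norm (\<nu> B)"
  shows "ennreal \<bar>signed_integral m \<psi>\<bar> \<le> 2 * (\<integral>\<^sup>+x. ennreal \<bar>\<psi> x\<bar> \<partial>total_variation_measure \<nu>)"
proof -
  have bnd: "ennreal \<bar>LINT x|positive_part m'. \<psi> x\<bar> \<le> (\<integral>\<^sup>+x. ennreal \<bar>\<psi> x\<bar> \<partial>total_variation_measure \<nu>)"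
    if m': "\<And>B. B \<in> sets borel \<Longrightarrow> bounded B \<Longrightarrow> m' B \<le> norm (\<nu> B)" for m'
  proof -
    have "ennreal \<bar>LINT x|positive_part m'. \<psi> x\<bar> \<le> (\<integral>\<^sup>+x. ennreal \<bar>\<psi> x\<bar> \<partial>positive_part m')"
      by (rule ennreal_abs_integral_le)
    also have "\<dots> \<le> (\<integral>\<^sup>+x. ennreal \<bar>\<psi> x\<bar> \<partial>total_variation_measure \<nu>)"
      by (rule nn_integral_mono_measure) (use positive_part_le[OF \<nu> m'] in auto)
    finally show ?thesis .
  qed
  have "ennreal \<bar>signed_integral m \<psi>\<bar> \<le> ennreal (\<bar>LINT x|positive_part m. \<psi> x\<bar> + \<bar>LINT x|positive_part (\<lambda>A. - m A). \<psi> x\<bar>)"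
    unfolding signed_integral_def by (intro ennreal_leI abs_triangle_ineq4)
  also have "\<dots> = ennreal \<bar>LINT x|positive_part m. \<psi> x\<bar> + ennreal \<bar>LINT x|positive_part (\<lambda>A. - m A). \<psi> x\<bar>"
    by simp
  also have "\<dots> \<le> (\<integral>\<^sup>+x. ennreal \<bar>\<psi> x\<bar> \<partial>total_variation_measure \<nu>) + (\<integral>\<^sup>+x. ennreal \<bar>\<psi> x\<bar> \<partial>total_variation_measure \<nu>)"
    by (intro add_mono bnd) (use m in \<open>force simp: abs_le_iff\<close>)+
  finally show ?thesis by (simp add: mult_2)
qed

lemma gradient_measure_component:
  assumes "\<phi> \<in> BV_loc"
  shows "is_distributional_partial \<phi> i (\<lambda>A. gradient_measure \<phi> A $ i)"
proof -
  have "\<exists>m. is_distributional_partial \<phi> i m" using assms by (simp add: BV_loc_def)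
  then have "is_distributional_partial \<phi> i (SOME m. is_distributional_partial \<phi> i m)" by (rule someI_ex)
  then show ?thesis by (simp add: gradient_measure_def)
qed

lemma bounded_countably_additive_gradient_measure:
  assumes "\<phi> \<in> BV_loc"
  shows "bounded_countably_additive (gradient_measure \<phi>)"
  unfolding bounded_countably_additive_def
proof (intro allI impI)
  fix A :: "nat \<Rightarrow> (real^'a) set"
  assume A: "range A \<subseteq> sets borel" "disjoint_family A" "bounded (\<Union>i. A i)"
  have "(\<lambda>n. gradient_measure \<phi> (A n) $ i) sums (gradient_measure \<phi> (\<Union>i. A i) $ i)" for i
    using gradient_measure_component[OF assms, of i] A
    unfolding is_distributional_partial_def signed_radon_measure_def by blast
  then show "(\<lambda>i. gradient_measure \<phi> (A i)) sums gradient_measure \<phi> (\<Union>i. A i)"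
    unfolding sums_def by (intro vec_tendstoI) simp
qed

text \<open>All later estimates use the membership of a coefficient in \<open>BV_loc\<close> through
  this inequality alone.\<close>

lemma integral_partial_le_gradient_variation:
  fixes \<phi> :: "real^'n::finite \<Rightarrow> real"
  assumes \<phi>: "\<phi> \<in> BV_loc" and \<psi>: "test_function \<psi>"
  shows "ennreal \<bar>LINT x|lebesgue. \<phi> x * partial i \<psi> x\<bar> \<le> 2 * (\<integral>\<^sup>+x. ennreal \<bar>\<psi> x\<bar> \<partial>gradient_variation \<phi>)"
proof -
  have "signed_integral (\<lambda>A. gradient_measure \<phi> A $ i) \<psi> = - (LINT x|lebesgue. \<phi> x * partial i \<psi> x)"
    using gradient_measure_component[OF \<phi>, of i] \<psi> unfolding is_distributional_partial_def by blast
  moreover have "ennreal \<bar>signed_integral (\<lambda>A. gradient_measure \<phi> A $ i) \<psi>\<bar> \<le> 2 * (\<integral>\<^sup>+x. ennreal \<bar>\<psi> x\<bar> \<partial>gradient_variation \<phi>)"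
    by (rule signed_integral_le[OF bounded_countably_additive_gradient_measure[OF \<phi>]]) (rule component_le_norm_cart)
  ultimately show ?thesis by simp
qed

section \<open>Smooth test functions\<close>

text \<open>The powers of \<open>1 / t\<close> are included because differentiating the basic flat
  function creates them: the family is closed under derivatives up to linear combinations.\<close>

definition flat_exp :: "nat \<Rightarrow> real \<Rightarrow> real" where
  "flat_exp m t = (if 0 < t then exp (- (1 / t)) / t ^ m else 0)"

lemma flat_exp_tendsto_0: "((\<lambda>t. flat_exp m t) \<longlongrightarrow> 0) (at 0)"
proof -
  have "filterlim (\<lambda>t::real. inverse t) at_top (at_right 0)" by (rule filterlim_inverse_at_top_right)
  then have "((\<lambda>t::real. inverse t ^ m / exp (inverse t)) \<longlongrightarrow> 0) (at_right 0)"
    by (rule filterlim_compose[OF tendsto_power_div_exp_0])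
  moreover have "\<forall>\<^sub>F t in at_right 0. inverse t ^ m / exp (inverse t) = flat_exp m t"
    using eventually_at_right_less[of "0::real"]
    by eventually_elim (auto simp: flat_exp_def exp_minus field_simps power_inverse)
  ultimately have r: "((\<lambda>t. flat_exp m t) \<longlongrightarrow> 0) (at_right 0)" by (rule Lim_transform_eventually)
  have "\<forall>\<^sub>F t in at_left 0. flat_exp m t = 0"
    using eventually_at_left_real[of "-1" 0] by (auto simp: flat_exp_def elim!: eventually_mono)
  then have "((\<lambda>t. flat_exp m t) \<longlongrightarrow> 0) (at_left 0)" by (rule tendsto_eventually)
  with r show ?thesis by (simp add: filterlim_at_split)
qed

lemma flat_exp_deriv:
  "(flat_exp m has_real_derivative (flat_exp (m + 2) t - real m * flat_exp (m + 1) t)) (at t)"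
proof -
  consider "t > 0" | "t < 0" | "t = 0" by linarith
  then show ?thesis
  proof cases
    case 1
    have "((\<lambda>t. exp (- (1 / t)) / t ^ m) has_real_derivative (flat_exp (m + 2) t - real m * flat_exp (m + 1) t)) (at t)"
    proof -
      have 2: "((\<lambda>t. exp (- (1 / t))) has_real_derivative exp (- (1 / t)) * (1 / t^2)) (at t)"
        using 1 by (auto intro!: derivative_eq_intros simp: power2_eq_square)
      have "t ^ m \<noteq> 0" using 1 by simp
      note D = DERIV_divide[OF 2 DERIV_pow[of m t] this]
      show ?thesis
        by (rule DERIV_cong[OF D]) (use 1 in \<open>cases m; simp add: flat_exp_def power2_eq_square field_simps\<close>)
    qed
    then show ?thesis
      by (rule has_field_derivative_transform_within_open[where S = "{0<..}"]) (use 1 in \<open>auto simp: flat_exp_def\<close>)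
  next
    case 2
    have "((\<lambda>t. 0::real) has_real_derivative (flat_exp (m + 2) t - real m * flat_exp (m + 1) t)) (at t)"
      using 2 by (simp add: flat_exp_def)
    then show ?thesis
      by (rule has_field_derivative_transform_within_open[where S = "{..<0}"]) (use 2 in \<open>auto simp: flat_exp_def\<close>)
  next
    case 3
    \<comment> \<open>At the origin the difference quotient of one member of the family is the next
      member, whose limit is 0.\<close>
    have "((\<lambda>h. flat_exp (m + 1) h) \<longlongrightarrow> 0) (at 0)" by (rule flat_exp_tendsto_0)
    moreover have "flat_exp (m + 1) h = (flat_exp m (0 + h) - flat_exp m 0) / h" for h
      by (auto simp: flat_exp_def field_simps)
    ultimately have "(flat_exp m has_real_derivative 0) (at 0)" by (simp add: DERIV_def)
    then show ?thesis unfolding 3 by (simp add: flat_exp_def)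
  qed
qed

text \<open>An algebra of functions that is closed under partial derivatives, hence consists of smooth functions.\<close>

inductive flat_algebra :: "(real^'n::finite \<Rightarrow> real) \<Rightarrow> bool" where
  const: "flat_algebra (\<lambda>x. c)"
| flat: "flat_algebra (\<lambda>x. flat_exp m (a + b * x $ i))"
| add: "flat_algebra f \<Longrightarrow> flat_algebra g \<Longrightarrow> flat_algebra (\<lambda>x. f x + g x)"
| mult: "flat_algebra f \<Longrightarrow> flat_algebra g \<Longrightarrow> flat_algebra (\<lambda>x. f x * g x)"

lemma flat_algebra_prod:
  assumes "finite S" "\<And>i. i \<in> S \<Longrightarrow> flat_algebra (F i)"
  shows "flat_algebra (\<lambda>x. \<Prod>i\<in>S. F i x)"
  using assms by (induction S rule: finite_induct) (auto intro: flat_algebra.intros)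

lemma continuous_on_flat_exp: "continuous_on UNIV (flat_exp m)"
  by (intro continuous_at_imp_continuous_on ballI DERIV_isCont[OF flat_exp_deriv])

lemma flat_algebra_continuous:
  assumes "flat_algebra f" shows "continuous_on UNIV f"
  using assms
proof induction
  case (flat m a b i)
  have "continuous_on UNIV (\<lambda>x::real^'a. flat_exp m (a + b * x $ i))"
    by (rule continuous_on_compose2[OF continuous_on_flat_exp]) (auto intro!: continuous_intros)
  then show ?case .
qed (auto intro!: continuous_intros)

lemma flat_algebra_has_partial:
  assumes "flat_algebra f"
  shows "\<exists>g. flat_algebra g \<and> (\<forall>x. has_partial f j (g x) x)"
  using assms
proof induction
  case (const c)
  show ?case by (intro exI[of _ "\<lambda>_. 0"]) (auto intro: flat_algebra.intros simp: has_partial_def)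
next
  case (flat m a b i)
  define d where "d = (if i = j then b else 0)"
  define g :: "real^'a \<Rightarrow> real" where "g = (\<lambda>x. (flat_exp (m + 2) (a + b * x $ i) + (- real m) * flat_exp (m + 1) (a + b * x $ i)) * d)"
  have "flat_algebra g" unfolding g_def by (intro flat_algebra.intros)
  moreover have "has_partial (\<lambda>x. flat_exp m (a + b * x $ i)) j (g x) x" for x
  proof -
    have "((\<lambda>\<tau>. a + b * (x + \<tau> *\<^sub>R axis j 1) $ i) has_real_derivative d) (at 0)"
      by (auto simp: axis_def d_def intro!: derivative_eq_intros)
    from DERIV_chain2[OF flat_exp_deriv this] show ?thesis unfolding has_partial_def g_def by simp
  qed
  ultimately show ?case by blast
next
  case (add f1 f2)
  then obtain g1 g2 where "flat_algebra g1" "flat_algebra g2" "\<And>x. has_partial f1 j (g1 x) x" "\<And>x. has_partial f2 j (g2 x) x" by blast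
  then show ?case
    by (intro exI[of _ "\<lambda>x. g1 x + g2 x"]) (auto simp: has_partial_def intro!: flat_algebra.add DERIV_add)
next
  case (mult f1 f2)
  then obtain g1 g2 where g: "flat_algebra g1" "flat_algebra g2" "\<And>x. has_partial f1 j (g1 x) x" "\<And>x. has_partial f2 j (g2 x) x" by blast
  have "has_partial (\<lambda>x. f1 x * f2 x) j (g1 x * f2 x + g2 x * f1 x) x" for x
    using DERIV_mult[OF g(3)[of x, unfolded has_partial_def] g(4)[of x, unfolded has_partial_def]]
    by (simp add: has_partial_def)
  then show ?case
    using g mult by (intro exI[of _ "\<lambda>x. g1 x * f2 x + g2 x * f1 x"]) (auto intro!: flat_algebra.intros)
qed

lemma has_partial_imp_partial: "has_partial f j D x \<Longrightarrow> partial j f x = D"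
  unfolding has_partial_def partial_def by (rule DERIV_imp_deriv)

lemma flat_algebra_C_k: "flat_algebra f \<Longrightarrow> C_k k f"
proof (induction k arbitrary: f)
  case (Suc k)
  have "(\<forall>x. \<exists>D. has_partial f i D x) \<and> C_k k (partial i f)" for i
  proof -
    obtain g where g: "flat_algebra g" "\<And>x. has_partial f i (g x) x" using flat_algebra_has_partial[OF Suc.prems] by blast
    then have "partial i f = g" using has_partial_imp_partial by blast
    then show ?thesis using g Suc.IH by auto
  qed
  then show ?case using flat_algebra_continuous[OF Suc.prems] by simp
qed (simp add: flat_algebra_continuous)

text \<open>Balls of the maximum norm are used instead of Euclidean ones because moving between two
  of their points one coordinate at a time does not leave them, which the Poincare argument
  needs.\<close>

definition cube :: "real^'n::finite \<Rightarrow> real \<Rightarrow> (real^'n) set" where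
  "cube x r = {y. \<forall>i. \<bar>y $ i - x $ i\<bar> \<le> r}"

lemma cube_eq_cbox: "cube x r = cbox (\<chi> i. x $ i - r) (\<chi> i. x $ i + r)"
  by (auto simp: cube_def mem_box_cart abs_le_iff algebra_simps)

lemma compact_cube [simp]: "compact (cube x r)" by (simp add: cube_eq_cbox)
lemma closed_cube [simp]: "closed (cube x r)" by (simp add: cube_eq_cbox closed_cbox)
lemma cube_borel [measurable, simp]: "cube x r \<in> sets borel" by (simp add: cube_eq_cbox)
lemma bounded_cube [simp]: "bounded (cube x r)" by (simp add: cube_eq_cbox)

lemma emeasure_cube:
  fixes x :: "real^'n::finite"
  assumes "0 \<le> r" shows "emeasure lborel (cube x r) = ennreal ((2 * r) ^ CARD('n))"
proof -
  have "x \<in> cube x r" using assms by (simp add: cube_def)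
  then have ne: "cbox (\<chi> i. x $ i - r) (\<chi> i. x $ i + r) \<noteq> {}" unfolding cube_eq_cbox by blast
  have "emeasure lborel (cube x r) = ennreal (measure lborel (cube x r))"
    using emeasure_lborel_cbox_finite[of "\<chi> i. x $ i - r" "\<chi> i. x $ i + r"] unfolding cube_eq_cbox
    by (intro emeasure_eq_ennreal_measure) auto
  also have "measure lborel (cube x r) = (2 * r) ^ CARD('n)"
    unfolding cube_eq_cbox using content_cbox_cart[OF ne] by simp
  finally show ?thesis .
qed

text \<open>The product is positive exactly on the open cube of radius \<open>e\<close> when
  \<open>e > 0\<close>. It is not normalised; its mass is divided out where needed.\<close>

definition bump :: "real \<Rightarrow> real^'n::finite \<Rightarrow> real" where
  "bump e z = (\<Prod>i\<in>UNIV. flat_exp 0 (1 + z $ i / e) * flat_exp 0 (1 - z $ i / e))"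

lemma flat_exp_0_bounds: "0 \<le> flat_exp 0 t" "flat_exp 0 t \<le> 1"
  by (auto simp: flat_exp_def)

lemma bump_bounds: "0 \<le> bump e z" "bump e z \<le> 1"
  unfolding bump_def by (auto intro!: prod_nonneg prod_le_1 mult_nonneg_nonneg mult_le_one simp: flat_exp_0_bounds)

lemma bump_eq_0:
  assumes "0 < e" "z \<notin> cube 0 e" shows "bump e z = 0"
proof -
  obtain i where i: "\<not> \<bar>z $ i\<bar> \<le> e" using assms(2) by (auto simp: cube_def)
  then have "1 + z $ i / e \<le> 0 \<or> 1 - z $ i / e \<le> 0" using assms(1) by (auto simp: field_simps abs_le_iff)
  then have "flat_exp 0 (1 + z $ i / e) * flat_exp 0 (1 - z $ i / e) = 0" by (auto simp: flat_exp_def)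
  then show ?thesis unfolding bump_def by (intro prod_zero) auto
qed

lemma bump_0_pos: "0 < bump e 0"
  unfolding bump_def by (intro prod_pos) (auto simp: flat_exp_def)

lemma flat_algebra_bump: "flat_algebra (bump e)"
proof -
  have 1: "flat_algebra (\<lambda>z::real^'n. flat_exp 0 (1 + z $ i / e))" for i :: "'n::finite"
    using flat_algebra.flat[of 0 1 "1 / e" i] by simp
  have 2: "flat_algebra (\<lambda>z::real^'n. flat_exp 0 (1 - z $ i / e))" for i :: "'n::finite"
    using flat_algebra.flat[of 0 1 "- (1 / e)" i] by simp
  show ?thesis unfolding bump_def[abs_def] by (intro flat_algebra_prod flat_algebra.mult 1 2) auto
qed

lemma flat_algebra_bump_reflect: "flat_algebra (\<lambda>y. bump e (x - y))"
proof -
  have 1: "flat_algebra (\<lambda>z::real^'n. flat_exp 0 (1 + (x - z) $ i / e))" for i :: "'n::finite" and x :: "real^'n"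
  proof -
    have "(\<lambda>z. flat_exp 0 (1 + (x - z) $ i / e)) = (\<lambda>z. flat_exp 0 ((1 + x $ i / e) + (- (1 / e)) * z $ i))"
      by (simp add: fun_eq_iff diff_divide_distrib algebra_simps)
    then show ?thesis using flat_algebra.flat[of 0 "1 + x $ i / e" "- (1 / e)" i] by simp
  qed
  have 2: "flat_algebra (\<lambda>z::real^'n. flat_exp 0 (1 - (x - z) $ i / e))" for i :: "'n::finite" and x :: "real^'n"
  proof -
    have "(\<lambda>z. flat_exp 0 (1 - (x - z) $ i / e)) = (\<lambda>z. flat_exp 0 ((1 - x $ i / e) + (1 / e) * z $ i))"
      by (simp add: fun_eq_iff diff_divide_distrib algebra_simps)
    then show ?thesis using flat_algebra.flat[of 0 "1 - x $ i / e" "1 / e" i] by simp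
  qed
  show ?thesis unfolding bump_def[abs_def] by (intro flat_algebra_prod flat_algebra.mult 1 2) auto
qed

lemma continuous_on_bump: "continuous_on UNIV (bump e)"
  by (rule flat_algebra_continuous[OF flat_algebra_bump])

lemma bump_measurable [measurable]: "bump e \<in> borel_measurable borel"
  by (rule borel_measurable_continuous_onI[OF continuous_on_bump])

lemma test_function_bump_reflect:
  assumes "0 < e" shows "test_function (\<lambda>y. bump e (x - y))"
proof -
  have "{y. bump e (x - y) \<noteq> 0} \<subseteq> cube x e"
    using bump_eq_0[OF assms, of "x - _"] by (fastforce simp: cube_def abs_minus_commute)
  then have "closure {y. bump e (x - y) \<noteq> 0} \<subseteq> cube x e" by (rule closure_minimal) simp
  then have "compact (closure {y. bump e (x - y) \<noteq> 0})"
    using bounded_subset[OF bounded_cube] by (auto simp: compact_eq_bounded_closed)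
  then show ?thesis unfolding test_function_def using flat_algebra_C_k[OF flat_algebra_bump_reflect] by blast
qed

lemma bump_partial:
  fixes i :: "'n::finite"
  assumes "0 < e"
  obtains g M where "continuous_on UNIV g" "\<And>z. has_partial (bump e) i (g z) z" "\<And>z. z \<notin> cube 0 e \<Longrightarrow> g z = 0"
    "\<And>z. \<bar>g z\<bar> \<le> M"
proof -
  obtain g where g: "flat_algebra g" "\<And>z. has_partial (bump e) i (g z) z"
    using flat_algebra_has_partial[OF flat_algebra_bump] by blast
  have c: "continuous_on UNIV g" by (rule flat_algebra_continuous[OF g(1)])
  have 0: "g z = 0" if z: "z \<notin> cube 0 e" for z
  proof -
    have op: "open (- cube 0 e :: (real^'n) set)" by auto
    have S: "open ((\<lambda>\<tau>. z + \<tau> *\<^sub>R axis i 1) -` (- cube 0 e))"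
      by (rule continuous_open_vimage[OF op]) (auto intro!: continuous_intros)
    have "((\<lambda>\<tau>. 0::real) has_real_derivative 0) (at 0)" by simp
    then have "((\<lambda>\<tau>. bump e (z + \<tau> *\<^sub>R axis i 1)) has_real_derivative 0) (at 0)"
      by (rule has_field_derivative_transform_within_open[OF _ S]) (use z bump_eq_0[OF assms] in auto)
    then show ?thesis using g(2)[of z] unfolding has_partial_def by (rule DERIV_unique[symmetric])
  qed
  have "compact (g ` cube 0 e)" by (rule compact_continuous_image[OF continuous_on_subset[OF c]]) auto
  then obtain M where M: "\<And>z. z \<in> cube 0 e \<Longrightarrow> \<bar>g z\<bar> \<le> M" using compact_imp_bounded bounded_iff by (metis imageI real_norm_def)
  have "\<bar>g z\<bar> \<le> max 0 M" for z using 0 M by (cases "z \<in> cube 0 e") (auto simp: le_max_iff_disj)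
  with c g(2) 0 show ?thesis using that by blast
qed

lemma nn_integral_bump:
  assumes "0 < e"
  shows "0 < (\<integral>\<^sup>+z. ennreal (bump e z) \<partial>(lborel :: (real^'n::finite) measure))" "(\<integral>\<^sup>+z. ennreal (bump e z) \<partial>(lborel :: (real^'n::finite) measure)) < \<infinity>"
proof -
  have "(\<integral>\<^sup>+z. ennreal (bump e z) \<partial>(lborel :: (real^'n) measure)) \<le> emeasure lborel (cube 0 e :: (real^'n) set)"
  proof -
    have le: "ennreal (bump e z) \<le> indicator (cube 0 e) z" for z :: "real^'n"
      using bump_bounds(2)[of e z] bump_eq_0[OF assms, of z] by (cases "z \<in> cube 0 e") auto
    have "(\<integral>\<^sup>+z. ennreal (bump e z) \<partial>(lborel :: (real^'n) measure)) \<le> (\<integral>\<^sup>+z. indicator (cube 0 e) z \<partial>(lborel :: (real^'n) measure))"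
      by (rule nn_integral_mono, rule le)
    then show ?thesis by simp
  qed
  also have "emeasure lborel (cube 0 e :: (real^'n) set) < \<infinity>" using assms by (simp add: emeasure_cube)
  finally show "(\<integral>\<^sup>+z. ennreal (bump e z) \<partial>(lborel :: (real^'n) measure)) < \<infinity>" .
  have "open ((bump e :: real^'n \<Rightarrow> real) -` {0<..})"
    using continuous_on_bump by (intro continuous_open_vimage) (auto simp: continuous_on_eq_continuous_at)
  moreover have "0 \<in> ((bump e :: real^'n \<Rightarrow> real) -` {0<..})" using bump_0_pos by auto
  ultimately have "\<not> (bump e :: real^'n \<Rightarrow> real) -` {0<..} \<in> null_sets lborel"
    using open_not_negligible negligible_iff_null_sets null_sets_completionI by blast
  then have "\<not> (AE z in (lborel :: (real^'n) measure). bump e z = 0)"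
    by (subst AE_iff_null) (auto simp: vimage_def bump_bounds less_le bump_bounds(1) intro: back_subst[of "\<lambda>A. A \<in> _"] dest: sym)
  moreover have "AE z in (lborel :: (real^'n) measure). bump e z = 0"
    if "(\<integral>\<^sup>+z. ennreal (bump e z) \<partial>(lborel :: (real^'n) measure)) = 0"
  proof -
    have "AE z in (lborel :: (real^'n) measure). ennreal (bump e z) = 0"
      using that by (subst (asm) nn_integral_0_iff_AE) auto
    then show ?thesis by eventually_elim (use bump_bounds(1) in \<open>auto simp: ennreal_eq_0_iff intro: antisym\<close>)
  qed
  ultimately have "(\<integral>\<^sup>+z. ennreal (bump e z) \<partial>(lborel :: (real^'n) measure)) \<noteq> 0" by blast
  then show "0 < (\<integral>\<^sup>+z. ennreal (bump e z) \<partial>(lborel :: (real^'n) measure))" by (simp add: zero_less_iff_neq_zero)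
qed

section \<open>Mollification\<close>

lemma nn_integral_lborel_shift:
  fixes f :: "'a::euclidean_space \<Rightarrow> ennreal"
  assumes [measurable]: "f \<in> borel_measurable borel"
  shows "(\<integral>\<^sup>+x. f (x + c) \<partial>lborel) = (\<integral>\<^sup>+x. f x \<partial>lborel)"
proof -
  have "(\<integral>\<^sup>+x. f x \<partial>lborel) = (\<integral>\<^sup>+x. f x \<partial>distr lborel borel ((+) c))" by (simp add: lborel_distr_plus)
  also have "\<dots> = (\<integral>\<^sup>+x. f (c + x) \<partial>lborel)" by (rule nn_integral_distr) auto
  finally show ?thesis by (simp add: add.commute)
qed

lemma distr_lborel_reflect: "distr lborel borel (\<lambda>x. c - x) = (lborel :: 'a::euclidean_space measure)"
proof -
  have "(lborel :: 'a measure) = density (distr lborel borel (\<lambda>x. c + (-1) *\<^sub>R x)) (\<lambda>x. ennreal (\<bar>-1\<bar> ^ DIM('a)))"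
    by (rule lborel_affine) simp
  then show ?thesis by (simp add: density_1)
qed

lemma integral_lborel_reflect:
  fixes f :: "'a::euclidean_space \<Rightarrow> real"
  assumes [measurable]: "f \<in> borel_measurable borel"
  shows "(\<integral>x. f (c - x) \<partial>lborel) = (\<integral>x. f x \<partial>lborel)"
  by (subst (2) distr_lborel_reflect[of c, symmetric], subst integral_distr) auto

text \<open>Measurability provides continuous functions converging to \<open>u\<close> off a
  negligible set. Truncated at level \<open>M\<close> they converge in mean on bounded sets, by
  dominated convergence, and each of them is uniformly continuous on compact sets.\<close>

lemma translation_continuity_L1:
  fixes u :: "'a::euclidean_space \<Rightarrow> real"
  assumes u[measurable]: "u \<in> borel_measurable borel" and bd: "\<And>x. \<bar>u x\<bar> \<le> M"
    and A[measurable]: "A \<in> sets borel" and "bounded A" and e: "0 < e"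
  shows "\<exists>d>0. \<forall>w. norm w < d \<longrightarrow> (\<integral>\<^sup>+x\<in>A. ennreal \<bar>u (x + w) - u x\<bar> \<partial>lborel) \<le> ennreal e"
proof -
  have M: "M \<ge> 0" using bd[of 0] by linarith
  have "u \<in> borel_measurable lebesgue" by (simp add: measurable_completion)
  then have "u measurable_on UNIV" by (intro lebesgue_measurable_imp_measurable_on_real) auto
  then obtain N g where N: "negligible N" and g: "\<And>n. continuous_on UNIV (g n)" "\<And>x. x \<notin> N \<Longrightarrow> (\<lambda>n. g n x) \<longlonglongrightarrow> u x"
    unfolding measurable_on_def by auto
  define G where "G n x = max (- M) (min M (g n x))" for n x
  have Gc: "continuous_on UNIV (G n)" for n unfolding G_def by (intro continuous_intros g(1))
  have [measurable]: "G n \<in> borel_measurable borel" for n by (rule borel_measurable_continuous_onI[OF Gc])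
  have Gb: "\<bar>G n x\<bar> \<le> M" for n x using M by (auto simp: G_def)
  have Gl: "(\<lambda>n. G n x) \<longlonglongrightarrow> u x" if "x \<notin> N" for x
  proof -
    have "(\<lambda>n. G n x) \<longlonglongrightarrow> max (- M) (min M (u x))" unfolding G_def by (intro tendsto_intros g(2) that)
    then show ?thesis using bd[of x] by (simp add: abs_le_iff)
  qed
  have aeN: "AE x in lborel. x \<notin> N"
    using N by (metis AE_completion_iff AE_not_in negligible_iff_null_sets)
  obtain R where R: "\<And>x. x \<in> A \<Longrightarrow> norm x \<le> R" using \<open>bounded A\<close> unfolding bounded_iff by blast
  \<comment> \<open>The extra radius 1 leaves room for the translates \<open>x + w\<close> with
    \<open>norm w < 1\<close>.\<close>
  define B where "B = cball (0::'a) (R + 1)"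
  have [measurable]: "B \<in> sets borel" by (simp add: B_def)
  define a where "a = measure lborel B"
  have Bfin: "emeasure lborel B < \<infinity>" unfolding B_def by (rule emeasure_bounded_finite) simp
  have a: "emeasure lborel B = ennreal a" unfolding a_def using Bfin by (intro emeasure_eq_ennreal_measure) auto
  have a0: "a \<ge> 0" by (simp add: a_def)
  have Bi: "integrable lborel (\<lambda>x. indicator B x * c)" for c :: real
    using Bfin by (intro integrable_mult_left integrable_real_indicator) auto
  have "(\<lambda>n. \<integral>x. indicator B x * \<bar>G n x - u x\<bar> \<partial>lborel) \<longlonglongrightarrow> (\<integral>x. 0 \<partial>(lborel :: 'a measure))"
  proof (rule integral_dominated_convergence[where w = "\<lambda>x. indicator B x * (2 * M)"])
    show "AE x in lborel. (\<lambda>n. indicator B x * \<bar>G n x - u x\<bar>) \<longlonglongrightarrow> 0"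
      using aeN
    proof eventually_elim
      case (elim x)
      have "(\<lambda>n. indicator B x * \<bar>G n x - u x\<bar>) \<longlonglongrightarrow> indicator B x * \<bar>u x - u x\<bar>" by (intro tendsto_intros Gl elim)
      then show ?case by simp
    qed
    show "AE x in lborel. norm (indicator B x * \<bar>G n x - u x\<bar>) \<le> indicator B x * (2 * M)" for n
    proof (rule AE_I2)
      fix x show "norm (indicator B x * \<bar>G n x - u x\<bar>) \<le> indicator B x * (2 * M)"
        using Gb[of n x] bd[of x] by (auto simp: indicator_def)
    qed
  qed (use Bi in auto)
  then have "\<forall>\<^sub>F n in sequentially. (\<integral>x. indicator B x * \<bar>G n x - u x\<bar> \<partial>lborel) < e / 3"
    by (rule order_tendstoD) (use e in simp)
  then obtain n where n: "(\<integral>x. indicator B x * \<bar>G n x - u x\<bar> \<partial>lborel) < e / 3" by (auto simp: eventually_sequentially)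
  define D where "D = (\<integral>\<^sup>+x. indicator B x * ennreal \<bar>G n x - u x\<bar> \<partial>lborel)"
  have D: "D \<le> ennreal (e / 3)"
  proof -
    have i: "integrable lborel (\<lambda>x. indicator B x * \<bar>G n x - u x\<bar>)"
    proof (rule Bochner_Integration.integrable_bound[OF Bi[of "2 * M"]])
      have "\<bar>G n x - u x\<bar> \<le> \<bar>2 * M\<bar>" for x using Gb[of n x] bd[of x] by linarith
      then show "AE x in lborel. norm (indicator B x * \<bar>G n x - u x\<bar>) \<le> norm (indicator B x * (2 * M))"
        by (auto simp: indicator_def)
    qed measurable
    have "D = (\<integral>\<^sup>+x. ennreal (indicator B x * \<bar>G n x - u x\<bar>) \<partial>lborel)"
      unfolding D_def by (intro nn_integral_cong) (auto simp: indicator_def)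
    also have "\<dots> = ennreal (\<integral>x. indicator B x * \<bar>G n x - u x\<bar> \<partial>lborel)" by (rule nn_integral_eq_integral[OF i]) auto
    finally show ?thesis using n by (auto intro: ennreal_leI)
  qed
  \<comment> \<open>One third of the error budget, spread over the volume \<open>a\<close> of
    \<open>B\<close>; the summand 1 covers the case \<open>a = 0\<close>.\<close>
  define e' where "e' = e / (3 * (1 + a))"
  have e': "e' > 0" using e a0 by (simp add: e'_def)
  have "uniformly_continuous_on B (G n)"
    by (rule compact_uniformly_continuous) (auto simp: B_def intro: continuous_on_subset[OF Gc])
  then obtain d where d: "d > 0" "\<And>x y. x \<in> B \<Longrightarrow> y \<in> B \<Longrightarrow> dist x y < d \<Longrightarrow> dist (G n x) (G n y) < e'"
    using e' unfolding uniformly_continuous_on_def by metis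
  have "(\<integral>\<^sup>+x\<in>A. ennreal \<bar>u (x + w) - u x\<bar> \<partial>lborel) \<le> ennreal e" if w: "norm w < min 1 d" for w
  proof -
    let ?q = "\<lambda>x. indicator B x * ennreal \<bar>G n x - u x\<bar>"
    have "(\<integral>\<^sup>+x\<in>A. ennreal \<bar>u (x + w) - u x\<bar> \<partial>lborel) \<le> (\<integral>\<^sup>+x. ?q (x + w) + ennreal e' * indicator B x + ?q x \<partial>lborel)"
    proof (rule nn_integral_mono)
      fix x
      show "ennreal \<bar>u (x + w) - u x\<bar> * indicator A x \<le> ?q (x + w) + ennreal e' * indicator B x + ?q x"
      proof (cases "x \<in> A")
        case True
        have nx: "norm x \<le> R" using True by (rule R)
        have "x \<in> B" using nx by (simp add: B_def)
        moreover have "x + w \<in> B" using nx w norm_triangle_ineq[of x w] by (simp add: B_def)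
        ultimately have "dist (G n (x + w)) (G n x) < e'" using w by (intro d(2)) (auto simp: dist_norm)
        then have "\<bar>u (x + w) - u x\<bar> \<le> \<bar>G n (x + w) - u (x + w)\<bar> + e' + \<bar>G n x - u x\<bar>" by (simp add: dist_real_def)
        then have "ennreal \<bar>u (x + w) - u x\<bar> \<le> ennreal (\<bar>G n (x + w) - u (x + w)\<bar> + e' + \<bar>G n x - u x\<bar>)" by (rule ennreal_leI)
        then show ?thesis using \<open>x \<in> B\<close> \<open>x + w \<in> B\<close> True e' by (simp add: ennreal_plus[symmetric] del: ennreal_plus)
      qed simp
    qed
    also have "\<dots> = (\<integral>\<^sup>+x. ?q (x + w) \<partial>lborel) + ennreal e' * emeasure lborel B + D"
      unfolding D_def by (simp add: nn_integral_add nn_integral_cmult)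
    also have "(\<integral>\<^sup>+x. ?q (x + w) \<partial>lborel) = D" unfolding D_def by (rule nn_integral_lborel_shift) measurable
    also have "D + ennreal e' * emeasure lborel B + D \<le> ennreal (e / 3) + ennreal (e / 3) + ennreal (e / 3)"
    proof (intro add_mono D)
      have "ennreal e' * emeasure lborel B = ennreal (e' * a)" unfolding a using e' by (simp add: ennreal_mult')
      also have "\<dots> \<le> ennreal (e / 3)" using e a0 by (intro ennreal_leI) (simp add: e'_def field_simps)
      finally show "ennreal e' * emeasure lborel B \<le> ennreal (e / 3)" .
    qed
    also have "\<dots> = ennreal e" using e by (simp add: ennreal_plus[symmetric] del: ennreal_plus)
    finally show ?thesis .
  qed
  then show ?thesis using d(1) by (intro exI[of _ "min 1 d"]) auto
qed

definition mollify :: "real \<Rightarrow> (real^'n::finite \<Rightarrow> real) \<Rightarrow> real^'n \<Rightarrow> real" where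
  "mollify e u x = (\<integral>y. u y * bump e (x - y) \<partial>lborel)"

text \<open>The type argument records the dimension, which \<open>e\<close> does not
  determine.\<close>

definition bump_mass :: "'n::finite itself \<Rightarrow> real \<Rightarrow> real" where
  "bump_mass _ e = (\<integral>z. bump e z \<partial>(lborel :: (real^'n) measure))"

lemma integrable_bump:
  assumes "0 < e" shows "integrable (lborel :: (real^'n::finite) measure) (bump e)"
proof (rule integrableI_bounded)
  show "(\<integral>\<^sup>+z. ennreal (norm (bump e z)) \<partial>(lborel :: (real^'n) measure)) < \<infinity>"
    using nn_integral_bump(2)[OF assms, where 'n = 'n] by (simp add: bump_bounds)
qed simp

lemma bump_mass:
  assumes "0 < e"
  shows "ennreal (bump_mass TYPE('n::finite) e) = (\<integral>\<^sup>+z. ennreal (bump e z) \<partial>(lborel :: (real^'n) measure))"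
    and "0 < bump_mass TYPE('n) e"
proof -
  show 1: "ennreal (bump_mass TYPE('n::finite) e) = (\<integral>\<^sup>+z. ennreal (bump e z) \<partial>(lborel :: (real^'n) measure))"
    unfolding bump_mass_def by (rule nn_integral_eq_integral[symmetric]) (use integrable_bump[OF assms] bump_bounds in auto)
  show "0 < bump_mass TYPE('n) e"
    using nn_integral_bump(1)[OF assms, where 'n = 'n] unfolding 1[symmetric] by simp
qed

text \<open>After normalisation, mollifying averages the translates \<open>u (x - w)\<close> with
  weight \<open>bump e w\<close>. By Tonelli the mean error is an average of translation errors,
  which are uniformly small.\<close>

lemma mollify_tendsto_L1:
  fixes u :: "real^'n::finite \<Rightarrow> real"
  assumes u[measurable]: "u \<in> borel_measurable borel" and bd: "\<And>x. \<bar>u x\<bar> \<le> M"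
    and A[measurable]: "A \<in> sets borel" and "bounded A" and \<eta>: "0 < \<eta>"
  shows "\<exists>d>0. \<forall>e. 0 < e \<and> e < d \<longrightarrow>
    (\<integral>\<^sup>+x\<in>A. ennreal \<bar>mollify e u x / bump_mass TYPE('n) e - u x\<bar> \<partial>lborel) \<le> ennreal \<eta>"
proof -
  obtain d where d: "d > 0" "\<And>w. norm w < d \<Longrightarrow> (\<integral>\<^sup>+x\<in>A. ennreal \<bar>u (x + w) - u x\<bar> \<partial>lborel) \<le> ennreal \<eta>"
    using translation_continuity_L1[OF u bd A \<open>bounded A\<close> \<eta>] by blast
  have "(\<integral>\<^sup>+x\<in>A. ennreal \<bar>mollify e u x / bump_mass TYPE('n) e - u x\<bar> \<partial>lborel) \<le> ennreal \<eta>"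
    \<comment> \<open>A vector in the cube of radius \<open>e\<close> has Euclidean norm at most
      \<open>CARD('n) * e\<close>, hence the division by the dimension.\<close>
    if e: "0 < e" "e < d / CARD('n)" for e
  proof -
    let ?c = "bump_mass TYPE('n) e"
    have c: "?c > 0" by (rule bump_mass(2)[OF e(1)])
    have pt: "ennreal \<bar>mollify e u x / ?c - u x\<bar> \<le> ennreal (1 / ?c) * (\<integral>\<^sup>+w. ennreal (\<bar>u (x + - w) - u x\<bar> * bump e w) \<partial>lborel)" for x
    proof -
      have ui: "integrable lborel (\<lambda>w. u (x - w) * bump e w)"
        by (rule Bochner_Integration.integrable_bound[OF integrable_mult_right[OF integrable_bump[OF e(1)], of M]])
           (use bd bump_bounds(1) in \<open>auto simp: abs_mult intro!: mult_mono order_trans[OF bd]\<close>)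
      have "mollify e u x = (\<integral>w. u (x - w) * bump e (x - (x - w)) \<partial>lborel)"
        unfolding mollify_def by (rule integral_lborel_reflect[symmetric]) measurable
      then have "mollify e u x - ?c * u x = (\<integral>w. u (x - w) * bump e w - bump e w * u x \<partial>lborel)"
        unfolding bump_mass_def using ui integrable_bump[OF e(1), where 'n = 'n]
        by (subst Bochner_Integration.integral_diff) auto
      also have "\<dots> = (\<integral>w. (u (x + - w) - u x) * bump e w \<partial>lborel)"
        by (intro Bochner_Integration.integral_cong) (auto simp: algebra_simps)
      finally have eq: "mollify e u x / ?c - u x = (1 / ?c) * (\<integral>w. (u (x + - w) - u x) * bump e w \<partial>lborel)"
        using c by (simp add: field_simps)
      have "\<bar>mollify e u x / ?c - u x\<bar> = (1 / ?c) * \<bar>\<integral>w. (u (x + - w) - u x) * bump e w \<partial>lborel\<bar>"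
        unfolding eq abs_mult using c by simp
      then have "ennreal \<bar>mollify e u x / ?c - u x\<bar> = ennreal (1 / ?c) * ennreal \<bar>\<integral>w. (u (x + - w) - u x) * bump e w \<partial>lborel\<bar>"
        using c by (simp only: ennreal_mult' divide_nonneg_pos zero_le_one)
      also have "\<dots> \<le> ennreal (1 / ?c) * (\<integral>\<^sup>+w. ennreal \<bar>(u (x + - w) - u x) * bump e w\<bar> \<partial>lborel)"
        by (intro mult_left_mono ennreal_abs_integral_le) auto
      finally show ?thesis by (simp add: abs_mult bump_bounds)
    qed
    have "(\<integral>\<^sup>+x\<in>A. ennreal \<bar>mollify e u x / ?c - u x\<bar> \<partial>lborel)
      \<le> (\<integral>\<^sup>+x. ennreal (1 / ?c) * (\<integral>\<^sup>+w. ennreal (\<bar>u (x + - w) - u x\<bar> * bump e w) * indicator A x \<partial>lborel) \<partial>lborel)"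
      using pt by (intro nn_integral_mono) (auto simp: indicator_def)
    also have "\<dots> = ennreal (1 / ?c) * (\<integral>\<^sup>+x. (\<integral>\<^sup>+w. ennreal (\<bar>u (x + - w) - u x\<bar> * bump e w) * indicator A x \<partial>lborel) \<partial>lborel)"
      by (rule nn_integral_cmult) measurable
    also have "(\<integral>\<^sup>+x. (\<integral>\<^sup>+w. ennreal (\<bar>u (x + - w) - u x\<bar> * bump e w) * indicator A x \<partial>lborel) \<partial>lborel)
       = (\<integral>\<^sup>+w. (\<integral>\<^sup>+x. ennreal (\<bar>u (x + - w) - u x\<bar> * bump e w) * indicator A x \<partial>lborel) \<partial>lborel)"
      by (rule lborel_pair.Fubini') measurable
    also have "\<dots> \<le> (\<integral>\<^sup>+w. ennreal \<eta> * ennreal (bump e w) \<partial>(lborel :: (real^'n) measure))"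
    proof (rule nn_integral_mono)
      fix w :: "real^'n"
      have "(\<integral>\<^sup>+x. ennreal (\<bar>u (x + - w) - u x\<bar> * bump e w) * indicator A x \<partial>lborel)
        = (\<integral>\<^sup>+x. ennreal (bump e w) * (ennreal \<bar>u (x + - w) - u x\<bar> * indicator A x) \<partial>lborel)"
        by (intro nn_integral_cong) (auto simp: ennreal_mult bump_bounds mult_ac)
      also have "\<dots> = ennreal (bump e w) * (\<integral>\<^sup>+x\<in>A. ennreal \<bar>u (x + - w) - u x\<bar> \<partial>lborel)"
        by (rule nn_integral_cmult) measurable
      also have "\<dots> \<le> ennreal (bump e w) * ennreal \<eta>"
      proof (cases "w \<in> cube 0 e")
        case True
        have "norm (- w) \<le> (\<Sum>i\<in>UNIV. \<bar>w $ i\<bar>)" using norm_le_l1_cart[of "- w"] by simp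
        also have "\<dots> \<le> (\<Sum>i\<in>(UNIV :: 'n set). e)" using True by (intro sum_mono) (auto simp: cube_def)
        also have "\<dots> < d" using e by (simp add: field_simps)
        finally show ?thesis by (intro mult_left_mono d(2)) auto
      next
        case False
        then show ?thesis by (simp add: bump_eq_0[OF e(1)])
      qed
      finally show "(\<integral>\<^sup>+x. ennreal (\<bar>u (x + - w) - u x\<bar> * bump e w) * indicator A x \<partial>lborel) \<le> ennreal \<eta> * ennreal (bump e w)"
        by (simp add: mult.commute)
    qed
    also have "(\<integral>\<^sup>+w. ennreal \<eta> * ennreal (bump e w) \<partial>(lborel :: (real^'n) measure)) = ennreal \<eta> * ennreal ?c"
      unfolding bump_mass(1)[OF e(1)] by (rule nn_integral_cmult) measurable
    also have "ennreal (1 / ?c) * (ennreal \<eta> * ennreal ?c) = ennreal \<eta>"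
      using c \<eta> by (simp add: ennreal_mult'[symmetric])
    finally show ?thesis by (simp add: mult_left_mono)
  qed
  then show ?thesis using d(1) by (intro exI[of _ "d / CARD('n)"]) auto
qed

lemma has_partial_at:
  assumes "has_partial f i D (x + \<tau> *\<^sub>R axis i 1)"
  shows "((\<lambda>\<sigma>. f (x + \<sigma> *\<^sub>R axis i 1)) has_real_derivative D) (at \<tau>)"
proof -
  have "((\<lambda>\<sigma>. f (x + (\<sigma> + \<tau>) *\<^sub>R axis i 1)) has_real_derivative D) (at 0)"
    using assms by (simp add: has_partial_def algebra_simps)
  then show ?thesis using DERIV_shift[of "\<lambda>\<sigma>. f (x + \<sigma> *\<^sub>R axis i 1)" D 0 \<tau>] by (simp add: add.commute)
qed

lemma integrable_bounded_support:
  fixes f :: "'a::euclidean_space \<Rightarrow> real"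
  assumes "f \<in> borel_measurable borel" "bounded S" "S \<in> sets borel" "\<And>x. x \<notin> S \<Longrightarrow> f x = 0" "\<And>x. \<bar>f x\<bar> \<le> B"
  shows "integrable lborel f"
proof (rule integrableI_bounded_set[where A = S and B = B])
  show "emeasure lborel S < \<infinity>" by (rule emeasure_bounded_finite[OF assms(2)])
qed (use assms in auto)

text \<open>The increment of the bump is the integral of its partial derivative along the segment.
  Once this is exchanged with the integration over \<open>y\<close>, each inner integral pairs
  \<open>\<phi>\<close> with the derivative of a reflected bump, that is, it tests the
  distributional derivative.\<close>

lemma mollify_increment:
  fixes \<phi> u :: "real^'n::finite \<Rightarrow> real"
  assumes \<phi>: "\<phi> \<in> BV_loc" and u[measurable]: "u \<in> borel_measurable borel" and bd: "\<And>x. \<bar>u x\<bar> \<le> M"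
    and ae: "AE x in lebesgue. \<phi> x = u x" and h: "0 \<le> h" and e: "0 < e"
  shows "ennreal \<bar>mollify e u (x + h *\<^sub>R axis i 1) - mollify e u x\<bar>
    \<le> (\<integral>\<^sup>+\<tau>\<in>{0..h}. 2 * (\<integral>\<^sup>+y. ennreal (bump e (x + \<tau> *\<^sub>R axis i 1 - y)) \<partial>gradient_variation \<phi>) \<partial>lborel)"
proof -
  have M: "M \<ge> 0" using bd[of 0] by linarith
  obtain g M' where gc: "continuous_on UNIV g" and g: "\<And>z. has_partial (bump e) i (g z) z" "\<And>z. z \<notin> cube 0 e \<Longrightarrow> g z = 0"
    "\<And>z. \<bar>g z\<bar> \<le> M'" using bump_partial[OF e] by blast
  have [measurable]: "g \<in> borel_measurable borel" by (rule borel_measurable_continuous_onI[OF gc])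
  have gC: "isCont g z" for z using gc by (simp add: continuous_on_eq_continuous_at)
  have M': "M' \<ge> 0" using g(3)[of 0] by linarith
  let ?a = "axis i 1 :: real^'n"
  have bi: "integrable lborel (\<lambda>y. u y * bump e (z - y))" for z
  proof (rule integrable_bounded_support[where S = "cube z e" and B = M])
    show "u y * bump e (z - y) = 0" if "y \<notin> cube z e" for y
    proof -
      have "z - y \<notin> cube 0 e" using that by (auto simp: cube_def abs_minus_commute)
      then show ?thesis by (simp add: bump_eq_0[OF e])
    qed
    show "(\<lambda>y. u y * bump e (z - y)) \<in> borel_measurable borel" by measurable
    show "bounded (cube z e)" "cube z e \<in> sets borel" by simp_all
    show "\<bar>u y * bump e (z - y)\<bar> \<le> M" for y
      unfolding abs_mult using mult_mono[OF bd[of y] bump_bounds(2)[of e "z - y"] M] bump_bounds(1)[of e "z - y"] by simp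
  qed
  have ftc: "bump e (x + h *\<^sub>R ?a - y) - bump e (x - y) = (\<integral>\<tau>. g (x - y + \<tau> *\<^sub>R ?a) * indicator {0..h} \<tau> \<partial>lborel)" for y
  proof -
    have "(\<integral>\<tau>. g (x - y + \<tau> *\<^sub>R ?a) * indicator {0..h} \<tau> \<partial>lborel) = bump e (x - y + h *\<^sub>R ?a) - bump e (x - y + 0 *\<^sub>R ?a)"
    proof (rule integral_FTC_Icc_real[OF h, where F = "\<lambda>\<tau>. bump e (x - y + \<tau> *\<^sub>R ?a)"])
      show "((\<lambda>\<tau>. bump e (x - y + \<tau> *\<^sub>R ?a)) has_real_derivative g (x - y + \<tau> *\<^sub>R ?a)) (at \<tau>)" for \<tau>
        by (rule has_partial_at[OF g(1)])
      show "isCont (\<lambda>\<tau>. g (x - y + \<tau> *\<^sub>R ?a)) \<tau>" for \<tau>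
        by (rule isCont_o2[OF _ gC]) (intro continuous_intros)
    qed
    then show ?thesis by (simp add: algebra_simps)
  qed
  define F where "F = (\<lambda>(y, \<tau>). u y * (g (x - y + \<tau> *\<^sub>R ?a) * indicator {0..h} \<tau>))"
  have [measurable]: "F \<in> borel_measurable (lborel \<Otimes>\<^sub>M lborel)" unfolding F_def by measurable
  \<comment> \<open>Shifting by at most \<open>h\<close> along one axis enlarges the support of the
    bump derivative to the cube of radius \<open>e + h\<close>; bounded support and boundedness give
    integrability.\<close>
  have F0: "F p = 0" if p: "p \<notin> cube x (e + h) \<times> {0..h}" for p
  proof -
    obtain y \<tau> where yt: "p = (y, \<tau>)" by force
    show ?thesis
    proof (cases "\<tau> \<in> {0..h}")
      case True
      then obtain j where j: "\<not> \<bar>y $ j - x $ j\<bar> \<le> e + h" using p yt by (auto simp: cube_def)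
      have "\<bar>(\<tau> *\<^sub>R ?a) $ j\<bar> \<le> h" using True h by (auto simp: axis_def)
      moreover have "(x - y + \<tau> *\<^sub>R ?a) $ j = x $ j - y $ j + (\<tau> *\<^sub>R ?a) $ j" by simp
      ultimately have "\<not> \<bar>(x - y + \<tau> *\<^sub>R ?a) $ j\<bar> \<le> e" using j by linarith
      then have "x - y + \<tau> *\<^sub>R ?a \<notin> cube 0 e" unfolding cube_def by force
      then show ?thesis by (simp add: F_def yt g(2))
    qed (simp add: F_def yt)
  qed
  have Fb: "\<bar>F p\<bar> \<le> M * M'" for p
  proof -
    obtain y \<tau> where yt: "p = (y, \<tau>)" by force
    have "\<bar>u y\<bar> * \<bar>g (x - y + \<tau> *\<^sub>R ?a)\<bar> \<le> M * M'" by (rule mult_mono[OF bd g(3) M]) simp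
    then show ?thesis using M M' by (auto simp: F_def yt abs_mult indicator_def)
  qed
  have Fi: "integrable (lborel \<Otimes>\<^sub>M lborel) F"
    unfolding lborel_prod
  proof (rule integrable_bounded_support)
    show "F \<in> borel_measurable borel"
      using \<open>F \<in> borel_measurable (lborel \<Otimes>\<^sub>M lborel)\<close> by (simp add: lborel_prod)
    show "bounded (cube x (e + h) \<times> {0..h})" by (intro bounded_Times) simp_all
    show "cube x (e + h) \<times> {0..h} \<in> sets borel" by (intro borel_closed closed_Times) simp_all
  qed (rule F0 Fb, assumption?)+
  \<comment> \<open>Reflection makes the partial derivative of the test function equal to
    \<open>- g (z - y)\<close>; the sign disappears in the absolute value, and \<open>u\<close> may
    replace \<open>\<phi>\<close> since they agree a.e.\<close>
  have Db: "ennreal \<bar>\<integral>y. u y * g (z - y) \<partial>lborel\<bar> \<le> 2 * (\<integral>\<^sup>+y. ennreal (bump e (z - y)) \<partial>gradient_variation \<phi>)" for z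
  proof -
    have p: "partial i (\<lambda>y. bump e (z - y)) y = - g (z - y)" for y
    proof (rule has_partial_imp_partial)
      have "((\<lambda>\<sigma>. bump e (z - y + \<sigma> *\<^sub>R ?a)) has_real_derivative g (z - y)) (at (- 0))"
        using g(1)[of "z - y"] by (simp add: has_partial_def)
      then have "((\<lambda>\<sigma>. bump e (z - y + (- \<sigma>) *\<^sub>R ?a)) has_real_derivative - g (z - y)) (at 0)"
        using DERIV_mirror[of "\<lambda>\<sigma>. bump e (z - y + \<sigma> *\<^sub>R ?a)" "g (z - y)" "0::real"] by simp
      then show "has_partial (\<lambda>y. bump e (z - y)) i (- g (z - y)) y" by (simp add: has_partial_def algebra_simps)
    qed
    have mu: "(\<lambda>y. u y * - g (z - y)) \<in> borel_measurable lebesgue" by (intro measurable_completion) measurable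
    have "(LINT y|lebesgue. \<phi> y * partial i (\<lambda>y. bump e (z - y)) y) = (LINT y|lebesgue. u y * - g (z - y))"
      unfolding p
    proof (rule integral_cong_AE[OF borel_measurable_AE[OF mu] mu])
      show "AE y in lebesgue. u y * - g (z - y) = \<phi> y * - g (z - y)" using ae by eventually_elim simp
      show "AE y in lebesgue. \<phi> y * - g (z - y) = u y * - g (z - y)" using ae by eventually_elim simp
    qed
    also have "\<dots> = (\<integral>y. u y * - g (z - y) \<partial>lborel)" by (rule integral_completion) measurable
    finally have "\<bar>LINT y|lebesgue. \<phi> y * partial i (\<lambda>y. bump e (z - y)) y\<bar> = \<bar>\<integral>y. u y * g (z - y) \<partial>lborel\<bar>" by simp
    then show ?thesis
      using integral_partial_le_gradient_variation[OF \<phi> test_function_bump_reflect[OF e, of z], of i]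
      by (simp add: bump_bounds)
  qed
  have "mollify e u (x + h *\<^sub>R ?a) - mollify e u x = (\<integral>y. u y * bump e (x + h *\<^sub>R ?a - y) - u y * bump e (x - y) \<partial>lborel)"
    unfolding mollify_def by (rule Bochner_Integration.integral_diff[symmetric]) (rule bi)+
  also have "\<dots> = (\<integral>y. (\<integral>\<tau>. F (y, \<tau>) \<partial>lborel) \<partial>lborel)"
  proof (rule Bochner_Integration.integral_cong[OF refl])
    fix y
    have "u y * bump e (x + h *\<^sub>R ?a - y) - u y * bump e (x - y) = u y * (\<integral>\<tau>. g (x - y + \<tau> *\<^sub>R ?a) * indicator {0..h} \<tau> \<partial>lborel)"
      by (simp add: right_diff_distrib[symmetric] ftc)
    then show "u y * bump e (x + h *\<^sub>R ?a - y) - u y * bump e (x - y) = (\<integral>\<tau>. F (y, \<tau>) \<partial>lborel)"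
      by (simp add: F_def)
  qed
  also have "\<dots> = (\<integral>\<tau>. (\<integral>y. F (y, \<tau>) \<partial>lborel) \<partial>lborel)"
    using lborel_pair.integral_snd[of "curry F"] Fi lborel_pair.integral_fst'[OF Fi] by simp
  finally have eq: "mollify e u (x + h *\<^sub>R ?a) - mollify e u x = (\<integral>\<tau>. (\<integral>y. F (y, \<tau>) \<partial>lborel) \<partial>lborel)" .
  have "ennreal \<bar>mollify e u (x + h *\<^sub>R ?a) - mollify e u x\<bar> \<le> (\<integral>\<^sup>+\<tau>. ennreal \<bar>\<integral>y. F (y, \<tau>) \<partial>lborel\<bar> \<partial>lborel)"
    unfolding eq by (rule ennreal_abs_integral_le)
  also have "\<dots> \<le> (\<integral>\<^sup>+\<tau>\<in>{0..h}. 2 * (\<integral>\<^sup>+y. ennreal (bump e (x + \<tau> *\<^sub>R ?a - y)) \<partial>gradient_variation \<phi>) \<partial>lborel)"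
  proof (rule nn_integral_mono)
    fix \<tau> :: real
    show "ennreal \<bar>\<integral>y. F (y, \<tau>) \<partial>lborel\<bar> \<le> 2 * (\<integral>\<^sup>+y. ennreal (bump e (x + \<tau> *\<^sub>R ?a - y)) \<partial>gradient_variation \<phi>) * indicator {0..h} \<tau>"
    proof (cases "\<tau> \<in> {0..h}")
      case True
      have "(\<integral>y. F (y, \<tau>) \<partial>lborel) = (\<integral>y. u y * g (x + \<tau> *\<^sub>R ?a - y) \<partial>lborel)"
        using True by (simp add: F_def algebra_simps)
      then show ?thesis using Db[of "x + \<tau> *\<^sub>R ?a"] True by simp
    qed (simp add: F_def)
  qed
  finally show ?thesis .
qed

text \<open>Integrating the increment bound over \<open>A\<close>, Tonelli gives each point
  \<open>y\<close> at most the total bump mass, for each of the \<open>\<tau>\<close> between 0 and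
  \<open>h\<close>, and nothing unless \<open>y\<close> lies in \<open>W\<close>.\<close>

lemma mollify_translation:
  fixes \<phi> u :: "real^'n::finite \<Rightarrow> real"
  assumes \<phi>: "\<phi> \<in> BV_loc" and u[measurable]: "u \<in> borel_measurable borel" and bd: "\<And>x. \<bar>u x\<bar> \<le> M"
    and ae: "AE x in lebesgue. \<phi> x = u x" and h: "0 \<le> h" and e: "0 < e"
    and sf: "sigma_finite_measure (gradient_variation \<phi>)"
    and A[measurable]: "A \<in> sets borel" and W[measurable]: "W \<in> sets borel"
    and AW: "\<And>x \<tau> y. x \<in> A \<Longrightarrow> 0 \<le> \<tau> \<Longrightarrow> \<tau> \<le> h \<Longrightarrow> x + \<tau> *\<^sub>R axis i 1 - y \<in> cube 0 e \<Longrightarrow> y \<in> W"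
  shows "(\<integral>\<^sup>+x\<in>A. ennreal \<bar>mollify e u (x + h *\<^sub>R axis i 1) - mollify e u x\<bar> \<partial>lborel)
    \<le> ennreal (2 * h * bump_mass TYPE('n) e) * emeasure (gradient_variation \<phi>) W"
proof -
  let ?a = "axis i 1 :: real^'n" and ?\<nu> = "gradient_variation \<phi>"
  interpret \<nu>: sigma_finite_measure ?\<nu> by (rule sf)
  interpret L\<nu>: pair_sigma_finite "lborel :: (real^'n) measure" ?\<nu> by standard
  let ?c = "bump_mass TYPE('n) e"
  have c: "?c > 0" by (rule bump_mass(2)[OF e])
  have "(\<integral>\<^sup>+x\<in>A. ennreal \<bar>mollify e u (x + h *\<^sub>R ?a) - mollify e u x\<bar> \<partial>lborel)
    \<le> (\<integral>\<^sup>+x. (\<integral>\<^sup>+\<tau>. 2 * ((\<integral>\<^sup>+y. ennreal (bump e (x + \<tau> *\<^sub>R ?a - y)) * indicator A x \<partial>?\<nu>) * indicator {0..h} \<tau>) \<partial>lborel) \<partial>lborel)"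
  proof (rule nn_integral_mono)
    fix x
    show "ennreal \<bar>mollify e u (x + h *\<^sub>R ?a) - mollify e u x\<bar> * indicator A x
      \<le> (\<integral>\<^sup>+\<tau>. 2 * ((\<integral>\<^sup>+y. ennreal (bump e (x + \<tau> *\<^sub>R ?a - y)) * indicator A x \<partial>?\<nu>) * indicator {0..h} \<tau>) \<partial>lborel)"
      using mollify_increment[OF \<phi> u bd ae h e, of x i] by (cases "x \<in> A") (auto simp: mult.assoc)
  qed
  also have "\<dots> = (\<integral>\<^sup>+\<tau>. (\<integral>\<^sup>+x. 2 * ((\<integral>\<^sup>+y. ennreal (bump e (x + \<tau> *\<^sub>R ?a - y)) * indicator A x \<partial>?\<nu>) * indicator {0..h} \<tau>) \<partial>lborel) \<partial>lborel)"
    by (rule lborel_pair.Fubini') measurable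
  also have "\<dots> \<le> (\<integral>\<^sup>+\<tau>. 2 * (ennreal ?c * emeasure ?\<nu> W) * indicator {0..h} \<tau> \<partial>lborel)"
  proof (rule nn_integral_mono)
    fix \<tau> :: real
    show "(\<integral>\<^sup>+x. 2 * ((\<integral>\<^sup>+y. ennreal (bump e (x + \<tau> *\<^sub>R ?a - y)) * indicator A x \<partial>?\<nu>) * indicator {0..h} \<tau>) \<partial>lborel)
      \<le> 2 * (ennreal ?c * emeasure ?\<nu> W) * indicator {0..h} \<tau>"
    proof (cases "\<tau> \<in> {0..h}")
      case True
      have "(\<integral>\<^sup>+x. 2 * ((\<integral>\<^sup>+y. ennreal (bump e (x + \<tau> *\<^sub>R ?a - y)) * indicator A x \<partial>?\<nu>) * indicator {0..h} \<tau>) \<partial>lborel)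
         = 2 * (\<integral>\<^sup>+x. (\<integral>\<^sup>+y. ennreal (bump e (x + \<tau> *\<^sub>R ?a - y)) * indicator A x \<partial>?\<nu>) \<partial>lborel)"
        using True by (simp add: nn_integral_cmult)
      also have "(\<integral>\<^sup>+x. (\<integral>\<^sup>+y. ennreal (bump e (x + \<tau> *\<^sub>R ?a - y)) * indicator A x \<partial>?\<nu>) \<partial>lborel)
         = (\<integral>\<^sup>+y. (\<integral>\<^sup>+x. ennreal (bump e (x + \<tau> *\<^sub>R ?a - y)) * indicator A x \<partial>lborel) \<partial>?\<nu>)"
        by (rule L\<nu>.Fubini'[symmetric]) measurable
      also have "\<dots> \<le> (\<integral>\<^sup>+y. ennreal ?c * indicator W y \<partial>?\<nu>)"
      proof (rule nn_integral_mono)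
        fix y
        show "(\<integral>\<^sup>+x. ennreal (bump e (x + \<tau> *\<^sub>R ?a - y)) * indicator A x \<partial>lborel) \<le> ennreal ?c * indicator W y"
        proof (cases "y \<in> W")
          case yW: True
          have "(\<integral>\<^sup>+x. ennreal (bump e (x + \<tau> *\<^sub>R ?a - y)) * indicator A x \<partial>lborel) \<le> (\<integral>\<^sup>+x. ennreal (bump e (x + (\<tau> *\<^sub>R ?a - y))) \<partial>lborel)"
            by (intro nn_integral_mono) (auto simp: indicator_def algebra_simps)
          also have "\<dots> = ennreal ?c" unfolding bump_mass(1)[OF e] by (rule nn_integral_lborel_shift) measurable
          finally show ?thesis using yW by simp
        next
          case False
          have z: "ennreal (bump e (x + \<tau> *\<^sub>R ?a - y)) * indicator A x = 0" for x
          proof (cases "x \<in> A")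
            case xA: True
            have "x + \<tau> *\<^sub>R ?a - y \<notin> cube 0 e" using AW[OF xA, of \<tau> y] True False by auto
            then show ?thesis by (simp add: bump_eq_0[OF e])
          qed simp
          have "(\<integral>\<^sup>+x. ennreal (bump e (x + \<tau> *\<^sub>R ?a - y)) * indicator A x \<partial>lborel) = 0"
            unfolding z by simp
          then show ?thesis by simp
        qed
      qed
      also have "\<dots> = ennreal ?c * emeasure ?\<nu> W" by (simp add: nn_integral_cmult)
      finally show ?thesis using True by (simp add: mult_left_mono)
    qed simp
  qed
  also have "\<dots> = 2 * (ennreal ?c * emeasure ?\<nu> W) * ennreal h"
    using h by (subst nn_integral_cmult) auto
  also have "\<dots> = ennreal (2 * h * ?c) * emeasure ?\<nu> W"
    using h c by (simp add: ennreal_mult mult_ac)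
  finally show ?thesis .
qed

text \<open>Dividing the estimate for mollifications by the bump mass removes all dependence on
  \<open>e\<close> except an error that can be made smaller than any \<open>\<eta>\<close>. The
  variation is taken over the doubled cube because the bump spreads beyond the cube of radius
  \<open>r\<close>.\<close>

lemma BV_translation:
  fixes \<phi> u :: "real^'n::finite \<Rightarrow> real"
  assumes \<phi>: "\<phi> \<in> BV_loc" and u[measurable]: "u \<in> borel_measurable borel" and bd: "\<And>x. \<bar>u x\<bar> \<le> M"
    and ae: "AE x in lebesgue. \<phi> x = u x"
    and sf: "sigma_finite_measure (gradient_variation \<phi>)" and r: "0 < r"
  shows "(\<integral>\<^sup>+v\<in>{v. v \<in> cube x r \<and> v + h *\<^sub>R axis i 1 \<in> cube x r}. ennreal \<bar>u (v + h *\<^sub>R axis i 1) - u v\<bar> \<partial>lborel)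
    \<le> ennreal (2 * \<bar>h\<bar>) * emeasure (gradient_variation \<phi>) (cube x (2 * r))"
proof -
  let ?a = "axis i 1 :: real^'n" and ?\<nu> = "gradient_variation \<phi>"
  have pos: "(\<integral>\<^sup>+v\<in>{v. v \<in> cube x r \<and> v + h *\<^sub>R ?a \<in> cube x r}. ennreal \<bar>u (v + h *\<^sub>R ?a) - u v\<bar> \<partial>lborel)
    \<le> ennreal (2 * h) * emeasure ?\<nu> (cube x (2 * r))" if h: "0 \<le> h" for h
  proof (rule ennreal_le_epsilon)
    fix \<eta> :: real assume \<eta>: "0 < \<eta>"
    let ?A = "{v. v \<in> cube x r \<and> v + h *\<^sub>R ?a \<in> cube x r}"
    have A[measurable]: "?A \<in> sets borel" 
    proof (rule borel_closed)
      have "closed (cube x r \<inter> (\<lambda>v. v + h *\<^sub>R ?a) -` cube x r)"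
        by (intro closed_Int closed_cube continuous_closed_vimage) (auto intro!: continuous_intros)
      then show "closed ?A" by (simp add: Int_def)
    qed
    obtain d where d: "d > 0" "\<And>e. 0 < e \<Longrightarrow> e < d \<Longrightarrow>
        (\<integral>\<^sup>+x\<in>cube x r. ennreal \<bar>mollify e u x / bump_mass TYPE('n) e - u x\<bar> \<partial>lborel) \<le> ennreal (\<eta> / 2)"
      using mollify_tendsto_L1[OF u bd cube_borel bounded_cube, of "\<eta> / 2" x r] \<eta> by auto
    \<comment> \<open>\<open>e < d\<close> makes the mollification error small, and
      \<open>e \<le> r\<close> keeps the spread of the bump inside the doubled cube.\<close>
    define e where "e = min (d / 2) r"
    have e: "0 < e" "e < d" "e \<le> r" using d(1) r by (auto simp: e_def)
    let ?c = "bump_mass TYPE('n) e"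
    have c: "?c > 0" by (rule bump_mass(2)[OF e(1)])
    have [measurable]: "mollify e u \<in> borel_measurable borel" unfolding mollify_def[abs_def] by measurable
    let ?q = "\<lambda>v. ennreal \<bar>mollify e u v / ?c - u v\<bar> * indicator (cube x r) v"
    have q: "(\<integral>\<^sup>+v. ?q v \<partial>lborel) \<le> ennreal (\<eta> / 2)" using d(2)[OF e(1,2)] by simp
    have "(\<integral>\<^sup>+v\<in>?A. ennreal \<bar>u (v + h *\<^sub>R ?a) - u v\<bar> \<partial>lborel)
      \<le> (\<integral>\<^sup>+v. ?q (v + h *\<^sub>R ?a) + ennreal (1 / ?c) * (ennreal \<bar>mollify e u (v + h *\<^sub>R ?a) - mollify e u v\<bar> * indicator ?A v) + ?q v \<partial>lborel)"
    proof (rule nn_integral_mono)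
      fix v
      show "ennreal \<bar>u (v + h *\<^sub>R ?a) - u v\<bar> * indicator ?A v
        \<le> ?q (v + h *\<^sub>R ?a) + ennreal (1 / ?c) * (ennreal \<bar>mollify e u (v + h *\<^sub>R ?a) - mollify e u v\<bar> * indicator ?A v) + ?q v"
      proof (cases "v \<in> ?A")
        case True
        let ?m = "mollify e u"
        have "\<bar>u (v + h *\<^sub>R ?a) - u v\<bar> \<le> \<bar>?m (v + h *\<^sub>R ?a) / ?c - u (v + h *\<^sub>R ?a)\<bar> + \<bar>?m (v + h *\<^sub>R ?a) / ?c - ?m v / ?c\<bar> + \<bar>?m v / ?c - u v\<bar>"
          by linarith
        also have "\<bar>?m (v + h *\<^sub>R ?a) / ?c - ?m v / ?c\<bar> = 1 / ?c * \<bar>?m (v + h *\<^sub>R ?a) - ?m v\<bar>"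
          using c by (simp add: diff_divide_distrib[symmetric])
        finally have "ennreal \<bar>u (v + h *\<^sub>R ?a) - u v\<bar> \<le> ennreal (\<bar>?m (v + h *\<^sub>R ?a) / ?c - u (v + h *\<^sub>R ?a)\<bar> + 1 / ?c * \<bar>?m (v + h *\<^sub>R ?a) - ?m v\<bar> + \<bar>?m v / ?c - u v\<bar>)"
          by (rule ennreal_leI)
        also have "\<dots> = ennreal \<bar>?m (v + h *\<^sub>R ?a) / ?c - u (v + h *\<^sub>R ?a)\<bar> + ennreal (1 / ?c) * ennreal \<bar>?m (v + h *\<^sub>R ?a) - ?m v\<bar> + ennreal \<bar>?m v / ?c - u v\<bar>"
          using c by (simp add: ennreal_mult'[symmetric])
        finally show ?thesis using True by simp
      qed simp
    qed
    also have "\<dots> = (\<integral>\<^sup>+v. ?q (v + h *\<^sub>R ?a) \<partial>lborel)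
        + ennreal (1 / ?c) * (\<integral>\<^sup>+v\<in>?A. ennreal \<bar>mollify e u (v + h *\<^sub>R ?a) - mollify e u v\<bar> \<partial>lborel) + (\<integral>\<^sup>+v. ?q v \<partial>lborel)"
      by (subst nn_integral_add, measurable, subst nn_integral_add, measurable, subst nn_integral_cmult, measurable)
    also have "(\<integral>\<^sup>+v. ?q (v + h *\<^sub>R ?a) \<partial>lborel) = (\<integral>\<^sup>+v. ?q v \<partial>lborel)" by (rule nn_integral_lborel_shift) measurable
    also have "(\<integral>\<^sup>+v. ?q v \<partial>lborel) + ennreal (1 / ?c) * (\<integral>\<^sup>+v\<in>?A. ennreal \<bar>mollify e u (v + h *\<^sub>R ?a) - mollify e u v\<bar> \<partial>lborel) + (\<integral>\<^sup>+v. ?q v \<partial>lborel)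
       \<le> ennreal (\<eta> / 2) + ennreal (1 / ?c) * (ennreal (2 * h * ?c) * emeasure ?\<nu> (cube x (2 * r))) + ennreal (\<eta> / 2)"
    proof (intro add_mono q mult_left_mono mollify_translation[OF \<phi> u bd ae h e(1) sf A])
      fix w \<tau> y assume w: "w \<in> ?A" "0 \<le> \<tau>" "\<tau> \<le> h" "w + \<tau> *\<^sub>R ?a - y \<in> cube 0 e"
      show "y \<in> cube x (2 * r)"
        unfolding cube_def
      proof (intro CollectI allI)
        fix j
        have 1: "\<bar>w $ j - x $ j\<bar> \<le> r" "\<bar>(w + h *\<^sub>R ?a) $ j - x $ j\<bar> \<le> r" "\<bar>(w + \<tau> *\<^sub>R ?a - y) $ j - 0 $ j\<bar> \<le> e"
          using w by (auto simp: cube_def)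
        show "\<bar>y $ j - x $ j\<bar> \<le> 2 * r"
        proof (cases "j = i")
          case True
          then have eq: "(w + h *\<^sub>R ?a) $ j = w $ j + h" "(w + \<tau> *\<^sub>R ?a - y) $ j = w $ j + \<tau> - y $ j" by (simp_all add: axis_def)
          have "\<bar>w $ j + h - x $ j\<bar> \<le> r" "\<bar>w $ j + \<tau> - y $ j\<bar> \<le> e" using 1(2,3) unfolding eq by (simp_all only: zero_index diff_0_right)
          then show ?thesis using 1(1) w(2,3) e(3) by linarith
        next
          case False
          then have eq: "(w + \<tau> *\<^sub>R ?a - y) $ j = w $ j - y $ j" by (simp add: axis_def)
          have "\<bar>w $ j - y $ j\<bar> \<le> e" using 1(3) unfolding eq by (simp only: zero_index diff_0_right)
          then show ?thesis using 1(1) e(3) by linarith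
        qed
      qed
    qed simp_all
    also have "\<dots> = ennreal (2 * h) * emeasure ?\<nu> (cube x (2 * r)) + ennreal \<eta>"
    proof -
      have "ennreal (1 / ?c) * (ennreal (2 * h * ?c) * emeasure ?\<nu> (cube x (2 * r))) = ennreal (2 * h) * emeasure ?\<nu> (cube x (2 * r))"
        using c h by (simp add: mult.assoc[symmetric] ennreal_mult'[symmetric])
      moreover have "ennreal \<eta> = ennreal (\<eta> / 2) + ennreal (\<eta> / 2)" using \<eta> by (simp add: ennreal_plus[symmetric] del: ennreal_plus)
      ultimately show ?thesis by (simp add: ac_simps)
    qed
    finally show "(\<integral>\<^sup>+v\<in>?A. ennreal \<bar>u (v + h *\<^sub>R ?a) - u v\<bar> \<partial>lborel) \<le> ennreal (2 * h) * emeasure ?\<nu> (cube x (2 * r)) + ennreal \<eta>" .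
  qed
  show ?thesis
  proof (cases "0 \<le> h")
    \<comment> \<open>A negative step is reversed by the substitution that renames
      \<open>v + h *\<^sub>R axis i 1\<close> as \<open>v\<close>; the condition on the pair of
      points is symmetric.\<close>
    case False
    let ?f = "\<lambda>v. ennreal \<bar>u (v + h *\<^sub>R ?a) - u v\<bar> * indicator {v. v \<in> cube x r \<and> v + h *\<^sub>R ?a \<in> cube x r} v"
    have "(\<integral>\<^sup>+v. ?f v \<partial>lborel) = (\<integral>\<^sup>+v. ?f (v + (- h) *\<^sub>R ?a) \<partial>lborel)"
      by (rule nn_integral_lborel_shift[symmetric]) measurable
    also have "\<dots> = (\<integral>\<^sup>+v\<in>{v. v \<in> cube x r \<and> v + (- h) *\<^sub>R ?a \<in> cube x r}. ennreal \<bar>u (v + (- h) *\<^sub>R ?a) - u v\<bar> \<partial>lborel)"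
      by (intro nn_integral_cong) (auto simp: indicator_def abs_minus_commute)
    also have "\<dots> \<le> ennreal (2 * (- h)) * emeasure ?\<nu> (cube x (2 * r))" using False by (intro pos) simp
    finally show ?thesis using False by simp
  qed (use pos in simp)
qed

section \<open>Campanato estimates\<close>

text \<open>The translation by \<open>w\<close> is performed one coordinate at a time,
  \<open>W J\<close> being the part already done. Each coordinate of \<open>v + W J\<close> is one
  of \<open>v\<close> or of \<open>v + w\<close>, so the intermediate points stay in the cube, and
  shifting back by \<open>W J\<close> reduces each step to \<open>H\<close>.\<close>

lemma nn_integral_translation_le:
  fixes u :: "real^'n::finite \<Rightarrow> real" and r B :: real
  assumes u[measurable]: "u \<in> borel_measurable borel" and B: "0 \<le> B"
    and H: "\<And>i h. (\<integral>\<^sup>+v\<in>{v. v \<in> cube x r \<and> v + h *\<^sub>R axis i 1 \<in> cube x r}. ennreal \<bar>u (v + h *\<^sub>R axis i 1) - u v\<bar> \<partial>lborel)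
      \<le> ennreal (\<bar>h\<bar> * B)"
  shows "(\<integral>\<^sup>+v\<in>{v. v \<in> cube x r \<and> v + w \<in> cube x r}. ennreal \<bar>u (v + w) - u v\<bar> \<partial>lborel)
      \<le> ennreal ((\<Sum>i\<in>UNIV. \<bar>w $ i\<bar>) * B)"
proof -
  define W where "W J = (\<chi> i. if i \<in> J then w $ i else 0)" for J
  have S[measurable]: "{v. v \<in> cube x r \<and> v + c \<in> cube x r} \<in> sets borel" for c
  proof (rule borel_closed)
    have "closed (cube x r \<inter> (\<lambda>v. v + c) -` cube x r)"
      by (intro closed_Int closed_cube continuous_closed_vimage) (auto intro!: continuous_intros)
    then show "closed {v. v \<in> cube x r \<and> v + c \<in> cube x r}" by (simp add: Int_def)
  qed
  have main: "(\<integral>\<^sup>+v\<in>{v. v \<in> cube x r \<and> v + W J \<in> cube x r}. ennreal \<bar>u (v + W J) - u v\<bar> \<partial>lborel)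
      \<le> ennreal ((\<Sum>i\<in>J. \<bar>w $ i\<bar>) * B)" if "finite J" for J
    using that
  proof (induction J rule: finite_induct)
    case empty
    have "W {} = 0" by (simp add: W_def vec_eq_iff)
    then show ?case by simp
  next
    case (insert j J)
    let ?c = "(w $ j) *\<^sub>R axis j 1 :: real^'n"
    have Wi: "W (insert j J) = W J + ?c" using insert(2) by (auto simp: W_def vec_eq_iff axis_def)
    let ?f = "\<lambda>v. ennreal \<bar>u (v + ?c) - u v\<bar> * indicator {v. v \<in> cube x r \<and> v + ?c \<in> cube x r} v"
    let ?g = "\<lambda>v. ennreal \<bar>u (v + W J) - u v\<bar> * indicator {v. v \<in> cube x r \<and> v + W J \<in> cube x r} v"
    have "(\<integral>\<^sup>+v\<in>{v. v \<in> cube x r \<and> v + W (insert j J) \<in> cube x r}. ennreal \<bar>u (v + W (insert j J)) - u v\<bar> \<partial>lborel)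
      \<le> (\<integral>\<^sup>+v. ?f (v + W J) + ?g v \<partial>lborel)"
    proof (rule nn_integral_mono)
      fix v
      show "ennreal \<bar>u (v + W (insert j J)) - u v\<bar> * indicator {v. v \<in> cube x r \<and> v + W (insert j J) \<in> cube x r} v \<le> ?f (v + W J) + ?g v"
      proof (cases "v \<in> cube x r \<and> v + W (insert j J) \<in> cube x r")
        case True
        have "v + W J \<in> cube x r"
          unfolding cube_def
        proof (intro CollectI allI)
          fix i
          show "\<bar>(v + W J) $ i - x $ i\<bar> \<le> r"
          proof (cases "i \<in> J")
            case iJ: True
            then have "(v + W J) $ i = (v + W (insert j J)) $ i" by (simp add: W_def)
            then show ?thesis using True unfolding cube_def by simp
          next
            case False
            then have "(v + W J) $ i = v $ i" by (simp add: W_def)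
            then show ?thesis using True unfolding cube_def by simp
          qed
        qed
        moreover have "ennreal \<bar>u (v + W J + ?c) - u v\<bar> \<le> ennreal (\<bar>u (v + W J + ?c) - u (v + W J)\<bar> + \<bar>u (v + W J) - u v\<bar>)"
          by (intro ennreal_leI) linarith
        ultimately show ?thesis using True by (simp add: Wi add.assoc)
      qed simp
    qed
    also have "\<dots> = (\<integral>\<^sup>+v. ?f (v + W J) \<partial>lborel) + (\<integral>\<^sup>+v. ?g v \<partial>lborel)" by (rule nn_integral_add) measurable
    also have "(\<integral>\<^sup>+v. ?f (v + W J) \<partial>lborel) = (\<integral>\<^sup>+v. ?f v \<partial>lborel)" by (rule nn_integral_lborel_shift) measurable
    also have "(\<integral>\<^sup>+v. ?f v \<partial>lborel) + (\<integral>\<^sup>+v. ?g v \<partial>lborel) \<le> ennreal (\<bar>w $ j\<bar> * B) + ennreal ((\<Sum>i\<in>J. \<bar>w $ i\<bar>) * B)"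
      by (intro add_mono H insert.IH)
    also have "\<dots> = ennreal ((\<Sum>i\<in>insert j J. \<bar>w $ i\<bar>) * B)"
      using insert B by (subst ennreal_plus[symmetric]) (auto simp: algebra_simps intro!: sum_nonneg mult_nonneg_nonneg)
    finally show ?case .
  qed
  have "W UNIV = w" by (simp add: W_def vec_eq_iff)
  then show ?thesis using main[of UNIV] by simp
qed

text \<open>Setting \<open>v' = w + v\<close> and integrating over \<open>v\<close> first leaves a
  translation estimate for each difference \<open>w\<close>. These differences fill the cube of
  radius \<open>2 * r\<close>, whose volume is the power of \<open>4 * r\<close>.\<close>

lemma poincare_cube:
  fixes u :: "real^'n::finite \<Rightarrow> real" and r B :: real
  assumes u[measurable]: "u \<in> borel_measurable borel" and B: "0 \<le> B" and r: "0 \<le> r"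
    and H: "\<And>i h. (\<integral>\<^sup>+v\<in>{v. v \<in> cube x r \<and> v + h *\<^sub>R axis i 1 \<in> cube x r}. ennreal \<bar>u (v + h *\<^sub>R axis i 1) - u v\<bar> \<partial>lborel)
      \<le> ennreal (\<bar>h\<bar> * B)"
  shows "(\<integral>\<^sup>+v\<in>cube x r. (\<integral>\<^sup>+v'\<in>cube x r. ennreal \<bar>u v' - u v\<bar> \<partial>lborel) \<partial>lborel)
    \<le> ennreal ((4 * r) ^ CARD('n) * (CARD('n) * (2 * r) * B))"
proof -
  let ?f = "\<lambda>v w. ennreal \<bar>u (w + v) - u v\<bar> * (indicator (cube x r) v * indicator (cube x r) (w + v))"
  have "(\<integral>\<^sup>+v\<in>cube x r. (\<integral>\<^sup>+v'\<in>cube x r. ennreal \<bar>u v' - u v\<bar> \<partial>lborel) \<partial>lborel)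
    = (\<integral>\<^sup>+v. (\<integral>\<^sup>+w. ?f v w \<partial>lborel) \<partial>lborel)"
  proof (rule nn_integral_cong)
    fix v :: "real^'n"
    have "(\<integral>\<^sup>+v'\<in>cube x r. ennreal \<bar>u v' - u v\<bar> \<partial>lborel) = (\<integral>\<^sup>+w. ennreal \<bar>u (w + v) - u v\<bar> * indicator (cube x r) (w + v) \<partial>lborel)"
      by (rule nn_integral_lborel_shift[symmetric]) measurable
    then show "(\<integral>\<^sup>+v'\<in>cube x r. ennreal \<bar>u v' - u v\<bar> \<partial>lborel) * indicator (cube x r) v = (\<integral>\<^sup>+w. ?f v w \<partial>lborel)"
      by (auto simp: indicator_def)
  qed
  also have "\<dots> = (\<integral>\<^sup>+w. (\<integral>\<^sup>+v. ?f v w \<partial>lborel) \<partial>lborel)" by (rule lborel_pair.Fubini') measurable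
  also have "\<dots> \<le> (\<integral>\<^sup>+w. ennreal (CARD('n) * (2 * r) * B) * indicator (cube 0 (2 * r)) w \<partial>(lborel :: (real^'n) measure))"
  proof (rule nn_integral_mono)
    fix w :: "real^'n"
    have e: "(\<integral>\<^sup>+v. ?f v w \<partial>lborel) = (\<integral>\<^sup>+v\<in>{v. v \<in> cube x r \<and> v + w \<in> cube x r}. ennreal \<bar>u (v + w) - u v\<bar> \<partial>lborel)"
      by (intro nn_integral_cong) (auto simp: indicator_def add.commute)
    show "(\<integral>\<^sup>+v. ?f v w \<partial>lborel) \<le> ennreal (CARD('n) * (2 * r) * B) * indicator (cube 0 (2 * r)) w"
    proof (cases "w \<in> cube 0 (2 * r)")
      case True
      have "(\<integral>\<^sup>+v. ?f v w \<partial>lborel) \<le> ennreal ((\<Sum>i\<in>UNIV. \<bar>w $ i\<bar>) * B)"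
        unfolding e by (rule nn_integral_translation_le[OF u B H])
      also have "\<dots> \<le> ennreal ((\<Sum>i\<in>(UNIV :: 'n set). 2 * r) * B)"
        using True B by (intro ennreal_leI mult_right_mono sum_mono) (auto simp: cube_def)
      finally show ?thesis using True by simp
    next
      case False
      have "v \<notin> {v. v \<in> cube x r \<and> v + w \<in> cube x r}" for v
      proof
        assume v: "v \<in> {v. v \<in> cube x r \<and> v + w \<in> cube x r}"
        obtain i where "\<not> \<bar>w $ i\<bar> \<le> 2 * r" using False by (auto simp: cube_def)
        moreover have "\<bar>v $ i - x $ i\<bar> \<le> r" "\<bar>v $ i + w $ i - x $ i\<bar> \<le> r" using v by (auto simp: cube_def)
        ultimately show False by linarith
      qed
      then have "{v. v \<in> cube x r \<and> v + w \<in> cube x r} = {}" by blast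
      then show ?thesis unfolding e by simp
    qed
  qed
  also have "\<dots> = ennreal (CARD('n) * (2 * r) * B) * ennreal ((2 * (2 * r)) ^ CARD('n))"
    using r by (subst nn_integral_cmult_indicator) (auto simp: emeasure_cube)
  also have "\<dots> = ennreal ((4 * r) ^ CARD('n) * (CARD('n) * (2 * r) * B))"
    using r B by (subst ennreal_mult'[symmetric]) (auto simp: mult.commute)
  finally show ?thesis .
qed

text \<open>The distance of \<open>u v\<close> to the mean is at most the mean distance of
  \<open>u v\<close> to the other values, so the double integral of \<open>poincare_cube\<close>
  applies. The factor \<open>2 ^ CARD('n)\<close> is the volume ratio of the cubes of radii
  \<open>2 * r\<close> and \<open>r\<close>.\<close>

lemma nn_integral_oscillation:
  fixes u :: "real^'n::finite \<Rightarrow> real" and r B :: real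
  assumes u[measurable]: "u \<in> borel_measurable borel" and B: "0 \<le> B" and r: "0 < r"
    and ui: "integrable lborel (\<lambda>v. indicator (cube x r) v * u v)"
    and H: "\<And>i h. (\<integral>\<^sup>+v\<in>{v. v \<in> cube x r \<and> v + h *\<^sub>R axis i 1 \<in> cube x r}. ennreal \<bar>u (v + h *\<^sub>R axis i 1) - u v\<bar> \<partial>lborel)
      \<le> ennreal (\<bar>h\<bar> * B)"
    and m: "m = (\<integral>v. indicator (cube x r) v * u v \<partial>lborel) / (2 * r) ^ CARD('n)"
  shows "(\<integral>\<^sup>+v\<in>cube x r. ennreal \<bar>u v - m\<bar> \<partial>lborel) \<le> ennreal (2 ^ CARD('n) * (CARD('n) * (2 * r) * B))"
proof -
  define N where "N = (2 * r) ^ CARD('n)"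
  have N: "N > 0" using r by (simp add: N_def)
  have ind: "(\<integral>v. indicator (cube x r) v \<partial>lborel) = N"
    using emeasure_cube[of r x] r by (simp add: measure_def N_def)
  have mN: "(\<integral>v. indicator (cube x r) v * u v \<partial>lborel) = N * m"
    using N unfolding m N_def[symmetric] by simp
  have ci: "integrable lborel (\<lambda>v. indicator (cube x r) v * c)" for c :: real
    using emeasure_cube[of r x] r by (intro integrable_mult_left integrable_real_indicator) auto
  have pt: "ennreal \<bar>u v - m\<bar> \<le> ennreal (1 / N) * (\<integral>\<^sup>+v'\<in>cube x r. ennreal \<bar>u v' - u v\<bar> \<partial>lborel)" for v
  proof -
    have "(\<integral>v'. indicator (cube x r) v' * (u v' - u v) \<partial>lborel) = (\<integral>v'. indicator (cube x r) v' * u v' - indicator (cube x r) v' * u v \<partial>lborel)"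
      by (simp add: algebra_simps)
    also have "\<dots> = (\<integral>v'. indicator (cube x r) v' * u v' \<partial>lborel) - (\<integral>v'. indicator (cube x r) v' * u v \<partial>lborel)"
      by (rule Bochner_Integration.integral_diff[OF ui ci])
    also have "\<dots> = N * (m - u v)" using ind by (simp add: mN right_diff_distrib)
    finally have "\<bar>\<integral>v'. indicator (cube x r) v' * (u v' - u v) \<partial>lborel\<bar> = N * \<bar>m - u v\<bar>"
      using N by (simp add: abs_mult)
    then have eq: "\<bar>u v - m\<bar> = (1 / N) * \<bar>\<integral>v'. indicator (cube x r) v' * (u v' - u v) \<partial>lborel\<bar>"
      using N by (simp add: abs_minus_commute)
    have "ennreal \<bar>u v - m\<bar> = ennreal (1 / N) * ennreal \<bar>\<integral>v'. indicator (cube x r) v' * (u v' - u v) \<partial>lborel\<bar>"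
      unfolding eq by (rule ennreal_mult') (use N in simp)
    also have "\<dots> \<le> ennreal (1 / N) * (\<integral>\<^sup>+v'. ennreal \<bar>indicator (cube x r) v' * (u v' - u v)\<bar> \<partial>lborel)"
      by (intro mult_left_mono ennreal_abs_integral_le) auto
    also have "(\<integral>\<^sup>+v'. ennreal \<bar>indicator (cube x r) v' * (u v' - u v)\<bar> \<partial>lborel) = (\<integral>\<^sup>+v'\<in>cube x r. ennreal \<bar>u v' - u v\<bar> \<partial>lborel)"
      by (intro nn_integral_cong) (auto simp: indicator_def)
    finally show ?thesis .
  qed
  have "(\<integral>\<^sup>+v\<in>cube x r. ennreal \<bar>u v - m\<bar> \<partial>lborel)
    \<le> (\<integral>\<^sup>+v. ennreal (1 / N) * ((\<integral>\<^sup>+v'\<in>cube x r. ennreal \<bar>u v' - u v\<bar> \<partial>lborel) * indicator (cube x r) v) \<partial>lborel)"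
    using pt by (intro nn_integral_mono) (auto simp: indicator_def)
  also have "\<dots> = ennreal (1 / N) * (\<integral>\<^sup>+v\<in>cube x r. (\<integral>\<^sup>+v'\<in>cube x r. ennreal \<bar>u v' - u v\<bar> \<partial>lborel) \<partial>lborel)"
    by (rule nn_integral_cmult) measurable
  also have "\<dots> \<le> ennreal (1 / N) * ennreal ((4 * r) ^ CARD('n) * (CARD('n) * (2 * r) * B))"
    using r by (intro mult_left_mono poincare_cube[OF u B _ H]) auto
  also have "\<dots> = ennreal (1 / N * ((4 * r) ^ CARD('n) * (CARD('n) * (2 * r) * B)))"
    using N by (intro ennreal_mult'[symmetric]) simp
  also have "1 / N * ((4 * r) ^ CARD('n) * (CARD('n) * (2 * r) * B)) = 2 ^ CARD('n) * (CARD('n) * (2 * r) * B)"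
  proof -
    have "4 * r = 2 * (2 * r)" by simp
    then have "(4 * r) ^ CARD('n) = 2 ^ CARD('n) * N" unfolding N_def by (simp only: power_mult_distrib)
    then show ?thesis using N by simp
  qed
  finally show ?thesis .
qed

text \<open>The first summand controls the oscillation about the mean at the given scale. The second
  controls the distance from this mean to the limit of the means: a geometric series of ratio
  \<open>2 powr - a\<close>, multiplied by the volume factor \<open>2 ^ n\<close> of a cube.\<close>

definition campanato_const :: "nat \<Rightarrow> real \<Rightarrow> real" where
  "campanato_const n a = 2 ^ Suc n * n + 2 ^ n * (2 ^ Suc n * n / (1 - 2 powr - a))"

lemma campanato_const_nonneg: "0 < a \<Longrightarrow> 0 \<le> campanato_const n a"
proof -
  assume "0 < a"
  then have "2 powr - a < (1::real)" using powr_less_mono[of "-a" 0 "2::real"] by simp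
  then show ?thesis by (simp add: campanato_const_def)
qed

text \<open>By \<open>H\<close> the mean oscillation at scale \<open>r\<close> is of order
  \<open>V * r powr a\<close>. Means at comparable scales therefore differ by that much, and since
  \<open>a > 0\<close> these differences are summable over dyadic scales; the means converge to a
  value \<open>l\<close> with the same rate.\<close>

lemma campanato:
  fixes u :: "real^'n::finite \<Rightarrow> real" and V a :: real
  assumes u[measurable]: "u \<in> borel_measurable borel" and V: "0 \<le> V" and a: "0 < a"
    and ui: "\<And>r. integrable lborel (\<lambda>v. indicator (cube x r) v * u v)"
    and H: "\<And>i h r. 0 < r \<Longrightarrow> (\<integral>\<^sup>+v\<in>{v. v \<in> cube x r \<and> v + h *\<^sub>R axis i 1 \<in> cube x r}. ennreal \<bar>u (v + h *\<^sub>R axis i 1) - u v\<bar> \<partial>lborel)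
      \<le> ennreal (\<bar>h\<bar> * (V * r powr (real CARD('n) - 1 + a)))"
  shows "\<exists>l. \<forall>r>0. (\<integral>\<^sup>+v\<in>cube x r. ennreal \<bar>u v - l\<bar> \<partial>lborel) \<le> ennreal (campanato_const CARD('n) a * V * r powr (real CARD('n) + a))"
proof -
  let ?n = "CARD('n)"
  define m where "m r = (\<integral>v. indicator (cube x r) v * u v \<partial>lborel) / (2 * r) ^ ?n" for r
  define K1 :: real where "K1 = 2 ^ Suc ?n * ?n"
  have K1: "K1 \<ge> 0" by (simp add: K1_def)
  define q where "q = (2::real) powr - a"
  have q: "0 < q" "q < 1" unfolding q_def using a powr_less_mono[of "-a" 0 "2::real"] by auto
  define K3 where "K3 = K1 / (1 - q)"
  \<comment> \<open>\<open>K3\<close> is the fixed point of one halving step: an error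
    \<open>K1\<close> now plus \<open>q\<close> times the error at the halved radius.\<close>
  have K3: "K3 \<ge> 0" "K1 + q * K3 = K3" "K1 \<le> K3" using K1 q by (auto simp: K3_def field_simps)
  have osc: "(\<integral>\<^sup>+v\<in>cube x r. ennreal \<bar>u v - m r\<bar> \<partial>lborel) \<le> ennreal (K1 * V * r powr (real ?n + a))" if r: "0 < r" for r
  proof -
    have "(\<integral>\<^sup>+v\<in>cube x r. ennreal \<bar>u v - m r\<bar> \<partial>lborel) \<le> ennreal (2 ^ ?n * (?n * (2 * r) * (V * r powr (real ?n - 1 + a))))"
      by (rule nn_integral_oscillation[OF u _ r ui H m_def]) (use V r in auto)
    also have "2 ^ ?n * (?n * (2 * r) * (V * r powr (real ?n - 1 + a))) = K1 * V * r powr (real ?n + a)"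
      using r powr_add[of r 1 "?n - 1 + a"] by (simp add: K1_def mult_ac)
    finally show ?thesis .
  qed
  \<comment> \<open>The comparison is made on the smaller cube, and \<open>r \<le> 2 * p\<close>
    bounds \<open>r ^ CARD('n)\<close> by its volume, so no further dimensional constant
    appears.\<close>
  have near: "\<bar>m r - m p\<bar> \<le> K1 * V * r powr a" if p: "0 < p" "p \<le> r" "r \<le> 2 * p" for p r
  proof -
    have r: "0 < r" using p by simp
    define P where "P = (2 * p) ^ ?n"
    have P: "P > 0" using p by (simp add: P_def)
    have ind: "(\<integral>v. indicator (cube x p) v \<partial>lborel) = P"
      using emeasure_cube[of p x] p by (simp add: measure_def P_def)
    have mP: "(\<integral>v. indicator (cube x p) v * u v \<partial>lborel) = P * m p" using p by (simp add: m_def P_def)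
    have ci: "integrable lborel (\<lambda>v. indicator (cube x p) v * c)" for c :: real
      using emeasure_cube[of p x] p by (intro integrable_mult_left integrable_real_indicator) auto
    have "(\<integral>v. indicator (cube x p) v * (u v - m r) \<partial>lborel) = (\<integral>v. indicator (cube x p) v * u v - indicator (cube x p) v * m r \<partial>lborel)"
      by (simp add: algebra_simps)
    also have "\<dots> = (\<integral>v. indicator (cube x p) v * u v \<partial>lborel) - (\<integral>v. indicator (cube x p) v * m r \<partial>lborel)"
      by (rule Bochner_Integration.integral_diff[OF ui ci])
    also have "\<dots> = P * (m p - m r)" using ind by (simp add: mP right_diff_distrib)
    finally have eq: "P * \<bar>m r - m p\<bar> = \<bar>\<integral>v. indicator (cube x p) v * (u v - m r) \<partial>lborel\<bar>"
      using P by (simp add: abs_mult abs_minus_commute)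
    have sub: "cube x p \<subseteq> cube x r" using p by (auto simp: cube_def intro: order_trans)
    have "ennreal (P * \<bar>m r - m p\<bar>) \<le> (\<integral>\<^sup>+v. ennreal \<bar>indicator (cube x p) v * (u v - m r)\<bar> \<partial>lborel)"
      unfolding eq by (rule ennreal_abs_integral_le)
    also have "\<dots> \<le> (\<integral>\<^sup>+v\<in>cube x r. ennreal \<bar>u v - m r\<bar> \<partial>lborel)"
      using sub by (intro nn_integral_mono) (auto simp: indicator_def)
    also have "\<dots> \<le> ennreal (K1 * V * r powr (real ?n + a))" by (rule osc[OF r])
    finally have "P * \<bar>m r - m p\<bar> \<le> K1 * V * r powr (real ?n + a)" using K1 V by (subst (asm) ennreal_le_iff) auto
    moreover have "r powr (real ?n + a) = r ^ ?n * r powr a" using r by (simp add: powr_add powr_realpow)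
    moreover have "r ^ ?n * \<bar>m r - m p\<bar> \<le> P * \<bar>m r - m p\<bar>" unfolding P_def using p r by (intro mult_right_mono power_mono) auto
    ultimately have "r ^ ?n * \<bar>m r - m p\<bar> \<le> r ^ ?n * (K1 * V * r powr a)" by (simp add: mult_ac)
    then show ?thesis using r by simp
  qed
  have far: "\<bar>m r - m p\<bar> \<le> K3 * V * r powr a" if "0 < p" "p \<le> r" "r \<le> 2 ^ k * p" for k p r
    using that
  proof (induction k arbitrary: r)
    case 0
    then have "r = p" by simp
    then show ?case using K3 V by simp
  next
    case (Suc k)
    show ?case
    proof (cases "r \<le> 2 * p")
      case True
      have "\<bar>m r - m p\<bar> \<le> K1 * V * r powr a" using Suc.prems True by (intro near) auto
      also have "\<dots> \<le> K3 * V * r powr a" using K3 V by (intro mult_right_mono) auto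
      finally show ?thesis .
    next
      case False
      have "\<bar>m r - m (r / 2)\<bar> \<le> K1 * V * r powr a" using Suc.prems by (intro near) auto
      moreover have "\<bar>m (r / 2) - m p\<bar> \<le> K3 * V * (r / 2) powr a" using Suc.prems False by (intro Suc.IH) auto
      moreover have "(r / 2) powr a = q * r powr a"
      proof -
        have "0 < r" using Suc.prems(1,2) by linarith
        then show ?thesis by (simp add: q_def powr_divide powr_minus_divide)
      qed
      ultimately have "\<bar>m r - m p\<bar> \<le> (K1 + q * K3) * (V * r powr a)" by (simp add: algebra_simps)
      then show ?thesis unfolding K3 by (simp add: mult.assoc)
    qed
  qed
  have far': "\<bar>m r - m p\<bar> \<le> K3 * V * r powr a" if p: "0 < p" "p \<le> r" for p r
  proof -
    obtain k where "r / p < 2 ^ k" using real_arch_pow[of 2 "r / p"] by auto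
    then show ?thesis using p by (intro far[of p r k]) (auto simp: field_simps)
  qed
  have z: "(\<lambda>k. K3 * V * (inverse (real (Suc k))) powr a) \<longlonglongrightarrow> 0"
  proof -
    have "(\<lambda>k. K3 * V * (inverse (real (Suc k))) powr a) \<longlonglongrightarrow> K3 * V * (0 powr a)"
      using a by (intro tendsto_intros tendsto_powr' LIMSEQ_inverse_real_of_nat) auto
    then show ?thesis using a by simp
  qed
  have "Cauchy (\<lambda>k. m (inverse (real (Suc k))))"
  proof (rule metric_CauchyI)
    fix e :: real assume e: "0 < e"
    obtain N where N: "\<And>k. k \<ge> N \<Longrightarrow> K3 * V * (inverse (real (Suc k))) powr a < e"
      using order_tendstoD(2)[OF z e] by (auto simp: eventually_sequentially)
    have le: "dist (m (inverse (real (Suc k)))) (m (inverse (real (Suc l)))) < e" if "N \<le> k" "k \<le> l" for k l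
    proof -
      have "\<bar>m (inverse (real (Suc k))) - m (inverse (real (Suc l)))\<bar> \<le> K3 * V * (inverse (real (Suc k))) powr a"
        by (rule far') (use that in \<open>auto intro: le_imp_inverse_le\<close>)
      then show ?thesis using N[OF that(1)] by (simp only: dist_real_def)
    qed
    then have "dist (m (inverse (real (Suc k)))) (m (inverse (real (Suc l)))) < e" if "N \<le> k" "N \<le> l" for k l
      using le[of k l] le[of l k] that linear[of k l] by (metis dist_commute)
    then show "\<exists>M. \<forall>k\<ge>M. \<forall>l\<ge>M. dist (m (inverse (real (Suc k)))) (m (inverse (real (Suc l)))) < e" by blast
  qed
  then obtain l where l: "(\<lambda>k. m (inverse (real (Suc k)))) \<longlonglongrightarrow> l" using real_Cauchy_convergent convergent_def by blast
  have ml: "\<bar>m r - l\<bar> \<le> K3 * V * r powr a" if r: "0 < r" for r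
  proof (rule tendsto_upperbound)
    show "(\<lambda>k. \<bar>m r - m (inverse (real (Suc k)))\<bar>) \<longlonglongrightarrow> \<bar>m r - l\<bar>" by (intro tendsto_intros l)
    have "(\<lambda>k. inverse (real (Suc k))) \<longlonglongrightarrow> 0" by (rule LIMSEQ_inverse_real_of_nat)
    then have "\<forall>\<^sub>F k in sequentially. inverse (real (Suc k)) < r" by (rule order_tendstoD(2)[OF _ r])
    then show "\<forall>\<^sub>F k in sequentially. \<bar>m r - m (inverse (real (Suc k)))\<bar> \<le> K3 * V * r powr a"
      by eventually_elim (intro far', auto)
  qed simp
  have "(\<integral>\<^sup>+v\<in>cube x r. ennreal \<bar>u v - l\<bar> \<partial>lborel) \<le> ennreal (campanato_const ?n a * V * r powr (real ?n + a))" if r: "0 < r" for r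
  proof -
    have "(\<integral>\<^sup>+v\<in>cube x r. ennreal \<bar>u v - l\<bar> \<partial>lborel) \<le> (\<integral>\<^sup>+v. ennreal \<bar>u v - m r\<bar> * indicator (cube x r) v + ennreal \<bar>m r - l\<bar> * indicator (cube x r) v \<partial>lborel)"
    proof (rule nn_integral_mono)
      fix v
      have "ennreal \<bar>u v - l\<bar> \<le> ennreal (\<bar>u v - m r\<bar> + \<bar>m r - l\<bar>)" by (intro ennreal_leI) linarith
      then show "ennreal \<bar>u v - l\<bar> * indicator (cube x r) v \<le> ennreal \<bar>u v - m r\<bar> * indicator (cube x r) v + ennreal \<bar>m r - l\<bar> * indicator (cube x r) v"
        by (auto simp: indicator_def)
    qed
    also have "\<dots> = (\<integral>\<^sup>+v\<in>cube x r. ennreal \<bar>u v - m r\<bar> \<partial>lborel) + ennreal \<bar>m r - l\<bar> * ennreal ((2 * r) ^ ?n)"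
      using r by (subst nn_integral_add) (auto simp: nn_integral_cmult_indicator emeasure_cube)
    also have "\<dots> \<le> ennreal (K1 * V * r powr (real ?n + a)) + ennreal (K3 * V * r powr a) * ennreal ((2 * r) ^ ?n)"
      by (intro add_mono mult_right_mono osc r ennreal_leI ml) auto
    also have "\<dots> = ennreal (K1 * V * r powr (real ?n + a) + K3 * V * r powr a * (2 * r) ^ ?n)"
      using K1 K3 V r by (simp add: ennreal_mult'[symmetric])
    also have "K1 * V * r powr (real ?n + a) + K3 * V * r powr a * (2 * r) ^ ?n = campanato_const ?n a * V * r powr (real ?n + a)"
    proof -
      have "r powr (real ?n + a) = r ^ ?n * r powr a" using r by (simp add: powr_add powr_realpow)
      then show ?thesis unfolding campanato_const_def K3_def K1_def q_def by (simp add: power_mult_distrib algebra_simps)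
    qed
    finally show ?thesis .
  qed
  then show ?thesis by blast
qed

text \<open>Both values are close to \<open>u\<close> on average over the cube around
  \<open>x'\<close> of radius \<open>norm (x - x')\<close>, which lies in the cube around
  \<open>x\<close> of twice that radius. The larger cube accounts for the factor
  \<open>2 powr a\<close>.\<close>

lemma oscillation_two_points:
  fixes u :: "real^'n::finite \<Rightarrow> real" and K K' a l l' :: real
  assumes u[measurable]: "u \<in> borel_measurable borel" and a: "0 < a" and K: "0 \<le> K" "0 \<le> K'"
    and l: "\<And>r. 0 < r \<Longrightarrow> (\<integral>\<^sup>+v\<in>cube x r. ennreal \<bar>u v - l\<bar> \<partial>lborel) \<le> ennreal (K * r powr (real CARD('n) + a))"
    and l': "\<And>r. 0 < r \<Longrightarrow> (\<integral>\<^sup>+v\<in>cube x' r. ennreal \<bar>u v - l'\<bar> \<partial>lborel) \<le> ennreal (K' * r powr (real CARD('n) + a))"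
  shows "\<bar>l - l'\<bar> \<le> 2 powr a * (K + K') * norm (x - x') powr a"
proof (cases "x = x'")
  case False
  let ?n = "CARD('n)"
  define \<rho> where "\<rho> = norm (x - x')"
  have \<rho>: "\<rho> > 0" using False by (simp add: \<rho>_def)
  have sub: "cube x' \<rho> \<subseteq> cube x (2 * \<rho>)"
  proof
    fix v assume v: "v \<in> cube x' \<rho>"
    have "\<bar>v $ i - x $ i\<bar> \<le> 2 * \<rho>" for i
    proof -
      have "\<bar>v $ i - x' $ i\<bar> \<le> \<rho>" using v by (simp add: cube_def)
      moreover have "\<bar>(x - x') $ i\<bar> \<le> \<rho>" unfolding \<rho>_def by (rule component_le_norm_cart)
      ultimately show ?thesis by simp
    qed
    then show "v \<in> cube x (2 * \<rho>)" by (simp add: cube_def)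
  qed
  have "ennreal (\<bar>l - l'\<bar> * (2 * \<rho>) ^ ?n) = (\<integral>\<^sup>+v. ennreal \<bar>l - l'\<bar> * indicator (cube x' \<rho>) v \<partial>lborel)"
    using \<rho> by (simp add: nn_integral_cmult_indicator emeasure_cube ennreal_mult')
  also have "\<dots> \<le> (\<integral>\<^sup>+v. ennreal \<bar>u v - l\<bar> * indicator (cube x (2 * \<rho>)) v + ennreal \<bar>u v - l'\<bar> * indicator (cube x' \<rho>) v \<partial>lborel)"
  proof (rule nn_integral_mono)
    fix v
    have "ennreal \<bar>l - l'\<bar> \<le> ennreal (\<bar>u v - l\<bar> + \<bar>u v - l'\<bar>)" by (intro ennreal_leI) linarith
    then show "ennreal \<bar>l - l'\<bar> * indicator (cube x' \<rho>) v \<le> ennreal \<bar>u v - l\<bar> * indicator (cube x (2 * \<rho>)) v + ennreal \<bar>u v - l'\<bar> * indicator (cube x' \<rho>) v"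
      using sub by (auto simp: indicator_def)
  qed
  also have "\<dots> = (\<integral>\<^sup>+v\<in>cube x (2 * \<rho>). ennreal \<bar>u v - l\<bar> \<partial>lborel) + (\<integral>\<^sup>+v\<in>cube x' \<rho>. ennreal \<bar>u v - l'\<bar> \<partial>lborel)"
    by (rule nn_integral_add) measurable
  also have "\<dots> \<le> ennreal (K * (2 * \<rho>) powr (real ?n + a)) + ennreal (K' * \<rho> powr (real ?n + a))"
    using \<rho> by (intro add_mono l l') auto
  also have "\<dots> = ennreal (K * (2 * \<rho>) powr (real ?n + a) + K' * \<rho> powr (real ?n + a))" using K by simp
  finally have "\<bar>l - l'\<bar> * (2 * \<rho>) ^ ?n \<le> K * (2 * \<rho>) powr (real ?n + a) + K' * \<rho> powr (real ?n + a)"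
    using K by (subst (asm) ennreal_le_iff) auto
  also have "\<dots> \<le> K * (2 * \<rho>) powr (real ?n + a) + K' * (2 * \<rho>) powr (real ?n + a)"
    using K \<rho> a by (intro add_left_mono mult_left_mono powr_mono2) auto
  also have "\<dots> = (2 powr a * (K + K') * \<rho> powr a) * (2 * \<rho>) ^ ?n"
  proof -
    have "(2 * \<rho>) powr (real ?n + a) = (2 * \<rho>) ^ ?n * (2 powr a * \<rho> powr a)"
      using \<rho> powr_add[of "2 * \<rho>" "real ?n" a] powr_realpow[of "2 * \<rho>" ?n] by (simp add: powr_mult)
    then show ?thesis by (simp add: algebra_simps)
  qed
  finally show ?thesis using \<rho> unfolding \<rho>_def[symmetric] by simp
next
  \<comment> \<open>Here \<open>0 powr a = 0\<close>, so the claim is \<open>l = l'\<close>; the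
    distance provides no scale and the radius is sent to 0 instead.\<close>
  case True
  have "\<bar>l - l'\<bar> \<le> 0"
  proof (rule field_le_epsilon)
    fix e :: real assume e: "0 < e"
    let ?n = "CARD('n)"
    have "((\<lambda>r. (K + K') * r powr a) \<longlongrightarrow> (K + K') * 0 powr a) (at_right 0)"
      using a by (intro tendsto_intros tendsto_powr') (auto simp: eventually_at_right_less intro: eventually_mono[OF eventually_at_right_less])
    then have "((\<lambda>r. (K + K') * r powr a) \<longlongrightarrow> 0) (at_right 0)" using a by simp
    then have "\<forall>\<^sub>F r in at_right 0. (K + K') * r powr a < e" by (rule order_tendstoD(2)[OF _ e])
    then have "\<forall>\<^sub>F r in at_right 0. (K + K') * r powr a < e \<and> 0 < r" using eventually_at_right_less[of "0::real"] by eventually_elim simp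
    then obtain r where r: "(K + K') * r powr a < e" "0 < r" by (auto dest!: eventually_happens)
    have "ennreal (\<bar>l - l'\<bar> * (2 * r) ^ ?n) = (\<integral>\<^sup>+v. ennreal \<bar>l - l'\<bar> * indicator (cube x r) v \<partial>lborel)"
      using r by (simp add: nn_integral_cmult_indicator emeasure_cube ennreal_mult')
    also have "\<dots> \<le> (\<integral>\<^sup>+v. ennreal \<bar>u v - l\<bar> * indicator (cube x r) v + ennreal \<bar>u v - l'\<bar> * indicator (cube x' r) v \<partial>lborel)"
    proof (rule nn_integral_mono)
      fix v
      have "ennreal \<bar>l - l'\<bar> \<le> ennreal (\<bar>u v - l\<bar> + \<bar>u v - l'\<bar>)" by (intro ennreal_leI) linarith
      then show "ennreal \<bar>l - l'\<bar> * indicator (cube x r) v \<le> ennreal \<bar>u v - l\<bar> * indicator (cube x r) v + ennreal \<bar>u v - l'\<bar> * indicator (cube x' r) v"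
        using True by (auto simp: indicator_def)
    qed
    also have "\<dots> = (\<integral>\<^sup>+v\<in>cube x r. ennreal \<bar>u v - l\<bar> \<partial>lborel) + (\<integral>\<^sup>+v\<in>cube x' r. ennreal \<bar>u v - l'\<bar> \<partial>lborel)"
      by (rule nn_integral_add) measurable
    also have "\<dots> \<le> ennreal (K * r powr (real ?n + a)) + ennreal (K' * r powr (real ?n + a))"
      using r by (intro add_mono l l') auto
    also have "\<dots> = ennreal ((K + K') * r powr (real ?n + a))" using K by (simp add: algebra_simps)
    finally have "\<bar>l - l'\<bar> * (2 * r) ^ ?n \<le> (K + K') * r powr (real ?n + a)"
      using K by (subst (asm) ennreal_le_iff) auto
    also have "\<dots> = ((K + K') * r powr a) * r ^ ?n" using r by (simp add: powr_add powr_realpow)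
    also have "\<dots> \<le> e * (2 * r) ^ ?n" using r K e by (intro mult_mono power_mono) auto
    finally show "\<bar>l - l'\<bar> \<le> 0 + e" using r by simp
  qed
  then show ?thesis using True by simp
qed

section \<open>Pointwise values of bounded functions of bounded variation\<close>

lemma norm_le_cube:
  fixes w x :: "real^'n::finite" and r :: real
  shows "w \<in> cube x r \<Longrightarrow> norm (w - x) \<le> real CARD('n) * r"
proof -
  assume w: "w \<in> cube x r"
  have "norm (w - x) \<le> (\<Sum>i\<in>UNIV. \<bar>(w - x) $ i\<bar>)" by (rule norm_le_l1_cart)
  also have "\<dots> \<le> (\<Sum>i\<in>(UNIV :: 'n set). r)" using w by (intro sum_mono) (auto simp: cube_def)
  finally show ?thesis by simp
qed

lemma cube_of_norm_le: "norm (w - x) \<le> r \<Longrightarrow> w \<in> cube x r" for w x :: "real^'n::finite"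
  using component_le_norm_cart[of "w - x"] by (auto simp: cube_def intro: order_trans)

lemma powr_mult_powr_minus: "0 < c \<Longrightarrow> c powr p * c powr - p = 1" for c p :: real
  by (simp add: powr_add[symmetric])

text \<open>A point of the cube of radius \<open>2 * r\<close> has Euclidean distance at most
  \<open>2 * CARD('n) * r\<close> from \<open>x\<close>, so the kernel is bounded below there. A
  finite potential thus forces a Morrey-type decay of the measure of small cubes.\<close>

lemma emeasure_cube_le_riesz:
  fixes x :: "real^'n::finite" and s r :: real
  assumes s: "0 < s" and r: "0 < r" and [measurable_cong]: "sets \<nu> = sets borel"
  shows "emeasure \<nu> (cube x (2 * r)) \<le> ennreal ((2 * real CARD('n) * r) powr (real CARD('n) - 1 + s))
     * (\<integral>\<^sup>+z. riesz_kernel (- real CARD('n) + 1 - s) (x - z) \<partial>\<nu>)"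
proof -
  let ?c = "2 * real CARD('n) * r" and ?p = "real CARD('n) - 1 + s"
  have c: "?c > 0" using r by simp
  have p: "?p > 0" using s by (simp add: add_nonneg_pos Suc_leI)
  have "ennreal (?c powr - ?p) * indicator (cube x (2 * r)) z \<le> riesz_kernel (- real CARD('n) + 1 - s) (x - z)" for z
  proof (cases "z \<in> cube x (2 * r)")
    case True
    have "norm (x - z) \<le> ?c" using norm_le_cube[OF True] by (simp add: norm_minus_commute mult_ac)
    then have "?c powr - ?p \<le> norm (x - z) powr - ?p" if "x \<noteq> z"
      using that p by (intro powr_mono2') auto
    then show ?thesis using True by (auto simp: riesz_kernel_def algebra_simps intro!: ennreal_leI)
  qed simp
  then have "(\<integral>\<^sup>+z. ennreal (?c powr - ?p) * indicator (cube x (2 * r)) z \<partial>\<nu>) \<le> (\<integral>\<^sup>+z. riesz_kernel (- real CARD('n) + 1 - s) (x - z) \<partial>\<nu>)"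
    by (rule nn_integral_mono)
  then have "ennreal (?c powr - ?p) * emeasure \<nu> (cube x (2 * r)) \<le> (\<integral>\<^sup>+z. riesz_kernel (- real CARD('n) + 1 - s) (x - z) \<partial>\<nu>)"
    by (subst (asm) nn_integral_cmult_indicator) auto
  then have "ennreal (?c powr ?p) * (ennreal (?c powr - ?p) * emeasure \<nu> (cube x (2 * r)))
    \<le> ennreal (?c powr ?p) * (\<integral>\<^sup>+z. riesz_kernel (- real CARD('n) + 1 - s) (x - z) \<partial>\<nu>)" by (rule mult_left_mono) simp
  moreover have "ennreal (?c powr ?p) * ennreal (?c powr - ?p) = 1"
  proof -
    have "ennreal (?c powr ?p) * ennreal (?c powr - ?p) = ennreal (?c powr ?p * ?c powr - ?p)" by (rule ennreal_mult'[symmetric]) simp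
    also have "?c powr ?p * ?c powr - ?p = 1" by (rule powr_mult_powr_minus[OF c])
    finally show ?thesis by simp
  qed
  ultimately show ?thesis by (simp add: mult.assoc[symmetric])
qed

text \<open>The factor 2 stems from \<open>BV_translation\<close>, the power of \<open>2 * n\<close>
  from comparing a cube with the kernel.\<close>

definition oscillation_const :: "nat \<Rightarrow> real \<Rightarrow> real" where
  "oscillation_const n s = campanato_const n s * (2 * (2 * real n) powr (real n - 1 + s))"

lemma oscillation_const_nonneg: "0 < s \<Longrightarrow> 0 \<le> oscillation_const n s"
  unfolding oscillation_const_def by (intro mult_nonneg_nonneg campanato_const_nonneg) auto

text \<open>The decay of the variation on cubes, of exponent \<open>n - 1 + s\<close>, is exactly
  the hypothesis of \<open>campanato\<close> with \<open>a = s\<close>.\<close>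

lemma BV_oscillation:
  fixes \<phi> u :: "real^'n::finite \<Rightarrow> real" and s v M :: real
  assumes \<phi>: "\<phi> \<in> BV_loc" and u[measurable]: "u \<in> borel_measurable borel" and bd: "\<And>x. \<bar>u x\<bar> \<le> M"
    and ae: "AE x in lebesgue. \<phi> x = u x"
    and sf: "sigma_finite_measure (gradient_variation \<phi>)" and s: "0 < s"
    and v: "(\<integral>\<^sup>+z. riesz_kernel (- real CARD('n) + 1 - s) (x - z) \<partial>gradient_variation \<phi>) = ennreal v" "0 \<le> v"
  shows "\<exists>l. \<forall>r>0. (\<integral>\<^sup>+y\<in>cube x r. ennreal \<bar>u y - l\<bar> \<partial>lborel) \<le> ennreal (oscillation_const CARD('n) s * v * r powr (real CARD('n) + s))"
proof -
  let ?p = "real CARD('n) - 1 + s"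
  define V where "V = 2 * (2 * real CARD('n)) powr ?p * v"
  have "\<exists>l. \<forall>r>0. (\<integral>\<^sup>+y\<in>cube x r. ennreal \<bar>u y - l\<bar> \<partial>lborel) \<le> ennreal (campanato_const CARD('n) s * V * r powr (real CARD('n) + s))"
  proof (rule campanato[OF u _ s])
    show "0 \<le> V" using v by (simp add: V_def)
    show "integrable lborel (\<lambda>y. indicator (cube x r) y * u y)" for r
      by (rule integrable_bounded_support[where S = "cube x r" and B = "\<bar>M\<bar>"])
         (use bd in \<open>auto simp: indicator_def intro: order_trans[OF bd]\<close>)
    fix i h and r :: real assume r: "0 < r"
    have "(\<integral>\<^sup>+y\<in>{y. y \<in> cube x r \<and> y + h *\<^sub>R axis i 1 \<in> cube x r}. ennreal \<bar>u (y + h *\<^sub>R axis i 1) - u y\<bar> \<partial>lborel)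
      \<le> ennreal (2 * \<bar>h\<bar>) * emeasure (gradient_variation \<phi>) (cube x (2 * r))"
      by (rule BV_translation[OF \<phi> u bd ae sf r])
    also have "\<dots> \<le> ennreal (2 * \<bar>h\<bar>) * (ennreal ((2 * real CARD('n) * r) powr ?p) * ennreal v)"
      unfolding v(1)[symmetric] by (intro mult_left_mono emeasure_cube_le_riesz[OF s r]) auto
    also have "\<dots> = ennreal (\<bar>h\<bar> * (V * r powr ?p))"
      using v r by (simp add: V_def ennreal_mult'[symmetric] powr_mult mult_ac)
    finally show "(\<integral>\<^sup>+y\<in>{y. y \<in> cube x r \<and> y + h *\<^sub>R axis i 1 \<in> cube x r}. ennreal \<bar>u (y + h *\<^sub>R axis i 1) - u y\<bar> \<partial>lborel)
      \<le> ennreal (\<bar>h\<bar> * (V * r powr ?p))" .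
  qed
  then show ?thesis by (simp add: oscillation_const_def V_def mult_ac)
qed

text \<open>Balls lie in cubes of the same radius, and dividing by the volume leaves
  \<open>r powr a\<close>. This identifies the Campanato value with the value of every Lebesgue
  representative at \<open>x\<close>.\<close>

lemma has_approximate_limit_of_oscillation:
  fixes \<phi> u :: "real^'n::finite \<Rightarrow> real" and K a l :: real
  assumes u[measurable]: "u \<in> borel_measurable borel" and ae: "AE x in lebesgue. \<phi> x = u x"
    and a: "0 < a" and K: "0 \<le> K"
    and l: "\<And>r. 0 < r \<Longrightarrow> (\<integral>\<^sup>+y\<in>cube x r. ennreal \<bar>u y - l\<bar> \<partial>lborel) \<le> ennreal (K * r powr (real CARD('n) + a))"
  shows "has_approximate_limit \<phi> x l"
  unfolding has_approximate_limit_def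
proof (rule Lim_null_comparison)
  let ?n = "CARD('n)"
  define c where "c = unit_ball_vol (real DIM(real^'n))"
  have c: "c > 0" by (simp add: c_def)
  show "\<forall>\<^sub>F r in at_right 0. norm ((LINT y:ball x r|lebesgue. \<bar>\<phi> y - l\<bar>) / measure lebesgue (ball x r)) \<le> K / c * r powr a"
    using eventually_at_right_less[of "0::real"]
  proof eventually_elim
    case (elim r)
    have m: "measure lebesgue (ball x r) = c * r ^ ?n"
      using elim by (simp add: content_ball c_def)
    have "ennreal \<bar>LINT y:ball x r|lebesgue. \<bar>\<phi> y - l\<bar>\<bar> \<le> (\<integral>\<^sup>+y. ennreal \<bar>indicator (ball x r) y *\<^sub>R \<bar>\<phi> y - l\<bar>\<bar> \<partial>lebesgue)"
      unfolding set_lebesgue_integral_def by (rule ennreal_abs_integral_le)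
    also have "\<dots> \<le> (\<integral>\<^sup>+y. ennreal \<bar>u y - l\<bar> * indicator (cube x r) y \<partial>lebesgue)"
    proof (rule nn_integral_mono_AE)
      have "ball x r \<subseteq> cube x r" by (auto intro!: cube_of_norm_le simp: dist_norm norm_minus_commute)
      then show "AE y in lebesgue. ennreal \<bar>indicator (ball x r) y *\<^sub>R \<bar>\<phi> y - l\<bar>\<bar> \<le> ennreal \<bar>u y - l\<bar> * indicator (cube x r) y"
        using ae by (auto simp: indicator_def elim!: eventually_mono)
    qed
    also have "\<dots> = (\<integral>\<^sup>+y\<in>cube x r. ennreal \<bar>u y - l\<bar> \<partial>lborel)" by (rule nn_integral_completion)
    also have "\<dots> \<le> ennreal (K * r powr (real ?n + a))" by (rule l[OF elim])
    finally have "\<bar>LINT y:ball x r|lebesgue. \<bar>\<phi> y - l\<bar>\<bar> \<le> K * r powr (real ?n + a)"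
      using K by (subst (asm) ennreal_le_iff) auto
    also have "\<dots> = K / c * r powr a * (c * r ^ ?n)" using elim c by (simp add: powr_add powr_realpow)
    finally show ?case unfolding m using c elim by (simp add: abs_divide divide_le_eq abs_mult)
  qed
  have "((\<lambda>r. K / c * r powr a) \<longlongrightarrow> K / c * 0 powr a) (at_right 0)"
    using a by (intro tendsto_intros tendsto_powr') (auto intro: eventually_mono[OF eventually_at_right_less])
  then show "((\<lambda>r. K / c * r powr a) \<longlongrightarrow> 0) (at_right 0)" using a by simp
qed

text \<open>Two uses are intended. With \<open>B = 0\<close> and \<open>c = 0\<close> a bound on
  \<open>u\<close> passes to \<open>l\<close>; with \<open>M = 0\<close> and \<open>c\<close> the
  value at \<open>x\<close> of a Lipschitz function, \<open>l\<close> is that value.\<close>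

lemma le_of_oscillation:
  fixes u :: "real^'n::finite \<Rightarrow> real" and K a l c :: real
  assumes u[measurable]: "u \<in> borel_measurable borel"
    and a: "0 < a" and K: "0 \<le> K" and B: "0 \<le> B"
    and l: "\<And>r. 0 < r \<Longrightarrow> (\<integral>\<^sup>+y\<in>cube x r. ennreal \<bar>u y - l\<bar> \<partial>lborel) \<le> ennreal (K * r powr (real CARD('n) + a))"
    and c: "\<And>y. \<bar>u y - c\<bar> \<le> M + B * norm (y - x)"
  shows "\<bar>l - c\<bar> \<le> M"
proof (rule tendsto_lowerbound)
  let ?n = "CARD('n)"
  have M: "0 \<le> M" using c[of x] by simp
  show "\<forall>\<^sub>F r :: real in at_right 0. \<bar>l - c\<bar> \<le> K / 2 ^ ?n * r powr a + (M + B * (real ?n * r))"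
    using eventually_at_right_less[of "0::real"]
  proof eventually_elim
    case (elim r)
    define P where "P = (2 * r) ^ ?n"
    have P: "P > 0" using elim by (simp add: P_def)
    have em: "emeasure lborel (cube x r) = ennreal P" using elim by (simp add: emeasure_cube P_def)
    have "ennreal (\<bar>l - c\<bar> * P) = (\<integral>\<^sup>+v. ennreal \<bar>l - c\<bar> * indicator (cube x r) v \<partial>lborel)"
      by (simp add: nn_integral_cmult_indicator em ennreal_mult')
    also have "\<dots> \<le> (\<integral>\<^sup>+v. ennreal \<bar>u v - l\<bar> * indicator (cube x r) v + ennreal (M + B * (real ?n * r)) * indicator (cube x r) v \<partial>lborel)"
    proof (rule nn_integral_mono)
      fix v
      show "ennreal \<bar>l - c\<bar> * indicator (cube x r) v \<le> ennreal \<bar>u v - l\<bar> * indicator (cube x r) v + ennreal (M + B * (real ?n * r)) * indicator (cube x r) v"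
      proof (cases "v \<in> cube x r")
        case True
        have "\<bar>u v - c\<bar> \<le> M + B * (real ?n * r)"
          by (rule order_trans[OF c]) (intro add_left_mono mult_left_mono norm_le_cube True B)
        then have "ennreal \<bar>l - c\<bar> \<le> ennreal (\<bar>u v - l\<bar> + (M + B * (real ?n * r)))" by (intro ennreal_leI) linarith
        then show ?thesis using True M B elim by simp
      qed simp
    qed
    also have "\<dots> = (\<integral>\<^sup>+v\<in>cube x r. ennreal \<bar>u v - l\<bar> \<partial>lborel) + ennreal (M + B * (real ?n * r)) * ennreal P"
      by (subst nn_integral_add) (auto simp: nn_integral_cmult_indicator em)
    also have "\<dots> \<le> ennreal (K * r powr (real ?n + a)) + ennreal (M + B * (real ?n * r)) * ennreal P"
      by (intro add_right_mono l elim)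
    also have "\<dots> = ennreal (K * r powr (real ?n + a) + (M + B * (real ?n * r)) * P)"
      using K M B elim P by (simp add: ennreal_mult'[symmetric] del: ennreal_plus flip: ennreal_plus)
    finally have "\<bar>l - c\<bar> * P \<le> K * r powr (real ?n + a) + (M + B * (real ?n * r)) * P"
      using K M B elim P by (subst (asm) ennreal_le_iff) auto
    also have "K * r powr (real ?n + a) = K / 2 ^ ?n * r powr a * P"
      using elim by (simp add: P_def powr_add powr_realpow power_mult_distrib)
    finally have "\<bar>l - c\<bar> * P \<le> (K / 2 ^ ?n * r powr a + (M + B * (real ?n * r))) * P" by (simp add: algebra_simps)
    then show ?case using P by (simp only: mult_le_cancel_right_pos)
  qed
  have "((\<lambda>r. K / 2 ^ ?n * r powr a + (M + B * (real ?n * r))) \<longlongrightarrow> K / 2 ^ ?n * 0 powr a + (M + B * (real ?n * 0))) (at_right 0)"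
    using a by (intro tendsto_intros tendsto_powr') (auto intro: eventually_mono[OF eventually_at_right_less])
  then show "((\<lambda>r. K / 2 ^ ?n * r powr a + (M + B * (real ?n * r))) \<longlongrightarrow> M) (at_right 0)" using a by simp
qed simp

section \<open>Bi-Lipschitz maps\<close>

lemma bi_lipschitz_continuous_on: "bi_lipschitz f \<Longrightarrow> continuous_on UNIV f"
proof -
  assume "bi_lipschitz f"
  then obtain L where L: "L > 0" "\<And>x y. dist (f x) (f y) \<le> L * dist x y" unfolding bi_lipschitz_def by blast
  then have "L-lipschitz_on UNIV f" by (auto intro!: lipschitz_onI)
  then show ?thesis by (rule lipschitz_on_continuous_on)
qed

text \<open>The range is open by invariance of domain, closed because preimages of a Cauchy sequence
  form a Cauchy sequence, and the space is connected.\<close>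

lemma bi_lipschitz_surj:
  fixes f :: "'a::euclidean_space \<Rightarrow> 'a"
  assumes "bi_lipschitz f" shows "surj f"
proof -
  obtain L where L: "L > 0" "\<And>x y. dist x y / L \<le> dist (f x) (f y)" using assms unfolding bi_lipschitz_def by blast
  have dle: "dist x y \<le> L * dist (f x) (f y)" for x y using L(1) L(2)[of x y] by (simp add: field_simps)
  have c: "continuous_on UNIV f" by (rule bi_lipschitz_continuous_on[OF assms])
  have "inj f"
  proof (rule injI)
    fix x y assume "f x = f y" then show "x = y" using dle[of x y] by simp
  qed
  then have op: "open (range f)" by (intro invariance_of_domain[OF c]) auto
  have "closed (range f)"
    unfolding closed_sequential_limits
  proof (intro allI impI, elim conjE)
    fix z l assume z: "\<forall>n. z n \<in> range f" "z \<longlonglongrightarrow> l"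
    then have "\<forall>n. \<exists>v. z n = f v" by blast
    then obtain w where w: "\<And>n. z n = f (w n)" by metis
    have "Cauchy w"
    proof (rule metric_CauchyI)
      fix e :: real assume "0 < e"
      then obtain N where N: "\<And>m n. m \<ge> N \<Longrightarrow> n \<ge> N \<Longrightarrow> dist (z m) (z n) < e / L"
        using metric_CauchyD[OF LIMSEQ_imp_Cauchy[OF z(2)], of "e / L"] L(1) by auto
      have "dist (w m) (w n) < e" if "m \<ge> N" "n \<ge> N" for m n
        using dle[of "w m" "w n"] N[OF that] L(1) by (simp add: w field_simps)
      then show "\<exists>M. \<forall>m\<ge>M. \<forall>n\<ge>M. dist (w m) (w n) < e" by blast
    qed
    then obtain v where v: "w \<longlonglongrightarrow> v" using Cauchy_convergent convergent_def by blast
    have "(\<lambda>n. f (w n)) \<longlonglongrightarrow> f v"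
      using v c by (intro isCont_tendsto_compose[of v f]) (auto simp: continuous_on_eq_continuous_at)
    then have "l = f v" using z(2) w LIMSEQ_unique by (metis ext)
    then show "l \<in> range f" by blast
  qed
  with op show ?thesis using clopen[of "range f"] by auto
qed

text \<open>
  For open \<open>U\<close> the indicator of \<open>f -` U\<close> is at most the limit of the densities of \<open>U\<close> in balls around
  \<open>f w\<close>; by Tonelli their integrals only involve the sets \<open>{w. dist (f w) x < e}\<close>, of diameter at
  most \<open>2 L e\<close>.
\<close>

lemma bi_lipschitz_emeasure_vimage:
  fixes f :: "'a::euclidean_space \<Rightarrow> 'a"
  assumes f: "bi_lipschitz f"
  obtains K :: real where "0 \<le> K" "\<And>E. E \<in> sets borel \<Longrightarrow> emeasure lborel (f -` E) \<le> ennreal K * emeasure lborel E"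
proof -
  obtain L where L: "L > 0" "\<And>x y. dist x y / L \<le> dist (f x) (f y)" using f unfolding bi_lipschitz_def by blast
  have dle: "dist x y \<le> L * dist (f x) (f y)" for x y using L(1) L(2)[of x y] by (simp add: field_simps)
  have fm[measurable]: "f \<in> borel_measurable borel" by (rule borel_measurable_continuous_onI[OF bi_lipschitz_continuous_on[OF f]])
  define c where "c = unit_ball_vol (real DIM('a))"
  have c: "c > 0" by (simp add: c_def)
  \<comment> \<open>The volume ratio of a ball of radius \<open>2 * L * e\<close> to one of radius
    \<open>e\<close>.\<close>
  define K where "K = (2 * L) ^ DIM('a)"
  have K: "K \<ge> 0" using L by (simp add: K_def)
  have ball: "emeasure lborel (ball x e) = ennreal (c * e ^ DIM('a))" if "0 \<le> e" for x :: 'a and e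
    using that by (simp add: emeasure_ball c_def)
  have op: "emeasure lborel (f -` U) \<le> ennreal K * emeasure lborel U" if U: "open U" for U
  proof -
    have [measurable]: "U \<in> sets borel" using U by simp
    define e where "e k = inverse (real (Suc k))" for k
    have e: "e k > 0" for k by (simp add: e_def)
    have est: "(\<integral>\<^sup>+w. ennreal (1 / (c * e k ^ DIM('a))) * emeasure lborel (ball (f w) (e k) \<inter> U) \<partial>lborel) \<le> ennreal K * emeasure lborel U" for k
    proof -
      have "(\<integral>\<^sup>+w. emeasure lborel (ball (f w) (e k) \<inter> U) \<partial>lborel)
         = (\<integral>\<^sup>+w. (\<integral>\<^sup>+x. indicator U x * (if dist (f w) x < e k then 1 else 0) \<partial>lborel) \<partial>lborel)"
      proof (rule nn_integral_cong)
        fix w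
        have "(\<integral>\<^sup>+x. indicator U x * (if dist (f w) x < e k then 1 else 0) \<partial>lborel) = (\<integral>\<^sup>+x. indicator (ball (f w) (e k) \<inter> U) x \<partial>lborel)"
          by (intro nn_integral_cong) (auto simp: indicator_def)
        then show "emeasure lborel (ball (f w) (e k) \<inter> U) = (\<integral>\<^sup>+x. indicator U x * (if dist (f w) x < e k then 1 else 0) \<partial>lborel)"
          by simp
      qed
      also have "\<dots> = (\<integral>\<^sup>+x. (\<integral>\<^sup>+w. indicator U x * (if dist (f w) x < e k then 1 else 0) \<partial>lborel) \<partial>lborel)"
        by (rule lborel_pair.Fubini') measurable
      also have "\<dots> \<le> (\<integral>\<^sup>+x. ennreal (c * (2 * L * e k) ^ DIM('a)) * indicator U x \<partial>lborel)"
      proof (rule nn_integral_mono)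
        fix x :: 'a
        have "(\<integral>\<^sup>+w. (if dist (f w) x < e k then 1 else 0) \<partial>lborel) \<le> ennreal (c * (2 * L * e k) ^ DIM('a))"
        proof (cases "\<exists>w0. dist (f w0) x < e k")
          case True
          then obtain w0 where w0: "dist (f w0) x < e k" by blast
          have "dist w0 w < 2 * L * e k" if "dist (f w) x < e k" for w
          proof -
            have "dist w0 w \<le> L * dist (f w0) (f w)" by (rule dle)
            also have "\<dots> < L * (2 * e k)"
              using w0 that L(1) dist_triangle2[of "f w0" "f w" x] by (intro mult_strict_left_mono) auto
            finally show ?thesis by (simp add: mult_ac)
          qed
          then have "(\<integral>\<^sup>+w. (if dist (f w) x < e k then 1 else 0) \<partial>lborel) \<le> (\<integral>\<^sup>+w. indicator (ball w0 (2 * L * e k)) w \<partial>lborel)"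
            by (intro nn_integral_mono) auto
          also have "\<dots> = ennreal (c * (2 * L * e k) ^ DIM('a))" using e[of k] L by (simp add: ball)
          finally show ?thesis .
        next
          case False
          then have "(\<lambda>w. if dist (f w) x < e k then 1 else 0 :: ennreal) = (\<lambda>_. 0)" by (auto simp: fun_eq_iff)
          then show ?thesis by simp
        qed
        then show "(\<integral>\<^sup>+w. indicator U x * (if dist (f w) x < e k then 1 else 0) \<partial>lborel) \<le> ennreal (c * (2 * L * e k) ^ DIM('a)) * indicator U x"
          by (cases "x \<in> U") auto
      qed
      also have "\<dots> = ennreal (c * (2 * L * e k) ^ DIM('a)) * emeasure lborel U" by (rule nn_integral_cmult_indicator) simp
      finally have "ennreal (1 / (c * e k ^ DIM('a))) * (\<integral>\<^sup>+w. emeasure lborel (ball (f w) (e k) \<inter> U) \<partial>lborel)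
        \<le> ennreal (1 / (c * e k ^ DIM('a))) * (ennreal (c * (2 * L * e k) ^ DIM('a)) * emeasure lborel U)" by (rule mult_left_mono) simp
      also have "\<dots> = ennreal (1 / (c * e k ^ DIM('a)) * (c * (2 * L * e k) ^ DIM('a))) * emeasure lborel U"
        using c e[of k] by (subst ennreal_mult') (auto simp: mult.assoc)
      also have "1 / (c * e k ^ DIM('a)) * (c * (2 * L * e k) ^ DIM('a)) = K"
        using c e[of k] by (simp add: K_def power_mult_distrib)
      finally have "ennreal (1 / (c * e k ^ DIM('a))) * (\<integral>\<^sup>+w. emeasure lborel (ball (f w) (e k) \<inter> U) \<partial>lborel) \<le> ennreal K * emeasure lborel U" .
      moreover have [measurable]: "(\<lambda>w. emeasure lborel (ball (f w) (e k) \<inter> U)) \<in> borel_measurable lborel"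
      proof -
        have "{p \<in> space (lborel \<Otimes>\<^sub>M lborel). snd p \<in> ball (f (fst p)) (e k) \<inter> U} \<in> sets ((lborel :: 'a measure) \<Otimes>\<^sub>M (lborel :: 'a measure))"
          unfolding mem_ball Int_iff by measurable
        then show ?thesis by (intro lborel.measurable_emeasure) auto
      qed
      ultimately show ?thesis by (subst nn_integral_cmult) auto
    qed
    have "emeasure lborel (f -` U) = (\<integral>\<^sup>+w. indicator (f -` U) w \<partial>lborel)"
      using measurable_sets[OF fm, of U] by (subst nn_integral_indicator) auto
    also have "\<dots> \<le> (\<integral>\<^sup>+w. liminf (\<lambda>k. ennreal (1 / (c * e k ^ DIM('a))) * emeasure lborel (ball (f w) (e k) \<inter> U)) \<partial>lborel)"
    proof (rule nn_integral_mono)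
      fix w
      show "indicator (f -` U) w \<le> liminf (\<lambda>k. ennreal (1 / (c * e k ^ DIM('a))) * emeasure lborel (ball (f w) (e k) \<inter> U))"
      proof (cases "f w \<in> U")
        case True
        then obtain d where d: "d > 0" "ball (f w) d \<subseteq> U" using U open_contains_ball by blast
        have "\<forall>\<^sub>F k in sequentially. e k < d"
          using order_tendstoD(2)[OF LIMSEQ_inverse_real_of_nat d(1)] by (simp add: e_def)
        then have "\<forall>\<^sub>F k in sequentially. 1 \<le> ennreal (1 / (c * e k ^ DIM('a))) * emeasure lborel (ball (f w) (e k) \<inter> U)"
        proof eventually_elim
          case (elim k)
          then have "ball (f w) (e k) \<inter> U = ball (f w) (e k)" using d(2) by (auto intro: less_trans)
          then have "emeasure lborel (ball (f w) (e k) \<inter> U) = ennreal (c * e k ^ DIM('a))" using ball e[of k] by simp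
          then show ?case using c e[of k] by (simp add: ennreal_mult'[symmetric] del: ennreal_1 flip: ennreal_1)
        qed
        then have "1 \<le> liminf (\<lambda>k. ennreal (1 / (c * e k ^ DIM('a))) * emeasure lborel (ball (f w) (e k) \<inter> U))"
          by (rule Liminf_bounded)
        then show ?thesis using True by simp
      qed simp
    qed
    also have "\<dots> \<le> liminf (\<lambda>k. \<integral>\<^sup>+w. ennreal (1 / (c * e k ^ DIM('a))) * emeasure lborel (ball (f w) (e k) \<inter> U) \<partial>lborel)"
    proof (rule nn_integral_liminf)
      fix k
      have "{p \<in> space (lborel \<Otimes>\<^sub>M lborel). snd p \<in> ball (f (fst p)) (e k) \<inter> U} \<in> sets ((lborel :: 'a measure) \<Otimes>\<^sub>M (lborel :: 'a measure))"
        unfolding mem_ball Int_iff by measurable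
      then have "(\<lambda>w. emeasure lborel (ball (f w) (e k) \<inter> U)) \<in> borel_measurable lborel"
        by (intro lborel.measurable_emeasure) auto
      then show "(\<lambda>w. ennreal (1 / (c * e k ^ DIM('a))) * emeasure lborel (ball (f w) (e k) \<inter> U)) \<in> borel_measurable lborel" by measurable
    qed
    also have "\<dots> \<le> liminf (\<lambda>k::nat. ennreal K * emeasure lborel U)"
      by (intro Liminf_mono always_eventually allI est)
    also have "\<dots> = ennreal K * emeasure lborel U" by (simp add: Liminf_const)
    finally show ?thesis .
  qed
  have "emeasure lborel (f -` E) \<le> ennreal K * emeasure lborel E" if E: "E \<in> sets borel" for E
  proof (rule ennreal_le_epsilon)
    fix \<eta> :: real assume \<eta>: "0 < \<eta>"
    obtain U where U: "open U" "E \<subseteq> U" "emeasure lborel (U - E) < ennreal (\<eta> / (K + 1))"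
      using outer_regular_lborel[OF E, of "\<eta> / (K + 1)"] \<eta> K by (auto simp: ennreal_zero_less_divide)
    have "emeasure lborel (f -` E) \<le> emeasure lborel (f -` U)"
      using U measurable_sets[OF fm, of U] by (intro emeasure_mono) auto
    also have "\<dots> \<le> ennreal K * emeasure lborel U" by (rule op[OF U(1)])
    also have "emeasure lborel U = emeasure lborel E + emeasure lborel (U - E)"
      using U E by (subst plus_emeasure) (auto simp: Un_absorb1)
    also have "ennreal K * (emeasure lborel E + emeasure lborel (U - E)) \<le> ennreal K * emeasure lborel E + ennreal K * ennreal (\<eta> / (K + 1))"
      unfolding distrib_left using U(3) by (intro add_left_mono mult_left_mono) auto
    also have "ennreal K * ennreal (\<eta> / (K + 1)) \<le> ennreal \<eta>"
      using K \<eta> by (simp add: ennreal_mult'[symmetric] field_simps)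
    finally show "emeasure lborel (f -` E) \<le> ennreal K * emeasure lborel E + ennreal \<eta>" by (simp add: add_left_mono)
  qed
  then show ?thesis using K that by blast
qed

text \<open>The image of Lebesgue measure under \<open>f\<close> is at most \<open>K\<close> times
  Lebesgue measure. The last conclusion allows a coefficient to be replaced by a Borel version even
  after composition with \<open>f\<close>.\<close>

lemma bi_lipschitz_nn_integral_le:
  fixes f :: "'a::euclidean_space \<Rightarrow> 'a"
  assumes f: "bi_lipschitz f"
  obtains K :: real where "0 \<le> K"
    "\<And>g. g \<in> borel_measurable borel \<Longrightarrow> (\<integral>\<^sup>+w. g (f w) \<partial>lborel) \<le> ennreal K * (\<integral>\<^sup>+x. g x \<partial>lborel)"
    "\<And>Q. (AE x in lborel. Q x) \<Longrightarrow> (AE w in lborel. Q (f w))"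
proof -
  obtain K :: real where K: "0 \<le> K" "\<And>E. E \<in> sets borel \<Longrightarrow> emeasure lborel (f -` E) \<le> ennreal K * emeasure lborel E"
    using bi_lipschitz_emeasure_vimage[OF f] by blast
  have fm[measurable]: "f \<in> borel_measurable borel" by (rule borel_measurable_continuous_onI[OF bi_lipschitz_continuous_on[OF f]])
  have le: "distr lborel borel f \<le> density lborel (\<lambda>_. ennreal K)"
  proof (subst le_measure)
    show "\<forall>E\<in>sets (distr lborel borel f). emeasure (distr lborel borel f) E \<le> emeasure (density lborel (\<lambda>_. ennreal K)) E"
      using K(2) by (auto simp: emeasure_distr emeasure_density nn_integral_cmult_indicator)
  qed simp
  have 1: "(\<integral>\<^sup>+w. g (f w) \<partial>lborel) \<le> ennreal K * (\<integral>\<^sup>+x. g x \<partial>lborel)" if [measurable]: "g \<in> borel_measurable borel" for g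
  proof -
    have "(\<integral>\<^sup>+w. g (f w) \<partial>lborel) = (\<integral>\<^sup>+x. g x \<partial>distr lborel borel f)" by (subst nn_integral_distr) auto
    also have "\<dots> \<le> (\<integral>\<^sup>+x. g x \<partial>density lborel (\<lambda>_. ennreal K))" by (rule nn_integral_mono_measure[OF _ le]) simp
    also have "\<dots> = ennreal K * (\<integral>\<^sup>+x. g x \<partial>lborel)" by (simp add: nn_integral_density nn_integral_cmult)
    finally show ?thesis .
  qed
  have 2: "AE w in lborel. Q (f w)" if Q: "AE x in lborel. Q x" for Q
  proof -
    obtain N where N: "{x \<in> space lborel. \<not> Q x} \<subseteq> N" "emeasure lborel N = 0" "N \<in> sets lborel" using AE_E[OF Q] by blast
    have "emeasure lborel (f -` N) \<le> 0" using K(2)[of N] N by simp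
    then have "f -` N \<in> null_sets lborel" using measurable_sets[OF fm, of N] N by (auto simp: null_sets_def)
    then show ?thesis by (rule AE_I') (use N in auto)
  qed
  show ?thesis by (rule that[OF K(1) 1 2])
qed

section \<open>First-order Taylor expansion\<close>

text \<open>Cut the step \<open>h\<close> into \<open>N + 1\<close> equal ones and shift each back
  to the starting point by translation invariance: the increment is bounded by \<open>h\<close>
  times the mean of a difference quotient over the cube. As \<open>N\<close> grows the quotients
  converge a.e. to \<open>g\<close>, dominated by the Lipschitz constant.\<close>

lemma lipschitz_translation:
  fixes \<psi> g :: "real^'n::finite \<Rightarrow> real" and \<Lambda> h r :: real
  assumes \<psi>: "\<And>v w. \<bar>\<psi> v - \<psi> w\<bar> \<le> \<Lambda> * norm (v - w)" and g[measurable]: "g \<in> borel_measurable borel"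
    and ae: "AE w in lborel. has_partial \<psi> i (g w) w"
  shows "(\<integral>\<^sup>+v\<in>{v. v \<in> cube y r \<and> v + h *\<^sub>R axis i 1 \<in> cube y r}. ennreal \<bar>\<psi> (v + h *\<^sub>R axis i 1) - \<psi> v\<bar> \<partial>lborel)
    \<le> ennreal \<bar>h\<bar> * (\<integral>\<^sup>+w\<in>cube y r. ennreal \<bar>g w\<bar> \<partial>lborel)"
proof -
  let ?a = "axis i 1 :: real^'n"
  have "\<Lambda>-lipschitz_on UNIV \<psi>"
  proof (rule lipschitz_onI)
    show "0 \<le> \<Lambda>" using \<psi>[of "axis i 1" 0] by (simp add: norm_axis_1)
  qed (use \<psi> in \<open>auto simp: dist_real_def dist_norm\<close>)
  then have "continuous_on UNIV \<psi>" by (rule lipschitz_on_continuous_on)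
  then have [measurable]: "\<psi> \<in> borel_measurable borel" by (rule borel_measurable_continuous_onI)
  have S[measurable]: "{v. v \<in> cube y r \<and> v + h *\<^sub>R ?a \<in> cube y r} \<in> sets borel" for h
  proof (rule borel_closed)
    have "closed (cube y r \<inter> (\<lambda>v. v + h *\<^sub>R ?a) -` cube y r)"
      by (intro closed_Int closed_cube continuous_closed_vimage) (auto intro!: continuous_intros)
    then show "closed {v. v \<in> cube y r \<and> v + h *\<^sub>R ?a \<in> cube y r}" by (simp add: Int_def)
  qed
  have pos: "(\<integral>\<^sup>+v\<in>{v. v \<in> cube y r \<and> v + h *\<^sub>R ?a \<in> cube y r}. ennreal \<bar>\<psi> (v + h *\<^sub>R ?a) - \<psi> v\<bar> \<partial>lborel)
    \<le> ennreal h * (\<integral>\<^sup>+w\<in>cube y r. ennreal \<bar>g w\<bar> \<partial>lborel)" (is "?I h \<le> _") if h: "0 < h" for h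
  proof -
    define t where "t N = h / real (Suc N)" for N
    have t: "t N > 0" for N using h by (simp add: t_def)
    define q where "q N v = ennreal \<bar>(\<psi> (v + t N *\<^sub>R ?a) - \<psi> v) / t N\<bar> * indicator (cube y r) v" for N v
    have [measurable]: "q N \<in> borel_measurable borel" for N unfolding q_def by measurable
    have le: "?I h \<le> ennreal h * (\<integral>\<^sup>+v. q N v \<partial>lborel)" for N
    proof -
      have "?I h \<le> (\<integral>\<^sup>+v. (\<Sum>m<Suc N. ennreal (t N) * q N (v + (real m * t N) *\<^sub>R ?a)) \<partial>lborel)"
      proof (rule nn_integral_mono)
        fix v
        show "ennreal \<bar>\<psi> (v + h *\<^sub>R ?a) - \<psi> v\<bar> * indicator {v. v \<in> cube y r \<and> v + h *\<^sub>R ?a \<in> cube y r} v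
          \<le> (\<Sum>m<Suc N. ennreal (t N) * q N (v + (real m * t N) *\<^sub>R ?a))"
        proof (cases "v \<in> cube y r \<and> v + h *\<^sub>R ?a \<in> cube y r")
          case True
          have inQ: "v + (real m * t N) *\<^sub>R ?a \<in> cube y r" if "m < Suc N" for m
          proof -
            have mt: "0 \<le> real m * t N" "real m * t N \<le> h"
              using t[of N] that h mult_right_mono[of "real m" "real (Suc N)" h] by (auto simp: t_def field_simps)
            show ?thesis unfolding cube_def
            proof (intro CollectI allI)
              fix j
              have 1: "\<bar>v $ j - y $ j\<bar> \<le> r" "\<bar>(v + h *\<^sub>R ?a) $ j - y $ j\<bar> \<le> r" using True by (auto simp: cube_def)
              show "\<bar>(v + (real m * t N) *\<^sub>R ?a) $ j - y $ j\<bar> \<le> r"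
              proof (cases "j = i")
                case True
                then have eq: "(v + h *\<^sub>R ?a) $ j = v $ j + h" "(v + (real m * t N) *\<^sub>R ?a) $ j = v $ j + real m * t N" by (simp_all add: axis_def)
                show ?thesis using 1 mt unfolding eq by linarith
              next
                case False
                then have eq: "(v + (real m * t N) *\<^sub>R ?a) $ j = v $ j" by (simp add: axis_def)
                show ?thesis using 1 unfolding eq by simp
              qed
            qed
          qed
          define p where "p m = \<psi> (v + (real m * t N) *\<^sub>R ?a)" for m
          have "\<psi> (v + h *\<^sub>R ?a) - \<psi> v = p (Suc N) - p 0" by (simp add: p_def t_def)
          also have "\<dots> = (\<Sum>m<Suc N. p (Suc m) - p m)" by (rule sum_lessThan_telescope[symmetric])
          finally have "\<bar>\<psi> (v + h *\<^sub>R ?a) - \<psi> v\<bar> \<le> (\<Sum>m<Suc N. \<bar>p (Suc m) - p m\<bar>)" by (simp only: sum_abs)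
          then have "ennreal \<bar>\<psi> (v + h *\<^sub>R ?a) - \<psi> v\<bar> \<le> ennreal (\<Sum>m<Suc N. \<bar>p (Suc m) - p m\<bar>)" by (rule ennreal_leI)
          also have "\<dots> = (\<Sum>m<Suc N. ennreal \<bar>p (Suc m) - p m\<bar>)" by (rule sum_ennreal[symmetric]) simp
          also have "\<dots> = (\<Sum>m<Suc N. ennreal (t N) * q N (v + (real m * t N) *\<^sub>R ?a))"
          proof (rule sum.cong[OF refl])
            fix m assume "m \<in> {..<Suc N}"
            then have "v + (real m * t N) *\<^sub>R ?a \<in> cube y r" by (intro inQ) simp
            moreover have "p (Suc m) = \<psi> ((v + (real m * t N) *\<^sub>R ?a) + t N *\<^sub>R ?a)" by (simp add: p_def algebra_simps)
            ultimately show "ennreal \<bar>p (Suc m) - p m\<bar> = ennreal (t N) * q N (v + (real m * t N) *\<^sub>R ?a)"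
              using t[of N] by (simp add: q_def p_def ennreal_mult'[symmetric] abs_divide)
          qed
          finally show ?thesis using True by simp
        qed simp
      qed
      also have "\<dots> = (\<Sum>m<Suc N. (\<integral>\<^sup>+v. ennreal (t N) * q N (v + (real m * t N) *\<^sub>R ?a) \<partial>lborel))"
        by (rule nn_integral_sum) measurable
      also have "\<dots> = (\<Sum>m<Suc N. ennreal (t N) * (\<integral>\<^sup>+v. q N v \<partial>lborel))"
      proof (rule sum.cong[OF refl])
        fix m
        have "(\<integral>\<^sup>+v. ennreal (t N) * q N (v + (real m * t N) *\<^sub>R ?a) \<partial>lborel) = ennreal (t N) * (\<integral>\<^sup>+v. q N (v + (real m * t N) *\<^sub>R ?a) \<partial>lborel)"
          by (rule nn_integral_cmult) measurable
        also have "(\<integral>\<^sup>+v. q N (v + (real m * t N) *\<^sub>R ?a) \<partial>lborel) = (\<integral>\<^sup>+v. q N v \<partial>lborel)"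
          by (rule nn_integral_lborel_shift) measurable
        finally show "(\<integral>\<^sup>+v. ennreal (t N) * q N (v + (real m * t N) *\<^sub>R ?a) \<partial>lborel) = ennreal (t N) * (\<integral>\<^sup>+v. q N v \<partial>lborel)" .
      qed
      also have "\<dots> = ennreal (real (Suc N)) * (ennreal (t N) * (\<integral>\<^sup>+v. q N v \<partial>lborel))"
        by (simp only: sum_constant card_lessThan ennreal_of_nat_eq_real_of_nat)
      also have "\<dots> = ennreal (real (Suc N) * t N) * (\<integral>\<^sup>+v. q N v \<partial>lborel)"
        by (subst ennreal_mult') (simp_all only: mult.assoc of_nat_0_le_iff)
      also have "real (Suc N) * t N = h" by (simp add: t_def)
      finally show ?thesis .
    qed
    have "(\<lambda>N. \<integral>\<^sup>+v. q N v \<partial>lborel) \<longlonglongrightarrow> (\<integral>\<^sup>+w\<in>cube y r. ennreal \<bar>g w\<bar> \<partial>lborel)"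
    proof (rule nn_integral_dominated_convergence[where w = "\<lambda>v. ennreal \<Lambda> * indicator (cube y r) v"])
      have "emeasure lborel (cube y r) < \<infinity>" by (rule emeasure_bounded_finite) simp
      then show "(\<integral>\<^sup>+v. ennreal \<Lambda> * indicator (cube y r) v \<partial>lborel) < \<infinity>"
        by (subst nn_integral_cmult_indicator) (auto simp: ennreal_mult_less_top)
      show "AE v in lborel. q N v \<le> ennreal \<Lambda> * indicator (cube y r) v" for N
      proof (rule AE_I2)
        fix v
        have "\<bar>\<psi> (v + t N *\<^sub>R ?a) - \<psi> v\<bar> \<le> \<Lambda> * t N" using \<psi>[of "v + t N *\<^sub>R ?a" v] t[of N] by (simp add: norm_axis_1)
        then have "\<bar>(\<psi> (v + t N *\<^sub>R ?a) - \<psi> v) / t N\<bar> \<le> \<Lambda>" using t[of N] by (simp add: abs_divide field_simps)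
        then show "q N v \<le> ennreal \<Lambda> * indicator (cube y r) v" by (auto simp: q_def indicator_def intro: ennreal_leI)
      qed
      show "AE v in lborel. (\<lambda>N. q N v) \<longlonglongrightarrow> ennreal \<bar>g v\<bar> * indicator (cube y r) v"
        using ae
      proof eventually_elim
        case (elim v)
        have "((\<lambda>\<tau>. (\<psi> (v + \<tau> *\<^sub>R ?a) - \<psi> v) / \<tau>) \<longlongrightarrow> g v) (at 0)"
          using elim by (simp add: has_partial_def DERIV_def)
        moreover have "filterlim t (at 0) sequentially"
        proof -
          have "(\<lambda>N. h * inverse (real (Suc N))) \<longlonglongrightarrow> h * 0" by (intro tendsto_intros LIMSEQ_inverse_real_of_nat)
          then have "t \<longlonglongrightarrow> 0" by (simp only: t_def[abs_def] divide_inverse mult_zero_right)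
          then show ?thesis using t by (simp add: filterlim_at less_imp_neq[symmetric])
        qed
        ultimately have "(\<lambda>N. (\<psi> (v + t N *\<^sub>R ?a) - \<psi> v) / t N) \<longlonglongrightarrow> g v" by (rule filterlim_compose)
        then have "(\<lambda>N. ennreal \<bar>(\<psi> (v + t N *\<^sub>R ?a) - \<psi> v) / t N\<bar>) \<longlonglongrightarrow> ennreal \<bar>g v\<bar>" by (intro tendsto_ennrealI tendsto_rabs)
        then show ?case by (cases "v \<in> cube y r") (auto simp: q_def)
      qed
    qed measurable
    then have "(\<lambda>N. ennreal h * (\<integral>\<^sup>+v. q N v \<partial>lborel)) \<longlonglongrightarrow> ennreal h * (\<integral>\<^sup>+w\<in>cube y r. ennreal \<bar>g w\<bar> \<partial>lborel)"
      by (intro ennreal_tendsto_cmult) auto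
    then show ?thesis by (rule LIMSEQ_le_const) (use le in blast)
  qed
  consider "h > 0" | "h = 0" | "h < 0" by linarith
  then show ?thesis
  proof cases
    case 3
    let ?f = "\<lambda>v. ennreal \<bar>\<psi> (v + h *\<^sub>R ?a) - \<psi> v\<bar> * indicator {v. v \<in> cube y r \<and> v + h *\<^sub>R ?a \<in> cube y r} v"
    have "(\<integral>\<^sup>+v. ?f v \<partial>lborel) = (\<integral>\<^sup>+v. ?f (v + (- h) *\<^sub>R ?a) \<partial>lborel)"
      by (rule nn_integral_lborel_shift[symmetric]) measurable
    also have "\<dots> = (\<integral>\<^sup>+v\<in>{v. v \<in> cube y r \<and> v + (- h) *\<^sub>R ?a \<in> cube y r}. ennreal \<bar>\<psi> (v + (- h) *\<^sub>R ?a) - \<psi> v\<bar> \<partial>lborel)"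
      by (intro nn_integral_cong) (auto simp: indicator_def abs_minus_commute)
    also have "\<dots> \<le> ennreal (- h) * (\<integral>\<^sup>+w\<in>cube y r. ennreal \<bar>g w\<bar> \<partial>lborel)" using 3 by (intro pos) simp
    finally show ?thesis using 3 by simp
  qed (use pos in simp_all)
qed

text \<open>The Campanato constant for exponent \<open>1 + s\<close>, the density bound
  \<open>K\<close> for the image measure, and the dilation \<open>L * n\<close> from a cube to the
  cube containing its image.\<close>

definition taylor_const :: "nat \<Rightarrow> real \<Rightarrow> real \<Rightarrow> real \<Rightarrow> real" where
  "taylor_const n s L K = campanato_const n (1 + s) * (K * (L * n) powr (n + s))"

text \<open>Subtracting the linear part leaves a function \<open>\<psi>\<close> with partial
  derivatives \<open>u k (f w) - l $ k\<close>. The oscillation of \<open>u k\<close> around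
  \<open>f y\<close>, pulled back by \<open>f\<close>, bounds their integral over cubes by order
  \<open>n + s\<close>, one more than \<open>BV_oscillation\<close> offers, so
  \<open>campanato\<close> applies with \<open>a = 1 + s\<close>.\<close>

lemma taylor_oscillation:
  fixes f :: "real^'n::finite \<Rightarrow> real^'n" and F :: "real^'n \<Rightarrow> real" and u :: "'n \<Rightarrow> real^'n \<Rightarrow> real"
    and l :: "real^'n" and L \<Lambda> K v s :: real
  assumes L: "0 < L" "\<And>x y. dist (f x) (f y) \<le> L * dist x y"
    and K: "0 \<le> K" "\<And>g. g \<in> borel_measurable borel \<Longrightarrow> (\<integral>\<^sup>+w. g (f w) \<partial>lborel) \<le> ennreal K * (\<integral>\<^sup>+x. g x \<partial>lborel)"
    and F: "\<And>v w. \<bar>F v - F w\<bar> \<le> \<Lambda> * norm (v - w)"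
    and u[measurable]: "\<And>k. u k \<in> borel_measurable borel"
    and ae: "\<And>k. AE w in lborel. has_partial F k (u k (f w)) w"
    and s: "0 < s" and v: "0 \<le> v"
    and osc: "\<And>k r. 0 < r \<Longrightarrow> (\<integral>\<^sup>+x\<in>cube (f y) r. ennreal \<bar>u k x - l $ k\<bar> \<partial>lborel) \<le> ennreal (v * r powr (real CARD('n) + s))"
    and r: "0 < r"
  shows "(\<integral>\<^sup>+w\<in>cube y r. ennreal \<bar>(F w - l \<bullet> w) - (F y - l \<bullet> y)\<bar> \<partial>lborel)
    \<le> ennreal (taylor_const CARD('n) s L K * v * r powr (real CARD('n) + (1 + s)))"
proof -
  let ?n = "real CARD('n)"
  define \<psi> where "\<psi> w = F w - l \<bullet> w" for w
  have \<psi>: "\<bar>\<psi> v - \<psi> w\<bar> \<le> (\<Lambda> + norm l) * norm (v - w)" for v w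
  proof -
    have "\<bar>\<psi> v - \<psi> w\<bar> = \<bar>(F v - F w) - l \<bullet> (v - w)\<bar>" by (simp add: \<psi>_def inner_diff_right)
    also have "\<dots> \<le> \<bar>F v - F w\<bar> + \<bar>l \<bullet> (v - w)\<bar>" by linarith
    also have "\<dots> \<le> \<Lambda> * norm (v - w) + norm l * norm (v - w)" by (intro add_mono F Cauchy_Schwarz_ineq2)
    finally show ?thesis by (simp add: algebra_simps)
  qed
  have \<Lambda>0: "0 \<le> \<Lambda> + norm l"
  proof -
    obtain k :: 'n where True by simp
    show ?thesis using \<psi>[of "axis k 1" 0] by (simp add: norm_axis_1)
  qed
  have "(\<Lambda> + norm l)-lipschitz_on UNIV \<psi>"
    by (rule lipschitz_onI) (use \<psi> \<Lambda>0 in \<open>auto simp: dist_real_def dist_norm\<close>)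
  then have \<psi>c: "continuous_on UNIV \<psi>" by (rule lipschitz_on_continuous_on)
  then have \<psi>m[measurable]: "\<psi> \<in> borel_measurable borel" by (rule borel_measurable_continuous_onI)
  have "L-lipschitz_on UNIV f" using L by (auto intro!: lipschitz_onI)
  then have fm[measurable]: "f \<in> borel_measurable borel"
    by (intro borel_measurable_continuous_onI lipschitz_on_continuous_on)
  define V where "V = K * (v * (L * ?n) powr (?n + s))"
  have V: "0 \<le> V" using K v by (simp add: V_def)
  obtain l' where l': "\<And>r. 0 < r \<Longrightarrow> (\<integral>\<^sup>+w\<in>cube y r. ennreal \<bar>\<psi> w - l'\<bar> \<partial>lborel) \<le> ennreal (campanato_const CARD('n) (1 + s) * V * r powr (?n + (1 + s)))"
  proof -
    have "\<exists>l'. \<forall>r>0. (\<integral>\<^sup>+w\<in>cube y r. ennreal \<bar>\<psi> w - l'\<bar> \<partial>lborel) \<le> ennreal (campanato_const CARD('n) (1 + s) * V * r powr (?n + (1 + s)))"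
    proof (rule campanato[OF \<psi>m V])
      show "0 < 1 + s" using s by simp
      show "integrable lborel (\<lambda>w. indicator (cube y r) w * \<psi> w)" for r
      proof -
        have "integrable lborel (\<lambda>x. indicator (cube y r) x *\<^sub>R \<psi> x)"
          by (rule borel_integrable_compact) (use continuous_on_subset[OF \<psi>c] in auto)
        then show ?thesis by simp
      qed
      fix i h and r :: real assume r: "0 < r"
      have "(\<integral>\<^sup>+v\<in>{v. v \<in> cube y r \<and> v + h *\<^sub>R axis i 1 \<in> cube y r}. ennreal \<bar>\<psi> (v + h *\<^sub>R axis i 1) - \<psi> v\<bar> \<partial>lborel)
        \<le> ennreal \<bar>h\<bar> * (\<integral>\<^sup>+w\<in>cube y r. ennreal \<bar>u i (f w) - l $ i\<bar> \<partial>lborel)"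
      proof (rule lipschitz_translation[OF \<psi>])
        show "AE w in lborel. has_partial \<psi> i (u i (f w) - l $ i) w"
          using ae[of i]
        proof eventually_elim
          case (elim w)
          have "((\<lambda>\<tau>. l \<bullet> (w + \<tau> *\<^sub>R axis i 1)) has_real_derivative l $ i) (at 0)"
            by (auto simp: inner_add_right inner_axis intro!: derivative_eq_intros)
          from DERIV_diff[OF elim[unfolded has_partial_def] this] show ?case unfolding has_partial_def \<psi>_def .
        qed
      qed measurable
      also have "(\<integral>\<^sup>+w\<in>cube y r. ennreal \<bar>u i (f w) - l $ i\<bar> \<partial>lborel)
        \<le> (\<integral>\<^sup>+w. ennreal \<bar>u i (f w) - l $ i\<bar> * indicator (cube (f y) (L * ?n * r)) (f w) \<partial>lborel)"
      proof (rule nn_integral_mono)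
        fix w
        have "f w \<in> cube (f y) (L * ?n * r)" if "w \<in> cube y r"
        proof (rule cube_of_norm_le)
          have "norm (f w - f y) \<le> L * norm (w - y)" using L(2)[of w y] by (simp add: dist_norm)
          also have "\<dots> \<le> L * (?n * r)" using L(1) norm_le_cube[OF that] by (intro mult_left_mono) auto
          finally show "norm (f w - f y) \<le> L * ?n * r" by (simp add: mult.assoc)
        qed
        then show "ennreal \<bar>u i (f w) - l $ i\<bar> * indicator (cube y r) w \<le> ennreal \<bar>u i (f w) - l $ i\<bar> * indicator (cube (f y) (L * ?n * r)) (f w)"
          by (auto simp: indicator_def)
      qed
      also have "\<dots> \<le> ennreal K * (\<integral>\<^sup>+x\<in>cube (f y) (L * ?n * r). ennreal \<bar>u i x - l $ i\<bar> \<partial>lborel)"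
        by (rule K(2)[of "\<lambda>x. ennreal \<bar>u i x - l $ i\<bar> * indicator (cube (f y) (L * ?n * r)) x"]) measurable
      also have "\<dots> \<le> ennreal K * ennreal (v * (L * ?n * r) powr (?n + s))"
        using L r by (intro mult_left_mono osc) auto
      also have "ennreal \<bar>h\<bar> * (ennreal K * ennreal (v * (L * ?n * r) powr (?n + s))) = ennreal (\<bar>h\<bar> * (V * r powr (?n - 1 + (1 + s))))"
        using K v r L by (simp add: V_def ennreal_mult'[symmetric] powr_mult mult_ac)
      finally show "(\<integral>\<^sup>+v\<in>{v. v \<in> cube y r \<and> v + h *\<^sub>R axis i 1 \<in> cube y r}. ennreal \<bar>\<psi> (v + h *\<^sub>R axis i 1) - \<psi> v\<bar> \<partial>lborel)
        \<le> ennreal (\<bar>h\<bar> * (V * r powr (?n - 1 + (1 + s))))"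
        by (simp add: mult_left_mono)
    qed
    then show ?thesis using that by blast
  qed
  \<comment> \<open>\<open>\<psi>\<close> is Lipschitz, so its Campanato value at \<open>y\<close>
    is its actual value.\<close>
  have "\<bar>l' - \<psi> y\<bar> \<le> 0"
    by (rule le_of_oscillation[OF \<psi>m _ _ \<Lambda>0 l'])
       (use s V campanato_const_nonneg[of "1 + s" "CARD('n)"] \<psi> in auto)
  then have "l' = \<psi> y" by simp
  with l'[OF r] show ?thesis by (simp add: \<psi>_def taylor_const_def V_def mult_ac)
qed

text \<open>On a cube around \<open>y'\<close> of radius \<open>norm (y' - y)\<close> the two
  expansions are compared through \<open>F\<close>. The first summand of the constant comes from the
  two mean remainders. The second bounds \<open>(l' - l) \<bullet> (w - y')\<close>, coordinate by
  coordinate, by the difference of the two gradients times the radius.\<close>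

lemma taylor_two_points:
  fixes f :: "real^'n::finite \<Rightarrow> real^'n" and F :: "real^'n \<Rightarrow> real" and u :: "'n \<Rightarrow> real^'n \<Rightarrow> real"
    and l l' y y' :: "real^'n" and L \<Lambda> K v v' s :: real
  assumes L: "0 < L" "\<And>x y. dist (f x) (f y) \<le> L * dist x y"
    and K: "0 \<le> K" "\<And>g. g \<in> borel_measurable borel \<Longrightarrow> (\<integral>\<^sup>+w. g (f w) \<partial>lborel) \<le> ennreal K * (\<integral>\<^sup>+x. g x \<partial>lborel)"
    and F: "\<And>v w. \<bar>F v - F w\<bar> \<le> \<Lambda> * norm (v - w)"
    and u[measurable]: "\<And>k. u k \<in> borel_measurable borel"
    and ae: "\<And>k. AE w in lborel. has_partial F k (u k (f w)) w"
    and s: "0 < s" and v: "0 \<le> v" "0 \<le> v'"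
    and osc: "\<And>k r. 0 < r \<Longrightarrow> (\<integral>\<^sup>+x\<in>cube (f y) r. ennreal \<bar>u k x - l $ k\<bar> \<partial>lborel) \<le> ennreal (v * r powr (real CARD('n) + s))"
    and osc': "\<And>k r. 0 < r \<Longrightarrow> (\<integral>\<^sup>+x\<in>cube (f y') r. ennreal \<bar>u k x - l' $ k\<bar> \<partial>lborel) \<le> ennreal (v' * r powr (real CARD('n) + s))"
  shows "\<bar>F y' - F y - l \<bullet> (y' - y)\<bar>
    \<le> (taylor_const CARD('n) s L K * 2 powr (1 + s) + CARD('n) * (2 powr s * L powr s)) * (v + v') * norm (y' - y) powr (1 + s)"
proof (cases "y = y'")
  case False
  let ?n = "CARD('n)"
  define \<rho> where "\<rho> = norm (y' - y)"
  have \<rho>: "\<rho> > 0" using False by (simp add: \<rho>_def)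
  define C where "C = taylor_const ?n s L K"
  have C: "C \<ge> 0" unfolding C_def taylor_const_def using K s by (intro mult_nonneg_nonneg campanato_const_nonneg) auto
  define D where "D = 2 powr s * L powr s * (v + v') * \<rho> powr s"
  have D: "D \<ge> 0" using v by (simp add: D_def)
  have ll: "\<bar>l $ k - l' $ k\<bar> \<le> D" for k
  proof -
    have 1: "\<bar>l $ k - l' $ k\<bar> \<le> 2 powr s * (v + v') * norm (f y - f y') powr s"
      by (rule oscillation_two_points[OF u s v osc osc'])
    have 2: "norm (f y - f y') powr s \<le> (L * \<rho>) powr s"
      using L(2)[of y y'] s by (intro powr_mono2) (auto simp: dist_norm \<rho>_def norm_minus_commute)
    from order_trans[OF 1 mult_left_mono[OF 2]] show ?thesis using v L \<rho> by (simp add: D_def powr_mult mult_ac)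
  qed
  define P where "P = (2 * \<rho>) ^ ?n"
  have P: "P > 0" using \<rho> by (simp add: P_def)
  define Z where "Z = \<bar>F y' - F y - l \<bullet> (y' - y)\<bar>"
  let ?q = "\<lambda>w. ennreal \<bar>(F w - l \<bullet> w) - (F y - l \<bullet> y)\<bar> * indicator (cube y (2 * \<rho>)) w"
  let ?q' = "\<lambda>w. ennreal \<bar>(F w - l' \<bullet> w) - (F y' - l' \<bullet> y')\<bar> * indicator (cube y' \<rho>) w"
  have em: "emeasure lborel (cube y' \<rho>) = ennreal P" using \<rho> by (simp add: emeasure_cube P_def)
  have "\<Lambda>-lipschitz_on UNIV F"
  proof (rule lipschitz_onI)
    obtain k :: 'n where True by simp
    show "0 \<le> \<Lambda>" using F[of "axis k 1" 0] by (simp add: norm_axis_1)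
  qed (use F in \<open>auto simp: dist_real_def dist_norm\<close>)
  then have [measurable]: "F \<in> borel_measurable borel"
    by (intro borel_measurable_continuous_onI lipschitz_on_continuous_on)
  have "ennreal (Z * P) = (\<integral>\<^sup>+w. ennreal Z * indicator (cube y' \<rho>) w \<partial>lborel)"
    by (simp add: nn_integral_cmult_indicator em ennreal_mult' Z_def)
  also have "\<dots> \<le> (\<integral>\<^sup>+w. (?q w + ?q' w) + ennreal (?n * D * \<rho>) * indicator (cube y' \<rho>) w \<partial>lborel)"
  proof (rule nn_integral_mono)
    fix w
    show "ennreal Z * indicator (cube y' \<rho>) w \<le> (?q w + ?q' w) + ennreal (?n * D * \<rho>) * indicator (cube y' \<rho>) w"
    proof (cases "w \<in> cube y' \<rho>")
      case True
      have "w \<in> cube y (2 * \<rho>)"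
        unfolding cube_def
      proof (intro CollectI allI)
        fix j
        have "\<bar>w $ j - y' $ j\<bar> \<le> \<rho>" using True by (simp add: cube_def)
        moreover have "\<bar>(y' - y) $ j\<bar> \<le> \<rho>" unfolding \<rho>_def by (rule component_le_norm_cart)
        ultimately show "\<bar>w $ j - y $ j\<bar> \<le> 2 * \<rho>" by simp
      qed
      have "\<bar>(l' - l) \<bullet> (w - y')\<bar> \<le> (\<Sum>k\<in>UNIV. \<bar>(l' - l) $ k * (w - y') $ k\<bar>)"
        unfolding inner_vec_def by simp
      also have "\<dots> \<le> (\<Sum>k\<in>(UNIV :: 'n set). D * \<rho>)"
      proof (rule sum_mono)
        fix k
        have "\<bar>w $ k - y' $ k\<bar> \<le> \<rho>" using True by (simp add: cube_def)
        then show "\<bar>(l' - l) $ k * (w - y') $ k\<bar> \<le> D * \<rho>"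
          unfolding abs_mult using ll[of k] D by (intro mult_mono) (auto simp: abs_minus_commute)
      qed
      finally have 1: "\<bar>(l' - l) \<bullet> (w - y')\<bar> \<le> ?n * D * \<rho>" by simp
      have "F y' - F y - l \<bullet> (y' - y) = ((F w - l \<bullet> w) - (F y - l \<bullet> y)) - ((F w - l' \<bullet> w) - (F y' - l' \<bullet> y')) - (l' - l) \<bullet> (w - y')"
        by (simp add: inner_diff_left inner_diff_right)
      then have "Z \<le> (\<bar>(F w - l \<bullet> w) - (F y - l \<bullet> y)\<bar> + \<bar>(F w - l' \<bullet> w) - (F y' - l' \<bullet> y')\<bar>) + ?n * D * \<rho>"
        unfolding Z_def using 1 by linarith
      then have "ennreal Z \<le> ennreal ((\<bar>(F w - l \<bullet> w) - (F y - l \<bullet> y)\<bar> + \<bar>(F w - l' \<bullet> w) - (F y' - l' \<bullet> y')\<bar>) + ?n * D * \<rho>)" by (rule ennreal_leI)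
      then show ?thesis using True \<open>w \<in> cube y (2 * \<rho>)\<close> D \<rho> by simp
    qed simp
  qed
  also have "\<dots> = (\<integral>\<^sup>+w. ?q w \<partial>lborel) + (\<integral>\<^sup>+w. ?q' w \<partial>lborel) + ennreal (?n * D * \<rho>) * ennreal P"
    by (simp add: nn_integral_add nn_integral_cmult_indicator em)
  also have "\<dots> \<le> ennreal (C * v * (2 * \<rho>) powr (real ?n + (1 + s))) + ennreal (C * v' * \<rho> powr (real ?n + (1 + s))) + ennreal (?n * D * \<rho>) * ennreal P"
    unfolding C_def
    by (intro add_mono order_refl taylor_oscillation[OF L K F u ae s v(1) osc] taylor_oscillation[OF L K F u ae s v(2) osc']) (use \<rho> in auto)
  also have "\<dots> = ennreal (C * v * (2 * \<rho>) powr (real ?n + (1 + s)) + C * v' * \<rho> powr (real ?n + (1 + s)) + ?n * D * \<rho> * P)"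
    using C v D \<rho> P by (simp add: ennreal_mult'[symmetric])
  finally have "Z * P \<le> C * v * (2 * \<rho>) powr (real ?n + (1 + s)) + C * v' * \<rho> powr (real ?n + (1 + s)) + ?n * D * \<rho> * P"
    using C v D \<rho> P by (subst (asm) ennreal_le_iff) auto
  also have "\<dots> \<le> C * v * (2 * \<rho>) powr (real ?n + (1 + s)) + C * v' * (2 * \<rho>) powr (real ?n + (1 + s)) + ?n * D * \<rho> * P"
  proof -
    have "C * v' * \<rho> powr (real ?n + (1 + s)) \<le> C * v' * (2 * \<rho>) powr (real ?n + (1 + s))"
      using C v \<rho> s by (intro mult_left_mono powr_mono2) auto
    then show ?thesis by simp
  qed
  also have "(2 * \<rho>) powr (real ?n + (1 + s)) = P * (2 powr (1 + s) * \<rho> powr (1 + s))"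
  proof -
    have b: "(2 * \<rho>) powr real ?n = P" unfolding P_def by (rule powr_realpow) (use \<rho> in simp)
    have c: "(2 * \<rho>) powr (1 + s) = 2 powr (1 + s) * \<rho> powr (1 + s)" using \<rho> by (simp add: powr_mult)
    show ?thesis by (simp only: powr_add[of "2 * \<rho>" "real ?n" "1 + s"] b c)
  qed
  also have "C * v * (P * (2 powr (1 + s) * \<rho> powr (1 + s))) + C * v' * (P * (2 powr (1 + s) * \<rho> powr (1 + s))) + ?n * D * \<rho> * P
    = ((C * 2 powr (1 + s) + ?n * (2 powr s * L powr s)) * (v + v') * \<rho> powr (1 + s)) * P"
  proof -
    have "\<rho> powr (1 + s) = \<rho> * \<rho> powr s" using \<rho> by (simp add: powr_add)
    then show ?thesis by (simp add: D_def algebra_simps)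
  qed
  finally have "Z \<le> (C * 2 powr (1 + s) + ?n * (2 powr s * L powr s)) * (v + v') * \<rho> powr (1 + s)" using P by simp
  then show ?thesis unfolding Z_def C_def \<rho>_def .
qed simp

section \<open>Riesz kernels\<close>

lemma riesz_kernel_measurable [measurable]:
  "(riesz_kernel p :: 'a::euclidean_space \<Rightarrow> ennreal) \<in> borel_measurable borel"
  unfolding riesz_kernel_def[abs_def] by measurable

lemma riesz_kernel_le:
  assumes "p \<le> 0" "0 < r" "r \<le> norm x"
  shows "riesz_kernel p x \<le> ennreal (r powr p)"
  using assms by (auto simp: riesz_kernel_def intro!: ennreal_leI powr_mono2')

lemma riesz_kernel_ge:
  assumes "p \<le> 0" "0 < r" "norm x \<le> r"
  shows "ennreal (r powr p) \<le> riesz_kernel p x"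
  using assms by (auto simp: riesz_kernel_def intro!: ennreal_leI powr_mono2')

lemma suminf_ennreal_geometric:
  assumes "0 \<le> c" "0 < a"
  shows "(\<Sum>i. ennreal (c * (2 powr - a) ^ i)) = ennreal (c / (1 - 2 powr - a))"
proof -
  have q: "0 < (2::real) powr - a" "(2::real) powr - a < 1" using assms powr_less_mono[of "-a" 0 "2::real"] by auto
  then have "(\<lambda>i. c * (2 powr - a) ^ i) sums (c * (1 / (1 - 2 powr - a)))" by (intro sums_mult geometric_sums) auto
  then show ?thesis using assms q by (subst suminf_ennreal_eq[of _ "c * (1 / (1 - 2 powr - a))"]) auto
qed

text \<open>The ball is exhausted by dyadic shells. On each the kernel is at most its value at the
  inner radius, and the contributions form a geometric series of ratio
  \<open>2 powr - a\<close>.\<close>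

lemma nn_integral_riesz_ball:
  fixes y :: "'a::euclidean_space" and a r :: real
  assumes a: "0 < a" "a \<le> DIM('a)" and r: "0 < r"
  shows "(\<integral>\<^sup>+x\<in>ball y r. riesz_kernel (- real DIM('a) + a) (x - y) \<partial>lborel)
    \<le> ennreal (unit_ball_vol (real DIM('a)) * 2 powr (real DIM('a) - a) / (1 - 2 powr - a) * r powr a)"
proof -
  let ?n = "DIM('a)" and ?p = "- real DIM('a) + a"
  define c where "c = unit_ball_vol (real ?n)"
  have c: "c > 0" by (simp add: c_def)
  let ?b = "\<lambda>i. ennreal ((r / 2 ^ Suc i) powr ?p) * indicator (ball y (r / 2 ^ i)) x"
  have "(\<integral>\<^sup>+x\<in>ball y r. riesz_kernel ?p (x - y) \<partial>lborel)
    \<le> (\<integral>\<^sup>+x. (\<Sum>i. ennreal ((r / 2 ^ Suc i) powr ?p) * indicator (ball y (r / 2 ^ i)) x) \<partial>lborel)"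
  proof (rule nn_integral_mono_AE)
    \<comment> \<open>The centre lies in no shell and the kernel is infinite there.\<close>
    have "AE x in lborel. x \<noteq> y" by (rule AE_lborel_singleton)
    then show "AE x in lborel. riesz_kernel ?p (x - y) * indicator (ball y r) x
      \<le> (\<Sum>i. ennreal ((r / 2 ^ Suc i) powr ?p) * indicator (ball y (r / 2 ^ i)) x)"
    proof eventually_elim
      case (elim x)
      show ?case
      proof (cases "x \<in> ball y r")
        case True
        define d where "d = norm (x - y)"
        have d: "0 < d" "d < r" using elim True by (auto simp: d_def dist_norm norm_minus_commute)
        have ex: "\<exists>k. r / 2 ^ k \<le> d"
        proof -
          obtain k where "r / d < 2 ^ k" using real_arch_pow[of 2 "r / d"] by auto
          then show ?thesis using d by (intro exI[of _ k]) (simp add: field_simps)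
        qed
        define k where "k = (LEAST k. r / 2 ^ k \<le> d)"
        have k: "r / 2 ^ k \<le> d" unfolding k_def by (rule LeastI_ex[OF ex])
        have "k \<noteq> 0" using k d by (cases k) auto
        then obtain i where i: "k = Suc i" by (cases k) auto
        have "\<not> r / 2 ^ i \<le> d" using not_less_Least[of i "\<lambda>k. r / 2 ^ k \<le> d"] i unfolding k_def by simp
        then have xi: "x \<in> ball y (r / 2 ^ i)" by (simp add: d_def dist_norm norm_minus_commute)
        have "riesz_kernel ?p (x - y) \<le> ennreal ((r / 2 ^ Suc i) powr ?p)"
          using k r a by (intro riesz_kernel_le) (auto simp: i d_def)
        also have "\<dots> = (\<Sum>j\<in>{i}. ennreal ((r / 2 ^ Suc j) powr ?p) * indicator (ball y (r / 2 ^ j)) x)" using xi by simp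
        also have "\<dots> \<le> (\<Sum>j. ennreal ((r / 2 ^ Suc j) powr ?p) * indicator (ball y (r / 2 ^ j)) x)"
          by (rule sum_le_suminf[OF summableI]) auto
        finally show ?thesis using True by simp
      qed simp
    qed
  qed
  also have "\<dots> = (\<Sum>i. \<integral>\<^sup>+x. ennreal ((r / 2 ^ Suc i) powr ?p) * indicator (ball y (r / 2 ^ i)) x \<partial>lborel)"
    by (rule nn_integral_suminf) (intro borel_measurable_times_ennreal borel_measurable_const borel_measurable_indicator, simp)
  also have "\<dots> = (\<Sum>i. ennreal (c * 2 powr (real ?n - a) * r powr a * (2 powr - a) ^ i))"
  proof (intro arg_cong[where f = suminf] ext)
    fix i
    have "(\<integral>\<^sup>+x. ennreal ((r / 2 ^ Suc i) powr ?p) * indicator (ball y (r / 2 ^ i)) x \<partial>lborel)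
      = ennreal ((r / 2 ^ Suc i) powr ?p) * ennreal (c * (r / 2 ^ i) ^ ?n)"
      using r by (subst nn_integral_cmult_indicator) (auto simp: emeasure_ball c_def)
    also have "\<dots> = ennreal ((r / 2 ^ Suc i) powr ?p * (c * (r / 2 ^ i) ^ ?n))" by (rule ennreal_mult'[symmetric]) simp
    also have "(r / 2 ^ Suc i) powr ?p * (c * (r / 2 ^ i) ^ ?n) = c * 2 powr (real ?n - a) * r powr a * (2 powr - a) ^ i"
    proof -
      define t where "t = r / 2 ^ i"
      have t: "t > 0" using r by (simp add: t_def)
      have "(r / 2 ^ Suc i) powr ?p = (t * (1 / 2)) powr ?p" by (simp add: t_def field_simps)
      also have "\<dots> = t powr ?p * (1 / 2) powr ?p" by (rule powr_mult)
      also have "(1 / 2) powr ?p = (2::real) powr (real ?n - a)" by (simp add: powr_divide powr_minus_divide[of 2 "real ?n - a", symmetric] flip: powr_minus_divide)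
      finally have 1: "(r / 2 ^ Suc i) powr ?p = t powr ?p * 2 powr (real ?n - a)" .
      have "t powr ?p * t ^ ?n = t powr a" using t by (simp add: powr_realpow[symmetric] powr_add[symmetric])
      moreover have "t powr a = r powr a * (2 powr - a) ^ i"
      proof -
        have "t = r * 2 powr (- real i)" by (simp add: t_def powr_minus_divide powr_realpow)
        then have "t powr a = r powr a * (2 powr (- real i)) powr a" using r by (simp add: powr_mult)
        also have "(2 powr (- real i)) powr a = (2::real) powr (- a * real i)" by (simp add: powr_powr mult.commute)
        also have "\<dots> = (2 powr - a) powr real i" by (simp add: powr_powr)
        also have "\<dots> = (2 powr - a) ^ i" by (simp add: powr_realpow)
        finally show ?thesis .
      qed
      ultimately have "t powr ?p * t ^ ?n = r powr a * (2 powr - a) ^ i" by simp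
      then show ?thesis unfolding 1 t_def[symmetric] by (simp add: mult_ac)
    qed
    finally show "(\<integral>\<^sup>+x. ennreal ((r / 2 ^ Suc i) powr ?p) * indicator (ball y (r / 2 ^ i)) x \<partial>lborel)
      = ennreal (c * 2 powr (real ?n - a) * r powr a * (2 powr - a) ^ i)" .
  qed
  also have "\<dots> = ennreal (c * 2 powr (real ?n - a) * r powr a / (1 - 2 powr - a))"
    using c by (intro suminf_ennreal_geometric a) auto
  finally show ?thesis by (simp add: c_def)
qed

text \<open>The same with shells of growing radius; the series converges since the kernel decays
  faster than the volume grows.\<close>

lemma nn_integral_riesz_outside:
  fixes b r :: real
  assumes b: "0 < b" and r: "0 < r"
  shows "(\<integral>\<^sup>+x. riesz_kernel (- real DIM('a) - b) x * indicator (- ball 0 r) x \<partial>(lborel :: 'a::euclidean_space measure))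
    \<le> ennreal (unit_ball_vol (real DIM('a)) * 2 ^ DIM('a) / (1 - 2 powr - b) * r powr - b)"
proof -
  let ?n = "DIM('a)" and ?p = "- real DIM('a) - b"
  define c where "c = unit_ball_vol (real ?n)"
  have c: "c > 0" by (simp add: c_def)
  have "(\<integral>\<^sup>+x. riesz_kernel ?p x * indicator (- ball 0 r) x \<partial>(lborel :: 'a measure))
    \<le> (\<integral>\<^sup>+x. (\<Sum>i. ennreal ((r * 2 ^ i) powr ?p) * indicator (ball 0 (r * 2 ^ Suc i)) x) \<partial>(lborel :: 'a measure))"
  proof (rule nn_integral_mono)
    fix x :: 'a
    show "riesz_kernel ?p x * indicator (- ball 0 r) x \<le> (\<Sum>i. ennreal ((r * 2 ^ i) powr ?p) * indicator (ball 0 (r * 2 ^ Suc i)) x)"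
    proof (cases "r \<le> norm x")
      case True
      have ex: "\<exists>k. norm x < r * 2 ^ k"
      proof -
        obtain k where "norm x / r < 2 ^ k" using real_arch_pow[of 2 "norm x / r"] by auto
        then show ?thesis using r by (intro exI[of _ k]) (simp add: field_simps)
      qed
      define k where "k = (LEAST k. norm x < r * 2 ^ k)"
      have k: "norm x < r * 2 ^ k" unfolding k_def by (rule LeastI_ex[OF ex])
      have "k \<noteq> 0" using k True by (cases k) auto
      then obtain i where i: "k = Suc i" by (cases k) auto
      have "\<not> norm x < r * 2 ^ i" using not_less_Least[of i "\<lambda>k. norm x < r * 2 ^ k"] i unfolding k_def by simp
      then have "riesz_kernel ?p x \<le> ennreal ((r * 2 ^ i) powr ?p)"
        using r b by (intro riesz_kernel_le) auto
      also have "\<dots> = (\<Sum>j\<in>{i}. ennreal ((r * 2 ^ j) powr ?p) * indicator (ball 0 (r * 2 ^ Suc j)) x)" using k i by simp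
      also have "\<dots> \<le> (\<Sum>j. ennreal ((r * 2 ^ j) powr ?p) * indicator (ball 0 (r * 2 ^ Suc j)) x)"
        by (rule sum_le_suminf[OF summableI]) auto
      finally show ?thesis using True by simp
    qed simp
  qed
  also have "\<dots> = (\<Sum>i. \<integral>\<^sup>+x. ennreal ((r * 2 ^ i) powr ?p) * indicator (ball 0 (r * 2 ^ Suc i)) x \<partial>(lborel :: 'a measure))"
    by (rule nn_integral_suminf) (intro borel_measurable_times_ennreal borel_measurable_const borel_measurable_indicator, simp)
  also have "\<dots> = (\<Sum>i. ennreal (c * 2 ^ ?n * r powr - b * (2 powr - b) ^ i))"
  proof (intro arg_cong[where f = suminf] ext)
    fix i
    have "(\<integral>\<^sup>+x. ennreal ((r * 2 ^ i) powr ?p) * indicator (ball 0 (r * 2 ^ Suc i)) x \<partial>(lborel :: 'a measure))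
      = ennreal ((r * 2 ^ i) powr ?p) * ennreal (c * (r * 2 ^ Suc i) ^ ?n)"
      using r by (subst nn_integral_cmult_indicator) (auto simp: emeasure_ball c_def)
    also have "\<dots> = ennreal ((r * 2 ^ i) powr ?p * (c * (r * 2 ^ Suc i) ^ ?n))" by (rule ennreal_mult'[symmetric]) simp
    also have "(r * 2 ^ i) powr ?p * (c * (r * 2 ^ Suc i) ^ ?n) = c * 2 ^ ?n * r powr - b * (2 powr - b) ^ i"
    proof -
      define t where "t = r * 2 ^ i"
      have t: "t > 0" using r by (simp add: t_def)
      have "r * 2 ^ Suc i = 2 * t" by (simp add: t_def)
      then have 1: "(r * 2 ^ Suc i) ^ ?n = 2 ^ ?n * t ^ ?n" by (simp only: power_mult_distrib)
      have "t powr ?p * t ^ ?n = t powr - b" using t by (simp add: powr_realpow[symmetric] powr_add[symmetric])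
      moreover have "t powr - b = r powr - b * (2 powr - b) ^ i"
      proof -
        have "t = r * 2 powr (real i)" by (simp add: t_def powr_realpow)
        then have "t powr - b = r powr - b * (2 powr (real i)) powr - b" using r by (simp add: powr_mult)
        also have "(2 powr (real i)) powr - b = (2 powr - b) powr real i" by (simp add: powr_powr mult.commute)
        also have "\<dots> = (2 powr - b) ^ i" by (simp add: powr_realpow)
        finally show ?thesis .
      qed
      ultimately have "t powr ?p * t ^ ?n = r powr - b * (2 powr - b) ^ i" by simp
      then show ?thesis unfolding 1 t_def[symmetric] by (simp add: mult_ac)
    qed
    finally show "(\<integral>\<^sup>+x. ennreal ((r * 2 ^ i) powr ?p) * indicator (ball 0 (r * 2 ^ Suc i)) x \<partial>(lborel :: 'a measure))
      = ennreal (c * 2 ^ ?n * r powr - b * (2 powr - b) ^ i)" .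
  qed
  also have "\<dots> = ennreal (c * 2 ^ ?n * r powr - b / (1 - 2 powr - b))"
    using c by (intro suminf_ennreal_geometric b) auto
  finally show ?thesis by (simp add: c_def)
qed

text \<open>With \<open>r = norm y / 2\<close> there are three regions. Within \<open>r\<close> of
  one singularity the other factor is at most a power of \<open>r\<close>; away from both, the
  product is bounded by a multiple of \<open>norm x powr (a + b - 2 * n)\<close>, integrable at
  infinity because \<open>a + b < n\<close>. All three contribute the same power of
  \<open>r\<close>.\<close>

lemma riesz_composition_le:
  fixes a b :: real
  assumes a: "0 < a" and b: "0 < b" and ab: "a + b < DIM('a)"
  obtains C :: real where "0 \<le> C"
    "\<And>y :: 'a::euclidean_space. y \<noteq> 0 \<Longrightarrow>
      (\<integral>\<^sup>+x. riesz_kernel (- real DIM('a) + a) x * riesz_kernel (- real DIM('a) + b) (x - y) \<partial>lborel)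
        \<le> ennreal C * riesz_kernel (- real DIM('a) + a + b) y"
proof -
  let ?n = "real DIM('a)"
  have n: "a < ?n" "b < ?n" using a b ab by auto
  define A where "A = unit_ball_vol ?n * 2 powr (?n - a) / (1 - 2 powr - a)"
  define B where "B = unit_ball_vol ?n * 2 powr (?n - b) / (1 - 2 powr - b)"
  define D where "D = unit_ball_vol ?n * 2 ^ DIM('a) / (1 - 2 powr - (?n - a - b))"
  have q: "(2::real) powr - t < 1" if "0 < t" for t :: real using powr_less_mono[of "-t" 0 "2::real"] that by simp
  have ABD: "0 \<le> A" "0 \<le> B" "0 \<le> D" unfolding A_def B_def D_def using a b ab q[of a] q[of b] q[of "?n - a - b"] by auto
  define h where "h = (1 / 2 :: real) powr (- ?n + a + b)"
  define C where "C = (A + B + 3 powr (?n - b) * D) * h"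
  have C: "0 \<le> C" unfolding C_def h_def using ABD by (intro mult_nonneg_nonneg add_nonneg_nonneg) auto
  have "(\<integral>\<^sup>+x. riesz_kernel (- ?n + a) x * riesz_kernel (- ?n + b) (x - y) \<partial>lborel) \<le> ennreal C * riesz_kernel (- ?n + a + b) y"
    if y: "y \<noteq> 0" for y :: 'a
  proof -
    define r where "r = norm y / 2"
    have r: "r > 0" using y by (simp add: r_def)
    let ?f1 = "\<lambda>x::'a. ennreal (r powr (- ?n + b)) * (riesz_kernel (- ?n + a) (x - 0) * indicator (ball 0 r) x)"
    let ?f2 = "\<lambda>x::'a. ennreal (r powr (- ?n + a)) * (riesz_kernel (- ?n + b) (x - y) * indicator (ball y r) x)"
    let ?f3 = "\<lambda>x::'a. ennreal (3 powr (?n - b)) * (riesz_kernel (- ?n - (?n - a - b)) x * indicator (- ball 0 r) x)"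
    have "(\<integral>\<^sup>+x. riesz_kernel (- ?n + a) x * riesz_kernel (- ?n + b) (x - y) \<partial>lborel)
      \<le> (\<integral>\<^sup>+x. (?f1 x + ?f2 x) + ?f3 x \<partial>lborel)"
    proof (rule nn_integral_mono)
      fix x :: 'a
      show "riesz_kernel (- ?n + a) x * riesz_kernel (- ?n + b) (x - y) \<le> (?f1 x + ?f2 x) + ?f3 x"
      proof -
        have tri: "norm y \<le> norm x + norm (x - y)" using norm_triangle_ineq[of x "y - x"] by (simp add: norm_minus_commute)
        consider "norm x < r" | "norm (x - y) < r" | "r \<le> norm x" "r \<le> norm (x - y)" by linarith
        then show ?thesis
        proof cases
          case 1
          then have "r \<le> norm (x - y)" using tri by (simp add: r_def)
          then have "riesz_kernel (- ?n + b) (x - y) \<le> ennreal (r powr (- ?n + b))" using r n by (intro riesz_kernel_le) auto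
          then have "riesz_kernel (- ?n + a) x * riesz_kernel (- ?n + b) (x - y) \<le> riesz_kernel (- ?n + a) x * ennreal (r powr (- ?n + b))"
            by (rule mult_left_mono) simp
          also have "\<dots> = ?f1 x" using 1 by (simp add: mult.commute)
          also have "\<dots> \<le> (?f1 x + ?f2 x) + ?f3 x" by (simp add: add.assoc)
          finally show ?thesis .
        next
          case 2
          then have "r \<le> norm x" using tri by (simp add: r_def)
          then have "riesz_kernel (- ?n + a) x \<le> ennreal (r powr (- ?n + a))" using r n by (intro riesz_kernel_le) auto
          then have "riesz_kernel (- ?n + a) x * riesz_kernel (- ?n + b) (x - y) \<le> ennreal (r powr (- ?n + a)) * riesz_kernel (- ?n + b) (x - y)"
            by (rule mult_right_mono) simp
          also have "\<dots> = ?f2 x" using 2 by (simp add: dist_norm norm_minus_commute)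
          also have "\<dots> \<le> (?f1 x + ?f2 x) + ?f3 x" by (simp add: add.assoc add.left_commute)
          finally show ?thesis .
        next
          case 3
          have x0: "x \<noteq> 0" using 3 r by auto
          \<comment> \<open>In this region \<open>norm y = 2 * r \<le> 2 * norm (x - y)\<close>, so
            the kernel at \<open>x - y\<close> is comparable to one at \<open>x\<close>.\<close>
          have "norm x \<le> 3 * norm (x - y)"
            using 3 norm_triangle_ineq[of "x - y" y] by (simp add: r_def)
          then have "riesz_kernel (- ?n + b) (x - y) \<le> ennreal ((norm x / 3) powr (- ?n + b))"
            using x0 n by (intro riesz_kernel_le) auto
          also have "(norm x / 3) powr (- ?n + b) = 3 powr (?n - b) * norm x powr (- ?n + b)"
            by (simp add: powr_divide powr_minus_divide[of 3 "?n - b", simplified])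
          finally have "riesz_kernel (- ?n + a) x * riesz_kernel (- ?n + b) (x - y) \<le> riesz_kernel (- ?n + a) x * ennreal (3 powr (?n - b) * norm x powr (- ?n + b))"
            by (rule mult_left_mono) simp
          also have "\<dots> = ennreal (norm x powr (- ?n + a) * (3 powr (?n - b) * norm x powr (- ?n + b)))"
            using x0 by (simp add: riesz_kernel_def ennreal_mult'[symmetric])
          also have "norm x powr (- ?n + a) * (3 powr (?n - b) * norm x powr (- ?n + b)) = 3 powr (?n - b) * norm x powr (- ?n - (?n - a - b))"
          proof -
            have "norm x powr (- ?n + a) * norm x powr (- ?n + b) = norm x powr (- ?n - (?n - a - b))"
              by (simp add: powr_add[symmetric] algebra_simps)
            then show ?thesis by (simp add: mult_ac)
          qed
          also have "ennreal (3 powr (?n - b) * norm x powr (- ?n - (?n - a - b))) = ?f3 x"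
            using x0 3 by (simp add: riesz_kernel_def ennreal_mult')
          also have "\<dots> \<le> (?f1 x + ?f2 x) + ?f3 x" by simp
          finally show ?thesis .
        qed
      qed
    qed
    also have "\<dots> = (\<integral>\<^sup>+x. ?f1 x \<partial>lborel) + (\<integral>\<^sup>+x. ?f2 x \<partial>lborel) + (\<integral>\<^sup>+x. ?f3 x \<partial>lborel)"
    proof -
      have [measurable]: "ball z r \<in> sets borel" "- ball z r \<in> sets borel" for z :: 'a by auto
      have "?f1 \<in> borel_measurable borel" "?f2 \<in> borel_measurable borel" "?f3 \<in> borel_measurable borel"
        by (measurable, measurable, measurable)
      then show ?thesis by (simp add: nn_integral_add)
    qed
    also have "\<dots> \<le> ennreal (r powr (- ?n + b)) * ennreal (A * r powr a) + ennreal (r powr (- ?n + a)) * ennreal (B * r powr b)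
        + ennreal (3 powr (?n - b)) * ennreal (D * r powr - (?n - a - b))"
    proof (intro add_mono)
      have [measurable]: "ball z r \<in> sets borel" for z :: 'a by simp
      have g1: "(\<integral>\<^sup>+x. riesz_kernel (- ?n + a) (x - 0) * indicator (ball 0 r) x \<partial>(lborel :: 'a measure)) \<le> ennreal (A * r powr a)"
        unfolding A_def by (rule nn_integral_riesz_ball[OF a _ r]) (use n in simp)
      show "(\<integral>\<^sup>+x. ?f1 x \<partial>lborel) \<le> ennreal (r powr (- ?n + b)) * ennreal (A * r powr a)"
        by (subst nn_integral_cmult, measurable) (rule mult_left_mono[OF g1], simp)
      have g2: "(\<integral>\<^sup>+x. riesz_kernel (- ?n + b) (x - y) * indicator (ball y r) x \<partial>lborel) \<le> ennreal (B * r powr b)"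
        unfolding B_def by (rule nn_integral_riesz_ball[OF b _ r]) (use n in simp)
      show "(\<integral>\<^sup>+x. ?f2 x \<partial>lborel) \<le> ennreal (r powr (- ?n + a)) * ennreal (B * r powr b)"
        by (subst nn_integral_cmult, measurable) (rule mult_left_mono[OF g2], simp)
      show "(\<integral>\<^sup>+x. ?f3 x \<partial>lborel) \<le> ennreal (3 powr (?n - b)) * ennreal (D * r powr - (?n - a - b))"
        using nn_integral_riesz_outside[of "?n - a - b" r, where 'a = 'a] r ab
        by (subst nn_integral_cmult) (auto simp: D_def intro!: mult_left_mono)
    qed
    also have "\<dots> = ennreal (r powr (- ?n + b) * (A * r powr a) + r powr (- ?n + a) * (B * r powr b) + 3 powr (?n - b) * (D * r powr - (?n - a - b)))"
      using ABD by (simp add: ennreal_mult'[symmetric])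
    also have "r powr (- ?n + b) * (A * r powr a) + r powr (- ?n + a) * (B * r powr b) + 3 powr (?n - b) * (D * r powr - (?n - a - b)) = C * norm y powr (- ?n + a + b)"
    proof -
      have 1: "r powr (- ?n + b) * r powr a = r powr (- ?n + a + b)" "r powr (- ?n + a) * r powr b = r powr (- ?n + a + b)"
        using powr_add[of r "- ?n + b" a] powr_add[of r "- ?n + a" b] by (simp_all add: algebra_simps)
      have 2: "r powr - (?n - a - b) = r powr (- ?n + a + b)" by (simp add: algebra_simps)
      have "r powr (- ?n + b) * (A * r powr a) + r powr (- ?n + a) * (B * r powr b) + 3 powr (?n - b) * (D * r powr - (?n - a - b))
        = A * (r powr (- ?n + b) * r powr a) + B * (r powr (- ?n + a) * r powr b) + 3 powr (?n - b) * D * r powr (- ?n + a + b)"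
        unfolding 2 by (simp add: mult_ac)
      also have "\<dots> = (A + B + 3 powr (?n - b) * D) * r powr (- ?n + a + b)" unfolding 1 by (simp add: algebra_simps)
      also have "r powr (- ?n + a + b) = (norm y * (1 / 2)) powr (- ?n + a + b)" by (simp add: r_def)
      also have "\<dots> = norm y powr (- ?n + a + b) * h" unfolding h_def by (rule powr_mult)
      finally show ?thesis by (simp add: C_def mult_ac)
    qed
    also have "ennreal (C * norm y powr (- ?n + a + b)) = ennreal C * riesz_kernel (- ?n + a + b) y"
      using y C by (simp add: riesz_kernel_def ennreal_mult')
    finally show ?thesis .
  qed
  with C show ?thesis using that by blast
qed

text \<open>The ball around \<open>y\<close> of radius \<open>norm (p - y)\<close> alone contributes
  the required amount. For \<open>p = y\<close> the left-hand side is infinite, and balls of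
  arbitrarily small radius show that the integral exceeds every bound.\<close>

lemma riesz_composition_ge:
  fixes a b :: real
  assumes a: "0 < a" and b: "0 < b" and ab: "a + b < DIM('a)"
  obtains c :: real where "0 < c"
    "\<And>p y :: 'a::euclidean_space. ennreal c * riesz_kernel (- real DIM('a) + a + b) (p - y) \<le>
      (\<integral>\<^sup>+x. riesz_kernel (- real DIM('a) + a) (p - x) * riesz_kernel (- real DIM('a) + b) (x - y) \<partial>lborel)"
proof -
  let ?n = "real DIM('a)"
  have n: "a < ?n" "b < ?n" using a b ab by auto
  define c where "c = 2 powr (- ?n + a) * unit_ball_vol ?n"
  have c: "0 < c" by (simp add: c_def)
  have main: "ennreal (c * r powr (- ?n + a + b)) \<le> (\<integral>\<^sup>+x. riesz_kernel (- ?n + a) (p - x) * riesz_kernel (- ?n + b) (x - y) \<partial>lborel)"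
    if r: "0 < r" "norm (p - y) \<le> r" for p y :: 'a and r
  proof -
    have "(\<integral>\<^sup>+x. ennreal ((2 * r) powr (- ?n + a) * r powr (- ?n + b)) * indicator (ball y r) x \<partial>lborel)
      \<le> (\<integral>\<^sup>+x. riesz_kernel (- ?n + a) (p - x) * riesz_kernel (- ?n + b) (x - y) \<partial>lborel)"
    proof (rule nn_integral_mono)
      fix x :: 'a
      show "ennreal ((2 * r) powr (- ?n + a) * r powr (- ?n + b)) * indicator (ball y r) x \<le> riesz_kernel (- ?n + a) (p - x) * riesz_kernel (- ?n + b) (x - y)"
      proof (cases "x \<in> ball y r")
        case True
        then have xy: "norm (x - y) \<le> r" by (simp add: dist_norm norm_minus_commute)
        then have px: "norm (p - x) \<le> 2 * r" using r norm_triangle_ineq[of "p - y" "y - x"] by (simp add: norm_minus_commute)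
        have "ennreal ((2 * r) powr (- ?n + a)) * ennreal (r powr (- ?n + b)) \<le> riesz_kernel (- ?n + a) (p - x) * riesz_kernel (- ?n + b) (x - y)"
          by (intro mult_mono riesz_kernel_ge) (use n r xy px in auto)
        then show ?thesis using True by (simp add: ennreal_mult')
      qed simp
    qed
    also have "(\<integral>\<^sup>+x. ennreal ((2 * r) powr (- ?n + a) * r powr (- ?n + b)) * indicator (ball y r) x \<partial>lborel)
      = ennreal ((2 * r) powr (- ?n + a) * r powr (- ?n + b)) * ennreal (unit_ball_vol ?n * r ^ DIM('a))"
      using r by (subst nn_integral_cmult_indicator) (auto simp: emeasure_ball)
    also have "\<dots> = ennreal ((2 * r) powr (- ?n + a) * r powr (- ?n + b) * (unit_ball_vol ?n * r ^ DIM('a)))"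
      by (rule ennreal_mult'[symmetric]) simp
    also have "(2 * r) powr (- ?n + a) * r powr (- ?n + b) * (unit_ball_vol ?n * r ^ DIM('a)) = c * r powr (- ?n + a + b)"
    proof -
      have "(2 * r) powr (- ?n + a) = 2 powr (- ?n + a) * r powr (- ?n + a)" using r by (simp add: powr_mult)
      moreover have "r powr (- ?n + a) * (r powr (- ?n + b) * r ^ DIM('a)) = r powr (- ?n + a + b)"
        using r by (simp add: powr_realpow[symmetric] powr_add[symmetric] add_ac)
      ultimately show ?thesis by (simp add: c_def mult_ac)
    qed
    finally show ?thesis .
  qed
  have "ennreal c * riesz_kernel (- ?n + a + b) (p - y) \<le> (\<integral>\<^sup>+x. riesz_kernel (- ?n + a) (p - x) * riesz_kernel (- ?n + b) (x - y) \<partial>lborel)"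
    (is "_ \<le> ?R") for p y :: 'a
  proof (cases "p = y")
    case False
    then show ?thesis using main[of "norm (p - y)" p y] c by (simp add: riesz_kernel_def ennreal_mult')
  next
    case True
    have "ennreal M \<le> ?R" for M
    proof -
      have e: "- ?n + a + b < 0" using ab by simp
      define q where "q = ?n - a - b"
      have q: "q > 0" using ab by (simp add: q_def)
      \<comment> \<open>The radius at which the lower bound equals \<open>max 1 M\<close>.\<close>
      define r where "r = (max 1 M / c) powr (- (1 / q))"
      have m: "max 1 M / c > 0" using c by simp
      have "- (1 / q) * (- ?n + a + b) = 1" using q by (simp add: q_def field_simps)
      then have "r powr (- ?n + a + b) = (max 1 M / c) powr 1" unfolding r_def powr_powr by simp
      then have "c * r powr (- ?n + a + b) = max 1 M" using m c by simp
      moreover have "r > 0" unfolding r_def powr_gt_zero using m by linarith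
      ultimately have "ennreal (max 1 M) \<le> ?R" using main[of r p y] True by simp
      moreover have "ennreal M \<le> ennreal (max 1 M)" by (rule ennreal_leI) simp
      ultimately show ?thesis by (rule order_trans[rotated])
    qed
    note all = this
    have "?R = \<top>"
    proof (rule ccontr)
      assume "?R \<noteq> \<top>"
      then obtain R where R: "?R = ennreal R" "0 \<le> R" by (cases ?R) auto
      show False using all[of "R + 1"] R by simp
    qed
    then show ?thesis by simp
  qed
  with c show ?thesis using that by blast
qed

section \<open>From the moment conditions to a finite mean potential\<close>

lemma riesz_kernel_scale_le:
  fixes p L :: real
  assumes "p \<le> 0" and L: "0 < L" and le: "norm x \<le> L * norm y"
  shows "riesz_kernel p y \<le> ennreal (L powr - p) * riesz_kernel p x"
proof (cases "x = 0")
  case True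
  then show ?thesis using L by (simp add: riesz_kernel_def ennreal_mult_top)
next
  case False
  then have y: "y \<noteq> 0" using le by auto
  have "norm y powr p \<le> (norm x / L) powr p"
    using False le L assms(1) by (intro powr_mono2') (auto simp: field_simps)
  also have "\<dots> = L powr - p * norm x powr p" using L by (simp add: powr_divide powr_minus_divide)
  finally show ?thesis using False y by (simp add: riesz_kernel_def ennreal_mult'[symmetric] ennreal_leI)
qed

text \<open>The kernel is bounded below on balls, so they have finite measure. This supplies the
  sigma-finiteness of the variation measures on which the uses of Tonelli's theorem rely.\<close>

lemma sigma_finite_of_riesz_moment:
  fixes \<nu> :: "'a::euclidean_space measure" and p :: real
  assumes \<nu> [measurable_cong]: "sets \<nu> = sets borel" and p: "p \<le> 0"
    and fin: "(\<integral>\<^sup>+x. riesz_kernel p (x - x0) \<partial>\<nu>) < \<infinity>"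
  shows "sigma_finite_measure \<nu>"
proof
  have sp: "space \<nu> = UNIV" using sets_eq_imp_space_eq[OF \<nu>] by simp
  have "emeasure \<nu> (ball x0 (real (Suc n))) \<noteq> \<infinity>" for n
  proof
    let ?B = "ball x0 (real (Suc n))"
    assume inf: "emeasure \<nu> ?B = \<infinity>"
    have B: "?B \<in> sets \<nu>" by (simp add: \<nu>)
    have pos: "0 < real (Suc n) powr p" by simp
    have "(\<integral>\<^sup>+x. ennreal (real (Suc n) powr p) * indicator ?B x \<partial>\<nu>) \<le> (\<integral>\<^sup>+x. riesz_kernel p (x - x0) \<partial>\<nu>)"
    proof (rule nn_integral_mono)
      fix x
      show "ennreal (real (Suc n) powr p) * indicator ?B x \<le> riesz_kernel p (x - x0)"
        using riesz_kernel_ge[OF p, of "real (Suc n)" "x - x0"]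
        by (auto simp: indicator_def dist_norm norm_minus_commute)
    qed
    also have "(\<integral>\<^sup>+x. ennreal (real (Suc n) powr p) * indicator ?B x \<partial>\<nu>) = ennreal (real (Suc n) powr p) * emeasure \<nu> ?B"
      by (rule nn_integral_cmult_indicator[OF B])
    also have "\<dots> = \<infinity>" unfolding inf using pos by (simp add: ennreal_mult_top)
    finally show False using fin by simp
  qed
  moreover have "(\<Union>n. ball x0 (real (Suc n))) = space \<nu>"
  proof -
    have "\<exists>n. x \<in> ball x0 (real (Suc n))" for x
    proof -
      obtain n where "dist x0 x < real n" using reals_Archimedean2 by blast
      then show ?thesis by (intro exI[of _ n]) simp
    qed
    then show ?thesis using sp by blast
  qed
  ultimately show "\<exists>A. countable A \<and> A \<subseteq> sets \<nu> \<and> \<Union> A = space \<nu> \<and> (\<forall>a\<in>A. emeasure \<nu> a \<noteq> \<infinity>)"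
    by (intro exI[of _ "range (\<lambda>n. ball x0 (real (Suc n)))"]) (auto simp: \<nu>)
qed

text \<open>This raises the order of the moment condition by \<open>b\<close>. The lower composition
  bound writes the kernel of order \<open>a + b\<close> as a mixture over \<open>x\<close> of
  kernels of order \<open>a\<close>, Tonelli lets \<open>moment\<close> act on each of them, and the
  upper composition bound evaluates the result. The excluded point \<open>x = 0\<close> is a null
  set.\<close>

lemma riesz_moment_bound:
  fixes G :: "'b \<Rightarrow> 'a::euclidean_space" and a b d c :: real
  assumes M: "sigma_finite_measure M" and [measurable]: "G \<in> borel_measurable M"
    and a: "0 < a" and b: "0 < b" and ab: "a + b < DIM('a)" and d: "0 < d" and db: "d + b < DIM('a)" and c: "0 \<le> c"
    and moment: "\<And>x. x \<noteq> 0 \<Longrightarrow> (\<integral>\<^sup>+w. riesz_kernel (- real DIM('a) + a) (G w - x) \<partial>M) \<le> ennreal c * riesz_kernel (- real DIM('a) + d) x"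
  obtains C :: real where "0 \<le> C"
    "\<And>y. y \<noteq> 0 \<Longrightarrow> (\<integral>\<^sup>+w. riesz_kernel (- real DIM('a) + a + b) (G w - y) \<partial>M) \<le> ennreal C * riesz_kernel (- real DIM('a) + d + b) y"
proof -
  let ?n = "real DIM('a)"
  interpret M: sigma_finite_measure M by fact
  interpret pair_sigma_finite M "lborel :: 'a measure" ..
  obtain C where C: "0 \<le> C" "\<And>y :: 'a. y \<noteq> 0 \<Longrightarrow>
      (\<integral>\<^sup>+x. riesz_kernel (- ?n + d) x * riesz_kernel (- ?n + b) (x - y) \<partial>lborel) \<le> ennreal C * riesz_kernel (- ?n + d + b) y"
    using riesz_composition_le[OF d b db] by auto
  obtain k where k: "0 < k" "\<And>p y :: 'a. ennreal k * riesz_kernel (- ?n + a + b) (p - y) \<le>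
      (\<integral>\<^sup>+x. riesz_kernel (- ?n + a) (p - x) * riesz_kernel (- ?n + b) (x - y) \<partial>lborel)"
    using riesz_composition_ge[OF a b ab] by auto
  have bound: "(\<integral>\<^sup>+w. riesz_kernel (- ?n + a + b) (G w - y) \<partial>M) \<le> ennreal (c * C / k) * riesz_kernel (- ?n + d + b) y"
    if y: "y \<noteq> 0" for y
  proof -
    have "ennreal k * (\<integral>\<^sup>+w. riesz_kernel (- ?n + a + b) (G w - y) \<partial>M) = (\<integral>\<^sup>+w. ennreal k * riesz_kernel (- ?n + a + b) (G w - y) \<partial>M)"
      by (rule nn_integral_cmult[symmetric]) measurable
    also have "\<dots> \<le> (\<integral>\<^sup>+w. (\<integral>\<^sup>+x. riesz_kernel (- ?n + a) (G w - x) * riesz_kernel (- ?n + b) (x - y) \<partial>lborel) \<partial>M)"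
      by (rule nn_integral_mono) (rule k(2))
    also have "\<dots> = (\<integral>\<^sup>+x. (\<integral>\<^sup>+w. riesz_kernel (- ?n + a) (G w - x) * riesz_kernel (- ?n + b) (x - y) \<partial>M) \<partial>lborel)"
      by (rule Fubini'[symmetric]) measurable
    also have "\<dots> = (\<integral>\<^sup>+x. (\<integral>\<^sup>+w. riesz_kernel (- ?n + a) (G w - x) \<partial>M) * riesz_kernel (- ?n + b) (x - y) \<partial>lborel)"
      by (intro nn_integral_cong nn_integral_multc) measurable
    also have "\<dots> \<le> (\<integral>\<^sup>+x. ennreal c * (riesz_kernel (- ?n + d) x * riesz_kernel (- ?n + b) (x - y)) \<partial>lborel)"
    proof (rule nn_integral_mono_AE)
      have "AE x :: 'a in lborel. x \<noteq> 0" by (rule AE_lborel_singleton)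
      then show "AE x in lborel. (\<integral>\<^sup>+w. riesz_kernel (- ?n + a) (G w - x) \<partial>M) * riesz_kernel (- ?n + b) (x - y)
          \<le> ennreal c * (riesz_kernel (- ?n + d) x * riesz_kernel (- ?n + b) (x - y))"
      proof eventually_elim
        case (elim x)
        show ?case using mult_right_mono[OF moment[OF elim], of "riesz_kernel (- ?n + b) (x - y)"] by (simp add: mult_ac)
      qed
    qed
    also have "\<dots> = ennreal c * (\<integral>\<^sup>+x. riesz_kernel (- ?n + d) x * riesz_kernel (- ?n + b) (x - y) \<partial>lborel)"
      by (rule nn_integral_cmult) measurable
    also have "\<dots> \<le> ennreal c * (ennreal C * riesz_kernel (- ?n + d + b) y)"
      by (rule mult_left_mono[OF C(2)[OF y]]) simp
    finally have "ennreal (1 / k) * (ennreal k * (\<integral>\<^sup>+w. riesz_kernel (- ?n + a + b) (G w - y) \<partial>M))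
        \<le> ennreal (1 / k) * (ennreal c * (ennreal C * riesz_kernel (- ?n + d + b) y))"
      by (rule mult_left_mono) simp
    moreover have "ennreal (1 / k) * (ennreal k * u) = u" for u
      using k(1) by (simp add: mult.assoc[symmetric] ennreal_mult'[symmetric])
    moreover have "ennreal (1 / k) * (ennreal c * (ennreal C * u)) = ennreal (c * C / k) * u" for u
      using k(1) c C(1) by (simp add: mult.assoc[symmetric] ennreal_mult'[symmetric])
    ultimately show ?thesis by simp
  qed
  have "0 \<le> c * C / k" using c C(1) k(1) by simp
  then show ?thesis using that[of "c * C / k"] bound by blast
qed

text \<open>Integrate over \<open>M\<close> first. Writing \<open>z\<close> as an image under
  \<open>f\<close>, the kernel in the target is comparable to one in the source, where
  \<open>moment\<close> applies; mapping back gives the kernel centred at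
  \<open>f y0\<close>.\<close>

lemma bi_lipschitz_riesz_moment:
  fixes G :: "'b \<Rightarrow> 'a::euclidean_space" and f :: "'a \<Rightarrow> 'c::euclidean_space" and \<nu> :: "'c measure" and p q L C :: real
  assumes M: "sigma_finite_measure M" and G [measurable]: "G \<in> borel_measurable M"
    and L: "0 < L" "\<And>x y. dist x y / L \<le> dist (f x) (f y)" "\<And>x y. dist (f x) (f y) \<le> L * dist x y"
    and f: "surj f"
    and p: "p \<le> 0" and q: "q \<le> 0" and C: "0 \<le> C"
    and moment: "\<And>y. y \<noteq> 0 \<Longrightarrow> (\<integral>\<^sup>+w. riesz_kernel p (G w - y) \<partial>M) \<le> ennreal C * riesz_kernel q y"
    and \<nu> [measurable_cong]: "sets \<nu> = sets borel"
    and fin: "(\<integral>\<^sup>+z. riesz_kernel q (z - f y0) \<partial>\<nu>) < \<infinity>"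
  shows "(\<integral>\<^sup>+w. (\<integral>\<^sup>+z. riesz_kernel p (f (G w + y0) - z) \<partial>\<nu>) \<partial>M) < \<infinity>"
proof -
  interpret M: sigma_finite_measure M by fact
  interpret \<nu>: sigma_finite_measure \<nu> by (rule sigma_finite_of_riesz_moment[OF \<nu> q fin])
  interpret pair_sigma_finite M \<nu> ..
  have fm [measurable]: "f \<in> borel_measurable borel"
  proof (rule borel_measurable_continuous_onI)
    have "L-lipschitz_on UNIV f" using L by (intro lipschitz_onI) auto
    then show "continuous_on UNIV f" by (rule lipschitz_on_continuous_on)
  qed
  \<comment> \<open>\<open>C + 1\<close> keeps \<open>D\<close> positive: at \<open>z = f y0\<close>
    the kernel on the right is infinite, but \<open>0 * \<infinity> = 0\<close>.\<close>
  define D where "D = L powr - p * (C + 1) * L powr - q"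
  have "(\<integral>\<^sup>+w. riesz_kernel p (f (G w + y0) - z) \<partial>M) \<le> ennreal D * riesz_kernel q (z - f y0)" for z
  proof (cases "z = f y0")
    case True
    have "0 < D" using L C by (simp add: D_def)
    then show ?thesis using True by (simp add: riesz_kernel_def ennreal_mult_top)
  next
    case False
    obtain \<zeta> where \<zeta>: "z = f \<zeta>" using f by (auto simp: surj_def)
    have nz: "\<zeta> - y0 \<noteq> 0" using False \<zeta> by auto
    have "riesz_kernel p (f (G w + y0) - z) \<le> ennreal (L powr - p) * riesz_kernel p (G w - (\<zeta> - y0))" for w
    proof (rule riesz_kernel_scale_le[OF p L(1)])
      have "dist (G w + y0) \<zeta> \<le> L * dist (f (G w + y0)) z"
        using L(2)[of "G w + y0" \<zeta>] L(1) by (simp add: \<zeta> field_simps)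
      then show "norm (G w - (\<zeta> - y0)) \<le> L * norm (f (G w + y0) - z)" by (simp add: dist_norm algebra_simps)
    qed
    then have "(\<integral>\<^sup>+w. riesz_kernel p (f (G w + y0) - z) \<partial>M) \<le> (\<integral>\<^sup>+w. ennreal (L powr - p) * riesz_kernel p (G w - (\<zeta> - y0)) \<partial>M)"
      by (intro nn_integral_mono)
    also have "\<dots> = ennreal (L powr - p) * (\<integral>\<^sup>+w. riesz_kernel p (G w - (\<zeta> - y0)) \<partial>M)"
      by (rule nn_integral_cmult) measurable
    also have "\<dots> \<le> ennreal (L powr - p) * (ennreal C * riesz_kernel q (\<zeta> - y0))"
      by (rule mult_left_mono[OF moment[OF nz]]) simp
    also have "riesz_kernel q (\<zeta> - y0) \<le> ennreal (L powr - q) * riesz_kernel q (z - f y0)"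
      using L(3)[of \<zeta> y0] by (intro riesz_kernel_scale_le[OF q L(1)]) (simp add: dist_norm \<zeta>)
    also have "ennreal (L powr - p) * (ennreal C * (ennreal (L powr - q) * riesz_kernel q (z - f y0)))
        = ennreal (L powr - p * C * L powr - q) * riesz_kernel q (z - f y0)"
      using C by (simp add: mult.assoc[symmetric] ennreal_mult'[symmetric])
    also have "\<dots> \<le> ennreal D * riesz_kernel q (z - f y0)"
      unfolding D_def by (intro mult_right_mono ennreal_leI mult_left_mono) simp_all
    finally show ?thesis by (simp add: mult_left_mono)
  qed
  note bound = this
  have "(\<integral>\<^sup>+w. (\<integral>\<^sup>+z. riesz_kernel p (f (G w + y0) - z) \<partial>\<nu>) \<partial>M) = (\<integral>\<^sup>+z. (\<integral>\<^sup>+w. riesz_kernel p (f (G w + y0) - z) \<partial>M) \<partial>\<nu>)"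
    by (rule Fubini'[symmetric]) measurable
  also have "\<dots> \<le> (\<integral>\<^sup>+z. ennreal D * riesz_kernel q (z - f y0) \<partial>\<nu>)"
    by (rule nn_integral_mono) (rule bound)
  also have "\<dots> = ennreal D * (\<integral>\<^sup>+z. riesz_kernel q (z - f y0) \<partial>\<nu>)"
    by (rule nn_integral_cmult) measurable
  also have "\<dots> < \<infinity>" using fin by (simp add: ennreal_mult_less_top)
  finally show ?thesis .
qed

section \<open>Potentials along the paths of a process\<close>

text \<open>By continuity of the paths the process is the limit of processes frozen at the last
  point of a grid. Those take their time argument from a countable set, so joint measurability
  reduces to that of single \<open>Z t\<close>.\<close>

lemma continuous_process_measurable:
  fixes Z :: "real \<Rightarrow> 'w \<Rightarrow> 'a::euclidean_space"
  assumes [measurable]: "\<And>t. Z t \<in> borel_measurable M"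
    and cont: "\<And>w. w \<in> space M \<Longrightarrow> continuous_on UNIV (\<lambda>t. Z t w)"
  shows "(\<lambda>x. Z (snd x) (fst x)) \<in> borel_measurable (M \<Otimes>\<^sub>M borel)"
proof (rule borel_measurable_LIMSEQ_metric)
  fix k :: nat
  show "(\<lambda>x. Z (of_int \<lfloor>real (Suc k) * snd x\<rfloor> / real (Suc k)) (fst x)) \<in> borel_measurable (M \<Otimes>\<^sub>M borel)"
  proof (rule measurable_compose_countable[where f = "\<lambda>i x. Z (of_int i / real (Suc k)) (fst x)" and g = "\<lambda>x. \<lfloor>real (Suc k) * snd x\<rfloor>"])
    fix i :: int
    show "(\<lambda>x. Z (of_int i / real (Suc k)) (fst x)) \<in> borel_measurable (M \<Otimes>\<^sub>M borel)"
      by measurable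
    show "(\<lambda>x. \<lfloor>real (Suc k) * snd x\<rfloor>) \<in> M \<Otimes>\<^sub>M borel \<rightarrow>\<^sub>M count_space UNIV"
      by measurable
  qed
next
  fix x :: "'w \<times> real" assume "x \<in> space (M \<Otimes>\<^sub>M borel)"
  then have x: "fst x \<in> space M" by (auto simp: space_pair_measure)
  have "(\<lambda>k. of_int \<lfloor>real (Suc k) * snd x\<rfloor> / real (Suc k)) \<longlonglongrightarrow> snd x"
  proof (rule real_tendsto_sandwich)
    show "(\<lambda>k. snd x - 1 / real (Suc k)) \<longlonglongrightarrow> snd x"
      using tendsto_diff[OF tendsto_const[of "snd x"] LIMSEQ_inverse_real_of_nat] by (simp add: inverse_eq_divide)
    show "(\<lambda>k. snd x) \<longlonglongrightarrow> snd x" by simp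
    have "snd x - 1 / real (Suc k) \<le> of_int \<lfloor>real (Suc k) * snd x\<rfloor> / real (Suc k)
      \<and> of_int \<lfloor>real (Suc k) * snd x\<rfloor> / real (Suc k) \<le> snd x" for k
    proof -
      define m where "m = real (Suc k)"
      have m: "m > 0" by (simp add: m_def)
      have fl: "m * snd x - 1 \<le> of_int \<lfloor>m * snd x\<rfloor>" "of_int \<lfloor>m * snd x\<rfloor> \<le> m * snd x"
        by (rule real_of_int_floor_ge_diff_one, rule of_int_floor_le)
      have fl2: "(m * snd x - 1) / m \<le> of_int \<lfloor>m * snd x\<rfloor> / m" "of_int \<lfloor>m * snd x\<rfloor> / m \<le> m * snd x / m"
        by (rule divide_right_mono[OF fl(1) less_imp_le[OF m]], rule divide_right_mono[OF fl(2) less_imp_le[OF m]])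
      show ?thesis using fl2 m unfolding m_def[symmetric] by (simp add: diff_divide_distrib)
    qed
    then show "\<forall>\<^sub>F k in sequentially. snd x - 1 / real (Suc k) \<le> of_int \<lfloor>real (Suc k) * snd x\<rfloor> / real (Suc k)"
      "\<forall>\<^sub>F k in sequentially. of_int \<lfloor>real (Suc k) * snd x\<rfloor> / real (Suc k) \<le> snd x" by auto
  qed
  then show "(\<lambda>k. Z (of_int \<lfloor>real (Suc k) * snd x\<rfloor> / real (Suc k)) (fst x)) \<longlonglongrightarrow> Z (snd x) (fst x)"
    by (rule continuous_on_tendsto_compose[OF cont[OF x]]) auto
qed

text \<open>The assumptions on \<open>Y\<close> hold only for times in \<open>{0..T}\<close> and
  almost surely, whereas joint measurability needs every path continuous on the whole line. Times
  are clamped, and paths in a measurable null set are replaced by 0.\<close>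

lemma continuous_modification:
  fixes Y :: "real \<Rightarrow> 'w \<Rightarrow> 'a::euclidean_space"
  assumes T: "0 \<le> T" and Y: "\<And>t. t \<in> {0..T} \<Longrightarrow> Y t \<in> borel_measurable M"
    and cont: "AE w in M. continuous_on {0..T} (\<lambda>t. Y t w)"
  obtains Z where "\<And>t. Z t \<in> borel_measurable M" "\<And>w. continuous_on UNIV (\<lambda>t. Z t w)"
    "AE w in M. \<forall>t\<in>{0..T}. Z t w = Y t w"
proof -
  obtain N where N: "{w\<in>space M. \<not> continuous_on {0..T} (\<lambda>t. Y t w)} \<subseteq> N" "N \<in> null_sets M"
    using cont by (auto elim!: AE_E intro: null_setsI)
  define Z where "Z t w = (if w \<in> space M - N then Y (max 0 (min T t)) w else 0)" for t w
  have [measurable]: "N \<in> sets M" using N(2) by auto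
  have cl: "max 0 (min T t) \<in> {0..T}" for t using T by auto
  have "Z t \<in> borel_measurable M" for t
  proof -
    have [measurable]: "Y (max 0 (min T t)) \<in> borel_measurable M" by (rule Y[OF cl])
    show ?thesis unfolding Z_def by measurable
  qed
  moreover have "continuous_on UNIV (\<lambda>t. Z t w)" for w
  proof (cases "w \<in> space M - N")
    case True
    then have c: "continuous_on {0..T} (\<lambda>t. Y t w)" using N(1) by auto
    have "continuous_on UNIV (\<lambda>t. Y (max 0 (min T t)) w)"
      by (rule continuous_on_compose2[OF c]) (use cl in \<open>auto intro!: continuous_intros\<close>)
    then show ?thesis using True by (simp add: Z_def)
  next
    case False
    then have eq: "(\<lambda>t. Z t w) = (\<lambda>t. 0)" unfolding Z_def by (intro ext if_not_P)
    show ?thesis unfolding eq by (rule continuous_on_const)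
  qed
  moreover have "AE w in M. \<forall>t\<in>{0..T}. Z t w = Y t w"
    using AE_not_in[OF N(2)] AE_space by eventually_elim (simp add: Z_def)
  ultimately show ?thesis by (rule that)
qed

text \<open>Chance and time are treated as a single parameter of the moment lemmas. The work is done
  for a continuous modification, which is jointly measurable, and the conclusion is carried back to
  \<open>Y\<close> almost surely.\<close>

lemma process_potential_finite_AE:
  fixes Y :: "real \<Rightarrow> 'w \<Rightarrow> 'a::euclidean_space" and f :: "'a \<Rightarrow> 'c::euclidean_space" and \<nu> :: "'c measure"
    and a b d c L T :: real
  assumes P: "prob_space P" and T: "0 \<le> T"
    and Y: "\<And>t. t \<in> {0..T} \<Longrightarrow> Y t \<in> borel_measurable P"
    and cont: "AE w in P. continuous_on {0..T} (\<lambda>t. Y t w)"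
    and a: "0 < a" and b: "0 < b" and ab: "a + b < DIM('a)" and d: "0 < d" and db: "d + b < DIM('a)" and c: "0 \<le> c"
    and moment: "\<And>x. x \<noteq> 0 \<Longrightarrow>
      (\<integral>\<^sup>+w. (\<integral>\<^sup>+t\<in>{0..T}. riesz_kernel (- real DIM('a) + a) (Y t w - x) \<partial>lebesgue) \<partial>P) \<le> ennreal (c * norm x powr (- real DIM('a) + d))"
    and L: "0 < L" "\<And>x y. dist x y / L \<le> dist (f x) (f y)" "\<And>x y. dist (f x) (f y) \<le> L * dist x y"
    and f: "surj f"
    and \<nu> [measurable_cong]: "sets \<nu> = sets borel"
    and fin: "(\<integral>\<^sup>+z. riesz_kernel (- real DIM('a) + d + b) (z - f y0) \<partial>\<nu>) < \<infinity>"
  shows "AE w in P. (\<integral>\<^sup>+t\<in>{0..T}. (\<integral>\<^sup>+z. riesz_kernel (- real DIM('a) + a + b) (f (Y t w + y0) - z) \<partial>\<nu>) \<partial>lborel) < \<infinity>"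
proof -
  let ?n = "real DIM('a)"
  interpret P: prob_space P by fact
  interpret \<nu>: sigma_finite_measure \<nu> by (rule sigma_finite_of_riesz_moment[OF \<nu> _ fin]) (use db in simp)
  obtain Z where Z [measurable]: "\<And>t. Z t \<in> borel_measurable P" and Zc: "\<And>w. continuous_on UNIV (\<lambda>t. Z t w)"
    and ZY: "AE w in P. \<forall>t\<in>{0..T}. Z t w = Y t w"
    using continuous_modification[OF T Y cont] by blast
  \<comment> \<open>Time becomes a finite measure, so that \<open>P \<Otimes>\<^sub>M Q\<close> is
    sigma-finite and can serve as the measure \<open>M\<close> of
    \<open>riesz_moment_bound\<close>.\<close>
  define Q where "Q = density lborel (\<lambda>t. indicator {0..T} t :: ennreal)"
  have sQ [measurable_cong, simp]: "sets Q = sets borel" by (simp add: Q_def)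
  interpret Q: finite_measure Q
    by (rule finite_measureI) (use T in \<open>simp add: Q_def emeasure_density\<close>)
  interpret PQ: pair_sigma_finite P Q ..
  have Zm: "(\<lambda>x. Z (snd x) (fst x)) \<in> borel_measurable (P \<Otimes>\<^sub>M borel)"
    using Z Zc by (rule continuous_process_measurable)
  have Zm' [measurable]: "(\<lambda>x. Z (snd x) (fst x)) \<in> borel_measurable (P \<Otimes>\<^sub>M Q)"
    using Zm by (simp cong: measurable_cong_sets add: sets_pair_measure_cong[of P P Q borel])
  have Zt [measurable]: "(\<lambda>t. Z t w) \<in> borel_measurable borel" for w
    using Zc by (rule borel_measurable_continuous_onI)
  have int_Q: "(\<integral>\<^sup>+t. u t \<partial>Q) = (\<integral>\<^sup>+t\<in>{0..T}. u t \<partial>lborel)" if "u \<in> borel_measurable borel" for u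
    using that unfolding Q_def by (subst nn_integral_density) (simp_all add: mult.commute)
  have fm [measurable]: "f \<in> borel_measurable borel"
  proof (rule borel_measurable_continuous_onI)
    have "L-lipschitz_on UNIV f" using L by (intro lipschitz_onI) auto
    then show "continuous_on UNIV f" by (rule lipschitz_on_continuous_on)
  qed
  have mom: "(\<integral>\<^sup>+x. riesz_kernel (- ?n + a) (Z (snd x) (fst x) - y) \<partial>(P \<Otimes>\<^sub>M Q)) \<le> ennreal c * riesz_kernel (- ?n + d) y"
    if y: "y \<noteq> 0" for y
  proof -
    have "(\<integral>\<^sup>+x. riesz_kernel (- ?n + a) (Z (snd x) (fst x) - y) \<partial>(P \<Otimes>\<^sub>M Q))
        = (\<integral>\<^sup>+w. (\<integral>\<^sup>+t. riesz_kernel (- ?n + a) (Z t w - y) \<partial>Q) \<partial>P)"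
      by (subst Q.nn_integral_fst[symmetric]) simp_all
    also have "\<dots> = (\<integral>\<^sup>+w. (\<integral>\<^sup>+t\<in>{0..T}. riesz_kernel (- ?n + a) (Y t w - y) \<partial>lebesgue) \<partial>P)"
    proof (rule nn_integral_cong_AE)
      show "AE w in P. (\<integral>\<^sup>+t. riesz_kernel (- ?n + a) (Z t w - y) \<partial>Q) = (\<integral>\<^sup>+t\<in>{0..T}. riesz_kernel (- ?n + a) (Y t w - y) \<partial>lebesgue)"
        using ZY
      proof eventually_elim
        case (elim w)
        have "(\<integral>\<^sup>+t. riesz_kernel (- ?n + a) (Z t w - y) \<partial>Q) = (\<integral>\<^sup>+t\<in>{0..T}. riesz_kernel (- ?n + a) (Z t w - y) \<partial>lborel)"
          by (rule int_Q) measurable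
        also have "\<dots> = (\<integral>\<^sup>+t\<in>{0..T}. riesz_kernel (- ?n + a) (Z t w - y) \<partial>lebesgue)"
          by (rule nn_integral_completion[symmetric]) 
        also have "\<dots> = (\<integral>\<^sup>+t\<in>{0..T}. riesz_kernel (- ?n + a) (Y t w - y) \<partial>lebesgue)"
          by (rule nn_integral_cong) (use elim in \<open>auto simp: indicator_def\<close>)
        finally show ?case .
      qed
    qed
    also have "\<dots> \<le> ennreal (c * norm y powr (- ?n + d))" by (rule moment[OF y])
    also have "\<dots> = ennreal c * riesz_kernel (- ?n + d) y" using y c by (simp add: riesz_kernel_def ennreal_mult')
    finally show ?thesis .
  qed
  have sf: "sigma_finite_measure (P \<Otimes>\<^sub>M Q)" by (rule PQ.sigma_finite_measure_axioms)
  obtain C where C: "0 \<le> C" "\<And>y. y \<noteq> 0 \<Longrightarrow>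
      (\<integral>\<^sup>+x. riesz_kernel (- ?n + a + b) (Z (snd x) (fst x) - y) \<partial>(P \<Otimes>\<^sub>M Q)) \<le> ennreal C * riesz_kernel (- ?n + d + b) y"
    by (rule riesz_moment_bound[OF sf Zm' a b ab d db c mom]) auto
  have "(\<integral>\<^sup>+x. (\<integral>\<^sup>+z. riesz_kernel (- ?n + a + b) (f (Z (snd x) (fst x) + y0) - z) \<partial>\<nu>) \<partial>(P \<Otimes>\<^sub>M Q)) < \<infinity>"
    by (rule bi_lipschitz_riesz_moment[OF sf Zm' L f _ _ C(1) C(2) \<nu> fin]) (use ab db in auto)
  then have "(\<integral>\<^sup>+w. (\<integral>\<^sup>+t. (\<integral>\<^sup>+z. riesz_kernel (- ?n + a + b) (f (Z t w + y0) - z) \<partial>\<nu>) \<partial>Q) \<partial>P) \<noteq> \<infinity>"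
    by (subst (asm) Q.nn_integral_fst[symmetric]) simp_all
  moreover have "(\<lambda>w. \<integral>\<^sup>+t. (\<integral>\<^sup>+z. riesz_kernel (- ?n + a + b) (f (Z t w + y0) - z) \<partial>\<nu>) \<partial>Q) \<in> borel_measurable P"
  proof -
    have m1: "(\<lambda>x. \<integral>\<^sup>+z. riesz_kernel (- ?n + a + b) (f (Z (snd x) (fst x) + y0) - z) \<partial>\<nu>) \<in> borel_measurable (P \<Otimes>\<^sub>M Q)"
      by measurable
    show ?thesis using Q.borel_measurable_nn_integral_fst[OF m1] by simp
  qed
  ultimately have "AE w in P. (\<integral>\<^sup>+t. (\<integral>\<^sup>+z. riesz_kernel (- ?n + a + b) (f (Z t w + y0) - z) \<partial>\<nu>) \<partial>Q) \<noteq> \<infinity>"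
    by (rule nn_integral_PInf_AE[rotated])
  then show ?thesis using ZY
  proof eventually_elim
    case (elim w)
    have "(\<integral>\<^sup>+t. (\<integral>\<^sup>+z. riesz_kernel (- ?n + a + b) (f (Z t w + y0) - z) \<partial>\<nu>) \<partial>Q)
      = (\<integral>\<^sup>+t\<in>{0..T}. (\<integral>\<^sup>+z. riesz_kernel (- ?n + a + b) (f (Z t w + y0) - z) \<partial>\<nu>) \<partial>lborel)"
      by (rule int_Q) measurable
    also have "\<dots> = (\<integral>\<^sup>+t\<in>{0..T}. (\<integral>\<^sup>+z. riesz_kernel (- ?n + a + b) (f (Y t w + y0) - z) \<partial>\<nu>) \<partial>lborel)"
      by (rule nn_integral_cong) (use elim in \<open>auto simp: indicator_def\<close>)
    finally show ?case using elim(1) by (simp add: top.not_eq_extremum)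
  qed
qed

section \<open>Solutions along a path\<close>

lemma nn_integral_abs_powr_le:
  fixes c p T :: real
  assumes p: "-1 < p" and c: "0 \<le> c" "c \<le> T"
  shows "(\<integral>\<^sup>+q\<in>{0<..<T}. ennreal (\<bar>c - q\<bar> powr p) \<partial>lborel) \<le> ennreal (2 * (T powr (p + 1) / (p + 1)))"
proof -
  have "(\<integral>\<^sup>+q\<in>{0<..<T}. ennreal (\<bar>c - q\<bar> powr p) \<partial>lborel)
    \<le> (\<integral>\<^sup>+q. ennreal ((c - q) powr p) * indicator {0<..<c} q + ennreal ((q - c) powr p) * indicator {c<..<T} q \<partial>lborel)"
    by (rule nn_integral_mono) (auto simp: indicator_def abs_if)
  also have "\<dots> = ennreal ((c - 0) powr (p + 1) / (p + 1)) + ennreal ((T - c) powr (p + 1) / (p + 1))"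
    by (subst nn_integral_add) (simp_all only: nn_integral_powr_left[OF p c(1)] nn_integral_powr_right[OF p c(2)], measurable)
  also have "\<dots> \<le> ennreal (T powr (p + 1) / (p + 1)) + ennreal (T powr (p + 1) / (p + 1))"
    using p c by (intro add_mono ennreal_leI divide_right_mono powr_mono2) auto
  also have "\<dots> = ennreal (2 * (T powr (p + 1) / (p + 1)))" using p by (simp add: ennreal_plus[symmetric] del: ennreal_plus)
  finally show ?thesis .
qed

text \<open>
  Across the jump at \<open>t\<^sub>0\<close> one has \<open>\<bar>r - q\<bar> = \<bar>t\<^sub>0 - r\<bar> + \<bar>t\<^sub>0 - q\<bar>\<close>, so the singular kernel
  is dominated by a product of two integrable functions.
\<close>

lemma marchaud_integrable_cutoff:
  fixes h :: "real \<Rightarrow> real" and V :: "real \<Rightarrow> ennreal" and T t0 \<theta> \<beta> M :: real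
  assumes h [measurable]: "h \<in> borel_measurable borel" and bd: "\<And>t. \<bar>h t\<bar> \<le> M"
    and V [measurable]: "V \<in> borel_measurable borel" and Vfin: "(\<integral>\<^sup>+t\<in>{0<..<T}. V t \<partial>lborel) < \<infinity>"
    and osc: "\<And>u r. 0 < u \<Longrightarrow> u < T \<Longrightarrow> 0 < r \<Longrightarrow> r < T \<Longrightarrow> ennreal \<bar>h u - h r\<bar> \<le> ennreal (\<bar>u - r\<bar> powr \<beta>) * (V u + V r)"
    and \<theta>: "0 < \<theta>" "\<theta> < \<beta>" "\<theta> < 1" and t0: "0 \<le> t0" "t0 \<le> T"
  shows "(\<integral>\<^sup>+r. \<integral>\<^sup>+q. ennreal (if 0 < q \<and> q < T \<and> 0 < r \<and> r < T
      then \<bar>indicator {0..t0} r * h r - indicator {0..t0} q * h q\<bar> * \<bar>r - q\<bar> powr (-(\<theta> + 1)) else 0) \<partial>lborel \<partial>lborel) < \<infinity>"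
proof -
  \<comment> \<open>\<open>p > -1\<close> follows from \<open>\<theta> < \<beta>\<close>.
    \<open>a\<close> is half of the exponent \<open>\<theta> + 1\<close>, shared equally between the
    two factors, and is below 1 since \<open>\<theta> < 1\<close>.\<close>
  define p where "p = \<beta> - \<theta> - 1"
  define a where "a = (1 + \<theta>) / 2"
  have p: "-1 < p" and a: "-1 < - a" "0 < a" using \<theta> by (auto simp: p_def a_def)
  have M: "0 \<le> M" using bd[of 0] by linarith
  define J where "J = ennreal (2 * (T powr (p + 1) / (p + 1)))"
  define A where "A = ennreal (2 * (T powr (- a + 1) / (- a + 1)))"
  let ?i = "\<lambda>x :: real. indicator {0<..<T} x :: ennreal"
  let ?B1 = "\<lambda>r q. (V r * ?i r) * (ennreal (\<bar>r - q\<bar> powr p) * ?i q)"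
  let ?D = "\<lambda>r. ennreal (\<bar>t0 - r\<bar> powr - a) * ?i r"
  have J: "(\<integral>\<^sup>+q. ennreal (\<bar>r - q\<bar> powr p) * ?i q \<partial>lborel) \<le> J" if "0 < r" "r < T" for r
    unfolding J_def using that by (intro nn_integral_abs_powr_le p) auto
  have A: "(\<integral>\<^sup>+q. ?D q \<partial>lborel) \<le> A" unfolding A_def by (rule nn_integral_abs_powr_le[OF a(1) t0])
  have B1: "(\<integral>\<^sup>+r. \<integral>\<^sup>+q. ?B1 r q \<partial>lborel \<partial>lborel) \<le> (\<integral>\<^sup>+t\<in>{0<..<T}. V t \<partial>lborel) * J"
  proof -
    have "(\<integral>\<^sup>+r. \<integral>\<^sup>+q. ?B1 r q \<partial>lborel \<partial>lborel) = (\<integral>\<^sup>+r. (V r * ?i r) * (\<integral>\<^sup>+q. ennreal (\<bar>r - q\<bar> powr p) * ?i q \<partial>lborel) \<partial>lborel)"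
      by (intro nn_integral_cong nn_integral_cmult) measurable
    also have "\<dots> \<le> (\<integral>\<^sup>+r. (V r * ?i r) * J \<partial>lborel)"
      by (rule nn_integral_mono) (use J in \<open>auto simp: indicator_def intro!: mult_left_mono\<close>)
    also have "\<dots> = (\<integral>\<^sup>+t\<in>{0<..<T}. V t \<partial>lborel) * J" by (rule nn_integral_multc) measurable
    finally show ?thesis .
  qed
  have B2: "(\<integral>\<^sup>+r. \<integral>\<^sup>+q. ?B1 q r \<partial>lborel \<partial>lborel) \<le> (\<integral>\<^sup>+t\<in>{0<..<T}. V t \<partial>lborel) * J"
    by (subst lborel_pair.Fubini') (measurable, rule B1)
  have B3: "(\<integral>\<^sup>+r. \<integral>\<^sup>+q. ennreal M * (?D r * ?D q) \<partial>lborel \<partial>lborel) \<le> ennreal M * (A * A)"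
  proof -
    have "(\<integral>\<^sup>+r. \<integral>\<^sup>+q. ennreal M * (?D r * ?D q) \<partial>lborel \<partial>lborel) = (\<integral>\<^sup>+r. ennreal M * (?D r * (\<integral>\<^sup>+q. ?D q \<partial>lborel)) \<partial>lborel)"
      by (intro nn_integral_cong) (simp add: nn_integral_cmult)
    also have "\<dots> = ennreal M * ((\<integral>\<^sup>+r. ?D r \<partial>lborel) * (\<integral>\<^sup>+q. ?D q \<partial>lborel))"
      by (simp add: nn_integral_cmult nn_integral_multc)
    also have "\<dots> \<le> ennreal M * (A * A)" by (intro mult_left_mono mult_mono A) auto
    finally show ?thesis .
  qed
  \<comment> \<open>The points at \<open>t0\<close> are excluded because
    \<open>0 powr - a = 0\<close> would make the dominating product vanish there.\<close>
  have pt: "ennreal (if 0 < q \<and> q < T \<and> 0 < r \<and> r < T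
      then \<bar>indicator {0..t0} r * h r - indicator {0..t0} q * h q\<bar> * \<bar>r - q\<bar> powr (-(\<theta> + 1)) else 0)
    \<le> (?B1 r q + ?B1 q r) + ennreal M * (?D r * ?D q)" if ne: "r \<noteq> t0" "q \<noteq> t0" for r q
  proof (cases "0 < q \<and> q < T \<and> 0 < r \<and> r < T")
    case True
    let ?e = "\<bar>indicator {0..t0} r - indicator {0..t0} q :: real\<bar>" and ?k = "\<bar>r - q\<bar> powr (-(\<theta> + 1))"
    have "\<bar>indicator {0..t0} r * h r - indicator {0..t0} q * h q\<bar> \<le> \<bar>h r - h q\<bar> + ?e * M"
      using bd[of r] bd[of q] M by (auto simp: indicator_def)
    then have "\<bar>indicator {0..t0} r * h r - indicator {0..t0} q * h q\<bar> * ?k \<le> (\<bar>h r - h q\<bar> + ?e * M) * ?k"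
      by (rule mult_right_mono) simp
    also have "\<dots> = \<bar>h r - h q\<bar> * ?k + M * (?e * ?k)" by (simp add: algebra_simps)
    finally have "ennreal (\<bar>indicator {0..t0} r * h r - indicator {0..t0} q * h q\<bar> * ?k) \<le> ennreal (\<bar>h r - h q\<bar> * ?k + M * (?e * ?k))"
      by (rule ennreal_leI)
    also have "\<dots> = ennreal (\<bar>h r - h q\<bar> * ?k) + ennreal (M * (?e * ?k))"
      by (rule ennreal_plus) (intro mult_nonneg_nonneg M abs_ge_zero powr_ge_zero)+
    finally have le: "ennreal (\<bar>indicator {0..t0} r * h r - indicator {0..t0} q * h q\<bar> * ?k) \<le> ennreal (\<bar>h r - h q\<bar> * ?k) + ennreal (M * (?e * ?k))" .
    have "ennreal (\<bar>h r - h q\<bar> * ?k) = ennreal \<bar>h r - h q\<bar> * ennreal ?k" by (rule ennreal_mult) simp_all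
    also have "\<dots> \<le> ennreal (\<bar>r - q\<bar> powr \<beta>) * (V r + V q) * ennreal ?k"
      using True by (intro mult_right_mono osc) auto
    also have "\<dots> = (ennreal (\<bar>r - q\<bar> powr \<beta>) * ennreal ?k) * (V r + V q)" by (simp add: mult_ac)
    also have "ennreal (\<bar>r - q\<bar> powr \<beta>) * ennreal ?k = ennreal (\<bar>r - q\<bar> powr p)"
    proof -
      have p': "p = \<beta> + - (\<theta> + 1)" by (simp add: p_def)
      show ?thesis unfolding p' powr_add by (rule ennreal_mult[symmetric]) simp_all
    qed
    also have "ennreal (\<bar>r - q\<bar> powr p) * (V r + V q) = ?B1 r q + ?B1 q r"
    proof -
      have i: "?i r = 1" "?i q = 1" using True by simp_all
      show ?thesis unfolding abs_minus_commute[of q r] by (simp only: i mult_1_right mult_1_left distrib_left distrib_right mult.commute)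
    qed
    finally have 1: "ennreal (\<bar>h r - h q\<bar> * ?k) \<le> ?B1 r q + ?B1 q r" .
    have e: "?e * ?k \<le> \<bar>t0 - r\<bar> powr - a * \<bar>t0 - q\<bar> powr - a"
    proof (cases "(r \<le> t0) = (q \<le> t0)")
      case True
      then have "?e = 0" using \<open>0 < q \<and> q < T \<and> 0 < r \<and> r < T\<close> by (auto simp: indicator_def)
      then show ?thesis by simp
    next
      case False
      then have eq: "\<bar>r - q\<bar> = \<bar>t0 - r\<bar> + \<bar>t0 - q\<bar>" by auto
      have a': "- (\<theta> + 1) = - a + - a" by (simp add: a_def)
      have "?k = \<bar>r - q\<bar> powr - a * \<bar>r - q\<bar> powr - a" unfolding a' by (rule powr_add)
      also have "\<dots> \<le> \<bar>t0 - r\<bar> powr - a * \<bar>t0 - q\<bar> powr - a"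
        using ne a eq by (intro mult_mono powr_mono2') auto
      finally have k: "?k \<le> \<bar>t0 - r\<bar> powr - a * \<bar>t0 - q\<bar> powr - a" .
      have "?e \<le> 1" by (simp add: indicator_def)
      then have "?e * ?k \<le> 1 * ?k" by (rule mult_right_mono) simp
      then show ?thesis using k by simp
    qed
    have "ennreal (M * (?e * ?k)) \<le> ennreal (M * (\<bar>t0 - r\<bar> powr - a * \<bar>t0 - q\<bar> powr - a))"
      by (intro ennreal_leI mult_left_mono e M)
    also have "\<dots> = ennreal M * (?D r * ?D q)" using M True by (simp add: ennreal_mult)
    finally have 2: "ennreal (M * (?e * ?k)) \<le> ennreal M * (?D r * ?D q)" .
    show ?thesis unfolding if_P[OF True] by (rule order_trans[OF le add_mono[OF 1 2]])
  next
    case False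
    show ?thesis unfolding if_not_P[OF False] by simp
  qed
  have "(\<integral>\<^sup>+r. \<integral>\<^sup>+q. ennreal (if 0 < q \<and> q < T \<and> 0 < r \<and> r < T
      then \<bar>indicator {0..t0} r * h r - indicator {0..t0} q * h q\<bar> * \<bar>r - q\<bar> powr (-(\<theta> + 1)) else 0) \<partial>lborel \<partial>lborel)
    \<le> (\<integral>\<^sup>+r. \<integral>\<^sup>+q. (?B1 r q + ?B1 q r) + ennreal M * (?D r * ?D q) \<partial>lborel \<partial>lborel)"
  proof (rule nn_integral_mono_AE)
    show "AE r in lborel. (\<integral>\<^sup>+q. ennreal (if 0 < q \<and> q < T \<and> 0 < r \<and> r < T
        then \<bar>indicator {0..t0} r * h r - indicator {0..t0} q * h q\<bar> * \<bar>r - q\<bar> powr (-(\<theta> + 1)) else 0) \<partial>lborel)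
      \<le> (\<integral>\<^sup>+q. (?B1 r q + ?B1 q r) + ennreal M * (?D r * ?D q) \<partial>lborel)"
      using AE_lborel_singleton[of t0]
    proof eventually_elim
      case (elim r)
      show ?case by (rule nn_integral_mono_AE, rule AE_mp[OF AE_lborel_singleton[of t0]], rule AE_I2, rule impI, rule pt[OF elim])
    qed
  qed
  also have "\<dots> = (\<integral>\<^sup>+r. \<integral>\<^sup>+q. ?B1 r q \<partial>lborel \<partial>lborel) + (\<integral>\<^sup>+r. \<integral>\<^sup>+q. ?B1 q r \<partial>lborel \<partial>lborel) + (\<integral>\<^sup>+r. \<integral>\<^sup>+q. ennreal M * (?D r * ?D q) \<partial>lborel \<partial>lborel)"
    by (simp add: nn_integral_add)
  also have "\<dots> \<le> (\<integral>\<^sup>+t\<in>{0<..<T}. V t \<partial>lborel) * J + (\<integral>\<^sup>+t\<in>{0<..<T}. V t \<partial>lborel) * J + ennreal M * (A * A)"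
    by (intro add_mono B1 B2 B3)
  also have "\<dots> < \<infinity>" using Vfin by (simp add: J_def A_def ennreal_mult_less_top)
  finally show ?thesis .
qed

text \<open>The averaged quotients of \<open>\<Phi>\<close> converge to its increment, those
  weighted by \<open>h\<close> to the \<open>I i\<close>, so it suffices that the averaged
  remainders vanish. By \<open>rem\<close> they are bounded by \<open>d powr (\<beta> - 1)\<close>
  times twice the integral of \<open>W\<close>, as a time shift does not change the form of the
  bound; \<open>crude\<close> handles the times within \<open>d\<close> of \<open>T\<close>, where
  \<open>rem\<close> is silent.\<close>

lemma increment_eq_sum_of_limits:
  fixes \<Phi> :: "real \<Rightarrow> real" and h \<kappa> :: "'k::finite \<Rightarrow> real \<Rightarrow> real" and I :: "'k \<Rightarrow> real"
    and W :: "real \<Rightarrow> ennreal" and T t0 \<beta> \<gamma> C M :: real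
  assumes \<Phi>: "continuous_on UNIV \<Phi>" "bounded (range \<Phi>)"
    and \<kappa>: "\<And>i. continuous_on UNIV (\<kappa> i)" "\<And>i. bounded (range (\<kappa> i))"
    and h [measurable]: "\<And>i. h i \<in> borel_measurable borel" and bd: "\<And>i t. \<bar>h i t\<bar> \<le> M"
    and W [measurable]: "W \<in> borel_measurable borel" and Wfin: "(\<integral>\<^sup>+t\<in>{0<..<T}. W t \<partial>lborel) < \<infinity>"
    and \<beta>: "1 < \<beta>" and \<gamma>: "0 < \<gamma>" and t0: "0 \<le> t0" "t0 \<le> T"
    and rem: "\<And>u d. 0 < u \<Longrightarrow> 0 < d \<Longrightarrow> u + d < T \<Longrightarrow>
      ennreal \<bar>\<Phi> (u + d) - \<Phi> u - (\<Sum>i\<in>UNIV. h i u * (\<kappa> i (u + d) - \<kappa> i u))\<bar> \<le> ennreal (d powr \<beta>) * (W u + W (u + d))"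
    and crude: "\<And>u d. 0 < u \<Longrightarrow> u < T \<Longrightarrow> 0 < d \<Longrightarrow>
      \<bar>\<Phi> (u + d) - \<Phi> u - (\<Sum>i\<in>UNIV. h i u * (\<kappa> i (u + d) - \<kappa> i u))\<bar> \<le> C * d powr \<gamma>"
    and lim: "\<And>i d. (\<forall>n. 0 < d n) \<Longrightarrow> d \<longlonglongrightarrow> 0 \<Longrightarrow>
      (\<lambda>n. \<integral>u. (if 0 < u \<and> u < T then indicator {0..t0} u * h i u * ((\<kappa> i (u + d n) - \<kappa> i u) / d n) else 0) \<partial>lborel) \<longlonglongrightarrow> I i"
  shows "\<Phi> t0 - \<Phi> 0 = (\<Sum>i\<in>UNIV. I i)"
proof -
  define d where "d n = inverse (real (Suc n))" for n
  have d: "0 < d n" for n by (simp add: d_def)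
  have d0: "d \<longlonglongrightarrow> 0" unfolding d_def by (rule LIMSEQ_inverse_real_of_nat)
  have [measurable]: "\<Phi> \<in> borel_measurable borel" "\<kappa> i \<in> borel_measurable borel" for i
    using \<Phi>(1) \<kappa>(1) by (auto intro: borel_measurable_continuous_onI)
  obtain B where B: "\<And>x. \<bar>\<Phi> x\<bar> \<le> B" using \<Phi>(2) by (auto simp: bounded_iff)
  have "\<exists>D. \<forall>x. \<bar>\<kappa> i x\<bar> \<le> D" for i using \<kappa>(2)[of i] by (auto simp: bounded_iff)
  then obtain D where D: "\<And>i x. \<bar>\<kappa> i x\<bar> \<le> D i" by metis
  have M: "0 \<le> M" using bd[of undefined 0] by linarith
  define F where "F n = (\<integral>u. (if 0 < u \<and> u < t0 then (\<Phi> (u + d n) - \<Phi> u) / d n else 0) \<partial>lborel)" for n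
  define S where "S i n = (\<integral>u. (if 0 < u \<and> u < t0 then h i u * ((\<kappa> i (u + d n) - \<kappa> i u) / d n) else 0) \<partial>lborel)" for i n
  define R where "R n u = \<Phi> (u + d n) - \<Phi> u - (\<Sum>i\<in>UNIV. h i u * (\<kappa> i (u + d n) - \<kappa> i u))" for n u
  have Rm [measurable]: "R n \<in> borel_measurable borel" for n unfolding R_def by measurable
  have intF: "integrable lborel (\<lambda>u. if 0 < u \<and> u < t0 then (\<Phi> (u + d n) - \<Phi> u) / d n else 0)" for n
  proof (rule integrable_bounded_support[where S = "{0..t0}" and B = "(B + B) / d n"])
    fix u :: real
    have "\<bar>\<Phi> (u + d n) - \<Phi> u\<bar> / d n \<le> (B + B) / d n"
      using B[of u] B[of "u + d n"] d[of n] by (intro divide_right_mono) auto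
    then show "\<bar>if 0 < u \<and> u < t0 then (\<Phi> (u + d n) - \<Phi> u) / d n else 0\<bar> \<le> (B + B) / d n"
      using d[of n] B[of u] by auto
  qed auto
  have intS: "integrable lborel (\<lambda>u. if 0 < u \<and> u < t0 then h i u * ((\<kappa> i (u + d n) - \<kappa> i u) / d n) else 0)" for i n
  proof (rule integrable_bounded_support[where S = "{0..t0}" and B = "M * ((D i + D i) / d n)"])
    fix u :: real
    have "\<bar>\<kappa> i (u + d n) - \<kappa> i u\<bar> / d n \<le> (D i + D i) / d n"
      using D[of i u] D[of i "u + d n"] d[of n] by (intro divide_right_mono) auto
    then have "\<bar>h i u\<bar> * (\<bar>\<kappa> i (u + d n) - \<kappa> i u\<bar> / d n) \<le> M * ((D i + D i) / d n)"
      using bd[of i u] M d[of n] by (intro mult_mono) auto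
    then show "\<bar>if 0 < u \<and> u < t0 then h i u * ((\<kappa> i (u + d n) - \<kappa> i u) / d n) else 0\<bar> \<le> M * ((D i + D i) / d n)"
      using d[of n] M D[of i u] by (auto simp: abs_mult)
  qed auto
  have F: "F \<longlonglongrightarrow> \<Phi> t0 - \<Phi> 0"
  proof -
    \<comment> \<open>With both \<open>T\<close> and \<open>r\<close> set to \<open>t0\<close> the
      second average in \<open>moving_average_increment\<close> runs over an empty interval, so the
      first alone is an increment of \<open>\<Phi>\<close>.\<close>
    have "\<exists>\<xi>. 0 < \<xi> \<and> \<xi> < d n \<and> F n = \<Phi> (t0 + \<xi>) - \<Phi> \<xi>" for n
    proof -
      obtain \<xi> where \<xi>: "0 < \<xi>" "\<xi> < d n"
        "(\<integral>u. (if 0 < u \<and> u < t0 then (\<Phi> u - \<Phi> (u + d n)) / d n else 0) \<partial>lborel)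
          - (\<integral>u. (if t0 < u \<and> u < t0 then (\<Phi> u - \<Phi> (u + d n)) / d n else 0) \<partial>lborel) = \<Phi> (0 + \<xi>) - \<Phi> (t0 + \<xi>)"
        using moving_average_increment[OF \<Phi>(1) d[of n], where t = 0 and r = t0 and T = t0] t0 by auto
      have z: "(\<lambda>u. if t0 < u \<and> u < t0 then (\<Phi> u - \<Phi> (u + d n)) / d n else 0) = (\<lambda>_. 0 :: real)" by auto
      have "F n = (\<integral>u. - (if 0 < u \<and> u < t0 then (\<Phi> u - \<Phi> (u + d n)) / d n else 0) \<partial>lborel)"
        unfolding F_def by (rule Bochner_Integration.integral_cong[OF refl]) (simp add: diff_divide_distrib)
      also have "\<dots> = - (\<Phi> (0 + \<xi>) - \<Phi> (t0 + \<xi>))" using \<xi>(3) unfolding z by simp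
      finally show ?thesis using \<xi>(1,2) by auto
    qed
    then obtain \<xi> where \<xi>: "\<And>n. 0 < \<xi> n" "\<And>n. \<xi> n < d n" "\<And>n. F n = \<Phi> (t0 + \<xi> n) - \<Phi> (\<xi> n)" by metis
    have "\<xi> \<longlonglongrightarrow> 0"
      by (rule tendsto_sandwich[OF _ _ tendsto_const d0]) (use \<xi>(1,2) in \<open>auto intro!: always_eventually less_imp_le\<close>)
    then have "(\<lambda>n. \<Phi> (t0 + \<xi> n) - \<Phi> (\<xi> n)) \<longlonglongrightarrow> \<Phi> (t0 + 0) - \<Phi> 0"
      by (intro tendsto_diff continuous_on_tendsto_compose[OF \<Phi>(1)] tendsto_add tendsto_const) auto
    moreover have "F = (\<lambda>n. \<Phi> (t0 + \<xi> n) - \<Phi> (\<xi> n))" by (rule ext) (rule \<xi>(3))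
    ultimately show ?thesis by simp
  qed
  have S: "S i \<longlonglongrightarrow> I i" for i
  proof -
    have "S i = (\<lambda>n. \<integral>u. (if 0 < u \<and> u < T then indicator {0..t0} u * h i u * ((\<kappa> i (u + d n) - \<kappa> i u) / d n) else 0) \<partial>lborel)"
      unfolding S_def
    proof (rule ext, rule integral_cong_AE)
      fix n
      show "AE u in lborel. (if 0 < u \<and> u < t0 then h i u * ((\<kappa> i (u + d n) - \<kappa> i u) / d n) else 0)
        = (if 0 < u \<and> u < T then indicator {0..t0} u * h i u * ((\<kappa> i (u + d n) - \<kappa> i u) / d n) else 0)"
        using AE_lborel_singleton[of t0] by eventually_elim (use t0 in \<open>auto simp: indicator_def\<close>)
    qed measurable
    then show ?thesis using lim[of d i] d d0 by (simp only: simp_thms)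
  qed
  have E: "(\<integral>u. (if 0 < u \<and> u < t0 then R n u / d n else 0) \<partial>lborel) = F n - (\<Sum>i\<in>UNIV. S i n)" for n
  proof -
    have "(\<integral>u. (if 0 < u \<and> u < t0 then R n u / d n else 0) \<partial>lborel)
      = (\<integral>u. (if 0 < u \<and> u < t0 then (\<Phi> (u + d n) - \<Phi> u) / d n else 0) - (\<Sum>i\<in>UNIV. if 0 < u \<and> u < t0 then h i u * ((\<kappa> i (u + d n) - \<kappa> i u) / d n) else 0) \<partial>lborel)"
    proof (rule Bochner_Integration.integral_cong[OF refl])
      fix u
      have eq: "R n u / d n = (\<Phi> (u + d n) - \<Phi> u) / d n - (\<Sum>i\<in>UNIV. h i u * ((\<kappa> i (u + d n) - \<kappa> i u) / d n))"
        unfolding R_def diff_divide_distrib[of _ "sum f A" for f A] sum_divide_distrib times_divide_eq_right ..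
      show "(if 0 < u \<and> u < t0 then R n u / d n else 0) = (if 0 < u \<and> u < t0 then (\<Phi> (u + d n) - \<Phi> u) / d n else 0)
        - (\<Sum>i\<in>UNIV. if 0 < u \<and> u < t0 then h i u * ((\<kappa> i (u + d n) - \<kappa> i u) / d n) else 0)"
      proof (cases "0 < u \<and> u < t0")
        case True
        show ?thesis unfolding if_P[OF True] by (rule eq)
      next
        case False
        show ?thesis unfolding if_not_P[OF False] by simp
      qed
    qed
    also have "\<dots> = F n - (\<Sum>i\<in>UNIV. S i n)"
      unfolding F_def S_def using intF intS by (subst Bochner_Integration.integral_diff) (auto simp: Bochner_Integration.integral_sum)
    finally show ?thesis .
  qed
  define w where "w = enn2real (\<integral>\<^sup>+t\<in>{0<..<T}. W t \<partial>lborel)"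
  have w: "(\<integral>\<^sup>+t\<in>{0<..<T}. W t \<partial>lborel) = ennreal w" "0 \<le> w" using Wfin by (auto simp: w_def)
  have bound: "\<bar>F n - (\<Sum>i\<in>UNIV. S i n)\<bar> \<le> d n powr (\<beta> - 1) * (w + w) + \<bar>C\<bar> * d n powr \<gamma>" for n
  proof -
    let ?e = "d n" and ?i = "\<lambda>x :: real. indicator {0<..<T} x :: ennreal"
    \<comment> \<open>The last interval has length \<open>d n\<close>, which cancels the division by
      \<open>d n\<close> in the crude bound and leaves \<open>d n powr \<gamma>\<close>.\<close>
    have pt: "ennreal \<bar>if 0 < u \<and> u < t0 then R n u / ?e else 0\<bar>
      \<le> ennreal (?e powr (\<beta> - 1)) * (W u * ?i u + W (u + ?e) * ?i (u + ?e)) + ennreal (\<bar>C\<bar> * ?e powr \<gamma> / ?e) * indicator {T - ?e..T} u" for u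
    proof (cases "0 < u \<and> u < t0")
      case True
      have div: "ennreal (\<bar>R n u\<bar> / ?e) = ennreal (1 / ?e) * ennreal \<bar>R n u\<bar>" using d[of n] by (simp add: ennreal_mult[symmetric])
      show ?thesis
      proof (cases "u + ?e < T")
        case le: True
        have "ennreal (1 / ?e) * ennreal \<bar>R n u\<bar> \<le> ennreal (1 / ?e) * (ennreal (?e powr \<beta>) * (W u + W (u + ?e)))"
          unfolding R_def using True le d[of n] by (intro mult_left_mono rem) auto
        also have "\<dots> = ennreal (1 / ?e * ?e powr \<beta>) * (W u + W (u + ?e))"
          using d[of n] by (subst ennreal_mult) (simp_all add: mult.assoc)
        also have "1 / ?e * ?e powr \<beta> = ?e powr (\<beta> - 1)" using d[of n] by (simp add: powr_diff)
        finally have "ennreal (\<bar>R n u\<bar> / ?e) \<le> ennreal (?e powr (\<beta> - 1)) * (W u * ?i u + W (u + ?e) * ?i (u + ?e))"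
          unfolding div using True le d[of n] t0 by simp
        then show ?thesis using True d[of n] by (auto intro: order_trans add_increasing2)
      next
        case False
        have "\<bar>R n u\<bar> \<le> C * ?e powr \<gamma>" unfolding R_def using True t0 d[of n] by (intro crude) auto
        also have "\<dots> \<le> \<bar>C\<bar> * ?e powr \<gamma>" by (rule mult_right_mono) auto
        finally have "\<bar>R n u\<bar> / ?e \<le> \<bar>C\<bar> * ?e powr \<gamma> / ?e" using d[of n] by (intro divide_right_mono) auto
        then have "ennreal (\<bar>R n u\<bar> / ?e) \<le> ennreal (\<bar>C\<bar> * ?e powr \<gamma> / ?e) * indicator {T - ?e..T} u"
          using True False t0 by (auto simp: indicator_def intro!: ennreal_leI)
        then show ?thesis using True d[of n] by (auto intro: order_trans add_increasing)
      qed
    next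
      case False
      show ?thesis unfolding if_not_P[OF False] by simp
    qed
    have "ennreal \<bar>F n - (\<Sum>i\<in>UNIV. S i n)\<bar> \<le> (\<integral>\<^sup>+u. ennreal \<bar>if 0 < u \<and> u < t0 then R n u / ?e else 0\<bar> \<partial>lborel)"
      unfolding E[symmetric] by (rule ennreal_abs_integral_le)
    also have "\<dots> \<le> (\<integral>\<^sup>+u. ennreal (?e powr (\<beta> - 1)) * (W u * ?i u + W (u + ?e) * ?i (u + ?e)) + ennreal (\<bar>C\<bar> * ?e powr \<gamma> / ?e) * indicator {T - ?e..T} u \<partial>lborel)"
      by (rule nn_integral_mono) (rule pt)
    also have "\<dots> = ennreal (?e powr (\<beta> - 1)) * ((\<integral>\<^sup>+u. W u * ?i u \<partial>lborel) + (\<integral>\<^sup>+u. W (u + ?e) * ?i (u + ?e) \<partial>lborel)) + ennreal (\<bar>C\<bar> * ?e powr \<gamma> / ?e) * ennreal ?e"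
      using d[of n] by (simp add: nn_integral_add nn_integral_cmult nn_integral_cmult_indicator)
    also have "(\<integral>\<^sup>+u. W (u + ?e) * ?i (u + ?e) \<partial>lborel) = (\<integral>\<^sup>+u. W u * ?i u \<partial>lborel)"
      by (rule nn_integral_lborel_shift) measurable
    also have "ennreal (?e powr (\<beta> - 1)) * ((\<integral>\<^sup>+u. W u * ?i u \<partial>lborel) + (\<integral>\<^sup>+u. W u * ?i u \<partial>lborel)) + ennreal (\<bar>C\<bar> * ?e powr \<gamma> / ?e) * ennreal ?e
      = ennreal (?e powr (\<beta> - 1) * (w + w) + \<bar>C\<bar> * ?e powr \<gamma>)"
      unfolding w(1) using w(2) d[of n] by (simp add: ennreal_mult[symmetric] ennreal_plus[symmetric] del: ennreal_plus)
    finally show ?thesis using w(2) by (subst (asm) ennreal_le_iff) simp_all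
  qed
  have z: "(\<lambda>n. d n powr p) \<longlonglongrightarrow> 0" if "0 < p" for p
    using tendsto_powr'[OF d0 tendsto_const[of p]] that d by (auto intro!: always_eventually less_imp_le)
  have "(\<lambda>n. d n powr (\<beta> - 1) * (w + w) + \<bar>C\<bar> * d n powr \<gamma>) \<longlonglongrightarrow> 0 * (w + w) + \<bar>C\<bar> * 0"
    using \<beta> \<gamma> by (intro tendsto_add tendsto_mult z tendsto_const) auto
  then have g0: "(\<lambda>n. d n powr (\<beta> - 1) * (w + w) + \<bar>C\<bar> * d n powr \<gamma>) \<longlonglongrightarrow> 0"
    by (simp only: mult_zero_left mult_zero_right add_0_right)
  have "\<forall>\<^sub>F n in sequentially. norm (F n - (\<Sum>i\<in>UNIV. S i n)) \<le> d n powr (\<beta> - 1) * (w + w) + \<bar>C\<bar> * d n powr \<gamma>"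
    unfolding real_norm_def by (rule always_eventually, rule allI, rule bound)
  then have "(\<lambda>n. F n - (\<Sum>i\<in>UNIV. S i n)) \<longlonglongrightarrow> 0" by (rule Lim_null_comparison[OF _ g0])
  moreover have "(\<lambda>n. F n - (\<Sum>i\<in>UNIV. S i n)) \<longlonglongrightarrow> (\<Phi> t0 - \<Phi> 0) - (\<Sum>i\<in>UNIV. I i)"
    by (intro tendsto_diff tendsto_sum F S)
  ultimately have "(\<Phi> t0 - \<Phi> 0) - (\<Sum>i\<in>UNIV. I i) = 0" using LIMSEQ_unique by blast
  then show ?thesis by simp
qed

text \<open>A Borel version is truncated at the essential bound, so that the bound holds at every
  point and not just a.e.; a path may visit a null set.\<close>

lemma essentially_bounded_representative:
  fixes \<phi> :: "'a::euclidean_space \<Rightarrow> real"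
  assumes "essentially_bounded \<phi>"
  shows "\<exists>u. u \<in> borel_measurable borel \<and> (\<exists>M. \<forall>x. \<bar>u x\<bar> \<le> M) \<and> (AE x in lebesgue. \<phi> x = u x)"
proof -
  obtain C where \<phi>: "\<phi> \<in> borel_measurable lebesgue" and C: "AE x in lebesgue. \<bar>\<phi> x\<bar> \<le> C"
    using assms by (auto simp: essentially_bounded_def)
  obtain \<phi>' where [measurable]: "\<phi>' \<in> borel_measurable lborel" and ae: "AE x in lborel. \<phi> x = \<phi>' x"
    using completion_ex_borel_measurable_real[OF \<phi>] by blast
  define u where "u x = max (- \<bar>C\<bar>) (min \<bar>C\<bar> (\<phi>' x))" for x
  have "u \<in> borel_measurable borel" unfolding u_def by measurable
  moreover have "\<bar>u x\<bar> \<le> \<bar>C\<bar>" for x by (simp add: u_def)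
  moreover have "AE x in lebesgue. \<phi> x = u x"
    using AE_completion[OF ae] C by eventually_elim (auto simp: u_def)
  ultimately show ?thesis by blast
qed

text \<open>At a point of finite potential the value \<open>l\<close> plays three roles: centre of
  oscillation for the Borel versions, common value of all Lebesgue representatives, and a number
  bounded by \<open>M\<close>. The sum \<open>V\<close> of the potentials lets a single finiteness
  condition cover all entries.\<close>

lemma pointwise_coefficients:
  fixes \<sigma> :: "real^'n::finite \<Rightarrow> real^'n^'n" and u :: "'n \<Rightarrow> 'n \<Rightarrow> real^'n \<Rightarrow> real" and s M :: real
  defines "V \<equiv> \<lambda>x. \<Sum>j\<in>UNIV. \<Sum>k\<in>UNIV. \<integral>\<^sup>+z. riesz_kernel (- real CARD('n) + 1 - s) (x - z) \<partial>gradient_variation (\<lambda>x. \<sigma> x $ j $ k)"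
  assumes \<sigma>: "\<And>j k. (\<lambda>x. \<sigma> x $ j $ k) \<in> BV_loc"
    and u: "\<And>j k. u j k \<in> borel_measurable borel" "\<And>j k x. \<bar>u j k x\<bar> \<le> M" "\<And>j k. AE x in lebesgue. \<sigma> x $ j $ k = u j k x"
    and sf: "\<And>j k. sigma_finite_measure (gradient_variation (\<lambda>x. \<sigma> x $ j $ k))" and s: "0 < s"
  obtains l :: "real^'n \<Rightarrow> 'n \<Rightarrow> 'n \<Rightarrow> real" where
    "\<And>x j k r. V x < \<infinity> \<Longrightarrow> 0 < r \<Longrightarrow> (\<integral>\<^sup>+y\<in>cube x r. ennreal \<bar>u j k y - l x j k\<bar> \<partial>lborel)
      \<le> ennreal (oscillation_const CARD('n) s * enn2real (V x) * r powr (real CARD('n) + s))"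
    "\<And>x j k g. V x < \<infinity> \<Longrightarrow> lebesgue_representative (\<lambda>x. \<sigma> x $ j $ k) g \<Longrightarrow> g x = l x j k"
    "\<And>x j k. V x < \<infinity> \<Longrightarrow> \<bar>l x j k\<bar> \<le> M"
proof -
  let ?c = "oscillation_const CARD('n) s" and ?p = "real CARD('n) + s"
  let ?v = "\<lambda>j k x. \<integral>\<^sup>+z. riesz_kernel (- real CARD('n) + 1 - s) (x - z) \<partial>gradient_variation (\<lambda>x. \<sigma> x $ j $ k)"
  have "\<exists>l. V x < \<infinity> \<longrightarrow> (\<forall>r>0. (\<integral>\<^sup>+y\<in>cube x r. ennreal \<bar>u j k y - l\<bar> \<partial>lborel) \<le> ennreal (?c * enn2real (V x) * r powr ?p))" for x j k
  proof (cases "V x < \<infinity>")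
    case True
    have "?v j k x \<le> (\<Sum>k\<in>UNIV. ?v j k x)" by (rule member_le_sum) auto
    also have "\<dots> \<le> V x" unfolding V_def by (rule member_le_sum) auto
    finally have le: "?v j k x \<le> V x" .
    then have v: "?v j k x = ennreal (enn2real (?v j k x))" using True by (auto simp: less_top)
    obtain l where l: "\<And>r. r > 0 \<Longrightarrow> (\<integral>\<^sup>+y\<in>cube x r. ennreal \<bar>u j k y - l\<bar> \<partial>lborel) \<le> ennreal (?c * enn2real (?v j k x) * r powr ?p)"
      using BV_oscillation[OF \<sigma> u(1) u(2) u(3) sf s v enn2real_nonneg] by blast
    have "ennreal (?c * enn2real (?v j k x) * r powr ?p) \<le> ennreal (?c * enn2real (V x) * r powr ?p)" for r
      using le True oscillation_const_nonneg[OF s]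
      by (intro ennreal_leI mult_right_mono mult_left_mono enn2real_mono) auto
    then show ?thesis using l order_trans by blast
  qed auto
  note ex = this
  define l where "l x j k = (SOME l. V x < \<infinity> \<longrightarrow> (\<forall>r>0. (\<integral>\<^sup>+y\<in>cube x r. ennreal \<bar>u j k y - l\<bar> \<partial>lborel) \<le> ennreal (?c * enn2real (V x) * r powr ?p)))" for x j k
  have l: "\<And>x j k r. V x < \<infinity> \<Longrightarrow> 0 < r \<Longrightarrow> (\<integral>\<^sup>+y\<in>cube x r. ennreal \<bar>u j k y - l x j k\<bar> \<partial>lborel)
      \<le> ennreal (?c * enn2real (V x) * r powr ?p)"
    using someI_ex[OF ex] unfolding l_def by blast
  have K: "0 \<le> ?c * enn2real (V x)" for x using oscillation_const_nonneg[OF s] by simp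
  have "g x = l x j k" if "V x < \<infinity>" "lebesgue_representative (\<lambda>x. \<sigma> x $ j $ k) g" for x j k g
    using has_approximate_limit_of_oscillation[OF u(1) u(3) s K l[OF that(1)]] that(2) by (auto simp: lebesgue_representative_def)
  moreover have "\<bar>l x j k\<bar> \<le> M" if "V x < \<infinity>" for x j k
    using le_of_oscillation[OF u(1) s K order_refl l[OF that], where c = 0 and M = M] u(2) by simp
  ultimately show ?thesis using that[of l] l by blast
qed

text \<open>Where the weights are infinite the bound is trivial, unless \<open>e = 0\<close>, as \<open>0 * \<infinity> = 0\<close>.\<close>

lemma ennreal_weighted_le:
  fixes x e a :: real and V V' :: ennreal
  assumes a: "0 < a" and e: "0 \<le> e" "e = 0 \<Longrightarrow> x \<le> 0"
    and fin: "V < \<infinity> \<Longrightarrow> V' < \<infinity> \<Longrightarrow> x \<le> e * (a * (enn2real V + enn2real V'))"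
  shows "ennreal x \<le> ennreal e * (ennreal a * V + ennreal a * V')"
proof (cases "V < \<infinity> \<and> V' < \<infinity>")
  case True
  then have V: "V = ennreal (enn2real V)" "V' = ennreal (enn2real V')" by (auto simp: less_top)
  have "ennreal x \<le> ennreal (e * (a * (enn2real V + enn2real V')))" using fin True by (intro ennreal_leI) auto
  also have "\<dots> = ennreal e * (ennreal a * (ennreal (enn2real V) + ennreal (enn2real V')))"
    using a e by (simp add: ennreal_mult)
  finally show ?thesis unfolding V[symmetric] by (simp add: distrib_left)
next
  case False
  then consider "V = \<infinity>" | "V' = \<infinity>" using top.not_eq_extremum[of V] top.not_eq_extremum[of V'] by auto
  then have inf: "ennreal a * V + ennreal a * V' = \<infinity>" by cases (use a in \<open>simp_all add: ennreal_mult_top\<close>)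
  show ?thesis
  proof (cases "e = 0")
    case True
    then show ?thesis using e(2) by (simp add: ennreal_neg)
  next
    case False
    then show ?thesis unfolding inf using e(1) by (simp add: ennreal_mult_top)
  qed
qed

text \<open>The deterministic core: a fixed Hoelder path \<open>y\<close> with finite integrated
  potentials along its image already gives a variability solution.\<close>

lemma pathwise_variability_solution:
  fixes \<sigma> :: "real^'n::finite \<Rightarrow> real^'n^'n" and f :: "real^'n \<Rightarrow> real^'n" and y :: "real \<Rightarrow> real^'n" and x0 :: "real^'n"
    and T s \<gamma> :: real
  assumes T: "0 < T" and \<sigma>: "\<And>j k. (\<lambda>x. \<sigma> x $ j $ k) \<in> BV_loc" "\<And>j k. essentially_bounded (\<lambda>x. \<sigma> x $ j $ k)"
    and f: "bi_lipschitz f" and jac: "AE x in lebesgue. has_jacobian f (\<sigma> (f x)) x"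
    and s: "0 < s" "s < 1" and \<gamma>: "1 / (1 + s) < \<gamma>" "\<gamma> < 1"
    and hol: "holder_on \<gamma> {0..T} y" and y_zero: "y 0 = 0"
    and sf: "\<And>j k. sigma_finite_measure (gradient_variation (\<lambda>x. \<sigma> x $ j $ k))"
    and pot: "\<And>j k. (\<integral>\<^sup>+t\<in>{0..T}. (\<integral>\<^sup>+z. riesz_kernel (- real CARD('n) + 1 - s) (f (y t + inv f x0) - z)
      \<partial>gradient_variation (\<lambda>x. \<sigma> x $ j $ k)) \<partial>lborel) < \<infinity>"
  shows "variability_solution T \<gamma> \<sigma> y x0 (\<lambda>t. f (y t + inv f x0)) \<and> holder_on \<gamma> {0..T} (\<lambda>t. f (y t + inv f x0))
    \<and> (\<lambda>t. f (y t + inv f x0)) \<in> V_class T \<sigma> s"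
proof -
  let ?n = "real CARD('n)"
  define y0 where "y0 = inv f x0"
  define X where "X t = f (y t + y0)" for t
  have fy0: "f y0 = x0" unfolding y0_def by (rule surj_f_inv_f[OF bi_lipschitz_surj[OF f]])
  have \<gamma>0: "0 < \<gamma>" and \<gamma>s: "1 < \<gamma> * (1 + s)" using \<gamma> s by (auto simp: field_simps intro: less_trans[of _ "1 / (1 + s)"])
  obtain L where L: "0 < L" "\<And>x y. dist (f x) (f y) \<le> L * dist x y" using f by (auto simp: bi_lipschitz_def)
  have fc: "continuous_on UNIV f" by (rule bi_lipschitz_continuous_on[OF f])
  have fm [measurable]: "f \<in> borel_measurable borel" by (rule borel_measurable_continuous_onI[OF fc])
  obtain H0 where H0: "\<And>t u. t \<in> {0..T} \<Longrightarrow> u \<in> {0..T} \<Longrightarrow> dist (y t) (y u) \<le> H0 * dist t u powr \<gamma>"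
    using hol unfolding holder_on_def by blast
  define H where "H = \<bar>H0\<bar>"
  have H: "0 \<le> H" by (simp add: H_def)
  have yH: "norm (y t - y u) \<le> H * \<bar>t - u\<bar> powr \<gamma>" if "t \<in> {0..T}" "u \<in> {0..T}" for t u
    using H0[OF that] mult_right_mono[OF abs_ge_self, of "\<bar>t - u\<bar> powr \<gamma>" H0] by (simp add: dist_norm H_def)
  \<comment> \<open>The argument of \<open>f\<close>, extended by constants in time so that forward
    increments are defined for all times.\<close>
  define p where "p t = y (max 0 (min T t)) + y0" for t
  have pX: "f (p t) = X t" if "t \<in> {0..T}" for t using that by (simp add: p_def X_def)
  have pH: "norm (p t - p u) \<le> H * \<bar>t - u\<bar> powr \<gamma>" for t u
  proof -
    have "norm (p t - p u) \<le> H * \<bar>max 0 (min T t) - max 0 (min T u)\<bar> powr \<gamma>"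
      using yH[of "max 0 (min T t)" "max 0 (min T u)"] T by (simp add: p_def)
    also have "\<dots> \<le> H * \<bar>t - u\<bar> powr \<gamma>"
      using H \<gamma>0 by (intro mult_left_mono powr_mono2) (auto simp: max_def min_def)
    finally show ?thesis .
  qed
  have pc: "continuous_on UNIV p"
    by (rule holder_on_continuous_on[OF _ \<gamma>0]) (use pH in \<open>auto simp: holder_on_def dist_norm\<close>)
  have pm [measurable]: "p \<in> borel_measurable borel" by (rule borel_measurable_continuous_onI[OF pc])
  have rng: "range p \<subseteq> p ` {0..T}"
  proof
    fix z assume "z \<in> range p"
    then obtain t where "z = p t" by blast
    moreover have "max 0 (min T (max 0 (min T t))) = max 0 (min T t)" using T by auto
    ultimately have "z = p (max 0 (min T t))" by (simp only: p_def)
    then show "z \<in> p ` {0..T}" using T by auto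
  qed
  have "compact (p ` {0..T})" by (rule compact_continuous_image[OF continuous_on_subset[OF pc]]) auto
  then have pb: "bounded (range p)" using rng bounded_subset compact_imp_bounded by blast
  have fpc: "continuous_on UNIV (\<lambda>t. f (p t))" by (rule continuous_on_compose2[OF fc pc]) auto
  have fpb: "bounded (range (\<lambda>t. f (p t)))"
  proof -
    have "compact ((\<lambda>t. f (p t)) ` {0..T})" by (rule compact_continuous_image[OF continuous_on_subset[OF fpc]]) auto
    moreover have "range (\<lambda>t. f (p t)) \<subseteq> (\<lambda>t. f (p t)) ` {0..T}"
      using image_mono[OF rng, of f] by (simp only: image_image)
    ultimately show ?thesis using bounded_subset compact_imp_bounded by blast
  qed

  have Xhol: "holder_on \<gamma> {0..T} X"
    unfolding holder_on_def
  proof (intro exI ballI)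
    fix t u assume tu: "t \<in> {0..T}" "u \<in> {0..T}"
    have "dist (X t) (X u) \<le> L * norm (y t - y u)" using L(2)[of "y t + y0" "y u + y0"] by (simp add: X_def dist_norm)
    also have "\<dots> \<le> L * (H * \<bar>t - u\<bar> powr \<gamma>)" by (rule mult_left_mono[OF yH[OF tu]]) (use L in simp)
    finally show "dist (X t) (X u) \<le> (L * H) * dist t u powr \<gamma>" by (simp add: dist_real_def)
  qed
  let ?v = "\<lambda>j k x. \<integral>\<^sup>+z. riesz_kernel (- ?n + 1 - s) (x - z) \<partial>gradient_variation (\<lambda>x. \<sigma> x $ j $ k)"
  have pot': "(\<integral>\<^sup>+t\<in>{0..T}. ?v j k (X t) \<partial>lborel) < \<infinity>" for j k
    using pot[of j k] by (simp add: X_def y0_def)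
  have Xc: "continuous_on {0..T} X" by (rule holder_on_continuous_on[OF Xhol \<gamma>0])
  have XV: "X \<in> V_class T \<sigma> s"
    unfolding V_class_def variable_path_def
  proof (intro CollectI allI conjI)
    fix j k
    have "bounded (X ` {0..T})" using compact_continuous_image[OF Xc] compact_imp_bounded by blast
    then obtain R where R: "\<And>t. t \<in> {0..T} \<Longrightarrow> norm (X t) \<le> R" unfolding bounded_iff by blast
    \<comment> \<open>Any bounded open set around the path serves, because \<open>pot\<close> bounds
      the potential of the whole measure.\<close>
    define U :: "(real^'n) set" where "U = ball 0 (R + 1)"
    have U: "open U" "compact (closure U)" by (simp_all add: U_def)
    have XU: "X ` {0..T} \<subseteq> U"
    proof
      fix z assume "z \<in> X ` {0..T}"
      then obtain t where "z = X t" "t \<in> {0..T}" by blast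
      then show "z \<in> U" using R[of t] by (simp add: U_def)
    qed
    have "(\<integral>\<^sup>+t\<in>{0..T}. (\<integral>\<^sup>+z\<in>U. riesz_kernel (- ?n + 1 - s) (X t - z) \<partial>gradient_variation (\<lambda>x. \<sigma> x $ j $ k)) \<partial>lebesgue)
      \<le> (\<integral>\<^sup>+t\<in>{0..T}. ?v j k (X t) \<partial>lebesgue)"
      by (intro nn_integral_mono mult_right_mono) (auto simp: indicator_def intro!: nn_integral_mono)
    also have "\<dots> = (\<integral>\<^sup>+t\<in>{0..T}. ?v j k (X t) \<partial>lborel)" by (rule nn_integral_completion)
    also have "\<dots> < \<infinity>" by (rule pot')
    finally show "\<exists>U. open U \<and> compact (closure U) \<and> X ` {0..T} \<subseteq> U \<and>
        (\<integral>\<^sup>+t\<in>{0..T}. (\<integral>\<^sup>+z\<in>U. riesz_kernel (- ?n + 1 - s) (X t - z) \<partial>gradient_variation (\<lambda>x. \<sigma> x $ j $ k)) \<partial>lebesgue) < \<infinity>"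
      using U XU by blast
  qed (use s Xc in auto)

  define u where "u j k = (SOME v. v \<in> borel_measurable borel \<and> (\<exists>M. \<forall>x. \<bar>v x\<bar> \<le> M) \<and> (AE x in lebesgue. \<sigma> x $ j $ k = v x))" for j k
  have uP: "u j k \<in> borel_measurable borel \<and> (\<exists>M. \<forall>x. \<bar>u j k x\<bar> \<le> M) \<and> (AE x in lebesgue. \<sigma> x $ j $ k = u j k x)" for j k
    unfolding u_def by (rule someI_ex[OF essentially_bounded_representative[OF \<sigma>(2)]])
  have u [measurable]: "u j k \<in> borel_measurable borel" for j k using uP by blast
  have u_bd: "\<exists>M. \<forall>x. \<bar>u j k x\<bar> \<le> M" for j k using uP by blast
  have u_ae: "AE x in lebesgue. \<sigma> x $ j $ k = u j k x" for j k using uP by blast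
  obtain M0 where uM0: "\<And>j k x. \<bar>u j k x\<bar> \<le> M0 j k" using u_bd by metis
  define M where "M = (\<Sum>j\<in>UNIV. \<Sum>k\<in>UNIV. \<bar>M0 j k\<bar>)"
  have M: "0 \<le> M" unfolding M_def by (intro sum_nonneg) simp
  have uM: "\<bar>u j k x\<bar> \<le> M" for j k x
  proof -
    have "\<bar>M0 j k\<bar> \<le> (\<Sum>k\<in>UNIV. \<bar>M0 j k\<bar>)" by (rule member_le_sum) auto
    also have "\<dots> \<le> M" unfolding M_def by (rule member_le_sum) (auto intro: sum_nonneg)
    finally show ?thesis using uM0[of j k x] by linarith
  qed
  obtain K where K: "0 \<le> K" "\<And>g. g \<in> borel_measurable borel \<Longrightarrow> (\<integral>\<^sup>+w. g (f w) \<partial>lborel) \<le> ennreal K * (\<integral>\<^sup>+x. g x \<partial>lborel)"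
    "\<And>Q. (AE x in lborel. Q x) \<Longrightarrow> (AE w in lborel. Q (f w))"
    using bi_lipschitz_nn_integral_le[OF f] by blast
  \<comment> \<open>\<open>\<sigma>\<close> and \<open>u\<close> differ on a null set, whose
    preimage under \<open>f\<close> is null by \<open>K(3)\<close>; hence \<open>u\<close> may
    replace \<open>\<sigma>\<close> in the equation for the Jacobian.\<close>
  have part: "AE w in lborel. has_partial (\<lambda>y. f y $ j) k (u j k (f w)) w" for j k
  proof -
    have "AE w in lborel. has_jacobian f (\<sigma> (f w)) w" using jac by (simp add: AE_completion_iff)
    moreover have "AE w in lborel. \<sigma> (f w) $ j $ k = u j k (f w)" using u_ae[of j k] by (intro K(3)) (simp add: AE_completion_iff)
    ultimately show ?thesis 
    proof eventually_elim
      case (elim w)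
      have "has_partial (\<lambda>y. f y $ j) k (\<sigma> (f w) $ j $ k) w" using elim(1) unfolding has_jacobian_def by blast
      then show ?case unfolding elim(2) .
    qed
  qed
  define Vs where "Vs x = (\<Sum>j\<in>UNIV. \<Sum>k\<in>UNIV. ?v j k x)" for x
  obtain l where l: "\<And>x j k r. Vs x < \<infinity> \<Longrightarrow> 0 < r \<Longrightarrow> (\<integral>\<^sup>+y\<in>cube x r. ennreal \<bar>u j k y - l x j k\<bar> \<partial>lborel)
      \<le> ennreal (oscillation_const CARD('n) s * enn2real (Vs x) * r powr (?n + s))"
    and lg: "\<And>x j k g. Vs x < \<infinity> \<Longrightarrow> lebesgue_representative (\<lambda>x. \<sigma> x $ j $ k) g \<Longrightarrow> g x = l x j k"
    and lM: "\<And>x j k. Vs x < \<infinity> \<Longrightarrow> \<bar>l x j k\<bar> \<le> M"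
    using pointwise_coefficients[where \<sigma> = \<sigma> and u = u and s = s and M = M] \<sigma>(1) u uM u_ae sf s(1) unfolding Vs_def by blast
  define c0 where "c0 = oscillation_const CARD('n) s"
  have c0: "0 \<le> c0" unfolding c0_def by (rule oscillation_const_nonneg[OF s(1)])
  define V where "V t = Vs (f (p t))" for t
  have vm [measurable]: "?v j k \<in> borel_measurable borel" for j k
  proof -
    interpret sigma_finite_measure "gradient_variation (\<lambda>x. \<sigma> x $ j $ k)" by (rule sf)
    show ?thesis by measurable
  qed
  have Vm [measurable]: "V \<in> borel_measurable borel" unfolding V_def Vs_def by measurable
  have Vfin: "(\<integral>\<^sup>+t\<in>{0<..<T}. V t \<partial>lborel) < \<infinity>"
  proof -
    have "(\<integral>\<^sup>+t\<in>{0<..<T}. V t \<partial>lborel) \<le> (\<integral>\<^sup>+t. (\<Sum>j\<in>UNIV. \<Sum>k\<in>UNIV. ?v j k (f (p t)) * indicator {0..T} t) \<partial>lborel)"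
      by (rule nn_integral_mono) (auto simp: V_def Vs_def indicator_def)
    also have "\<dots> = (\<Sum>j\<in>UNIV. \<Sum>k\<in>UNIV. \<integral>\<^sup>+t. ?v j k (f (p t)) * indicator {0..T} t \<partial>lborel)"
      by (subst nn_integral_sum, measurable, intro sum.cong refl, rule nn_integral_sum, measurable)
    also have "\<dots> = (\<Sum>j\<in>UNIV. \<Sum>k\<in>UNIV. \<integral>\<^sup>+t. ?v j k (X t) * indicator {0..T} t \<partial>lborel)"
      by (intro sum.cong refl nn_integral_cong) (use pX in \<open>auto simp: indicator_def\<close>)
    also have "\<dots> < \<infinity>" using pot' by simp
    finally show ?thesis .
  qed
  have cfin: "(\<integral>\<^sup>+t\<in>{0<..<T}. ennreal a * V t \<partial>lborel) < \<infinity>" for a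
  proof -
    have "(\<integral>\<^sup>+t\<in>{0<..<T}. ennreal a * V t \<partial>lborel) = ennreal a * (\<integral>\<^sup>+t\<in>{0<..<T}. V t \<partial>lborel)"
      unfolding mult.assoc by (rule nn_integral_cmult) measurable
    then show ?thesis using Vfin by (simp add: ennreal_mult_less_top)
  qed
  have Vae: "AE t in lborel. 0 < t \<and> t < T \<longrightarrow> V t < \<infinity>"
  proof -
    have "AE t in lborel. V t * indicator {0<..<T} t \<noteq> \<infinity>"
      by (rule nn_integral_PInf_AE) (use Vfin in auto)
    then show ?thesis by eventually_elim (auto simp: less_top)
  qed
  define q where "q = \<gamma> * s"
  \<comment> \<open>The midpoint of the interval from \<open>1 - \<gamma>\<close> to
    \<open>\<gamma> * s\<close>. The lower end is dictated by the smoothness of \<open>y\<close>,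
    the upper end by that of the coefficients along the path.\<close>
  define \<theta> where "\<theta> = (1 - \<gamma> + q) / 2"
  have \<gamma>s1: "\<gamma> * s < 1" using mult_strict_mono[of \<gamma> 1 s 1] \<gamma> \<gamma>0 s by simp
  have q: "1 < \<gamma> + q" "q < 1" "0 < q" using \<gamma>s \<gamma>s1 \<gamma>0 s(1) by (simp_all add: q_def distrib_left)
  have \<theta>2_eq: "2 * \<theta> = 1 - \<gamma> + q" by (simp add: \<theta>_def)
  have \<theta>1: "0 < \<theta>" using \<theta>2_eq q \<gamma>0 \<gamma>(2) by linarith
  have \<theta>2: "\<theta> < 1" using \<theta>2_eq q \<gamma>0 \<gamma>(2) by linarith
  have \<theta>3: "1 - \<theta> < \<gamma>" using \<theta>2_eq q \<gamma>0 \<gamma>(2) by linarith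
  have \<theta>4: "\<theta> < \<gamma> * s" unfolding q_def[symmetric] using \<theta>2_eq q \<gamma>0 \<gamma>(2) by linarith
  note \<theta> = \<theta>1 \<theta>2 \<theta>3 \<theta>4

  have eqn: "\<exists>I. (\<forall>k. has_stieltjes_integral T (\<lambda>u. indicator {0..t0} u * h j k u) (\<lambda>u. y u $ k) (I k)) \<and>
      X t0 $ j = x0 $ j + (\<Sum>k\<in>UNIV. I k)"
    if h: "\<And>j k. h j k \<in> composition_class T (\<lambda>x. \<sigma> x $ j $ k) X" and t0: "t0 \<in> {0..T}" for h t0 j
  proof -
    define G where "G k g \<longleftrightarrow> lebesgue_representative (\<lambda>x. \<sigma> x $ j $ k) g \<and> (AE t in lebesgue. t \<in> {0..T} \<longrightarrow> h j k t = g (X t))" for k g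
    have "\<exists>g. G k g" for k using h[of j k] unfolding composition_class_def G_def by blast
    then obtain g where G: "\<And>k. G k (g k)" by metis
    have g: "lebesgue_representative (\<lambda>x. \<sigma> x $ j $ k) (g k)" and hg: "AE t in lebesgue. t \<in> {0..T} \<longrightarrow> h j k t = g k (X t)" for k
      using G[of k] unfolding G_def by (rule conjunct1, rule conjunct2)
    have [measurable]: "g k \<in> borel_measurable borel" for k using g[of k] by (simp add: lebesgue_representative_def)
    \<comment> \<open>A Borel function with the values of the representative along the path. The
      clamp makes it bounded also at times of infinite potential, and changes nothing where
      \<open>V\<close> is finite, since there the value is \<open>l\<close>, bounded by
      \<open>M\<close>.\<close>
    define h' where "h' k t = max (- M) (min M (g k (f (p t))))" for k t
    have h'm [measurable]: "h' k \<in> borel_measurable borel" for k unfolding h'_def by measurable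
    have h'M: "\<bar>h' k t\<bar> \<le> M" for k t using M by (auto simp: h'_def)
    have h'l: "h' k t = l (f (p t)) j k" if "V t < \<infinity>" for k t
      using lM[of "f (p t)" j k] lg[OF _ g[of k], of "f (p t)"] that by (auto simp: h'_def V_def)
    have hh': "AE t in lborel. 0 < t \<and> t < T \<longrightarrow> indicator {0..t0} t * h j k t = indicator {0..t0} t * h' k t" for k
    proof -
      have "AE t in lborel. t \<in> {0..T} \<longrightarrow> h j k t = g k (X t)" using hg[of k] by (simp add: AE_completion_iff)
      then show ?thesis using Vae
      proof eventually_elim
        case (elim t)
        show ?case
        proof
          assume t: "0 < t \<and> t < T"
          then have "V t < \<infinity>" using elim by blast
          then have "h' k t = g k (f (p t))" using h'l[of t k] lg[OF _ g[of k], of "f (p t)"] by (simp add: V_def)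
          then show "indicator {0..t0} t * h j k t = indicator {0..t0} t * h' k t" using elim t pX[of t] by simp
        qed
      qed
    qed
    \<comment> \<open>The added 1 makes \<open>a\<close> positive, so that an infinite weight
      remains infinite after multiplication.\<close>
    define a where "a = 2 powr s * c0 * (L * H) powr s + 1"
    have a: "0 < a" using c0 by (simp add: a_def add_nonneg_pos)
    have osc: "ennreal \<bar>h' k t - h' k r\<bar> \<le> ennreal (\<bar>t - r\<bar> powr (\<gamma> * s)) * (ennreal a * V t + ennreal a * V r)" for k t r
    proof (rule ennreal_weighted_le[OF a])
      assume V: "V t < \<infinity>" "V r < \<infinity>"
      let ?w = "enn2real (V t) + enn2real (V r)"
      have vv: "0 \<le> c0 * enn2real (V t)" "0 \<le> c0 * enn2real (V r)" using c0 by auto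
      have "\<bar>h' k t - h' k r\<bar> \<le> 2 powr s * (c0 * enn2real (V t) + c0 * enn2real (V r)) * norm (f (p t) - f (p r)) powr s"
        unfolding h'l[OF V(1)] h'l[OF V(2)]
        by (rule oscillation_two_points[OF u s(1) vv l[of "f (p t)", folded c0_def V_def, OF V(1)] l[of "f (p r)", folded c0_def V_def, OF V(2)]])
      also have "norm (f (p t) - f (p r)) powr s \<le> (L * H * \<bar>t - r\<bar> powr \<gamma>) powr s"
      proof (rule powr_mono2)
        have "norm (f (p t) - f (p r)) \<le> L * norm (p t - p r)" using L(2)[of "p t" "p r"] by (simp add: dist_norm)
        also have "\<dots> \<le> L * (H * \<bar>t - r\<bar> powr \<gamma>)" by (rule mult_left_mono[OF pH]) (use L in simp)
        finally show "norm (f (p t) - f (p r)) \<le> L * H * \<bar>t - r\<bar> powr \<gamma>" by simp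
      qed (use s in auto)
      also have "(L * H * \<bar>t - r\<bar> powr \<gamma>) powr s = (L * H) powr s * \<bar>t - r\<bar> powr (\<gamma> * s)"
        using L H by (simp add: powr_mult powr_powr)
      also have "2 powr s * (c0 * enn2real (V t) + c0 * enn2real (V r)) * ((L * H) powr s * \<bar>t - r\<bar> powr (\<gamma> * s))
        = \<bar>t - r\<bar> powr (\<gamma> * s) * (2 powr s * c0 * (L * H) powr s * ?w)" by (simp add: algebra_simps)
      also have "\<dots> \<le> \<bar>t - r\<bar> powr (\<gamma> * s) * (a * ?w)"
        unfolding a_def by (intro mult_left_mono mult_right_mono) auto
      finally show "\<bar>h' k t - h' k r\<bar> \<le> \<bar>t - r\<bar> powr (\<gamma> * s) * (a * ?w)"
        using vv by (simp add: mult_left_mono)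
    qed auto
    define A where "A k I \<longleftrightarrow> has_stieltjes_integral T (\<lambda>u. indicator {0..t0} u * h j k u) (\<lambda>u. y u $ k) I \<and>
      (\<forall>d. (\<forall>n. 0 < d n) \<longrightarrow> d \<longlonglongrightarrow> 0 \<longrightarrow> (\<lambda>n. \<integral>u. (if 0 < u \<and> u < T then indicator {0..t0} u * h' k u * ((y (min T (u + d n)) $ k - y u $ k) / d n) else 0) \<partial>lborel) \<longlonglongrightarrow> I)" for k I
    have "\<exists>I. A k I" for k
      unfolding A_def
    proof (rule has_stieltjes_integral_forward_limit[OF _ _ hh' \<theta>(1,2) T \<theta>(3)])
      show "(\<lambda>u. indicator {0..t0} u * h' k u) \<in> borel_measurable borel" by measurable
      show "\<bar>indicator {0..t0} t * h' k t\<bar> \<le> M" for t using h'M[of k t] M by (auto simp: indicator_def)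
      show "(\<integral>\<^sup>+r. \<integral>\<^sup>+q. ennreal (if 0 < q \<and> q < T \<and> 0 < r \<and> r < T
          then \<bar>indicator {0..t0} r * h' k r - indicator {0..t0} q * h' k q\<bar> * \<bar>r - q\<bar> powr (-(\<theta> + 1)) else 0) \<partial>lborel \<partial>lborel) < \<infinity>"
        by (rule marchaud_integrable_cutoff[OF h'm h'M _ cfin osc \<theta>(1,4,2)]) (use t0 in auto)
      show "\<bar>y t $ k - y u $ k\<bar> \<le> H * \<bar>t - u\<bar> powr \<gamma>" if "t \<in> {0..T}" "u \<in> {0..T}" for t u
        using component_le_norm_cart[of "y t - y u" k] yH[OF that] by simp
    qed
    then obtain I where AI: "\<And>k. A k (I k)" by metis
    have I: "\<And>k. has_stieltjes_integral T (\<lambda>u. indicator {0..t0} u * h j k u) (\<lambda>u. y u $ k) (I k)"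
      and lim: "\<And>k d. (\<forall>n. 0 < d n) \<Longrightarrow> d \<longlonglongrightarrow> 0 \<Longrightarrow> (\<lambda>n. \<integral>u. (if 0 < u \<and> u < T then indicator {0..t0} u * h' k u * ((y (min T (u + d n)) $ k - y u $ k) / d n) else 0) \<partial>lborel) \<longlonglongrightarrow> I k"
      using AI unfolding A_def by blast+
    have lim': "(\<lambda>n. \<integral>u. (if 0 < u \<and> u < T then indicator {0..t0} u * h' k u * ((p (u + d n) $ k - p u $ k) / d n) else 0) \<partial>lborel) \<longlonglongrightarrow> I k"
      if d: "\<forall>n. 0 < d n" "d \<longlonglongrightarrow> 0" for k d
    proof -
      have eq: "(\<lambda>u. if 0 < u \<and> u < T then indicator {0..t0} u * h' k u * ((p (u + d n) $ k - p u $ k) / d n) else 0)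
        = (\<lambda>u. if 0 < u \<and> u < T then indicator {0..t0} u * h' k u * ((y (min T (u + d n)) $ k - y u $ k) / d n) else 0)" for n
      proof
        fix u
        show "(if 0 < u \<and> u < T then indicator {0..t0} u * h' k u * ((p (u + d n) $ k - p u $ k) / d n) else 0)
          = (if 0 < u \<and> u < T then indicator {0..t0} u * h' k u * ((y (min T (u + d n)) $ k - y u $ k) / d n) else 0)"
        proof (cases "0 < u \<and> u < T")
          case True
          have "max 0 (min T (u + d n)) = min T (u + d n)" "max 0 (min T u) = u"
            using True T d(1)[rule_format, of n] by auto
          then have "p (u + d n) $ k - p u $ k = y (min T (u + d n)) $ k - y u $ k" by (simp add: p_def)
          then show ?thesis by (simp only:)
        next
          case False
          show ?thesis unfolding if_not_P[OF False] ..
        qed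
      qed
      show ?thesis unfolding eq by (rule lim[OF d])
    qed
    define CT where "CT = taylor_const CARD('n) s L K * 2 powr (1 + s) + CARD('n) * (2 powr s * L powr s)"
    \<comment> \<open>Again the summand 1 ensures positivity. The power of \<open>H\<close> arises
      from inserting the Hoelder bound of the path into the Taylor remainder.\<close>
    define b where "b = \<bar>CT\<bar> * c0 * H powr (1 + s) + 1"
    have b: "0 < b" using c0 by (simp add: b_def add_nonneg_pos)
    have FL: "\<bar>f v $ j - f w $ j\<bar> \<le> L * norm (v - w)" for v w
      using component_le_norm_cart[of "f v - f w" j] L(2)[of v w] by (simp add: dist_norm)
    have "f (p t0) $ j - f (p 0) $ j = (\<Sum>k\<in>UNIV. I k)"
    \<comment> \<open>\<open>\<Phi>\<close> is a component of the candidate solution. The constant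
      \<open>C\<close> combines the Lipschitz bound for \<open>f\<close> with the bound
      \<open>M\<close> on the coefficients, both applied to Hoelder increments of
      \<open>p\<close>.\<close>
    proof (rule increment_eq_sum_of_limits[where \<Phi> = "\<lambda>t. f (p t) $ j" and \<kappa> = "\<lambda>k t. p t $ k" and h = h' and M = M
          and W = "\<lambda>t. ennreal b * V t" and T = T and \<beta> = "\<gamma> * (1 + s)" and \<gamma> = \<gamma> and C = "L * H + (\<Sum>k\<in>(UNIV :: 'n set). M * H)"])
      show "continuous_on UNIV (\<lambda>t. f (p t) $ j)" by (intro continuous_intros fpc)
      show "continuous_on UNIV (\<lambda>t. p t $ k)" for k by (intro continuous_intros pc)
      obtain B where B: "\<And>t. norm (f (p t)) \<le> B" using fpb by (auto simp: bounded_iff)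
      show "bounded (range (\<lambda>t. f (p t) $ j))"
        unfolding bounded_iff by (intro exI[of _ B]) (auto intro: order_trans[OF component_le_norm_cart B])
      obtain B' where B': "\<And>t. norm (p t) \<le> B'" using pb by (auto simp: bounded_iff)
      show "bounded (range (\<lambda>t. p t $ k))" for k
        unfolding bounded_iff by (intro exI[of _ B']) (auto intro: order_trans[OF component_le_norm_cart B'])
      show "(\<lambda>t. ennreal b * V t) \<in> borel_measurable borel" by measurable
      show "(\<integral>\<^sup>+t\<in>{0<..<T}. ennreal b * V t \<partial>lborel) < \<infinity>" by (rule cfin)
      show "1 < \<gamma> * (1 + s)" by (rule \<gamma>s)
      show "0 < \<gamma>" by (rule \<gamma>0)
      show "0 \<le> t0" "t0 \<le> T" using t0 by auto
      fix t d :: real assume t: "0 < t" and d: "0 < d"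
      let ?S = "\<Sum>k\<in>UNIV. h' k t * (p (t + d) $ k - p t $ k)"
      have "\<bar>f (p (t + d)) $ j - f (p t) $ j - ?S\<bar> \<le> \<bar>f (p (t + d)) $ j - f (p t) $ j\<bar> + \<bar>?S\<bar>" by linarith
      also have "\<bar>f (p (t + d)) $ j - f (p t) $ j\<bar> \<le> L * (H * d powr \<gamma>)"
        using order_trans[OF FL[of "p (t + d)" "p t"] mult_left_mono[OF pH[of "t + d" t] less_imp_le[OF L(1)]]] d by simp
      also have "\<bar>?S\<bar> \<le> (\<Sum>k\<in>UNIV. \<bar>h' k t * (p (t + d) $ k - p t $ k)\<bar>)" by (rule sum_abs)
      also have "\<dots> \<le> (\<Sum>k\<in>(UNIV :: 'n set). M * (H * d powr \<gamma>))"
      proof (rule sum_mono)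
        fix k
        have "\<bar>p (t + d) $ k - p t $ k\<bar> \<le> H * d powr \<gamma>"
          using component_le_norm_cart[of "p (t + d) - p t" k] pH[of "t + d" t] d by simp
        then show "\<bar>h' k t * (p (t + d) $ k - p t $ k)\<bar> \<le> M * (H * d powr \<gamma>)"
          unfolding abs_mult using h'M M by (intro mult_mono) auto
      qed
      finally show "\<bar>f (p (t + d)) $ j - f (p t) $ j - ?S\<bar> \<le> (L * H + (\<Sum>k\<in>(UNIV :: 'n set). M * H)) * d powr \<gamma>"
        by (simp add: algebra_simps)
      show "ennreal \<bar>f (p (t + d)) $ j - f (p t) $ j - ?S\<bar> \<le> ennreal (d powr (\<gamma> * (1 + s))) * (ennreal b * V t + ennreal b * V (t + d))"
      proof (rule ennreal_weighted_le[OF b])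
        assume V: "V t < \<infinity>" "V (t + d) < \<infinity>"
        let ?w = "enn2real (V t) + enn2real (V (t + d))"
        have vv: "0 \<le> c0 * enn2real (V t)" "0 \<le> c0 * enn2real (V (t + d))" using c0 by auto
        let ?l = "\<lambda>t. (\<chi> k. l (f (p t)) j k)"
        have osc: "(\<integral>\<^sup>+x\<in>cube (f (p t)) r. ennreal \<bar>u j k x - ?l t $ k\<bar> \<partial>lborel) \<le> ennreal (c0 * enn2real (V t) * r powr (?n + s))"
          if "V t < \<infinity>" "0 < r" for t k r
          using l[of "f (p t)" r j k] that by (simp add: V_def c0_def)
        have S: "?S = ?l t \<bullet> (p (t + d) - p t)" using h'l[OF V(1)] by (simp add: inner_vec_def)
        have "\<bar>f (p (t + d)) $ j - f (p t) $ j - ?S\<bar> \<le> CT * (c0 * enn2real (V t) + c0 * enn2real (V (t + d))) * norm (p (t + d) - p t) powr (1 + s)"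
          unfolding S CT_def
          by (rule taylor_two_points[OF L K(1,2) FL u part s(1) vv osc[OF V(1)] osc[OF V(2)]])
        also have "\<dots> \<le> \<bar>CT\<bar> * (c0 * enn2real (V t) + c0 * enn2real (V (t + d))) * (H * d powr \<gamma>) powr (1 + s)"
          using vv pH[of "t + d" t] d s by (intro mult_mono powr_mono2) auto
        also have "(H * d powr \<gamma>) powr (1 + s) = H powr (1 + s) * d powr (\<gamma> * (1 + s))" using H by (simp add: powr_mult powr_powr)
        also have "\<bar>CT\<bar> * (c0 * enn2real (V t) + c0 * enn2real (V (t + d))) * (H powr (1 + s) * d powr (\<gamma> * (1 + s)))
          = d powr (\<gamma> * (1 + s)) * (\<bar>CT\<bar> * c0 * H powr (1 + s) * ?w)" by (simp add: algebra_simps)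
        also have "\<dots> \<le> d powr (\<gamma> * (1 + s)) * (b * ?w)" unfolding b_def by (intro mult_left_mono mult_right_mono) auto
        finally show "\<bar>f (p (t + d)) $ j - f (p t) $ j - ?S\<bar> \<le> d powr (\<gamma> * (1 + s)) * (b * ?w)" .
      qed (use d in auto)
    qed (use h'm h'M lim' in auto)
    moreover have "f (p t0) $ j = X t0 $ j" using pX[OF t0] by simp
    moreover have "f (p 0) $ j = x0 $ j" using T by (simp add: p_def y_zero fy0)
    ultimately show ?thesis using I by (intro exI[of _ I]) auto
  qed
  have "variability_solution T \<gamma> \<sigma> y x0 X"
    unfolding variability_solution_def
  proof (intro conjI allI impI ballI)
    show "X 0 = x0" by (simp add: X_def y_zero fy0)
    \<comment> \<open>The witnesses are \<open>\<alpha> = \<gamma>\<close> and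
      \<open>s' = s\<close>; the condition relating them is \<open>\<gamma> * (1 + s) > 1\<close>
      rearranged.\<close>
    have "(1 - \<gamma>) / \<gamma> < s" using \<gamma>s \<gamma>0 by (simp add: field_simps)
    then show "\<exists>\<alpha> s'. 0 < \<alpha> \<and> \<alpha> < 1 \<and> (1 - \<gamma>) / \<alpha> < s' \<and> s' < 1 \<and> holder_on \<alpha> {0..T} X \<and> X \<in> V_class T \<sigma> s'"
      using \<gamma>0 \<gamma>(2) s Xhol XV by blast
    fix h t j assume h: "\<forall>j k. h j k \<in> composition_class T (\<lambda>x. \<sigma> x $ j $ k) X" and t: "t \<in> {0..T}"
    show "\<exists>I. (\<forall>k. has_stieltjes_integral T (\<lambda>u. indicator {0..t} u * h j k u) (\<lambda>u. y u $ k) (I k)) \<and>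
      X t $ j = x0 $ j + (\<Sum>k\<in>UNIV. I k)"
      by (rule eqn[OF _ t]) (use h in blast)
  qed (rule hol)
  moreover have "X = (\<lambda>t. f (y t + inv f x0))" by (simp add: fun_eq_iff X_def y0_def)
  ultimately show ?thesis using Xhol XV by simp
qed

theorem corollary3p26:
  fixes \<sigma> :: "real^'n::finite \<Rightarrow> real^'n^'n"
    and f :: "real^'n \<Rightarrow> real^'n"
    and P :: "'w measure"
    and Y :: "real \<Rightarrow> 'w \<Rightarrow> real^'n"
    and x\<^sub>0 :: "real^'n"
    and T s \<gamma> \<epsilon>\<^sub>0 \<epsilon> \<delta> c :: real
  assumes "0 < T"
    and sigma: "\<And>j k. (\<lambda>x. \<sigma> x $ j $ k) \<in> BV_loc"
      "\<And>j k. essentially_bounded (\<lambda>x. \<sigma> x $ j $ k)"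
    and det: "0 < \<epsilon>\<^sub>0" "AE x in lebesgue. det (\<sigma> x) > \<epsilon>\<^sub>0"
    and f: "bi_lipschitz f" "AE x in lebesgue. has_jacobian f (\<sigma> (f x)) x"
    and s: "0 < s" "s < 1"
    and \<gamma>: "1 / (1 + s) < \<gamma>" "\<gamma> < 1"
    and P: "prob_space P"
    and Y_process: "\<And>t. t \<in> {0..T} \<Longrightarrow> Y t \<in> borel_measurable P"
    and Y_zero: "AE \<omega> in P. Y 0 \<omega> = 0"
    and Y_holder: "AE \<omega> in P. holder_on \<gamma> {0..T} (\<lambda>t. Y t \<omega>)"
    and params: "0 < \<epsilon>" "\<epsilon> < 1 - s" "0 < c" "0 < \<delta>" "\<delta> < real CARD('n) - 1 + s + \<epsilon>"
    and Y_moment: "\<And>x. x \<noteq> 0 \<Longrightarrow>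
      (\<integral>\<^sup>+ \<omega>. (\<integral>\<^sup>+ t\<in>{0..T}. riesz_kernel (- real CARD('n) + \<epsilon>) (Y t \<omega> - x) \<partial>lebesgue) \<partial>P)
        < ennreal (c * norm x powr (- real CARD('n) + \<delta>))"
    and sigma_moment: "\<And>j k.
      (\<integral>\<^sup>+ x. riesz_kernel (- real CARD('n) + 1 - s - \<epsilon> + \<delta>) (x - x\<^sub>0)
         \<partial>gradient_variation (\<lambda>x. \<sigma> x $ j $ k)) < \<infinity>"
  shows "AE \<omega> in P.
    variability_solution T \<gamma> \<sigma> (\<lambda>t. Y t \<omega>) x\<^sub>0 (\<lambda>t. f (Y t \<omega> + inv f x\<^sub>0)) \<and>
    holder_on \<gamma> {0..T} (\<lambda>t. f (Y t \<omega> + inv f x\<^sub>0)) \<and>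
    (\<lambda>t. f (Y t \<omega> + inv f x\<^sub>0)) \<in> V_class T \<sigma> s"
proof -
  have "0 < 1 / (1 + s)" using s by simp
  then have \<gamma>0: "0 < \<gamma>" using \<gamma>(1) by linarith
  obtain L where L: "0 < L" "\<And>x y. dist x y / L \<le> dist (f x) (f y)" "\<And>x y. dist (f x) (f y) \<le> L * dist x y"
    using f(1) by (auto simp: bi_lipschitz_def)
  have surj: "surj f" by (rule bi_lipschitz_surj[OF f(1)])
  have inv: "f (inv f x\<^sub>0) = x\<^sub>0" by (rule surj_f_inv_f[OF surj])
  have n: "1 \<le> real CARD('n)" using one_le_card_finite[where 'a = 'n] by linarith
  \<comment> \<open>This is the condition \<open>a + b < n\<close> of the composition lemmas for
    \<open>a = \<epsilon>\<close> and \<open>b = 1 - s - \<epsilon>\<close>.\<close>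
  have n1: "1 - s < real CARD('n)" using n s by linarith
  have cont: "AE \<omega> in P. continuous_on {0..T} (\<lambda>t. Y t \<omega>)"
    by (rule eventually_mono[OF Y_holder]) (rule holder_on_continuous_on[OF _ \<gamma>0])
  have sf: "sigma_finite_measure (gradient_variation (\<lambda>x. \<sigma> x $ j $ k))" for j k
    by (rule sigma_finite_of_riesz_moment[OF _ _ sigma_moment]) (use params in auto)
  have e1: "- real DIM(real^'n) + \<epsilon> + (1 - s - \<epsilon>) = - real CARD('n) + 1 - s" by simp
  have e2: "- real CARD('n) + 1 - s - \<epsilon> + \<delta> = - real DIM(real^'n) + \<delta> + (1 - s - \<epsilon>)" by simp
  have pot: "AE \<omega> in P. (\<integral>\<^sup>+t\<in>{0..T}. (\<integral>\<^sup>+z. riesz_kernel (- real CARD('n) + 1 - s) (f (Y t \<omega> + inv f x\<^sub>0) - z)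
      \<partial>gradient_variation (\<lambda>x. \<sigma> x $ j $ k)) \<partial>lborel) < \<infinity>" for j k
    unfolding e1[symmetric]
  proof (rule process_potential_finite_AE[OF P _ Y_process cont _ _ _ params(4) _ _ _ L surj])
    show "(\<integral>\<^sup>+\<omega>. (\<integral>\<^sup>+t\<in>{0..T}. riesz_kernel (- real DIM(real^'n) + \<epsilon>) (Y t \<omega> - x) \<partial>lebesgue) \<partial>P) \<le> ennreal (c * norm x powr (- real DIM(real^'n) + \<delta>))"
      if "x \<noteq> 0" for x using Y_moment[OF that] by (simp add: less_imp_le)
    show "(\<integral>\<^sup>+z. riesz_kernel (- real DIM(real^'n) + \<delta> + (1 - s - \<epsilon>)) (z - f (inv f x\<^sub>0)) \<partial>gradient_variation (\<lambda>x. \<sigma> x $ j $ k)) < \<infinity>"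
      using sigma_moment[of j k] unfolding inv e2 .
  qed (use params \<open>0 < T\<close> s n1 in auto)
  have "AE \<omega> in P. \<forall>j\<in>UNIV. \<forall>k\<in>UNIV. (\<integral>\<^sup>+t\<in>{0..T}. (\<integral>\<^sup>+z. riesz_kernel (- real CARD('n) + 1 - s) (f (Y t \<omega> + inv f x\<^sub>0) - z)
      \<partial>gradient_variation (\<lambda>x. \<sigma> x $ j $ k)) \<partial>lborel) < \<infinity>"
    \<comment> \<open>There are finitely many entries, so their exceptional null sets can be
      united.\<close>
    by (intro AE_finite_allI finite pot)
  then show ?thesis using Y_zero Y_holder
  proof eventually_elim
    case (elim \<omega>)
    show ?case
      by (rule pathwise_variability_solution[OF \<open>0 < T\<close> sigma f s \<gamma> elim(3) elim(2) sf]) (use elim(1) in blast)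
  qed
qed

end
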